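(* Fix $k\ge 2$, $\lambda>0$ and a probability $p=(p(i,j))_{1\le i<j\le k}$. For every $N\ge k$, let $\{Y^N_t:t\ge 0\}$ be the $(N,p)$-BBM with parameters $\lambda$ and $p$. Suppose that the initial distributions satisfy $$\lim_{N\to\infty}\|F_{Y^N_0}-U_0\|_\infty=0\quad\text{in probability},$$ where $U_0$ is the distribution function of a probability on $[-\infty,\infty)$. Then, for every $t>0$, $$\lim_{N\to\infty}\|F_{Y^N_t}-U(t,\cdot)\|_\infty=0\quad\text{in probability},$$ where $U$ is the unique bounded solution of the F-KPP equation $$\partial_tU=\tfrac12\partial_{xx}U-h_p(U),\qquad U(0,\cdot)=U_0 .$$
   Context: The $(N,p)$-BBM with parameters $k\ge2$, $\lambda>0$ and $p$ (a probability on $\{(i,j):1\le i<j\le k\}$) is the following system of $N\ge k$ particles in $[-\infty,\infty)$. Between jump times, particles move as independent standard Brownian motions (a particle located at $-\infty$ stays at $-\infty$). At rate $\lambda N$, a subset $\{\ell_1<\dots<\ell_k\}$ of $\{1,\dots,N\}$ with $k$ elements is chosen uniformly at random and, independently, a pair $(i,j)$ is chosen with probability $p(i,j)$; instantaneously the particle with quantile $\ell_i$ jumps on top of (to the position of) the particle with quantile $\ell_j$. Here the quantile of a particle is its rank from the left (the $m$-th quantile is the $m$-th order statistic, ties broken by labels). The initial configuration $Y^N_0\in[-\infty,\infty)^N$ is random and independent of the Brownian motions and of the jump mechanism; $Y^N_t=(Y^N_t(1),\dots,Y^N_t(N))$. For $\zeta\in[-\infty,\infty)^N$, $F_\zeta(x)=\frac1N\sum_{i=1}^N\mathbf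 1\{\zeta(i)\le x\}$, $x\in\mathbb R$. The norm $\|\cdot\|_\infty$ is the supremum over $x\in\mathbb R$. $h_p:[0,1]\to\mathbb R$ is $h_p(v)=\lambda\sum_{r=1}^{k-1}\hat p(r)\binom kr v^r(1-v)^{k-r}$, where $\hat p(r)=\sum_{i\le r}\sum_{j>r}p(i,j)$. Solution means classical solution: on each interval $[0,t]$, $U|_{(0,t]\times\mathbb R}\in C^{1,2}$ (i.e. it extends to a $C^{1,2}$ function on an open set containing $(0,t]\times\mathbb R$) and satisfies the equation at every point of $(0,t]\times\mathbb R$, $U(0,\cdot)=U_0$, and $\lim_{s\downarrow0}U(s,x)=U_0(x)$ at every continuity point $x$ of $U_0$. *)

theory Defs
  imports "HOL-Probability.Probability"
begin

section \<open>Brownian motion and convergence in probability\<close>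

definition std_brownian_motion :: "'a measure \<Rightarrow> (real \<Rightarrow> 'a \<Rightarrow> real) \<Rightarrow> bool" where
  "std_brownian_motion M W \<longleftrightarrow>
     (\<forall>t\<ge>0. W t \<in> borel_measurable M) \<and>
     (AE \<omega> in M. W 0 \<omega> = 0) \<and>
     (AE \<omega> in M. continuous_on {0..} (\<lambda>t. W t \<omega>)) \<and>
     (\<forall>s t. 0 \<le> s \<and> s < t \<longrightarrow>
        distributed M lborel (\<lambda>\<omega>. W t \<omega> - W s \<omega>) (normal_density 0 (sqrt (t - s)))) \<and>
     (\<forall>(n::nat) t. 0 \<le> t 0 \<and> mono t \<longrightarrow>
        prob_space.indep_vars M (\<lambda>_. borel) (\<lambda>m \<omega>. W (t (Suc m)) \<omega> - W (t m) \<omega>) {..<n})"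

text \<open>
  The random variables \<open>X N\<close> may live on different probability spaces. The definition presupposes
  that they are measurable. It is used below for \<^term>\<open>SUP x. \<bar>F x - G x\<bar>\<close> with \<open>F\<close>, \<open>G\<close>
  right-continuous, where the supremum may be taken over the rationals.
\<close>

definition tendsto_0_in_prob :: "(nat \<Rightarrow> 'a measure) \<Rightarrow> (nat \<Rightarrow> 'a \<Rightarrow> real) \<Rightarrow> bool" where
  "tendsto_0_in_prob M X \<longleftrightarrow>
     (\<forall>\<epsilon>>0. (\<lambda>N. measure (M N) {\<omega> \<in> space (M N). \<bar>X N \<omega>\<bar> > \<epsilon>}) \<longlonglongrightarrow> 0)"

section \<open>Particle configurations and jumps\<close>

text \<open>
  A configuration of \<open>N\<close> particles is a function \<open>\<zeta> :: nat \<Rightarrow> ereal\<close> of which only the values on the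
  labels \<open>{1..N}\<close> matter; none of these equals \<open>\<infinity>\<close>.
\<close>

definition empirical_cdf :: "nat \<Rightarrow> (nat \<Rightarrow> ereal) \<Rightarrow> real \<Rightarrow> real" where
  "empirical_cdf N \<zeta> x = real (card {i \<in> {1..N}. \<zeta> i \<le> ereal x}) / real N"

definition quantile :: "nat \<Rightarrow> (nat \<Rightarrow> ereal) \<Rightarrow> nat \<Rightarrow> nat" where
  "quantile N \<zeta> i = card {j \<in> {1..N}. \<zeta> j < \<zeta> i \<or> (\<zeta> j = \<zeta> i \<and> j \<le> i)}"

definition label_of_quantile :: "nat \<Rightarrow> (nat \<Rightarrow> ereal) \<Rightarrow> nat \<Rightarrow> nat" where
  "label_of_quantile N \<zeta> m = (THE i. i \<in> {1..N} \<and> quantile N \<zeta> i = m)"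

text \<open>\<open>nth_elem S i\<close> is \<open>\<ell>\<^sub>i\<close> when \<open>S = {\<ell>\<^sub>1 < \<dots> < \<ell>\<^sub>k}\<close>; the list index starts at 0.\<close>

definition nth_elem :: "nat set \<Rightarrow> nat \<Rightarrow> nat" where
  "nth_elem S i = sorted_list_of_set S ! (i - 1)"

definition jump :: "nat \<Rightarrow> nat set \<Rightarrow> nat \<times> nat \<Rightarrow> (nat \<Rightarrow> ereal) \<Rightarrow> (nat \<Rightarrow> ereal)" where
  "jump N S ij \<zeta> =
     \<zeta>(label_of_quantile N \<zeta> (nth_elem S (fst ij)) :=
         \<zeta> (label_of_quantile N \<zeta> (nth_elem S (snd ij))))"

section \<open>The particle system\<close>

text \<open>
  The sources of randomness: initial configuration, the Brownian motion of each label, and for the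
  \<open>n\<close>-th jump (\<open>n = 0, 1, \<dots>\<close>) the waiting time before it, the subset of quantiles and the pair.
\<close>

datatype source = Initial | Motion nat | Clock nat | Subset nat | Pair nat

definition sources :: "nat \<Rightarrow> source set" where
  "sources N = {Initial} \<union> Motion ` {1..N} \<union> range Clock \<union> range Subset \<union> range Pair"

fun source_events ::
  "nat \<Rightarrow> 'a measure \<Rightarrow> ('a \<Rightarrow> nat \<Rightarrow> ereal) \<Rightarrow> (nat \<Rightarrow> real \<Rightarrow> 'a \<Rightarrow> real) \<Rightarrow> (nat \<Rightarrow> 'a \<Rightarrow> real) \<Rightarrow>
   (nat \<Rightarrow> 'a \<Rightarrow> nat set) \<Rightarrow> (nat \<Rightarrow> 'a \<Rightarrow> nat \<times> nat) \<Rightarrow> source \<Rightarrow> 'a set set" where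
  "source_events N M Y0 B \<tau> S q Initial =
     sets (vimage_algebra (space M) (\<lambda>\<omega>. restrict (Y0 \<omega>) {1..N}) (Pi\<^sub>M {1..N} (\<lambda>_. borel)))"
| "source_events N M Y0 B \<tau> S q (Motion i) =
     sets (vimage_algebra (space M) (\<lambda>\<omega>. \<lambda>t\<in>{0..}. B i t \<omega>) (Pi\<^sub>M {0..} (\<lambda>_. borel)))"
| "source_events N M Y0 B \<tau> S q (Clock n) = sets (vimage_algebra (space M) (\<tau> n) borel)"
| "source_events N M Y0 B \<tau> S q (Subset n) = sets (vimage_algebra (space M) (S n) (count_space UNIV))"
| "source_events N M Y0 B \<tau> S q (Pair n) = sets (vimage_algebra (space M) (q n) (count_space UNIV))"

definition jump_time :: "(nat \<Rightarrow> 'a \<Rightarrow> real) \<Rightarrow> nat \<Rightarrow> 'a \<Rightarrow> real" where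
  "jump_time \<tau> n \<omega> = (\<Sum>m<n. \<tau> m \<omega>)"

text \<open>
  \<open>jump_time \<tau> 0 = 0\<close>, and jump number \<open>n\<close> happens at time \<open>jump_time \<tau> (Suc n)\<close>, acting on
  the configuration just before that time. As the jump times increase to infinity almost surely, the
  last clause determines the path of \<open>Y\<close> on the labels \<open>{1..N}\<close>. Measurability of all sources is
  part of \<^const>\<open>prob_space.indep_sets\<close>.
\<close>

definition np_BBM_driven_by ::
  "nat \<Rightarrow> real \<Rightarrow> (nat \<times> nat) pmf \<Rightarrow> nat \<Rightarrow> 'a measure \<Rightarrow> (real \<Rightarrow> 'a \<Rightarrow> nat \<Rightarrow> ereal) \<Rightarrow>
   (nat \<Rightarrow> real \<Rightarrow> 'a \<Rightarrow> real) \<Rightarrow> (nat \<Rightarrow> 'a \<Rightarrow> real) \<Rightarrow> (nat \<Rightarrow> 'a \<Rightarrow> nat set) \<Rightarrow>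
   (nat \<Rightarrow> 'a \<Rightarrow> nat \<times> nat) \<Rightarrow> bool" where
  "np_BBM_driven_by k lam p N M Y B \<tau> S q \<longleftrightarrow>
     prob_space.indep_sets M (source_events N M (Y 0) B \<tau> S q) (sources N) \<and>
     (\<forall>i\<in>{1..N}. std_brownian_motion M (B i)) \<and>
     (\<forall>n. distributed M lborel (\<tau> n) (exponential_density (lam * real N))) \<and>
     (\<forall>n. distr M (count_space UNIV) (S n) =
            measure_pmf (pmf_of_set {A. A \<subseteq> {1..N} \<and> card A = k})) \<and>
     (\<forall>n. distr M (count_space UNIV) (q n) = measure_pmf p) \<and>
     (\<forall>t\<ge>0. \<forall>i\<in>{1..N}. (\<lambda>\<omega>. Y t \<omega> i) \<in> borel_measurable M \<and>
        (\<forall>\<omega>\<in>space M. Y t \<omega> i \<noteq> \<infinity>)) \<and>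
     (AE \<omega> in M. \<forall>n. \<forall>i\<in>{1..N}.
        let T = jump_time \<tau> n \<omega>; T' = jump_time \<tau> (Suc n) \<omega>;
            moved = (\<lambda>t i. Y T \<omega> i + ereal (B i t \<omega> - B i T \<omega>))
        in (\<forall>t. T \<le> t \<and> t < T' \<longrightarrow> Y t \<omega> i = moved t i) \<and>
           Y T' \<omega> i = jump N (S n \<omega>) (q n \<omega>) (moved T') i)"

definition np_BBM ::
  "nat \<Rightarrow> real \<Rightarrow> (nat \<times> nat) pmf \<Rightarrow> nat \<Rightarrow> 'a measure \<Rightarrow> (real \<Rightarrow> 'a \<Rightarrow> nat \<Rightarrow> ereal) \<Rightarrow> bool" where
  "np_BBM k lam p N M Y \<longleftrightarrow>
     prob_space M \<and> (\<exists>B \<tau> S q. np_BBM_driven_by k lam p N M Y B \<tau> S q)"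

section \<open>The F-KPP equation\<close>

definition p_hat :: "nat \<Rightarrow> (nat \<times> nat) pmf \<Rightarrow> nat \<Rightarrow> real" where
  "p_hat k p r = (\<Sum>i=1..r. \<Sum>j=r+1..k. pmf p (i, j))"

text \<open>The polynomial is taken on all of \<open>\<real>\<close>, so that \<open>h_p(U)\<close> makes sense for any bounded \<open>U\<close>.\<close>

definition h_p :: "nat \<Rightarrow> real \<Rightarrow> (nat \<times> nat) pmf \<Rightarrow> real \<Rightarrow> real" where
  "h_p k lam p v =
     lam * (\<Sum>r=1..k-1. p_hat k p r * real (k choose r) * v ^ r * (1 - v) ^ (k - r))"

text \<open>\<open>C\<^sup>1\<^sup>,\<^sup>2\<close> on a set \<open>G\<close> of points \<open>(t, x)\<close>, which is meant to be open.\<close>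

definition C12_on :: "(real \<times> real) set \<Rightarrow> (real \<Rightarrow> real \<Rightarrow> real) \<Rightarrow> bool" where
  "C12_on G V \<longleftrightarrow>
     (\<forall>(t, x)\<in>G. (\<lambda>s. V s x) differentiable (at t) \<and> V t differentiable (at x) \<and>
        deriv (V t) differentiable (at x)) \<and>
     continuous_on G (\<lambda>(t, x). V t x) \<and>
     continuous_on G (\<lambda>(t, x). deriv (\<lambda>s. V s x) t) \<and>
     continuous_on G (\<lambda>(t, x). deriv (V t) x) \<and>
     continuous_on G (\<lambda>(t, x). deriv (deriv (V t)) x)"

definition FKPP_solution_upto ::
  "(real \<Rightarrow> real) \<Rightarrow> (real \<Rightarrow> real) \<Rightarrow> real \<Rightarrow> (real \<Rightarrow> real \<Rightarrow> real) \<Rightarrow> bool" where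
  "FKPP_solution_upto h U0 T U \<longleftrightarrow>
     (\<exists>G V. open G \<and> {0<..T} \<times> UNIV \<subseteq> G \<and> C12_on G V \<and>
        (\<forall>t\<in>{0<..T}. \<forall>x. V t x = U t x \<and>
           deriv (\<lambda>s. V s x) t = 1 / 2 * deriv (deriv (V t)) x - h (V t x))) \<and>
     (\<forall>x. U 0 x = U0 x) \<and>
     (\<forall>x. isCont U0 x \<longrightarrow> ((\<lambda>s. U s x) \<longlongrightarrow> U0 x) (at_right 0))"

text \<open>Only the values \<open>U t x\<close> with \<open>t \<ge> 0\<close> matter.\<close>

definition bounded_FKPP_solution ::
  "(real \<Rightarrow> real) \<Rightarrow> (real \<Rightarrow> real) \<Rightarrow> (real \<Rightarrow> real \<Rightarrow> real) \<Rightarrow> bool" where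
  "bounded_FKPP_solution h U0 U \<longleftrightarrow>
     (\<forall>T>0. FKPP_solution_upto h U0 T U) \<and> (\<exists>C. \<forall>t\<ge>0. \<forall>x. \<bar>U t x\<bar> \<le> C)"

end

theory Submission
 imports Defs
begin

text \<open>
 The limit \<open>U\<close> is constructed as the mild (Duhamel) solution, with the nonlinearity clipped to \<open>[0, 1]\<close>
 outside that interval. All functions live on the extended line, where the heat semigroup fixes \<open>\<plusminus>\<infinity>\<close>.

 Averaged over its random marks, a jump changes \<open>F\<^sub>\<zeta>\<close> by \<open>- h\<^sub>p(F\<^sub>\<zeta>) / (lam N) + O(N\<^sup>-\<^sup>2)\<close>, as
 sampling without replacement is close to binomial sampling. Split \<open>[0, t]\<close> into short cells. In each cell
 the heat semigroup, applied to the test function \<open>1{\<cdot> \<le> x}\<close> and to \<open>U\<close> alike, absorbs the Brownian motion;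
 at most one jump matters; and the drift of the squared error is controlled by the Lipschitz constant \<open>L\<close>
 of \<open>h\<^sub>p\<close>. Hence, with the mesh tending to 0 at fixed \<open>N\<close>, a discrete Gronwall inequality gives
 \<open>sup\<^sub>x E(F(x) - U(t, x))\<^sup>2 \<le> exp(2 L t) (sup\<^sub>x E(F\<^sub>0(x) - U\<^sub>0(x))\<^sup>2 + C / N)\<close>. This already forces \<open>U(t, \<cdot>)\<close> to be
 monotone with values in \<open>[0, 1]\<close>, so the clipping is immaterial, and Polya's argument makes the convergence
 uniform in \<open>x\<close>. Uniqueness comes from a maximum principle for the difference of two solutions.
\<close>

text \<open>Two square-root singularities shape the estimates. The indicator of a half-line is not
  Lipschitz, so a test function of age r has Lipschitz constant 1 / sqrt r; and the initial function
  may jump, so the limit at time s has a Lipschitz constant of order 1 / sqrt s. On a grid of mesh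
  d, the cell with index i counted from time 0 and l counted from the final time therefore costs d *
  (1 / sqrt (i + 1) + 1 / sqrt (l + 1)) up to constants, and these costs add up to O(sqrt d). In the
  cell next to the final time the age is 0 and no Lipschitz constant exists; a crude bound of order
  d is used there, once. These constants may grow with N, since N is fixed while the mesh shrinks;
  only the coefficient of d / N must not. No stochastic calculus enters. All that is used of the
  dynamics is that the increment of one particle over a cell is independent of its own past and of
  all other noise, that the running clock is memoryless, and that the marks of the next jump are
  independent of the present configuration. Conditioning is always carried out by freezing
  independent variables and applying Fubini.\<close>

definition gauss :: "real measure" where
 "gauss = density lborel std_normal_density"

lemma prob_space_gauss: "prob_space gauss"
 unfolding gauss_def by (rule prob_space_normal_density) simp

interpretation gauss: prob_space gauss
 by (rule prob_space_gauss)

lemma sets_gauss [simp, measurable_cong]: "sets gauss = sets borel"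
 by (simp add: gauss_def)

lemma space_gauss [simp]: "space gauss = UNIV"
 by (simp add: gauss_def)

lemma integral_gauss:
 fixes f :: "real => real"
 assumes [measurable]: "f \<in> borel_measurable borel"
 shows "(\<integral>z. f z \<partial>gauss) = (\<integral>z. std_normal_density z * f z \<partial>lborel)"
 unfolding gauss_def by (subst integral_density) auto

lemma integrable_gauss:
 fixes f :: "real => real"
 assumes [measurable]: "f \<in> borel_measurable borel"
 shows "integrable gauss f \<longleftrightarrow> integrable lborel (\<lambda>z. std_normal_density z * f z)"
 unfolding gauss_def by (subst integrable_density) auto

lemma integrable_gauss_abs: "integrable gauss (\<lambda>z. \<bar>z\<bar>)"
 using integrable_std_normal_moment_abs[of 1] by (subst integrable_gauss) auto

lemma integrable_gauss_id: "integrable gauss (\<lambda>z. z)"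
 using integrable_std_normal_moment[of 1] by (subst integrable_gauss) auto

lemma integrable_gauss_power2: "integrable gauss (\<lambda>z. z\<^sup>2)"
 using integrable_std_normal_moment[of 2] by (subst integrable_gauss) auto

lemma integral_gauss_power2: "(\<integral>z. z\<^sup>2 \<partial>gauss) = 1"
 using integral_std_normal_moment_even[of 1]
 by (subst integral_gauss) (auto simp: numeral_2_eq_2)

lemma integral_gauss_id: "(\<integral>z. z \<partial>gauss) = 0"
 using integral_std_normal_moment_odd[of 0] by (subst integral_gauss) auto

text \<open>From \<open>\<bar>z\<bar> \<le> (1 + z^2) / 2\<close> and the unit variance. The bound 1
  in place of the exact first absolute moment keeps the constants of the gradient estimates
  simple.\<close>

lemma integral_gauss_abs_le_1: "(\<integral>z. \<bar>z\<bar> \<partial>gauss) \<le> 1"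
proof -
 have "(\<integral>z. \<bar>z\<bar> \<partial>gauss) \<le> (\<integral>z. (1 + z\<^sup>2) / 2 \<partial>gauss)"
 proof (rule integral_mono)
  show "\<bar>z\<bar> \<le> (1 + z\<^sup>2) / 2" for z :: real
   using zero_le_power2[of "\<bar>z\<bar> - 1"] by (simp add: power2_diff)
 qed (use integrable_gauss_abs integrable_gauss_power2 in simp_all)
 also have "... = 1"
  using integrable_gauss_power2 by (simp add: integral_gauss_power2 gauss.prob_space[simplified])
 finally show ?thesis .
qed

text \<open>A monotone initial function has only countably many discontinuities; this turns
  convergence at its continuity points into almost everywhere convergence under the heat
  kernel.\<close>

lemma gauss_AE_notin_countable:
 assumes "countable C"
 shows "AE z in gauss. z \<notin> C"
proof -
 have "AE z in lborel. z \<notin> C"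
  using assms by (metis AE_not_in countable_imp_null_set_lborel)
 then show ?thesis
  unfolding gauss_def by (subst AE_density) auto
qed

lemma gauss_distr_scale:
 assumes "a \<noteq> 0"
 shows "distr gauss borel (\<lambda>z. a * z) = density lborel (normal_density 0 \<bar>a\<bar>)"
proof -
 have "distributed gauss lborel (\<lambda>z. z) (normal_density 0 1)"
  unfolding distributed_def gauss_def by (auto simp: distr_id2)
 from gauss.normal_density_affine[OF this, of a 0] assms
 have "distributed gauss lborel (\<lambda>z. a * z) (normal_density 0 \<bar>a\<bar>)" by simp
 then show ?thesis
  unfolding distributed_def by (simp cong: distr_cong)
qed

abbreviation joint_measurable :: "('a::topological_space => 'b::topological_space => real) => bool" where
 "joint_measurable f \<equiv> (\<lambda>(s, y). f s y) \<in> borel_measurable (borel \<Otimes>\<^sub>M borel)"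

section \<open>The heat semigroup\<close>

text \<open>The time \<open>r\<close> enters only through the scaling of one fixed Gaussian. Hence
  \<open>r = 0\<close> gives the identity, and limits in \<open>(r, x)\<close> jointly are dominated
  convergence under a fixed probability measure.\<close>

definition heat :: "real => (ereal => real) => ereal => real" where
 "heat r f x = (\<integral>z. f (x + ereal (sqrt r * z)) \<partial>gauss)"

lemma measurable_shift [measurable]:
 "(\<lambda>x::real \<times> ereal \<times> real. fst (snd x) + ereal (sqrt (fst x) * snd (snd x))) \<in> borel_measurable borel"
 unfolding borel_prod[symmetric] by measurable

lemma heat_integrable:
 fixes f :: "ereal => real"
 assumes [measurable]: "f \<in> borel_measurable borel" and "\<And>y. \<bar>f y\<bar> \<le> K"
 shows "integrable gauss (\<lambda>z. f (x + ereal (sqrt r * z)))"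
 using assms(2) by (intro gauss.integrable_const_bound[where B=K]) auto

lemma heat_bound:
 assumes [measurable]: "f \<in> borel_measurable borel" and b: "\<And>y. \<bar>f y\<bar> \<le> K"
 shows "\<bar>heat r f x\<bar> \<le> K"
proof -
 have "\<bar>heat r f x\<bar> \<le> (\<integral>z. \<bar>f (x + ereal (sqrt r * z))\<bar> \<partial>gauss)"
  unfolding heat_def by (rule integral_abs_bound)
 also have "... \<le> (\<integral>z. K \<partial>gauss)"
  using heat_integrable[OF assms] b by (intro integral_mono) auto
 finally show ?thesis by (simp add: gauss.prob_space[simplified])
qed

lemma heat_infinity [simp]:
 assumes "\<bar>x\<bar> = \<infinity>" shows "heat r f x = f x"
proof -
 have "x + ereal c = x" for c using assms by (cases x) auto
 then show ?thesis by (simp add: heat_def gauss.prob_space[simplified])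
qed

lemma heat_0 [simp]: "heat 0 f x = f x"
 by (simp add: heat_def zero_ereal_def[symmetric] gauss.prob_space[simplified])

lemma heat_mono:
 assumes [measurable]: "f \<in> borel_measurable borel" "g \<in> borel_measurable borel"
  and "\<And>y. \<bar>f y\<bar> \<le> K" "\<And>y. \<bar>g y\<bar> \<le> K'" "\<And>y. f y \<le> g y"
 shows "heat r f x \<le> heat r g x"
 unfolding heat_def using assms by (intro integral_mono heat_integrable) auto

lemma heat_diff:
 assumes "f \<in> borel_measurable borel" "g \<in> borel_measurable borel"
  and "\<And>y. \<bar>f y\<bar> \<le> K" "\<And>y. \<bar>g y\<bar> \<le> K'"
 shows "heat r (\<lambda>y. f y - g y) x = heat r f x - heat r g x"
 unfolding heat_def
 by (intro Bochner_Integration.integral_diff heat_integrable[OF assms(1,3)] heat_integrable[OF assms(2,4)])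

lemma heat_add:
 assumes "f \<in> borel_measurable borel" "g \<in> borel_measurable borel"
  and "\<And>y. \<bar>f y\<bar> \<le> K" "\<And>y. \<bar>g y\<bar> \<le> K'"
 shows "heat r (\<lambda>y. f y + g y) x = heat r f x + heat r g x"
 unfolding heat_def
 by (intro Bochner_Integration.integral_add heat_integrable[OF assms(1,3)] heat_integrable[OF assms(2,4)])

lemma heat_cmult: "heat r (\<lambda>y. c * f y) x = c * heat r f x"
 by (simp add: heat_def)

lemma heat_const [simp]: "heat r (\<lambda>y. c) x = c"
 by (simp add: heat_def gauss.prob_space[simplified])

lemma measurable_heat_joint:
 fixes f :: "'a => ereal => real"
 assumes [measurable]: "(\<lambda>(a, y). f a y) \<in> borel_measurable (A \<Otimes>\<^sub>M borel)"
  and [measurable]: "r \<in> borel_measurable A" "x \<in> borel_measurable A"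
 shows "(\<lambda>a. heat (r a) (f a) (x a)) \<in> borel_measurable A"
 unfolding heat_def by measurable

lemma measurable_heat [measurable]:
 assumes [measurable]: "f \<in> borel_measurable borel"
 shows "heat r f \<in> borel_measurable borel"
 by (rule measurable_heat_joint) simp_all

lemma heat_le_abs:
 assumes [measurable]: "f \<in> borel_measurable borel" "g \<in> borel_measurable borel"
  and f: "\<And>y. \<bar>f y\<bar> \<le> K" and g: "\<And>y. \<bar>g y\<bar> \<le> K'" and le: "\<And>y. \<bar>f y\<bar> \<le> g y"
 shows "\<bar>heat r f x\<bar> \<le> heat r g x"
proof -
 have "\<bar>heat r f x\<bar> \<le> (\<integral>z. \<bar>f (x + ereal (sqrt r * z))\<bar> \<partial>gauss)"
  unfolding heat_def by (rule integral_abs_bound)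
 also have "... \<le> heat r g x"
  unfolding heat_def using heat_integrable[of f K] f g le by (intro integral_mono heat_integrable) auto
 finally show ?thesis .
qed

text \<open>Jensen's inequality for the square: expand the nonnegative variance of \<open>f\<close>
  under the heat kernel.\<close>

lemma heat_power2_le:
 assumes [measurable]: "f \<in> borel_measurable borel" and f: "\<And>y. \<bar>f y\<bar> \<le> K"
 shows "(heat r f x)\<^sup>2 \<le> heat r (\<lambda>y. (f y)\<^sup>2) x"
proof -
 have b: "\<bar>(f y)\<^sup>2\<bar> \<le> K\<^sup>2" for y
  using f[of y] by (simp add: abs_le_square_iff[symmetric])
 define c where "c = heat r f x"
 have "0 \<le> heat r (\<lambda>y. (f y - c)\<^sup>2) x"
  unfolding heat_def by (intro integral_nonneg_AE) auto
 also have "... = heat r (\<lambda>y. (f y)\<^sup>2 - 2 * c * f y + c\<^sup>2) x"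
  by (simp add: power2_diff algebra_simps)
 also have "... = heat r (\<lambda>y. (f y)\<^sup>2) x - 2 * c * c + c\<^sup>2"
 proof -
  have i: "integrable gauss (\<lambda>z. f (x + ereal (sqrt r * z)))" "integrable gauss (\<lambda>z. (f (x + ereal (sqrt r * z)))\<^sup>2)"
   by (rule heat_integrable[OF assms(1) f]) (rule heat_integrable[of "\<lambda>y. (f y)\<^sup>2", OF _ b], simp)
  then show ?thesis
   by (simp add: heat_def c_def gauss.prob_space[simplified])
 qed
 finally show ?thesis by (simp add: c_def power2_eq_square)
qed

text \<open>Stability of the normal law under sums of independent variables. Variances equal to 0
  are split off because a degenerate normal law has no density.\<close>

lemma gauss_sum:
 fixes f :: "real => real"
 assumes r: "r \<ge> 0" and s: "s \<ge> 0" and [measurable]: "f \<in> borel_measurable borel"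
  and b: "\<And>y. \<bar>f y\<bar> \<le> K"
 shows "(\<integral>z. \<integral>w. f (sqrt r * z + sqrt s * w) \<partial>gauss \<partial>gauss) = (\<integral>z. f (sqrt (r + s) * z) \<partial>gauss)"
proof (cases "r = 0 \<or> s = 0")
 case True
 then show ?thesis by (auto simp: gauss.prob_space[simplified])
next
 case False
 with r s have pos: "r > 0" "s > 0" by auto
 interpret P: pair_prob_space gauss gauss ..
 let ?G = "gauss \<Otimes>\<^sub>M gauss"
 have X: "distributed ?G lborel (\<lambda>p. sqrt r * fst p) (normal_density 0 (sqrt r))"
  and Y: "distributed ?G lborel (\<lambda>p. sqrt s * snd p) (normal_density 0 (sqrt s))"
  and XY: "P.indep_var borel (\<lambda>p. sqrt r * fst p) borel (\<lambda>p. sqrt s * snd p)"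
 proof -
  have 1: "distr ?G borel fst = gauss" "distr ?G borel snd = gauss"
  proof -
   have "distr ?G gauss fst = gauss"
    by (rule gauss.distr_pair_fst)
   then show "distr ?G borel fst = gauss" by (simp cong: distr_cong)
   have "distr ?G gauss snd = gauss"
    by (intro measure_eqI)
     (auto simp: emeasure_distr gauss.emeasure_pair_measure_Times space_pair_measure gauss.emeasure_space_1[simplified]
       vimage_def snd_vimage_eq_Times[unfolded vimage_def])
   then show "distr ?G borel snd = gauss" by (simp cong: distr_cong)
  qed
  have n: "distributed ?G lborel fst (normal_density 0 1)" "distributed ?G lborel snd (normal_density 0 1)"
   unfolding distributed_def using 1 by (auto simp: gauss_def cong: distr_cong)
  show "distributed ?G lborel (\<lambda>p. sqrt r * fst p) (normal_density 0 (sqrt r))"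
   using P.normal_density_affine[OF n(1), of "sqrt r" 0] pos by simp
  show "distributed ?G lborel (\<lambda>p. sqrt s * snd p) (normal_density 0 (sqrt s))"
   using P.normal_density_affine[OF n(2), of "sqrt s" 0] pos by simp
  have "P.indep_var borel fst borel snd"
   by (subst P.indep_var_distribution_eq) (simp add: 1 distr_id2 sets_pair_measure_cong[of gauss borel gauss borel])
  from P.indep_var_compose[OF this, of "\<lambda>x. sqrt r * x" borel "\<lambda>x. sqrt s * x" borel]
  show "P.indep_var borel (\<lambda>p. sqrt r * fst p) borel (\<lambda>p. sqrt s * snd p)"
   by (simp add: comp_def)
 qed
 have "distributed ?G lborel (\<lambda>p. sqrt r * fst p + sqrt s * snd p) (normal_density 0 (sqrt (r + s)))"
  using P.add_indep_normal[OF XY _ _ X Y] pos by simp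
 then have "distr ?G borel (\<lambda>p. sqrt r * fst p + sqrt s * snd p) = density lborel (normal_density 0 (sqrt (r + s)))"
  by (simp add: distributed_def cong: distr_cong)
 also have "... = distr gauss borel (\<lambda>z. sqrt (r + s) * z)"
  using gauss_distr_scale[of "sqrt (r + s)"] pos by simp
 finally have eq: "distr ?G borel (\<lambda>p. sqrt r * fst p + sqrt s * snd p) = distr gauss borel (\<lambda>z. sqrt (r + s) * z)" .
 have "(\<integral>z. \<integral>w. f (sqrt r * z + sqrt s * w) \<partial>gauss \<partial>gauss) = (\<integral>p. f (sqrt r * fst p + sqrt s * snd p) \<partial>?G)"
  using b by (subst P.integral_fst'[symmetric]) (auto intro!: P.integrable_const_bound[where B=K])
 also have "... = (\<integral>y. f y \<partial>distr ?G borel (\<lambda>p. sqrt r * fst p + sqrt s * snd p))"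
  by (subst integral_distr) auto
 also have "... = (\<integral>z. f (sqrt (r + s) * z) \<partial>gauss)"
  unfolding eq by (subst integral_distr) auto
 finally show ?thesis .
qed

lemma heat_semigroup:
 assumes r: "r \<ge> 0" and s: "s \<ge> 0" and [measurable]: "f \<in> borel_measurable borel"
  and b: "\<And>y. \<bar>f y\<bar> \<le> K"
 shows "heat r (heat s f) x = heat (r + s) f x"
proof -
 have "heat r (heat s f) x = (\<integral>z. \<integral>w. f (x + ereal (sqrt r * z + sqrt s * w)) \<partial>gauss \<partial>gauss)"
  unfolding heat_def by (simp add: add.assoc)
 also have "... = heat (r + s) f x"
  unfolding heat_def by (rule gauss_sum[OF r s _ b]) simp
 finally show ?thesis .
qed

text \<open>The space derivative of the heat semigroup after a Gaussian integration by parts: the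
  derivative falls on the kernel, so the formula makes sense for every bounded measurable
  \<open>f\<close>, at the price of the factor \<open>1 / sqrt r\<close>.\<close>

definition dheat :: "real => (ereal => real) => ereal => real" where
 "dheat r f x = (\<integral>z. z * f (x + ereal (sqrt r * z)) \<partial>gauss) / sqrt r"

lemma dheat_integrable:
 assumes [measurable]: "f \<in> borel_measurable borel" and b: "\<And>y. \<bar>f y\<bar> \<le> K"
 shows "integrable gauss (\<lambda>z. z * f (x + ereal (sqrt r * z)))"
proof (rule Bochner_Integration.integrable_bound)
 show "integrable gauss (\<lambda>z. \<bar>z\<bar> * K)"
  using integrable_gauss_abs by simp
 show "AE z in gauss. norm (z * f (x + ereal (sqrt r * z))) \<le> norm (\<bar>z\<bar> * K)"
  using b by (auto simp: abs_mult intro!: mult_left_mono order_trans[OF b])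
qed auto

lemma dheat_bound:
 assumes [measurable]: "f \<in> borel_measurable borel" and b: "\<And>y. \<bar>f y\<bar> \<le> K" and r: "r \<ge> 0"
 shows "\<bar>dheat r f x\<bar> \<le> K / sqrt r"
proof -
 have K: "K \<ge> 0" using b[of 0] by auto
 have "\<bar>\<integral>z. z * f (x + ereal (sqrt r * z)) \<partial>gauss\<bar> \<le> (\<integral>z. \<bar>z * f (x + ereal (sqrt r * z))\<bar> \<partial>gauss)"
  by (rule integral_abs_bound)
 also have "... \<le> (\<integral>z. \<bar>z\<bar> * K \<partial>gauss)"
  using integrable_abs[OF dheat_integrable[OF assms(1) b]] b integrable_gauss_abs
  by (intro integral_mono) (auto simp: abs_mult intro!: mult_left_mono)
 also have "... \<le> 1 * K"
  using integral_gauss_abs_le_1 K by (simp add: mult_left_le_one_le)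
 finally show ?thesis
  using r by (simp add: dheat_def abs_divide divide_right_mono)
qed

lemma measurable_dheat_joint:
 fixes f :: "'a => ereal => real"
 assumes [measurable]: "(\<lambda>(a, y). f a y) \<in> borel_measurable (A \<Otimes>\<^sub>M borel)"
  and [measurable]: "r \<in> borel_measurable A" "x \<in> borel_measurable A"
 shows "(\<lambda>a. dheat (r a) (f a) (x a)) \<in> borel_measurable A"
 unfolding dheat_def by measurable

lemma measurable_dheat [measurable]:
 assumes [measurable]: "f \<in> borel_measurable borel"
 shows "dheat r f \<in> borel_measurable borel"
 by (rule measurable_dheat_joint) simp_all

lemma normal_density_shift:
 "\<sigma> > 0 ==> normal_density x \<sigma> (x + \<sigma> * z) = std_normal_density z / \<sigma>"
 by (simp add: normal_density_def real_sqrt_mult power_mult_distrib)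

lemma gauss_integral_lborel:
 fixes F :: "real => real"
 assumes \<sigma>: "\<sigma> > 0" and [measurable]: "F \<in> borel_measurable borel"
 shows "(\<integral>z. F (x + \<sigma> * z) \<partial>gauss) = (\<integral>y. F y * normal_density x \<sigma> y \<partial>lborel)"
proof -
 have "(\<integral>y. F y * normal_density x \<sigma> y \<partial>lborel) = \<sigma> * (\<integral>z. F (x + \<sigma> * z) * (std_normal_density z / \<sigma>) \<partial>lborel)"
  using \<sigma> lborel_integral_real_affine[of \<sigma> "\<lambda>y. F y * normal_density x \<sigma> y" x]
  by (simp add: normal_density_shift)
 also have "... = (\<integral>z. \<sigma> * (F (x + \<sigma> * z) * (std_normal_density z / \<sigma>)) \<partial>lborel)"
  by (rule integral_mult_right_zero[symmetric])
 also have "... = (\<integral>z. F (x + \<sigma> * z) \<partial>gauss)"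
  using \<sigma> by (subst integral_gauss) (auto simp: mult.commute)
 finally show ?thesis by simp
qed

lemma gauss_integrable_lborel:
 fixes F :: "real => real"
 assumes \<sigma>: "\<sigma> > 0" and [measurable]: "F \<in> borel_measurable borel"
 shows "integrable gauss (\<lambda>z. F (x + \<sigma> * z)) \<longleftrightarrow> integrable lborel (\<lambda>y. F y * normal_density x \<sigma> y)"
proof -
 have "integrable lborel (\<lambda>y. F y * normal_density x \<sigma> y)
   \<longleftrightarrow> integrable lborel (\<lambda>z. F (x + \<sigma> * z) * (std_normal_density z / \<sigma>))"
  using \<sigma> lborel_integrable_real_affine_iff[of \<sigma> "\<lambda>y. F y * normal_density x \<sigma> y" x]
  by (simp add: normal_density_shift)
 also have "... \<longleftrightarrow> integrable lborel (\<lambda>z. (F (x + \<sigma> * z) * std_normal_density z) / \<sigma>)"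
  by simp
 also have "... \<longleftrightarrow> integrable gauss (\<lambda>z. F (x + \<sigma> * z))"
  using \<sigma> integrable_mult_left_iff[of lborel "1 / \<sigma>" "\<lambda>z. F (x + \<sigma> * z) * std_normal_density z"]
  by (subst integrable_gauss) (auto simp: mult.commute)
 finally show ?thesis by simp
qed

lemma normal_density_deriv_mean:
 assumes "\<sigma> > 0"
 shows "((\<lambda>x. normal_density x \<sigma> y) has_real_derivative (y - x) / \<sigma>\<^sup>2 * normal_density x \<sigma> y) (at x within S)"
proof -
 have "((\<lambda>x. exp (- (y - x)\<^sup>2 / (2 * \<sigma>\<^sup>2))) has_real_derivative (y - x) / \<sigma>\<^sup>2 * exp (- (y - x)\<^sup>2 / (2 * \<sigma>\<^sup>2))) (at x within S)"
  using assms by (auto intro!: derivative_eq_intros simp: field_simps)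
 from DERIV_cmult[OF this, of "1 / sqrt (2 * pi * \<sigma>\<^sup>2)"] show ?thesis
  unfolding normal_density_def by (simp add: mult_ac)
qed

text \<open>Since \<open>f\<close> is merely measurable, the derivative is taken of the normal
  density in its mean. The identity is stated in integrated form: Fubini and the fundamental theorem
  of calculus prove it without differentiating under an integral, and it stays usable when
  \<open>dheat\<close> is later integrated over singular ages.\<close>

lemma heat_diff_eq_integral_dheat:
 assumes [measurable]: "f \<in> borel_measurable borel" and b: "\<And>y. \<bar>f y\<bar> \<le> K"
  and r: "r > 0" and ab: "a \<le> b"
 shows "heat r f (ereal b) - heat r f (ereal a) = (\<integral>x. indicator {a..b} x * dheat r f (ereal x) \<partial>lborel)"
proof -
 define \<sigma> where "\<sigma> = sqrt r"
 have \<sigma>: "\<sigma> > 0" "\<sigma>\<^sup>2 = r" using r by (auto simp: \<sigma>_def)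
 define F where "F = (\<lambda>y::real. f (ereal y))"
 have [measurable]: "F \<in> borel_measurable borel" unfolding F_def by measurable
 have K: "K \<ge> 0" using b[of 0] by auto
 have bF: "\<bar>F y\<bar> \<le> K" for y using b by (simp add: F_def)
 have h: "heat r f (ereal x) = (\<integral>y. F y * normal_density x \<sigma> y \<partial>lborel)" for x
  using gauss_integral_lborel[OF \<sigma>(1), of F x] by (simp add: heat_def F_def \<sigma>_def)
 \<comment> \<open>\<open>k x y\<close> is the derivative in \<open>x\<close> of
   \<open>F y * normal_density x \<sigma> y\<close>.\<close>
 define k where "k = (\<lambda>x y. F y * ((y - x) / \<sigma>\<^sup>2 * normal_density x \<sigma> y))"
 have [measurable]: "joint_measurable k"
  unfolding k_def normal_density_def by measurable
 have d: "dheat r f (ereal x) = (\<integral>y. k x y \<partial>lborel)" for x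
 proof -
  have "(\<integral>y. k x y \<partial>lborel) = (\<integral>y. (F y * ((y - x) / \<sigma>\<^sup>2)) * normal_density x \<sigma> y \<partial>lborel)"
   by (simp add: k_def mult.assoc)
  also have "... = (\<integral>z. F (x + \<sigma> * z) * (((x + \<sigma> * z) - x) / \<sigma>\<^sup>2) \<partial>gauss)"
   by (rule gauss_integral_lborel[OF \<sigma>(1), symmetric]) measurable
  also have "... = (\<integral>z. z * F (x + \<sigma> * z) / \<sigma> \<partial>gauss)"
   using \<sigma>(1) by (intro Bochner_Integration.integral_cong) (auto simp: power2_eq_square field_simps)
  finally show ?thesis using \<sigma> by (simp add: dheat_def F_def \<sigma>_def)
 qed
 have ki: "integrable lborel (k x)" for x
 proof -
  have "integrable gauss (\<lambda>z. F (x + \<sigma> * z) * (((x + \<sigma> * z) - x) / \<sigma>\<^sup>2))"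
  proof -
   have "(\<lambda>z. F (x + \<sigma> * z) * (((x + \<sigma> * z) - x) / \<sigma>\<^sup>2)) = (\<lambda>z. z * f (ereal x + ereal (sqrt r * z)) / \<sigma>)"
    using \<sigma>(1) by (auto simp: F_def \<sigma>_def[symmetric] power2_eq_square)
   then show ?thesis
    using integrable_divide_zero[OF dheat_integrable[OF assms(1) b, of "ereal x" r], of \<sigma>] by simp
  qed
  then have "integrable lborel (\<lambda>y. (F y * ((y - x) / \<sigma>\<^sup>2)) * normal_density x \<sigma> y)"
   by (subst (asm) gauss_integrable_lborel[OF \<sigma>(1)]) auto
  then show ?thesis by (simp add: k_def mult.assoc)
 qed
 have kb: "(\<integral>y. \<bar>k x y\<bar> \<partial>lborel) \<le> K / \<sigma>" for x
 proof -
  have "(\<integral>y. \<bar>k x y\<bar> \<partial>lborel) = (\<integral>y. (\<bar>F y\<bar> * (\<bar>y - x\<bar> / \<sigma>\<^sup>2)) * normal_density x \<sigma> y \<partial>lborel)"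
   by (simp add: k_def abs_mult mult.assoc)
  also have "... = (\<integral>z. \<bar>F (x + \<sigma> * z)\<bar> * (\<bar>(x + \<sigma> * z) - x\<bar> / \<sigma>\<^sup>2) \<partial>gauss)"
   by (rule gauss_integral_lborel[OF \<sigma>(1), symmetric]) measurable
  also have "... \<le> (\<integral>z. K / \<sigma> * \<bar>z\<bar> \<partial>gauss)"
  proof (rule integral_mono)
   show "integrable gauss (\<lambda>z. \<bar>F (x + \<sigma> * z)\<bar> * (\<bar>(x + \<sigma> * z) - x\<bar> / \<sigma>\<^sup>2))"
   proof -
    have "(\<lambda>z. \<bar>F (x + \<sigma> * z)\<bar> * (\<bar>(x + \<sigma> * z) - x\<bar> / \<sigma>\<^sup>2)) = (\<lambda>z. \<bar>z * f (ereal x + ereal (sqrt r * z))\<bar> / \<sigma>)"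
     using \<sigma>(1) by (auto simp: F_def \<sigma>_def[symmetric] power2_eq_square abs_mult)
    then show ?thesis
     using integrable_divide_zero[OF integrable_abs[OF dheat_integrable[OF assms(1) b, of "ereal x" r]], of \<sigma>] by simp
   qed
   show "integrable gauss (\<lambda>z. K / \<sigma> * \<bar>z\<bar>)"
    using integrable_gauss_abs by simp
   show "\<bar>F (x + \<sigma> * z)\<bar> * (\<bar>(x + \<sigma> * z) - x\<bar> / \<sigma>\<^sup>2) \<le> K / \<sigma> * \<bar>z\<bar>" for z
    using bF[of "x + \<sigma> * z"] \<sigma>(1)
    mult_right_mono[OF bF[of "x + \<sigma> * z"], of "\<bar>z\<bar>"]
    by (simp add: abs_mult power2_eq_square) (simp add: field_simps)
  qed
  also have "... \<le> K / \<sigma> * 1"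
   using integral_gauss_abs_le_1 K \<sigma> by (simp add: divide_right_mono mult_left_le)
  finally show ?thesis by simp
 qed
 have prod: "integrable (lborel \<Otimes>\<^sub>M lborel) (\<lambda>(x, y). indicator {a..b} x * k x y)"
 proof (rule lborel_pair.Fubini_integrable)
  show "integrable lborel (\<lambda>x. \<integral>y. norm (case (x, y) of (x, y) => indicator {a..b} x * k x y) \<partial>lborel)"
  proof (rule Bochner_Integration.integrable_bound)
   show "integrable lborel (\<lambda>x. indicator {a..b} x * (K / \<sigma>))"
    by (intro integrable_mult_left integrable_real_indicator) (use ab in auto)
   show "AE x in lborel. norm (\<integral>y. norm (case (x, y) of (x, y) => indicator {a..b} x * k x y) \<partial>lborel)
     \<le> norm (indicator {a..b} x * (K / \<sigma>))"
    using kb K \<sigma> by (auto simp: abs_mult indicator_def)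
  qed simp
  show "AE x in lborel. integrable lborel (\<lambda>y. case (x, y) of (x, y) => indicator {a..b} x * k x y)"
   using ki by simp
 qed simp
 have "(\<integral>x. indicator {a..b} x * dheat r f (ereal x) \<partial>lborel) = (\<integral>x. (\<integral>y. indicator {a..b} x * k x y \<partial>lborel) \<partial>lborel)"
  by (simp add: d)
 also have "... = (\<integral>y. (\<integral>x. indicator {a..b} x * k x y \<partial>lborel) \<partial>lborel)"
  using lborel_pair.Fubini_integral[OF prod] by simp
 also have "... = (\<integral>y. F y * normal_density b \<sigma> y - F y * normal_density a \<sigma> y \<partial>lborel)"
 proof (rule Bochner_Integration.integral_cong[OF refl])
  fix y
  have "(\<integral>x. indicator {a..b} x * k x y \<partial>lborel)
    = (\<integral>x. F y * (indicator {a..b} x *\<^sub>R ((y - x) / \<sigma>\<^sup>2 * normal_density x \<sigma> y)) \<partial>lborel)"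
   by (intro Bochner_Integration.integral_cong) (auto simp: k_def)
  also have "... = F y * (\<integral>x. indicator {a..b} x *\<^sub>R ((y - x) / \<sigma>\<^sup>2 * normal_density x \<sigma> y) \<partial>lborel)"
   by (rule integral_mult_right_zero)
  also have "(\<integral>x. indicator {a..b} x *\<^sub>R ((y - x) / \<sigma>\<^sup>2 * normal_density x \<sigma> y) \<partial>lborel)
    = normal_density b \<sigma> y - normal_density a \<sigma> y"
  proof (rule integral_FTC_atLeastAtMost[OF ab])
   show "((\<lambda>x. normal_density x \<sigma> y) has_vector_derivative (y - x) / \<sigma>\<^sup>2 * normal_density x \<sigma> y) (at x within {a..b})" for x
    using normal_density_deriv_mean[OF \<sigma>(1)]
    by (simp add: has_real_derivative_iff_has_vector_derivative)
   show "continuous_on {a..b} (\<lambda>x. (y - x) / \<sigma>\<^sup>2 * normal_density x \<sigma> y)"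
    unfolding normal_density_def using \<sigma> by (intro continuous_intros) auto
  qed
  finally show "(\<integral>x. indicator {a..b} x * k x y \<partial>lborel) = F y * normal_density b \<sigma> y - F y * normal_density a \<sigma> y"
   by (simp add: algebra_simps)
 qed
 also have "... = heat r f (ereal b) - heat r f (ereal a)"
 proof -
  have "integrable lborel (\<lambda>y. F y * normal_density x \<sigma> y)" for x
   using heat_integrable[OF assms(1) b, of "ereal x" r]
   by (subst gauss_integrable_lborel[OF \<sigma>(1), symmetric]) (auto simp: F_def \<sigma>_def)
  then show ?thesis by (simp add: h)
 qed
 finally show ?thesis by simp
qed

text \<open>Smoothing: bounded measurable data become Lipschitz after time \<open>r\<close>, by
  integrating the gradient bound \<open>K / sqrt r\<close>. At the infinite points a shift has no
  effect and the bound is trivial.\<close>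

lemma heat_Lipschitz:
 assumes f [measurable]: "f \<in> borel_measurable borel" and b: "\<And>y. \<bar>f y\<bar> \<le> K" and r: "r > 0"
 shows "\<bar>heat r f (x + ereal c) - heat r f x\<bar> \<le> K / sqrt r * \<bar>c\<bar>"
proof -
 have K: "K \<ge> 0" using b[of 0] by auto
 have *: "\<bar>heat r f (ereal d) - heat r f (ereal a)\<bar> \<le> K / sqrt r * (d - a)" if "a \<le> d" for a d
 proof -
  have i: "integrable lborel (\<lambda>x. indicator {a..d} x * (K / sqrt r))"
   by (intro integrable_mult_left integrable_real_indicator) (use that in auto)
  have bd: "\<bar>indicator {a..d} x * dheat r f (ereal x)\<bar> \<le> indicator {a..d} x * (K / sqrt r)" for x
   using dheat_bound[OF f b, of r "ereal x"] r by (auto simp: indicator_def)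
  have "\<bar>\<integral>x. indicator {a..d} x * dheat r f (ereal x) \<partial>lborel\<bar> \<le> (\<integral>x. \<bar>indicator {a..d} x * dheat r f (ereal x)\<bar> \<partial>lborel)"
   by (rule integral_abs_bound)
  also have "... \<le> (\<integral>x. indicator {a..d} x * (K / sqrt r) \<partial>lborel)"
   by (rule integral_mono'[OF i bd]) (use K r in \<open>auto simp: indicator_def\<close>)
  also have "... = K / sqrt r * (d - a)" using that by simp
  finally show ?thesis
   using heat_diff_eq_integral_dheat[OF f b r that] by simp
 qed
 show ?thesis
 proof (cases x)
  case (real y)
  then show ?thesis
   using *[of y "y + c"] *[of "y + c" y] by (cases "c \<ge> 0") (auto simp: abs_minus_commute)
 next
  case PInf
  then show ?thesis using K r by simp
 next
  case MInf
  then show ?thesis using K r by simp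
 qed
qed

text \<open>Brownian motion travels \<open>sqrt r * \<bar>z\<bar>\<close> in time \<open>r\<close>,
  and the mean of \<open>\<bar>z\<bar>\<close> is at most 1.\<close>

lemma heat_minus_self_Lipschitz:
 assumes f [measurable]: "f \<in> borel_measurable borel" and b: "\<And>y. \<bar>f y\<bar> \<le> K" and r: "r \<ge> 0"
  and lip: "\<And>y c. \<bar>f (y + ereal c) - f y\<bar> \<le> \<Lambda> * \<bar>c\<bar>"
 shows "\<bar>heat r f x - f x\<bar> \<le> \<Lambda> * sqrt r"
proof -
 have L: "\<Lambda> \<ge> 0" using lip[of 0 1] by simp
 have "heat r f x - f x = (\<integral>z. f (x + ereal (sqrt r * z)) - f x \<partial>gauss)"
  unfolding heat_def using heat_integrable[OF f b, of x r]
  by (subst Bochner_Integration.integral_diff) (simp_all add: gauss.prob_space[simplified])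
 also have "\<bar>...\<bar> \<le> (\<integral>z. \<bar>f (x + ereal (sqrt r * z)) - f x\<bar> \<partial>gauss)"
  by (rule integral_abs_bound)
 also have "... \<le> (\<integral>z. \<Lambda> * sqrt r * \<bar>z\<bar> \<partial>gauss)"
  using integrable_gauss_abs r lip[of x] L
  by (intro integral_mono') (auto simp: abs_mult mult.assoc intro: order_trans[OF lip])
 also have "... \<le> \<Lambda> * sqrt r * 1"
  using L r integral_gauss_abs_le_1 by (simp add: mult_left_le)
 finally show ?thesis by simp
qed

section \<open>The Duhamel integral\<close>

text \<open>\<open>r\<close> is the age of the source, so the source acts at time
  \<open>t - r\<close>. With the open interval, \<open>f\<close> contributes at strictly positive
  times only, where bounds and continuity are available.\<close>

definition duhamel :: "(real => ereal => real) => real => ereal => real" where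
 "duhamel f t x = (\<integral>r. indicator {0<..<t} r * heat r (f (t - r)) x \<partial>lborel)"

lemma borel_measurable_slice:
 assumes "joint_measurable f"
 shows "f s \<in> borel_measurable borel"
 using measurable_Pair2[OF assms, of s] by simp

lemma borel_measurable_uncurry:
 assumes "joint_measurable f"
  and "s \<in> borel_measurable A" "x \<in> borel_measurable A"
 shows "(\<lambda>a. f (s a) (x a)) \<in> borel_measurable A"
 using measurable_compose[OF measurable_Pair[OF assms(2,3)] assms(1)] by simp

lemma measurable_heat_slice:
 assumes f: "joint_measurable f"
  and [measurable]: "r \<in> borel_measurable A" "s \<in> borel_measurable A" "x \<in> borel_measurable A"
 shows "(\<lambda>a. heat (r a) (f (s a)) (x a)) \<in> borel_measurable A"
proof (rule measurable_heat_joint)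
 show "(\<lambda>(a, y). f (s a) y) \<in> borel_measurable (A \<Otimes>\<^sub>M borel)"
  using borel_measurable_uncurry[OF f, of "\<lambda>p. s (fst p)" "A \<Otimes>\<^sub>M borel" snd]
  by (simp add: case_prod_beta')
qed fact+

lemma borel_measurable_indicator_age [measurable]:
 fixes r t :: "'a => real"
 assumes [measurable]: "r \<in> borel_measurable A" "t \<in> borel_measurable A"
 shows "(\<lambda>a. indicator {0<..<t a} (r a) :: real) \<in> borel_measurable A"
proof -
 have "(\<lambda>a. indicator {0<..<t a} (r a) :: real) = (\<lambda>a. if 0 < r a \<and> r a < t a then 1 else 0)"
  by (auto simp: indicator_def)
 then show ?thesis by simp
qed

lemma measurable_duhamel [measurable]:
 assumes [measurable]: "joint_measurable f"
 shows "joint_measurable (\<lambda>t x. duhamel f t x)"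
proof -
 have [measurable]: "(\<lambda>x. heat (snd x) (f (fst (fst x) - snd x)) (snd (fst x))) \<in> borel_measurable ((borel \<Otimes>\<^sub>M borel) \<Otimes>\<^sub>M lborel)"
  by (rule measurable_heat_slice[OF assms]) auto
 show ?thesis
  unfolding duhamel_def by measurable
qed

lemma duhamel_0 [simp]: "t \<le> 0 ==> duhamel f t x = 0"
 by (simp add: duhamel_def)

lemma heat_slice_bound:
 assumes [measurable]: "joint_measurable f"
  and b: "\<And>s y. 0 < s ==> \<bar>f s y\<bar> \<le> g s" and s: "0 < s"
 shows "\<bar>heat r (f s) x\<bar> \<le> g s"
 by (rule heat_bound) (use b s borel_measurable_slice[OF assms(1)] in auto)

lemma duhamel_integrable:
 assumes [measurable]: "joint_measurable f"
  and b: "\<And>s y. 0 < s ==> \<bar>f s y\<bar> \<le> K"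
 shows "integrable lborel (\<lambda>r. indicator {0<..<t} r * heat r (f (t - r)) x)"
proof (rule Bochner_Integration.integrable_bound)
 show "integrable lborel (\<lambda>r. indicator {0<..<t} r * K)"
  by (cases "t \<ge> 0") auto
 show "AE r in lborel. norm (indicator {0<..<t} r * heat r (f (t - r)) x) \<le> norm (indicator {0<..<t} r * K)"
  using heat_slice_bound[OF assms(1) b] by (auto simp: indicator_def intro!: order_trans[OF heat_slice_bound[OF assms(1) b]])
 have [measurable]: "(\<lambda>r. heat r (f (t - r)) x) \<in> borel_measurable lborel"
  by (rule measurable_heat_slice[OF assms(1)]) auto
 show "(\<lambda>r. indicator {0<..<t} r * heat r (f (t - r)) x) \<in> borel_measurable lborel"
  by measurable
qed

lemma duhamel_abs_le:
 assumes [measurable]: "joint_measurable f"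
  and b: "\<And>s y. 0 < s ==> \<bar>f s y\<bar> \<le> g s"
  and i: "integrable lborel (\<lambda>r. indicator {0<..<t} r * g (t - r))"
 shows "\<bar>duhamel f t x\<bar> \<le> (\<integral>r. indicator {0<..<t} r * g (t - r) \<partial>lborel)"
proof -
 have "\<bar>duhamel f t x\<bar> \<le> (\<integral>r. \<bar>indicator {0<..<t} r * heat r (f (t - r)) x\<bar> \<partial>lborel)"
  unfolding duhamel_def by (rule integral_abs_bound)
 also have "... \<le> (\<integral>r. indicator {0<..<t} r * g (t - r) \<partial>lborel)"
  using heat_slice_bound[OF assms(1) b] order_trans[OF abs_ge_zero b]
  by (intro integral_mono'[OF i]) (auto simp: indicator_def)
 finally show ?thesis .
qed

lemma duhamel_bound:
 assumes [measurable]: "joint_measurable f"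
  and b: "\<And>s y. 0 < s ==> \<bar>f s y\<bar> \<le> K" and t: "t \<ge> 0"
 shows "\<bar>duhamel f t x\<bar> \<le> K * t"
 using duhamel_abs_le[OF assms(1) b, of t x] t by (simp add: mult.commute)

lemma integral_exp_interval:
 fixes L t :: real
 assumes "L > 0" "t \<ge> 0"
 shows "integrable lborel (\<lambda>r. indicator {0<..<t} r * exp (L * (t - r)))"
  and "(\<integral>r. indicator {0<..<t} r * exp (L * (t - r)) \<partial>lborel) \<le> exp (L * t) / L"
proof -
 have c: "continuous_on {0..t} (\<lambda>r. exp (L * (t - r)))" by (intro continuous_intros)
 have i: "integrable lborel (\<lambda>r. indicator {0..t} r *\<^sub>R exp (L * (t - r)))"
  using borel_integrable_atLeastAtMost'[OF c] by (simp add: set_integrable_def)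
 show i': "integrable lborel (\<lambda>r. indicator {0<..<t} r * exp (L * (t - r)))"
  by (rule Bochner_Integration.integrable_bound[OF i]) (auto simp: indicator_def)
 have "(\<integral>r. indicator {0<..<t} r * exp (L * (t - r)) \<partial>lborel) \<le> (\<integral>r. indicator {0..t} r *\<^sub>R exp (L * (t - r)) \<partial>lborel)"
  by (rule integral_mono[OF i' i]) (auto simp: indicator_def)
 also have "... = (- exp (L * (t - t)) / L) - (- exp (L * (t - 0)) / L)"
  by (rule integral_FTC_atLeastAtMost[OF assms(2) _ c])
    (use assms in \<open>auto intro!: derivative_eq_intros simp: has_real_derivative_iff_has_vector_derivative[symmetric]\<close>)
 also have "... \<le> exp (L * t) / L" using assms by (simp add: field_simps)
 finally show "(\<integral>r. indicator {0<..<t} r * exp (L * (t - r)) \<partial>lborel) \<le> exp (L * t) / L" .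
qed

text \<open>Measured in the weight \<open>exp (L * t)\<close>, integration in time gains a factor
  \<open>1 / L\<close>. A large rate therefore makes the Picard map a contraction for all times at
  once.\<close>

lemma duhamel_bound_exp:
 assumes [measurable]: "joint_measurable f"
  and b: "\<And>s y. 0 < s ==> \<bar>f s y\<bar> \<le> A * exp (L * s)" and t: "t \<ge> 0" and L: "L > 0"
 shows "\<bar>duhamel f t x\<bar> \<le> A / L * exp (L * t)"
proof -
 have A: "A \<ge> 0" using order_trans[OF abs_ge_zero b[of 1 0]] by (simp add: zero_le_mult_iff)
 have i: "integrable lborel (\<lambda>r. indicator {0<..<t} r * (A * exp (L * (t - r))))"
  using integrable_mult_right[OF integral_exp_interval(1)[OF L t], of A] by (simp add: mult.left_commute)
 have "\<bar>duhamel f t x\<bar> \<le> (\<integral>r. indicator {0<..<t} r * (A * exp (L * (t - r))) \<partial>lborel)"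
  by (rule duhamel_abs_le[OF assms(1) b i])
 also have "... = A * (\<integral>r. indicator {0<..<t} r * exp (L * (t - r)) \<partial>lborel)"
  by (subst integral_mult_right_zero[symmetric]) (simp add: mult.left_commute)
 also have "... \<le> A * (exp (L * t) / L)"
  by (rule mult_left_mono[OF integral_exp_interval(2)[OF L t] A])
 finally show ?thesis by simp
qed

lemma duhamel_diff:
 fixes f g :: "real => ereal => real"
 assumes [measurable]: "joint_measurable f"
   "joint_measurable g"
  and b: "\<And>s y. 0 < s ==> \<bar>f s y\<bar> \<le> K" "\<And>s y. 0 < s ==> \<bar>g s y\<bar> \<le> K'"
 shows "duhamel (\<lambda>s y. f s y - g s y) t x = duhamel f t x - duhamel g t x"
proof -
 have "heat r (\<lambda>y. f (t - r) y - g (t - r) y) x = heat r (f (t - r)) x - heat r (g (t - r)) x"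
  if "0 < r" "r < t" for r
  by (rule heat_diff[where K=K and K'=K']) (use that b borel_measurable_slice assms(1,2) in auto)
 then have "duhamel (\<lambda>s y. f s y - g s y) t x
   = (\<integral>r. indicator {0<..<t} r * heat r (f (t - r)) x - indicator {0<..<t} r * heat r (g (t - r)) x \<partial>lborel)"
  unfolding duhamel_def by (intro Bochner_Integration.integral_cong) (auto simp: indicator_def)
 also have "... = duhamel f t x - duhamel g t x"
  unfolding duhamel_def
  by (intro Bochner_Integration.integral_diff duhamel_integrable[OF assms(1) b(1)] duhamel_integrable[OF assms(2) b(2)])
 finally show ?thesis .
qed

text \<open>Fubini moves the heat flow under the age integral, where the semigroup law adds
  \<open>d\<close> to each age.\<close>

lemma heat_duhamel:
 assumes [measurable]: "joint_measurable f"
  and b: "\<And>s y. 0 < s ==> \<bar>f s y\<bar> \<le> K" and d: "d \<ge> 0"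
 shows "heat d (duhamel f s) x = (\<integral>r. indicator {0<..<s} r * heat (d + r) (f (s - r)) x \<partial>lborel)"
proof -
 interpret P: pair_sigma_finite gauss lborel ..
 have [measurable]: "(\<lambda>p. heat (snd p) (f (s - snd p)) (x + ereal (sqrt d * fst p))) \<in> borel_measurable (gauss \<Otimes>\<^sub>M lborel)"
  by (rule measurable_heat_slice[OF assms(1)]) auto
 have m: "(\<lambda>(z, r). indicator {0<..<s} r * heat r (f (s - r)) (x + ereal (sqrt d * z))) \<in> borel_measurable (gauss \<Otimes>\<^sub>M lborel)"
  by measurable
 have hb: "\<bar>indicator {0<..<s} r * heat r (f (s - r)) y\<bar> \<le> indicator {0<..<s} r * K" for r y
  using heat_slice_bound[OF assms(1) b, of "s - r"] by (auto simp: indicator_def)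
 have i0: "integrable lborel (\<lambda>r. indicator {0<..<s} r * K)" by (cases "s \<ge> 0") auto
 have i: "integrable (gauss \<Otimes>\<^sub>M lborel) (\<lambda>(z, r). indicator {0<..<s} r * heat r (f (s - r)) (x + ereal (sqrt d * z)))"
 proof (rule P.Fubini_integrable[OF m])
  have mm: "(\<lambda>z. \<integral>r. norm (case (z, r) of (z, r) => indicator {0<..<s} r * heat r (f (s - r)) (x + ereal (sqrt d * z))) \<partial>lborel) \<in> borel_measurable gauss"
   by (rule lborel.borel_measurable_lebesgue_integral) (use m in measurable)
  show "integrable gauss (\<lambda>z. \<integral>r. norm (case (z, r) of (z, r) => indicator {0<..<s} r * heat r (f (s - r)) (x + ereal (sqrt d * z))) \<partial>lborel)"
  proof (rule gauss.integrable_const_bound[OF _ mm])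
   have "0 \<le> indicator {0<..<s} r * K" for r
    using hb[of r x] order_trans[OF abs_ge_zero] by blast
   then show "AE z in gauss. norm (\<integral>r. norm (case (z, r) of (z, r) => indicator {0<..<s} r * heat r (f (s - r)) (x + ereal (sqrt d * z))) \<partial>lborel)
     \<le> (\<integral>r. indicator {0<..<s} r * K \<partial>lborel)"
    using hb by (intro AE_I2) (simp del: integral_mult_left_zero integral_mult_right_zero, intro integral_mono'[OF i0], auto)
  qed
  show "AE z in gauss. integrable lborel (\<lambda>r. case (z, r) of (z, r) => indicator {0<..<s} r * heat r (f (s - r)) (x + ereal (sqrt d * z)))"
   using duhamel_integrable[OF assms(1) b] by simp
 qed
 have "heat d (duhamel f s) x = (\<integral>z. (\<integral>r. indicator {0<..<s} r * heat r (f (s - r)) (x + ereal (sqrt d * z)) \<partial>lborel) \<partial>gauss)"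
  by (simp add: heat_def[of d] duhamel_def)
 also have "... = (\<integral>r. (\<integral>z. indicator {0<..<s} r * heat r (f (s - r)) (x + ereal (sqrt d * z)) \<partial>gauss) \<partial>lborel)"
  using P.Fubini_integral[OF i] by simp
 also have "... = (\<integral>r. indicator {0<..<s} r * heat d (heat r (f (s - r))) x \<partial>lborel)"
  by (simp add: heat_def[of d])
 also have "... = (\<integral>r. indicator {0<..<s} r * heat (d + r) (f (s - r)) x \<partial>lborel)"
  using d b borel_measurable_slice[OF assms(1)]
  by (intro Bochner_Integration.integral_cong refl) (auto simp: indicator_def intro!: heat_semigroup[where K=K])
 finally show ?thesis .
qed

text \<open>Ages above \<open>d\<close> belong to sources active before time \<open>s\<close>, ages
  below \<open>d\<close> to later ones; after a shift by \<open>d\<close> the former are the Duhamel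
  integral at time \<open>s\<close>, carried on by the heat flow. The age \<open>d\<close> itself is
  a null set.\<close>

lemma duhamel_split:
 assumes f [measurable]: "joint_measurable f"
  and b: "\<And>s y. 0 < s ==> \<bar>f s y\<bar> \<le> K" and d: "d \<ge> 0" and s: "s \<ge> 0"
 shows "duhamel f (s + d) x = heat d (duhamel f s) x + duhamel (\<lambda>r. f (s + r)) d x"
proof -
 let ?g = "\<lambda>r. heat r (f (s + d - r)) x"
 have 1: "duhamel (\<lambda>r. f (s + r)) d x = (\<integral>r. indicator {0<..<d} r * ?g r \<partial>lborel)"
  by (simp add: duhamel_def add_diff_eq)
 have i1: "integrable lborel (\<lambda>r. indicator {0<..<d} r * ?g r)"
 proof -
  have m: "joint_measurable (\<lambda>r y. f (s + r) y)"
   using borel_measurable_uncurry[OF f, of "\<lambda>p. s + fst p" "borel \<Otimes>\<^sub>M borel" snd]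
   by (simp add: case_prod_beta')
  show ?thesis
   using duhamel_integrable[OF m, of K d x] b s by (simp add: add_diff_eq)
 qed
 have i: "integrable lborel (\<lambda>r. indicator {0<..<s + d} r * ?g r)"
  by (rule duhamel_integrable[OF f b])
 have [measurable]: "?g \<in> borel_measurable lborel"
  by (rule measurable_heat_slice[OF f]) auto
 have "duhamel f (s + d) x - duhamel (\<lambda>r. f (s + r)) d x
   = (\<integral>r. indicator {0<..<s + d} r * ?g r - indicator {0<..<d} r * ?g r \<partial>lborel)"
  unfolding 1 by (subst Bochner_Integration.integral_diff[OF i i1]) (simp add: duhamel_def)
 also have "... = (\<integral>r. indicator {d<..<s + d} r * ?g r \<partial>lborel)"
 proof (rule integral_cong_AE)
  have "AE r in lborel. r \<noteq> d" by (rule AE_lborel_singleton)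
  then show "AE r in lborel. indicator {0<..<s + d} r * ?g r - indicator {0<..<d} r * ?g r = indicator {d<..<s + d} r * ?g r"
   by eventually_elim (use s d in \<open>auto simp: indicator_def\<close>)
 qed measurable
 also have "... = (\<integral>r. indicator {d<..<s + d} (d + r) * ?g (d + r) \<partial>lborel)"
  using lborel_integral_real_affine[of 1 "\<lambda>r. indicator {d<..<s + d} r * ?g r" d] by simp
 also have "... = (\<integral>r. indicator {0<..<s} r * heat (d + r) (f (s - r)) x \<partial>lborel)"
  by (intro Bochner_Integration.integral_cong) (auto simp: indicator_def)
 also have "... = heat d (duhamel f s) x"
  by (rule heat_duhamel[OF f b d, symmetric])
 finally show ?thesis by simp
qed

text \<open>The gradient bound of the heat kernel is singular at age 0; its integrability is what
  makes Duhamel integrals Lipschitz in space. The antiderivative \<open>2 * sqrt r\<close> is not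
  differentiable at 0, so the improper form of the fundamental theorem is used.\<close>

lemma integral_inverse_sqrt:
 assumes "t > 0"
 shows "integrable lborel (\<lambda>r. indicator {0<..<t} r * (1 / sqrt r))"
  and "(\<integral>r. indicator {0<..<t} r * (1 / sqrt r) \<partial>lborel) = 2 * sqrt t"
proof -
 have t: "ereal 0 < ereal t" using assms by simp
 have A: "(((\<lambda>r. 2 * sqrt r) \<circ> real_of_ereal) \<longlongrightarrow> 0) (at_right (ereal 0))"
 proof -
  have "((\<lambda>r. 2 * sqrt r) \<longlongrightarrow> 2 * sqrt 0) (at_right 0)" by (intro tendsto_intros)
  then show ?thesis
   by (simp add: at_right_ereal comp_def filterlim_filtermap)
 qed
 have B: "(((\<lambda>r. 2 * sqrt r) \<circ> real_of_ereal) \<longlongrightarrow> 2 * sqrt t) (at_left (ereal t))"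
 proof -
  have "((\<lambda>r. 2 * sqrt r) \<longlongrightarrow> 2 * sqrt t) (at_left t)" by (intro tendsto_intros)
  then show ?thesis
   by (simp add: at_left_ereal comp_def filterlim_filtermap)
 qed
 have D: "((\<lambda>r. 2 * sqrt r) has_real_derivative 1 / sqrt x) (at x)" if "ereal 0 < ereal x" for x
  using that by (auto intro!: derivative_eq_intros simp: field_simps)
 have C: "isCont (\<lambda>x. 1 / sqrt x) x" if "ereal 0 < ereal x" for x
  using that by (auto intro!: continuous_intros)
 note FTC = interval_integral_FTC_nonneg[OF t D C _ A B]
 have e: "einterval 0 (ereal t) = {0<..<t}"
  by (auto simp: einterval_def)
 show "integrable lborel (\<lambda>r. indicator {0<..<t} r * (1 / sqrt r))"
  using FTC(1) by (simp add: set_integrable_def e zero_ereal_def[symmetric] AE_I2)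
 show "(\<integral>r. indicator {0<..<t} r * (1 / sqrt r) \<partial>lborel) = 2 * sqrt t"
  using FTC(2) assms by (simp add: interval_lebesgue_integral_def set_lebesgue_integral_def e zero_ereal_def[symmetric])
qed

lemma duhamel_Lipschitz:
 assumes f [measurable]: "joint_measurable f"
  and b: "\<And>s y. 0 < s ==> \<bar>f s y\<bar> \<le> K" and t: "t > 0"
 shows "\<bar>duhamel f t (x + ereal c) - duhamel f t x\<bar> \<le> 2 * K * sqrt t * \<bar>c\<bar>"
proof -
 have i: "integrable lborel (\<lambda>r. indicator {0<..<t} r * (1 / sqrt r) * (K * \<bar>c\<bar>))"
  using integral_inverse_sqrt(1)[OF t] by (rule integrable_mult_left)
 have eq: "duhamel f t (x + ereal c) - duhamel f t x
   = (\<integral>r. indicator {0<..<t} r * heat r (f (t - r)) (x + ereal c) - indicator {0<..<t} r * heat r (f (t - r)) x \<partial>lborel)"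
  unfolding duhamel_def
  by (intro Bochner_Integration.integral_diff[symmetric] duhamel_integrable[OF f b])
 have "\<bar>duhamel f t (x + ereal c) - duhamel f t x\<bar> \<le> (\<integral>r. \<bar>indicator {0<..<t} r * heat r (f (t - r)) (x + ereal c) - indicator {0<..<t} r * heat r (f (t - r)) x\<bar> \<partial>lborel)"
  unfolding eq by (rule integral_abs_bound)
 also have "... \<le> (\<integral>r. indicator {0<..<t} r * (1 / sqrt r) * (K * \<bar>c\<bar>) \<partial>lborel)"
 proof (rule integral_mono'[OF i])
  fix r
  show "\<bar>indicator {0<..<t} r * heat r (f (t - r)) (x + ereal c) - indicator {0<..<t} r * heat r (f (t - r)) x\<bar>
    \<le> indicator {0<..<t} r * (1 / sqrt r) * (K * \<bar>c\<bar>)"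
   using heat_Lipschitz[of "f (t - r)" K r x c] b borel_measurable_slice[OF f] by (auto simp: indicator_def)
 next
  have "0 \<le> K" using order_trans[OF abs_ge_zero b[of 1 0]] by simp
  then show "0 \<le> indicator {0<..<t} r * (1 / sqrt r) * (K * \<bar>c\<bar>)" for r
   by (auto simp: indicator_def)
 qed
 also have "... = 2 * sqrt t * (K * \<bar>c\<bar>)"
  by (subst integral_mult_left_zero) (simp only: integral_inverse_sqrt(2)[OF t])
 finally show ?thesis by (simp add: algebra_simps)
qed

section \<open>The mild solution\<close>

text \<open>Joint continuity at all points with positive time, the infinite ones included, in
  sequential form because it is fed into dominated convergence. Early terms of \<open>T\<close> may
  be nonpositive.\<close>

definition seq_cont :: "(real => ereal => real) => bool" where
 "seq_cont f \<longleftrightarrow> (\<forall>t x T X. 0 < t \<and> T \<longlonglongrightarrow> t \<and> X \<longlonglongrightarrow> x \<longrightarrow> (\<lambda>n. f (T n) (X n)) \<longlonglongrightarrow> f t x)"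

lemma tendsto_add_ereal_real:
 assumes "(X \<longlongrightarrow> x) F" "(c \<longlongrightarrow> d) F"
 shows "((\<lambda>n. X n + ereal (c n)) \<longlongrightarrow> x + ereal d) F"
 by (rule tendsto_add_ereal_general1) (use assms in auto)

text \<open>Convergence is asked only for almost every \<open>z\<close>, which leaves room for the
  discontinuities of the initial function.\<close>

lemma heat_tendsto:
 fixes F :: "nat => ereal => real"
 assumes [measurable]: "\<And>n. F n \<in> borel_measurable borel" "G \<in> borel_measurable borel"
  and b: "\<And>n y. \<bar>F n y\<bar> \<le> K"
  and lim: "AE z in gauss. (\<lambda>n. F n (X n + ereal (sqrt (r n) * z))) \<longlonglongrightarrow> G (x + ereal (sqrt s * z))"
 shows "(\<lambda>n. heat (r n) (F n) (X n)) \<longlonglongrightarrow> heat s G x"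
 unfolding heat_def
 by (rule integral_dominated_convergence[where w="\<lambda>_. K"]) (use lim b in auto)

text \<open>Dominated convergence in the age; the indicator of \<open>{0<..<T n}\<close> converges
  at every age except \<open>t\<close>.\<close>

lemma duhamel_seq_cont:
 assumes f: "joint_measurable f"
  and b: "\<And>s y. 0 < s ==> \<bar>f s y\<bar> \<le> K" and c: "seq_cont f"
 shows "seq_cont (duhamel f)"
 unfolding seq_cont_def
proof (intro allI impI, elim conjE)
 fix t :: real and x and T :: "nat => real" and X :: "nat => ereal"
 assume t: "0 < t" and T: "T \<longlonglongrightarrow> t" and X: "X \<longlonglongrightarrow> x"
 have K: "K \<ge> 0" using order_trans[OF abs_ge_zero b[of 1 0]] by simp
 obtain C where C: "\<And>n. T n \<le> C"
  using convergent_imp_Bseq[OF convergentI[OF T]] unfolding Bseq_def real_norm_def by (meson abs_le_D1)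
 have m: "(\<lambda>r. heat r (f (t - r)) x) \<in> borel_measurable lborel" for t x
  by (rule measurable_heat_slice[OF f]) auto
 note [measurable] = m
 have fm [measurable]: "f s \<in> borel_measurable borel" for s
  by (rule borel_measurable_slice[OF f])
 show "(\<lambda>n. duhamel f (T n) (X n)) \<longlonglongrightarrow> duhamel f t x"
  unfolding duhamel_def
 proof (rule integral_dominated_convergence[where w="\<lambda>r. indicator {0<..<C} r * K"])
  show "integrable lborel (\<lambda>r. indicator {0<..<C} r * K)"
   by (cases "C \<ge> 0") auto
  show "AE r in lborel. norm (indicator {0<..<T n} r * heat r (f (T n - r)) (X n)) \<le> indicator {0<..<C} r * K" for n
   using C[of n] K by (intro AE_I2) (auto simp: indicator_def intro: heat_slice_bound[OF f b])
  have "AE r in lborel. r \<noteq> t" by (rule AE_lborel_singleton)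
  then show "AE r in lborel. (\<lambda>n. indicator {0<..<T n} r * heat r (f (T n - r)) (X n)) \<longlonglongrightarrow> indicator {0<..<t} r * heat r (f (t - r)) x"
  proof eventually_elim
   case (elim r)
   show ?case
   proof (cases "0 < r \<and> r < t")
    case True
    then have ev: "eventually (\<lambda>n. r < T n) sequentially"
     using order_tendstoD(1)[OF T, of r] by auto
    \<comment> \<open>For \<open>T n \<le> r\<close> the slice \<open>f (T n - r)\<close> sits at a
      nonpositive time, where no bound is known; the value 0 put there matters for finitely many
      \<open>n\<close> only.\<close>
    have "(\<lambda>n. heat r (\<lambda>y. if r < T n then f (T n - r) y else 0) (X n)) \<longlonglongrightarrow> heat r (f (t - r)) x"
    proof (rule heat_tendsto[where K=K and r="\<lambda>_. r"])
     show "\<bar>if r < T n then f (T n - r) y else 0\<bar> \<le> K" for n y using b K by auto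
     have "(\<lambda>n. f (T n - r) (X n + ereal (sqrt r * z))) \<longlonglongrightarrow> f (t - r) (x + ereal (sqrt r * z))" for z
     proof -
      have "(\<lambda>n. T n - r) \<longlonglongrightarrow> t - r" by (intro tendsto_intros T)
      moreover have "(\<lambda>n. X n + ereal (sqrt r * z)) \<longlonglongrightarrow> x + ereal (sqrt r * z)"
       by (intro tendsto_add_ereal_real X tendsto_const)
      ultimately show ?thesis
       using c True unfolding seq_cont_def by auto
     qed
     then show "AE z in gauss. (\<lambda>n. if r < T n then f (T n - r) (X n + ereal (sqrt r * z)) else 0) \<longlonglongrightarrow> f (t - r) (x + ereal (sqrt r * z))"
     proof (intro AE_I2)
      fix z
      assume lim: "(\<And>z. (\<lambda>n. f (T n - r) (X n + ereal (sqrt r * z))) \<longlonglongrightarrow> f (t - r) (x + ereal (sqrt r * z)))"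
      show "(\<lambda>n. if r < T n then f (T n - r) (X n + ereal (sqrt r * z)) else 0) \<longlonglongrightarrow> f (t - r) (x + ereal (sqrt r * z))"
       by (rule Lim_transform_eventually[OF lim]) (use ev in \<open>eventually_elim, simp\<close>)
     qed
    qed auto
    then show ?thesis
    proof (rule Lim_transform_eventually[THEN back_subst[where P="\<lambda>c. _ \<longlonglongrightarrow> c"]])
     show "\<forall>\<^sub>F n in sequentially. heat r (\<lambda>y. if r < T n then f (T n - r) y else 0) (X n) = indicator {0<..<T n} r * heat r (f (T n - r)) (X n)"
      using ev by eventually_elim (use True in simp)
    qed (use True in simp)
   next
    case False
    then consider "r \<le> 0" | "t < r" using elim by fastforce
    then show ?thesis
    proof cases
     case 2
     then have ev: "eventually (\<lambda>n. T n < r) sequentially"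
      using order_tendstoD(2)[OF T, of r] by auto
     show ?thesis
     proof (rule Lim_transform_eventually[OF tendsto_const])
      show "\<forall>\<^sub>F n in sequentially. indicator {0<..<t} r * heat r (f (t - r)) x = indicator {0<..<T n} r * heat r (f (T n - r)) (X n)"
       using ev by eventually_elim (use 2 in simp)
     qed
    qed (simp add: indicator_def)
   qed
  qed
 qed simp_all
qed

text \<open>\<open>h\<close> is globally Lipschitz and bounded. Picard iteration then converges for
  all times, and the solution grows at most linearly, with no a priori knowledge of its
  range.\<close>

locale mild_problem =
 fixes U0 :: "ereal => real" and h :: "real => real" and K L H :: real
 assumes U0 [measurable]: "U0 \<in> borel_measurable borel" and U0_bound: "\<And>y. \<bar>U0 y\<bar> \<le> K"
  and h_lip: "\<And>a b. \<bar>h a - h b\<bar> \<le> L * \<bar>a - b\<bar>" and h_bound: "\<And>a. \<bar>h a\<bar> \<le> H"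
  and L: "L > 0"
begin

lemma h_tendsto: "(f \<longlongrightarrow> a) F ==> ((\<lambda>x. h (f x)) \<longlongrightarrow> h a) F"
proof -
 assume f: "(f \<longlongrightarrow> a) F"
 have "((\<lambda>x. L * \<bar>f x - a\<bar>) \<longlongrightarrow> L * \<bar>a - a\<bar>) F" by (intro tendsto_intros f)
 then have "((\<lambda>x. L * \<bar>f x - a\<bar>) \<longlongrightarrow> 0) F" by simp
 then have "((\<lambda>x. h (f x) - h a) \<longlongrightarrow> 0) F"
  by (rule Lim_null_comparison[rotated]) (auto intro!: always_eventually simp: h_lip)
 then show ?thesis by (simp add: Lim_null[symmetric])
qed

lemma h_measurable [measurable]: "h \<in> borel_measurable borel"
 by (intro borel_measurable_continuous_onI continuous_at_imp_continuous_on ballI)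
   (simp add: isCont_def h_tendsto)

lemma H_nonneg: "H \<ge> 0" using order_trans[OF abs_ge_zero h_bound[of 0]] .

lemma K_nonneg: "K \<ge> 0" using order_trans[OF abs_ge_zero U0_bound[of 0]] .

primrec iter :: "nat => real => ereal => real" where
 "iter 0 = (\<lambda>t x. heat t U0 x)"
| "iter (Suc n) = (\<lambda>t x. heat t U0 x - duhamel (\<lambda>s y. h (iter n s y)) t x)"

lemma heat_U0_measurable [measurable]: "joint_measurable (\<lambda>t x. heat t U0 x)"
 using measurable_heat_joint[of "\<lambda>_. U0" "borel \<Otimes>\<^sub>M borel" fst snd] by (simp add: case_prod_beta')

lemma measurable_h_comp:
 assumes [measurable]: "joint_measurable f"
 shows "(\<lambda>(t, x). h (f t x)) \<in> borel_measurable ((borel :: real measure) \<Otimes>\<^sub>M (borel :: ereal measure))"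
 using measurable_compose[OF assms h_measurable] by (simp add: case_prod_beta')

lemma iter_measurable [measurable]: "joint_measurable (\<lambda>t x. iter n t x)"
proof (induction n)
 case (Suc n)
 note [measurable] = measurable_duhamel[OF measurable_h_comp[OF Suc]]
 show ?case by simp
qed simp

text \<open>The weight has rate \<open>2 * L\<close>, twice the Lipschitz constant, so one Picard
  step halves the weighted distance.\<close>

lemma h_duhamel_diff:
 assumes f: "joint_measurable f"
  and g: "joint_measurable g"
  and b: "\<And>s y. 0 < s ==> \<bar>f s y - g s y\<bar> \<le> A * exp (2 * L * s)" and t: "t \<ge> 0"
 shows "\<bar>duhamel (\<lambda>s y. h (f s y)) t x - duhamel (\<lambda>s y. h (g s y)) t x\<bar> \<le> A / 2 * exp (2 * L * t)"
proof -
 note [measurable] = measurable_h_comp[OF f] measurable_h_comp[OF g]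
 have "duhamel (\<lambda>s y. h (f s y)) t x - duhamel (\<lambda>s y. h (g s y)) t x = duhamel (\<lambda>s y. h (f s y) - h (g s y)) t x"
  by (rule duhamel_diff[symmetric]) (auto intro: h_bound)
 moreover have "\<bar>duhamel (\<lambda>s y. h (f s y) - h (g s y)) t x\<bar> \<le> L * A / (2 * L) * exp (2 * L * t)"
 proof (rule duhamel_bound_exp)
  show "\<bar>h (f s y) - h (g s y)\<bar> \<le> L * A * exp (2 * L * s)" if "0 < s" for s y
   using order_trans[OF h_lip mult_left_mono[OF b[OF that], of L]] L by (simp add: mult.assoc)
 qed (use t L in auto)
 ultimately show ?thesis using L by simp
qed

text \<open>The size of the first Picard correction in the weighted norm:
  \<open>H * t = A0 * (2 * L * t) \<le> A0 * exp (2 * L * t)\<close>.\<close>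

definition "A0 = H / (2 * L)"

lemma iter_step:
 assumes "t \<ge> 0" shows "\<bar>iter (Suc n) t x - iter n t x\<bar> \<le> A0 / 2 ^ n * exp (2 * L * t)"
 using assms
proof (induction n arbitrary: t x)
 case 0
 have "\<bar>duhamel (\<lambda>s y. h (iter 0 s y)) t x\<bar> \<le> H * t"
  by (rule duhamel_bound[OF measurable_h_comp[OF iter_measurable] h_bound 0])
 also have "... = A0 * (2 * L * t)" using L by (simp add: A0_def)
 also have "... \<le> A0 * exp (2 * L * t)"
  using H_nonneg L exp_ge_add_one_self[of "2 * L * t"] by (intro mult_left_mono) (linarith, simp add: A0_def)
 finally show ?case by simp
next
 case (Suc n)
 have "\<bar>duhamel (\<lambda>s y. h (iter (Suc n) s y)) t x - duhamel (\<lambda>s y. h (iter n s y)) t x\<bar> \<le> A0 / 2 ^ n / 2 * exp (2 * L * t)"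
  by (rule h_duhamel_diff[OF iter_measurable iter_measurable Suc.IH Suc.prems]) simp
 then show ?case
  by (simp only: iter.simps(2)) (simp add: abs_minus_commute)
qed

lemma iter_Cauchy:
 assumes "t \<ge> 0" "m \<ge> n" shows "\<bar>iter m t x - iter n t x\<bar> \<le> 2 * A0 * (1 / 2 ^ n - 1 / 2 ^ m) * exp (2 * L * t)"
 using assms(2)
proof (induction m rule: dec_induct)
 case (step m)
 have "\<bar>iter (Suc m) t x - iter n t x\<bar> \<le> \<bar>iter (Suc m) t x - iter m t x\<bar> + \<bar>iter m t x - iter n t x\<bar>" by simp
 also have "... \<le> A0 / 2 ^ m * exp (2 * L * t) + 2 * A0 * (1 / 2 ^ n - 1 / 2 ^ m) * exp (2 * L * t)"
  using iter_step[OF assms(1), of m x] step.IH by linarith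
 also have "... = 2 * A0 * (1 / 2 ^ n - 1 / 2 ^ Suc m) * exp (2 * L * t)"
  by (simp add: field_simps)
 finally show ?case .
qed simp

lemma A0_nonneg: "A0 \<ge> 0" using H_nonneg L by (simp add: A0_def)

lemma iter_close:
 assumes "t \<ge> 0" "m \<ge> n" shows "\<bar>iter m t x - iter n t x\<bar> \<le> 2 * A0 / 2 ^ n * exp (2 * L * t)"
proof -
 have "2 * A0 * (1 / 2 ^ n - 1 / 2 ^ m) * exp (2 * L * t) \<le> 2 * A0 * (1 / 2 ^ n) * exp (2 * L * t)"
  using A0_nonneg by (intro mult_right_mono mult_left_mono) auto
 with iter_Cauchy[OF assms, of x] show ?thesis by simp
qed

definition mild :: "real => ereal => real" where
 "mild t x = lim (\<lambda>n. iter n t x)"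

lemma close_null: "(\<lambda>n. c / 2 ^ n * e) \<longlonglongrightarrow> (0::real)"
proof -
 have "(\<lambda>n. (1 / 2) ^ n * (c * e)) \<longlonglongrightarrow> 0 * (c * e)"
  by (intro tendsto_mult LIMSEQ_realpow_zero tendsto_const) auto
 then show ?thesis by (simp add: power_divide)
qed

lemma iter_LIMSEQ: assumes t: "t \<ge> 0" shows "(\<lambda>n. iter n t x) \<longlonglongrightarrow> mild t x"
proof -
 have "Cauchy (\<lambda>n. iter n t x)"
 proof (rule CauchyI)
  fix e :: real assume "e > 0"
  then have "eventually (\<lambda>n. 2 * A0 / 2 ^ n * exp (2 * L * t) < e / 2) sequentially"
   using order_tendstoD(2)[OF close_null] by auto
  then obtain n where n: "2 * A0 / 2 ^ n * exp (2 * L * t) < e / 2"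
   unfolding eventually_sequentially by auto
  show "\<exists>M. \<forall>m\<ge>M. \<forall>n\<ge>M. norm (iter m t x - iter n t x) < e"
  proof (intro exI allI impI)
   fix k l assume "n \<le> k" "n \<le> l"
   then have "\<bar>iter k t x - iter n t x\<bar> < e / 2" "\<bar>iter l t x - iter n t x\<bar> < e / 2"
    using iter_close[OF t, of n k x] iter_close[OF t, of n l x] n by auto
   then show "norm (iter k t x - iter l t x) < e" unfolding real_norm_def by linarith
  qed
 qed
 then show ?thesis
  unfolding mild_def using Cauchy_convergent_iff convergent_LIMSEQ_iff by blast
qed

lemma mild_iter_close:
 assumes t: "t \<ge> 0" shows "\<bar>mild t x - iter n t x\<bar> \<le> 2 * A0 / 2 ^ n * exp (2 * L * t)"
proof (rule LIMSEQ_le_const2)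
 show "(\<lambda>m. \<bar>iter m t x - iter n t x\<bar>) \<longlonglongrightarrow> \<bar>mild t x - iter n t x\<bar>"
  by (intro tendsto_intros iter_LIMSEQ t)
 show "\<exists>N. \<forall>m\<ge>N. \<bar>iter m t x - iter n t x\<bar> \<le> 2 * A0 / 2 ^ n * exp (2 * L * t)"
  using iter_close[OF t] by blast
qed

lemma mild_measurable [measurable]: "joint_measurable mild"
proof -
 have "(\<lambda>p. iter n (fst p) (snd p)) \<in> borel_measurable (borel \<Otimes>\<^sub>M borel)" for n
  using iter_measurable[of n] by (simp add: case_prod_beta')
 then show ?thesis
  unfolding mild_def by (simp add: case_prod_beta' borel_measurable_lim_metric)
qed

lemma h_mild_measurable: "joint_measurable (\<lambda>t x. h (mild t x))"
 by (rule measurable_h_comp[OF mild_measurable])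

lemma mild_eq:
 assumes t: "t \<ge> 0" shows "mild t x = heat t U0 x - duhamel (\<lambda>s y. h (mild s y)) t x"
proof -
 have "(\<lambda>n. duhamel (\<lambda>s y. h (mild s y)) t x - duhamel (\<lambda>s y. h (iter n s y)) t x) \<longlonglongrightarrow> 0"
 proof (rule Lim_null_comparison[OF _ close_null])
  have "\<bar>duhamel (\<lambda>s y. h (mild s y)) t x - duhamel (\<lambda>s y. h (iter n s y)) t x\<bar> \<le> 2 * A0 / 2 ^ n / 2 * exp (2 * L * t)" for n
   by (rule h_duhamel_diff[OF mild_measurable iter_measurable mild_iter_close t]) simp
  then show "\<forall>\<^sub>F n in sequentially. norm (duhamel (\<lambda>s y. h (mild s y)) t x - duhamel (\<lambda>s y. h (iter n s y)) t x) \<le> A0 / 2 ^ n * exp (2 * L * t)"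
   by (intro always_eventually) simp
 qed
 then have "(\<lambda>n. heat t U0 x - duhamel (\<lambda>s y. h (mild s y)) t x + (duhamel (\<lambda>s y. h (mild s y)) t x - duhamel (\<lambda>s y. h (iter n s y)) t x))
   \<longlonglongrightarrow> heat t U0 x - duhamel (\<lambda>s y. h (mild s y)) t x + 0"
  by (intro tendsto_add tendsto_const)
 then have "(\<lambda>n. iter (Suc n) t x) \<longlonglongrightarrow> heat t U0 x - duhamel (\<lambda>s y. h (mild s y)) t x"
  by simp
 moreover have "(\<lambda>n. iter (Suc n) t x) \<longlonglongrightarrow> mild t x"
  using iter_LIMSEQ[OF t] by (rule LIMSEQ_Suc)
 ultimately show ?thesis using LIMSEQ_unique by blast
qed

lemma mild_0: "mild 0 x = U0 x"
 by (simp add: mild_eq)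

lemma mild_slice_measurable [measurable]: "mild t \<in> borel_measurable borel"
 by (rule borel_measurable_slice[OF mild_measurable])

lemma mild_bound: assumes t: "t \<ge> 0" shows "\<bar>mild t x\<bar> \<le> K + H * t"
proof -
 have "\<bar>heat t U0 x\<bar> \<le> K" by (rule heat_bound[OF U0 U0_bound])
 moreover have "\<bar>duhamel (\<lambda>s y. h (mild s y)) t x\<bar> \<le> H * t"
  by (rule duhamel_bound[OF h_mild_measurable h_bound t])
 ultimately show ?thesis using mild_eq[OF t] by (simp add: abs_le_iff)
qed

lemma duhamel_shift_measurable:
 fixes f :: "real => ereal => real"
 assumes "joint_measurable f"
 shows "joint_measurable (\<lambda>r y. f (s + r) y)"
 using borel_measurable_uncurry[OF assms, of "\<lambda>p. s + fst p" "borel \<Otimes>\<^sub>M borel" snd]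
 by (simp add: case_prod_beta')

text \<open>The semigroup law and the splitting of the Duhamel integral at age \<open>d\<close>
  restart the equation at time \<open>s\<close>. Both the analysis of one cell and the regularity
  theory work from this form, in which \<open>mild s\<close> replaces the irregular initial
  function.\<close>

lemma mild_flow:
 assumes s: "s \<ge> 0" and d: "d \<ge> 0"
 shows "mild (s + d) x = heat d (mild s) x - duhamel (\<lambda>r y. h (mild (s + r) y)) d x"
proof -
 have "heat d (mild s) x = heat d (\<lambda>y. heat s U0 y - duhamel (\<lambda>s y. h (mild s y)) s y) x"
  using mild_eq[OF s] by (metis (no_types, lifting) ext)
 also have "... = heat d (heat s U0) x - heat d (duhamel (\<lambda>s y. h (mild s y)) s) x"
 proof (rule heat_diff)
  show "duhamel (\<lambda>s y. h (mild s y)) s \<in> borel_measurable borel"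
   by (rule borel_measurable_slice[OF measurable_duhamel[OF h_mild_measurable]])
 qed (auto intro!: heat_bound[OF U0 U0_bound] duhamel_bound[OF h_mild_measurable h_bound s])
 also have "heat d (heat s U0) x = heat (s + d) U0 x"
  by (subst heat_semigroup[OF d s U0 U0_bound]) (simp add: add.commute)
 finally show ?thesis
  using mild_eq[of "s + d" x] s d duhamel_split[OF h_mild_measurable h_bound d s, of x] by simp
qed

lemma mild_Lipschitz:
 assumes s: "s > 0"
 shows "\<bar>mild s (x + ereal c) - mild s x\<bar> \<le> (K / sqrt s + 2 * H * sqrt s) * \<bar>c\<bar>"
proof -
 have "\<bar>mild s (x + ereal c) - mild s x\<bar> \<le> \<bar>heat s U0 (x + ereal c) - heat s U0 x\<bar>
   + \<bar>duhamel (\<lambda>s y. h (mild s y)) s (x + ereal c) - duhamel (\<lambda>s y. h (mild s y)) s x\<bar>"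
  using mild_eq[of s x] mild_eq[of s "x + ereal c"] s by simp
 also have "... \<le> K / sqrt s * \<bar>c\<bar> + 2 * H * sqrt s * \<bar>c\<bar>"
  by (rule add_mono[OF heat_Lipschitz[OF U0 U0_bound s] duhamel_Lipschitz[OF h_mild_measurable h_bound s]])
 finally show ?thesis by (simp only: distrib_right)
qed

lemma mild_step_bound:
 assumes s: "s \<ge> 0" and d: "d \<ge> 0"
 shows "\<bar>mild (s + d) x - heat d (mild s) x\<bar> \<le> H * d"
 using mild_flow[OF s d, of x] duhamel_bound[OF duhamel_shift_measurable[OF h_mild_measurable] h_bound d, of s x]
 by simp

text \<open>Local error of replacing the Duhamel integral over one cell by
  \<open>d * h (mild s x)\<close>. Within the cell the solution moves by at most
  \<open>\<Lambda> * sqrt d + H * d\<close>, and averaging by the heat kernel costs another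
  \<open>\<Lambda> * sqrt d\<close>, where \<open>\<Lambda>\<close> is the Lipschitz constant at
  time \<open>s\<close>; the factor \<open>L * d\<close> comes from \<open>h\<close> and the length
  of the cell.\<close>

lemma mild_consistency:
 assumes s: "s > 0" and d: "d \<ge> 0"
 shows "\<bar>mild (s + d) x - heat d (mild s) x + d * h (mild s x)\<bar> \<le> L * d * (2 * (K / sqrt s + 2 * H * sqrt s) * sqrt d + H * d)"
proof -
 define \<Lambda> where "\<Lambda> = K / sqrt s + 2 * H * sqrt s"
 have \<Lambda>: "\<Lambda> \<ge> 0" using K_nonneg H_nonneg s by (simp add: \<Lambda>_def)
 have mb: "\<bar>mild s y\<bar> \<le> K + H * s" for y using mild_bound s by simp
 have lip: "\<bar>mild s (y + ereal c) - mild s y\<bar> \<le> \<Lambda> * \<bar>c\<bar>" for y c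
  using mild_Lipschitz[OF s] by (simp add: \<Lambda>_def)
 let ?B = "L * (2 * \<Lambda> * sqrt d + H * d)"
 have near: "\<bar>heat r (\<lambda>y. h (mild (s + (d - r)) y)) x - h (mild s x)\<bar> \<le> ?B" if r: "0 < r" "r < d" for r
 proof -
  have 1: "\<bar>h (mild (s + (d - r)) y) - h (mild s y)\<bar> \<le> L * (\<Lambda> * sqrt d + H * d)" for y
  proof -
   have "\<bar>mild (s + (d - r)) y - mild s y\<bar> \<le> \<bar>mild (s + (d - r)) y - heat (d - r) (mild s) y\<bar> + \<bar>heat (d - r) (mild s) y - mild s y\<bar>"
    by simp
   also have "... \<le> H * (d - r) + \<Lambda> * sqrt (d - r)"
    using mild_step_bound[of s "d - r" y] heat_minus_self_Lipschitz[OF mild_slice_measurable mb _ lip, of "d - r" y] r s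
    by simp
   also have "... \<le> H * d + \<Lambda> * sqrt d"
    using r H_nonneg \<Lambda> by (intro add_mono mult_left_mono) auto
   finally show ?thesis
    using order_trans[OF h_lip mult_left_mono] L by (simp add: add.commute)
  qed
  have hm [measurable]: "(\<lambda>y. h (mild t y)) \<in> borel_measurable borel" for t by measurable
  have d1: "heat r (\<lambda>y. h (mild (s + (d - r)) y)) x - heat r (\<lambda>y. h (mild s y)) x
    = heat r (\<lambda>y. h (mild (s + (d - r)) y) - h (mild s y)) x"
   by (rule heat_diff[symmetric, OF hm hm h_bound h_bound])
  have d2: "\<bar>heat r (\<lambda>y. h (mild (s + (d - r)) y) - h (mild s y)) x\<bar> \<le> L * (\<Lambda> * sqrt d + H * d)"
   by (rule heat_bound[OF _ 1]) measurable
  have d3: "\<bar>heat r (\<lambda>y. h (mild s y)) x - h (mild s x)\<bar> \<le> L * \<Lambda> * sqrt r"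
  proof (rule heat_minus_self_Lipschitz[OF hm h_bound])
   show "\<bar>h (mild s (y + ereal c)) - h (mild s y)\<bar> \<le> L * \<Lambda> * \<bar>c\<bar>" for y c
    using order_trans[OF h_lip mult_left_mono[OF lip]] L by (simp add: mult.assoc)
  qed (use r in simp)
  have "L * \<Lambda> * sqrt r \<le> L * \<Lambda> * sqrt d" using r L \<Lambda> by (intro mult_left_mono) auto
  then show ?thesis using d1 d2 d3 by (simp add: algebra_simps abs_le_iff)
 qed
 let ?f = "\<lambda>r y. h (mild (s + r) y)"
 have fm: "joint_measurable (\<lambda>r y. ?f r y)"
  by (rule duhamel_shift_measurable[OF h_mild_measurable])
 have i1: "integrable lborel (\<lambda>r. indicator {0<..<d} r * heat r (?f (d - r)) x)"
  by (rule duhamel_integrable[OF fm h_bound])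
 have i2: "integrable lborel (\<lambda>r. indicator {0<..<d} r * c)" for c :: real
  using d by simp
 have eq: "duhamel ?f d x - d * h (mild s x) = (\<integral>r. indicator {0<..<d} r * heat r (?f (d - r)) x - indicator {0<..<d} r * h (mild s x) \<partial>lborel)"
  unfolding duhamel_def using d by (subst Bochner_Integration.integral_diff[OF i1 i2]) simp
 have "\<bar>duhamel ?f d x - d * h (mild s x)\<bar> \<le> (\<integral>r. \<bar>indicator {0<..<d} r * heat r (?f (d - r)) x - indicator {0<..<d} r * h (mild s x)\<bar> \<partial>lborel)"
  unfolding eq by (rule integral_abs_bound)
 also have "... \<le> (\<integral>r. indicator {0<..<d} r * ?B \<partial>lborel)"
 proof (rule integral_mono'[OF i2])
  show "\<bar>indicator {0<..<d} r * heat r (?f (d - r)) x - indicator {0<..<d} r * h (mild s x)\<bar> \<le> indicator {0<..<d} r * ?B" for r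
   using near[of r] by (auto simp: indicator_def)
  show "0 \<le> indicator {0<..<d} r * ?B" for r using L \<Lambda> d H_nonneg by simp
 qed
 also have "... = d * ?B" using d by simp
 finally show ?thesis
  using mild_flow[of s d x] s d by (simp add: \<Lambda>_def algebra_simps abs_le_iff)
qed

text \<open>The iterates inherit continuity through the Duhamel integral, and they converge
  uniformly on bounded time intervals by the geometric bound.\<close>

lemma mild_seq_cont:
 assumes "seq_cont (\<lambda>t x. heat t U0 x)"
 shows "seq_cont mild"
proof -
 have it: "seq_cont (iter n)" for n
 proof (induction n)
  case (Suc n)
  have "seq_cont (\<lambda>s y. h (iter n s y))"
   using Suc h_tendsto unfolding seq_cont_def by blast
  then have "seq_cont (duhamel (\<lambda>s y. h (iter n s y)))"
   by (rule duhamel_seq_cont[OF measurable_h_comp[OF iter_measurable] h_bound])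
  then show ?case
   using assms unfolding seq_cont_def by (auto intro!: tendsto_diff)
 qed (use assms in simp)
 show ?thesis
  unfolding seq_cont_def
 proof (intro allI impI, elim conjE)
  fix t :: real and x and T :: "nat => real" and X :: "nat => ereal"
  assume t: "0 < t" and T: "T \<longlonglongrightarrow> t" and X: "X \<longlonglongrightarrow> x"
  obtain C where C: "\<And>n. T n \<le> C"
   using convergent_imp_Bseq[OF convergentI[OF T]] unfolding Bseq_def real_norm_def by (meson abs_le_D1)
  have tC: "t \<le> C" using LIMSEQ_le_const2[OF T] C by blast
  show "(\<lambda>n. mild (T n) (X n)) \<longlonglongrightarrow> mild t x"
  proof (rule LIMSEQ_I)
   fix e :: real assume e: "e > 0"
   then have "eventually (\<lambda>n. 2 * A0 / 2 ^ n * exp (2 * L * C) < e / 3) sequentially"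
    using order_tendstoD(2)[OF close_null] by auto
   then obtain k where k: "2 * A0 / 2 ^ k * exp (2 * L * C) < e / 3"
    unfolding eventually_sequentially by auto
   have cl: "\<bar>mild s y - iter k s y\<bar> < e / 3" if "0 \<le> s" "s \<le> C" for s y
   proof -
    have "2 * A0 / 2 ^ k * exp (2 * L * s) \<le> 2 * A0 / 2 ^ k * exp (2 * L * C)"
     using that A0_nonneg L by (intro mult_left_mono) auto
    then show ?thesis using mild_iter_close[OF that(1), of y k] k by linarith
   qed
   have "(\<lambda>n. iter k (T n) (X n)) \<longlonglongrightarrow> iter k t x"
    using it[of k] t T X unfolding seq_cont_def by blast
   then have "eventually (\<lambda>n. \<bar>iter k (T n) (X n) - iter k t x\<bar> < e / 3) sequentially"
    unfolding tendsto_iff dist_real_def using e by (meson divide_pos_pos zero_less_numeral)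
   moreover have "eventually (\<lambda>n. 0 < T n) sequentially"
    by (rule order_tendstoD(1)[OF T t])
   ultimately have "eventually (\<lambda>n. norm (mild (T n) (X n) - mild t x) < e) sequentially"
   proof eventually_elim
    case (elim n)
    then show ?case
     using cl[of "T n" "X n"] cl[of t x] C[of n] t tC unfolding real_norm_def by linarith
   qed
   then show "\<exists>no. \<forall>n\<ge>no. norm (mild (T n) (X n) - mild t x) < e"
    unfolding eventually_sequentially .
  qed
 qed
qed

end

section \<open>Regularity\<close>

text \<open>Like \<open>seq_cont\<close>, but at real points only: the space derivatives below take
  the value 0 at the infinite points, where continuity is not claimed.\<close>

definition seq_cont_real :: "(real => ereal => real) => bool" where
 "seq_cont_real f \<longleftrightarrow> (\<forall>t x T X. 0 < t \<and> T \<longlonglongrightarrow> t \<and> X \<longlonglongrightarrow> x \<longrightarrow>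
   (\<lambda>n. f (T n) (ereal (X n))) \<longlonglongrightarrow> f t (ereal x))"

lemma seq_cont_realD:
 "seq_cont_real f ==> 0 < t ==> T \<longlonglongrightarrow> t ==> X \<longlonglongrightarrow> x ==> (\<lambda>n. f (T n) (ereal (X n))) \<longlonglongrightarrow> f t (ereal x)"
 unfolding seq_cont_real_def by blast

lemma seq_cont_imp_real: "seq_cont f ==> seq_cont_real f"
 unfolding seq_cont_def seq_cont_real_def by (auto simp: lim_ereal)

lemma seq_cont_real_continuous_on:
 assumes "seq_cont_real f"
 shows "continuous_on ({0<..} \<times> UNIV) (\<lambda>(t, x). f t (ereal x))"
 unfolding continuous_on_sequentially
proof (intro allI ballI impI, elim conjE)
 fix X :: "nat => real \<times> real" and a assume a: "a \<in> {0<..} \<times> UNIV" "X \<longlonglongrightarrow> a"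
 have "(\<lambda>n. f (fst (X n)) (ereal (snd (X n)))) \<longlonglongrightarrow> f (fst a) (ereal (snd a))"
  by (rule seq_cont_realD[OF assms]) (use a in \<open>auto intro: tendsto_fst tendsto_snd\<close>)
 then show "((\<lambda>(t, x). f t (ereal x)) \<circ> X) \<longlonglongrightarrow> (case a of (t, x) => f t (ereal x))"
  by (simp add: comp_def case_prod_beta')
qed

lemma dheat_tendsto:
 fixes F :: "nat => ereal => real"
 assumes [measurable]: "\<And>n. F n \<in> borel_measurable borel" "G \<in> borel_measurable borel"
  and b: "\<And>n y. \<bar>F n y\<bar> \<le> K" and s: "s > 0" and r: "r \<longlonglongrightarrow> s"
  and lim: "AE z in gauss. (\<lambda>n. F n (X n + ereal (sqrt (r n) * z))) \<longlonglongrightarrow> G (x + ereal (sqrt s * z))"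
 shows "(\<lambda>n. dheat (r n) (F n) (X n)) \<longlonglongrightarrow> dheat s G x"
 unfolding dheat_def
proof (intro tendsto_divide tendsto_real_sqrt r)
 have K: "K \<ge> 0" using order_trans[OF abs_ge_zero b[of 0 0]] .
 show "(\<lambda>n. \<integral>z. z * F n (X n + ereal (sqrt (r n) * z)) \<partial>gauss) \<longlonglongrightarrow> (\<integral>z. z * G (x + ereal (sqrt s * z)) \<partial>gauss)"
 proof (rule integral_dominated_convergence[where w="\<lambda>z. \<bar>z\<bar> * K"])
  show "integrable gauss (\<lambda>z. \<bar>z\<bar> * K)" using integrable_gauss_abs by simp
  show "AE z in gauss. (\<lambda>n. z * F n (X n + ereal (sqrt (r n) * z))) \<longlonglongrightarrow> z * G (x + ereal (sqrt s * z))"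
   using lim by eventually_elim (intro tendsto_intros)
  show "AE z in gauss. norm (z * F n (X n + ereal (sqrt (r n) * z))) \<le> \<bar>z\<bar> * K" for n
   using b by (auto simp: abs_mult mult_left_mono)
 qed auto
qed (use s in simp)

definition duhamel_deriv :: "(real => ereal => real) => real => ereal => real" where
 "duhamel_deriv f t x = (\<integral>r. indicator {0<..<t} r * dheat r (f (t - r)) x \<partial>lborel)"

lemma measurable_dheat_slice:
 assumes f: "joint_measurable f"
  and [measurable]: "r \<in> borel_measurable A" "s \<in> borel_measurable A" "x \<in> borel_measurable A"
 shows "(\<lambda>a. dheat (r a) (f (s a)) (x a)) \<in> borel_measurable A"
proof (rule measurable_dheat_joint)
 show "(\<lambda>(a, y). f (s a) y) \<in> borel_measurable (A \<Otimes>\<^sub>M borel)"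
  using borel_measurable_uncurry[OF f, of "\<lambda>p. s (fst p)" "A \<Otimes>\<^sub>M borel" snd]
  by (simp add: case_prod_beta')
qed fact+

lemma dheat_slice_bound:
 assumes f: "joint_measurable f"
  and b: "\<And>s y. 0 < s ==> \<bar>f s y\<bar> \<le> K"
 shows "\<bar>indicator {0<..<t} r * dheat r (f (t - r)) x\<bar> \<le> indicator {0<..<t} r * (1 / sqrt r) * K"
 using dheat_bound[of "f (t - r)" K r x] b borel_measurable_slice[OF f] by (auto simp: indicator_def)

lemma duhamel_deriv_bound:
 assumes f: "joint_measurable f"
  and b: "\<And>s y. 0 < s ==> \<bar>f s y\<bar> \<le> K" and t: "t > 0"
 shows "\<bar>duhamel_deriv f t x\<bar> \<le> 2 * sqrt t * K"
proof -
 have i: "integrable lborel (\<lambda>r. indicator {0<..<t} r * (1 / sqrt r) * K)"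
  by (rule integrable_mult_left[OF integral_inverse_sqrt(1)[OF t]])
 have "\<bar>duhamel_deriv f t x\<bar> \<le> (\<integral>r. \<bar>indicator {0<..<t} r * dheat r (f (t - r)) x\<bar> \<partial>lborel)"
  unfolding duhamel_deriv_def by (rule integral_abs_bound)
 also have "... \<le> (\<integral>r. indicator {0<..<t} r * (1 / sqrt r) * K \<partial>lborel)"
  by (rule integral_mono'[OF i dheat_slice_bound[OF f b]]) (use order_trans[OF abs_ge_zero dheat_slice_bound[OF f b]] in blast)+
 also have "... = 2 * sqrt t * K"
  by (subst integral_mult_left_zero) (simp only: integral_inverse_sqrt(2)[OF t])
 finally show ?thesis .
qed

lemma duhamel_deriv_seq_cont:
 assumes f: "joint_measurable f"
  and b: "\<And>s y. 0 < s ==> \<bar>f s y\<bar> \<le> K" and c: "seq_cont_real f"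
 shows "seq_cont_real (duhamel_deriv f)"
 unfolding seq_cont_real_def
proof (intro allI impI, elim conjE)
 fix t x :: real and T X :: "nat => real"
 assume t: "0 < t" and T: "T \<longlonglongrightarrow> t" and X: "X \<longlonglongrightarrow> x"
 have K: "K \<ge> 0" using order_trans[OF abs_ge_zero b[of 1 0]] by simp
 obtain C where C: "\<And>n. T n \<le> C"
  using convergent_imp_Bseq[OF convergentI[OF T]] unfolding Bseq_def real_norm_def by (meson abs_le_D1)
 have tC: "t \<le> C" using LIMSEQ_le_const2[OF T] C by blast
 have m [measurable]: "(\<lambda>r. dheat r (f (t - r)) x) \<in> borel_measurable lborel" for t x
  by (rule measurable_dheat_slice[OF f]) auto
 have fm [measurable]: "f s \<in> borel_measurable borel" for s
  by (rule borel_measurable_slice[OF f])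
 show "(\<lambda>n. duhamel_deriv f (T n) (ereal (X n))) \<longlonglongrightarrow> duhamel_deriv f t (ereal x)"
  unfolding duhamel_deriv_def
 proof (rule integral_dominated_convergence[where w="\<lambda>r. indicator {0<..<C} r * (1 / sqrt r) * K"])
  show "integrable lborel (\<lambda>r. indicator {0<..<C} r * (1 / sqrt r) * K)"
   by (rule integrable_mult_left[OF integral_inverse_sqrt(1)]) (use t tC in simp)
  show "AE r in lborel. norm (indicator {0<..<T n} r * dheat r (f (T n - r)) (ereal (X n))) \<le> indicator {0<..<C} r * (1 / sqrt r) * K" for n
  proof (intro AE_I2)
   fix r
   have "indicator {0<..<T n} r * (1 / sqrt r) * K \<le> indicator {0<..<C} r * (1 / sqrt r) * K"
    using C[of n] K by (auto simp: indicator_def)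
   then show "norm (indicator {0<..<T n} r * dheat r (f (T n - r)) (ereal (X n))) \<le> indicator {0<..<C} r * (1 / sqrt r) * K"
    using dheat_slice_bound[OF f b, of "T n" r "ereal (X n)"] by simp
  qed
  have "AE r in lborel. r \<noteq> t" by (rule AE_lborel_singleton)
  then show "AE r in lborel. (\<lambda>n. indicator {0<..<T n} r * dheat r (f (T n - r)) (ereal (X n))) \<longlonglongrightarrow> indicator {0<..<t} r * dheat r (f (t - r)) (ereal x)"
  proof eventually_elim
   case (elim r)
   show ?case
   proof (cases "0 < r \<and> r < t")
    case True
    then have ev: "eventually (\<lambda>n. r < T n) sequentially"
     using order_tendstoD(1)[OF T, of r] by auto
    have "(\<lambda>n. dheat r (\<lambda>y. if r < T n then f (T n - r) y else 0) (ereal (X n))) \<longlonglongrightarrow> dheat r (f (t - r)) (ereal x)"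
    proof (rule dheat_tendsto[where K=K and r="\<lambda>_. r"])
     show "\<bar>if r < T n then f (T n - r) y else 0\<bar> \<le> K" for n y using b K by auto
     have lim: "(\<lambda>n. f (T n - r) (ereal (X n) + ereal (sqrt r * z))) \<longlonglongrightarrow> f (t - r) (ereal x + ereal (sqrt r * z))" for z
     proof -
      have "(\<lambda>n. T n - r) \<longlonglongrightarrow> t - r" "(\<lambda>n. X n + sqrt r * z) \<longlonglongrightarrow> x + sqrt r * z"
       by (intro tendsto_intros T X)+
      then show ?thesis
       using seq_cont_realD[OF c, of "t - r"] True by simp
     qed
     show "AE z in gauss. (\<lambda>n. if r < T n then f (T n - r) (ereal (X n) + ereal (sqrt r * z)) else 0) \<longlonglongrightarrow> f (t - r) (ereal x + ereal (sqrt r * z))"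
     proof (intro AE_I2)
      fix z
      show "(\<lambda>n. if r < T n then f (T n - r) (ereal (X n) + ereal (sqrt r * z)) else 0) \<longlonglongrightarrow> f (t - r) (ereal x + ereal (sqrt r * z))"
       by (rule Lim_transform_eventually[OF lim]) (use ev in \<open>eventually_elim, simp\<close>)
     qed
    qed (use True in auto)
    then show ?thesis
    proof (rule Lim_transform_eventually[THEN back_subst[where P="\<lambda>c. _ \<longlonglongrightarrow> c"]])
     show "\<forall>\<^sub>F n in sequentially. dheat r (\<lambda>y. if r < T n then f (T n - r) y else 0) (ereal (X n)) = indicator {0<..<T n} r * dheat r (f (T n - r)) (ereal (X n))"
      using ev by eventually_elim (use True in simp)
    qed (use True in simp)
   next
    case False
    then consider "r \<le> 0" | "t < r" using elim by fastforce
    then show ?thesis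
    proof cases
     case 2
     then have ev: "eventually (\<lambda>n. T n < r) sequentially"
      using order_tendstoD(2)[OF T, of r] by auto
     show ?thesis
     proof (rule Lim_transform_eventually[OF tendsto_const])
      show "\<forall>\<^sub>F n in sequentially. indicator {0<..<t} r * dheat r (f (t - r)) (ereal x) = indicator {0<..<T n} r * dheat r (f (T n - r)) (ereal (X n))"
       using ev by eventually_elim (use 2 in simp)
     qed
    qed (simp add: indicator_def)
   qed
  qed
 qed simp_all
qed

lemma dheat_seq_cont:
 fixes g :: "ereal => real"
 assumes g: "g \<in> borel_measurable borel" and b: "\<And>y. \<bar>g y\<bar> \<le> K"
  and c: "continuous_on UNIV (\<lambda>x::real. g (ereal x))"
 shows "seq_cont_real (\<lambda>t x. dheat t g x)"
 unfolding seq_cont_real_def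
proof (intro allI impI, elim conjE)
 fix t x :: real and T X :: "nat => real"
 assume t: "0 < t" and T: "T \<longlonglongrightarrow> t" and X: "X \<longlonglongrightarrow> x"
 have "(\<lambda>n. g (ereal (X n) + ereal (sqrt (T n) * z))) \<longlonglongrightarrow> g (ereal x + ereal (sqrt t * z))" for z
 proof -
  have "(\<lambda>n. X n + sqrt (T n) * z) \<longlonglongrightarrow> x + sqrt t * z"
   by (intro tendsto_intros T X)
  then show ?thesis
   using continuous_on_tendsto_compose[OF c, of "\<lambda>n. X n + sqrt (T n) * z" "x + sqrt t * z" sequentially] by simp
 qed
 then show "(\<lambda>n. dheat (T n) g (ereal (X n))) \<longlonglongrightarrow> dheat t g (ereal x)"
  by (intro dheat_tendsto[OF g g b t T] AE_I2)
qed

text \<open>Differentiability is read off from an integral identity, so that derivatives of Duhamel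
  integrals involve no exchange of a derivative with an integral that is singular at age 0.\<close>

lemma has_real_derivative_if_integral:
 fixes F G :: "real => real"
 assumes G: "continuous_on UNIV G"
  and FG: "\<And>a b. a \<le> b ==> F b - F a = (\<integral>x. indicator {a..b} x * G x \<partial>lborel)"
 shows "(F has_real_derivative G x) (at x)"
proof -
 define a b where "a = x - 1" and "b = x + 1"
 have c: "continuous_on {a..y} G" for y by (rule continuous_on_subset[OF G]) simp
 have "F y = F a + integral {a..y} G" if "y \<in> {a..b}" for y
 proof -
  have "F y - F a = integral {a..y} G"
   using FG[of a y] that borel_integrable_atLeastAtMost'[OF c] set_borel_integral_eq_integral(2)[of "{a..y}" G]
   by (simp add: set_lebesgue_integral_def)
  then show ?thesis by simp
 qed
 note eq = this
 have "((\<lambda>y. F a + integral {a..y} G) has_real_derivative G x) (at x within {a..b})"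
  using integral_has_real_derivative[OF c, of x b] by (auto simp: a_def b_def intro!: derivative_eq_intros)
 then have "(F has_real_derivative G x) (at x within {a..b})"
  by (rule has_field_derivative_transform_within[where d=1]) (use eq[symmetric] in \<open>simp_all add: a_def b_def\<close>)
 then show ?thesis
  by (subst (asm) at_within_interior) (auto simp: a_def b_def)
qed

lemma seq_cont_real_slice:
 assumes "seq_cont_real f" "t > 0"
 shows "continuous_on UNIV (\<lambda>x. f t (ereal x))"
 unfolding continuous_on_sequentially comp_def
 using seq_cont_realD[OF assms(1,2) tendsto_const] by auto

lemma heat_has_derivative:
 fixes g :: "ereal => real"
 assumes g: "g \<in> borel_measurable borel" and b: "\<And>y. \<bar>g y\<bar> \<le> K"
  and c: "continuous_on UNIV (\<lambda>x::real. g (ereal x))" and t: "t > 0"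
 shows "((\<lambda>x. heat t g (ereal x)) has_real_derivative dheat t g (ereal x)) (at x)"
 by (rule has_real_derivative_if_integral[OF seq_cont_real_slice[OF dheat_seq_cont[OF g b c] t]])
   (rule heat_diff_eq_integral_dheat[OF g b t])

text \<open>\<open>dheat\<close> is integrated over \<open>{a..d}\<close> for each age and the two
  integrals are exchanged; the double integral converges absolutely because
  \<open>1 / sqrt r\<close> is integrable.\<close>

lemma duhamel_has_derivative:
 assumes f: "joint_measurable f"
  and b: "\<And>s y. 0 < s ==> \<bar>f s y\<bar> \<le> K" and c: "seq_cont_real f" and t: "t > 0"
 shows "((\<lambda>x. duhamel f t (ereal x)) has_real_derivative duhamel_deriv f t (ereal x)) (at x)"
proof (rule has_real_derivative_if_integral[OF seq_cont_real_slice[OF duhamel_deriv_seq_cont[OF f b c] t]])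
 fix a d :: real assume ad: "a \<le> d"
 have K: "K \<ge> 0" using order_trans[OF abs_ge_zero b[of 1 0]] by simp
 have fm [measurable]: "f s \<in> borel_measurable borel" for s
  by (rule borel_measurable_slice[OF f])
 define k where "k = (\<lambda>r x. indicator {a..d} x * (indicator {0<..<t} r * dheat r (f (t - r)) (ereal x)))"
 have km [measurable]: "joint_measurable k"
 proof -
  have [measurable]: "(\<lambda>p. dheat (fst p) (f (t - fst p)) (ereal (snd p))) \<in> borel_measurable (borel \<Otimes>\<^sub>M borel)"
   by (rule measurable_dheat_slice[OF f]) auto
  show ?thesis unfolding k_def by measurable
 qed
 have kb: "\<bar>k r x\<bar> \<le> indicator {a..d} x * (indicator {0<..<t} r * (1 / sqrt r) * K)" for r x
  using dheat_slice_bound[OF f b, of t r "ereal x"] by (auto simp: k_def abs_mult indicator_def)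
 have ia: "integrable lborel (\<lambda>x. indicator {a..d} x * c)" for c :: real
  by (intro integrable_mult_left integrable_real_indicator) (use ad in auto)
 have ik: "integrable lborel (k r)" for r
 proof (rule Bochner_Integration.integrable_bound[OF ia[of "indicator {0<..<t} r * (1 / sqrt r) * K"]])
  show "AE x in lborel. norm (k r x) \<le> norm (indicator {a..d} x * (indicator {0<..<t} r * (1 / sqrt r) * K))"
   using kb by (intro AE_I2) (metis abs_ge_self order_trans real_norm_def)
 qed (use km in measurable)
 have i: "integrable (lborel \<Otimes>\<^sub>M lborel) (\<lambda>(r, x). k r x)"
 proof (rule lborel_pair.Fubini_integrable)
  show "integrable lborel (\<lambda>r. \<integral>x. norm (case (r, x) of (r, x) => k r x) \<partial>lborel)"
  proof (rule Bochner_Integration.integrable_bound)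
   show "integrable lborel (\<lambda>r. indicator {0<..<t} r * (1 / sqrt r) * (K * (d - a)))"
    by (rule integrable_mult_left[OF integral_inverse_sqrt(1)[OF t]])
   show "AE r in lborel. norm (\<integral>x. norm (case (r, x) of (r, x) => k r x) \<partial>lborel) \<le> norm (indicator {0<..<t} r * (1 / sqrt r) * (K * (d - a)))"
   proof (intro AE_I2)
    fix r
    have "(\<integral>x. \<bar>k r x\<bar> \<partial>lborel) \<le> (\<integral>x. indicator {a..d} x * (indicator {0<..<t} r * (1 / sqrt r) * K) \<partial>lborel)"
     by (rule integral_mono'[OF ia kb]) (use order_trans[OF abs_ge_zero kb] in blast)
    also have "... = indicator {0<..<t} r * (1 / sqrt r) * (K * (d - a))"
     using ad by simp
    finally show "norm (\<integral>x. norm (case (r, x) of (r, x) => k r x) \<partial>lborel) \<le> norm (indicator {0<..<t} r * (1 / sqrt r) * (K * (d - a)))"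
     using Bochner_Integration.integral_nonneg[of lborel "\<lambda>x. \<bar>k r x\<bar>"]
      abs_ge_self[of "indicator {0<..<t} r * (1 / sqrt r) * (K * (d - a))"]
     unfolding case_prod_conv real_norm_def by linarith
   qed
  qed simp
 qed (use ik in simp_all)
 have "duhamel f t (ereal d) - duhamel f t (ereal a)
   = (\<integral>r. indicator {0<..<t} r * heat r (f (t - r)) (ereal d) - indicator {0<..<t} r * heat r (f (t - r)) (ereal a) \<partial>lborel)"
  unfolding duhamel_def by (intro Bochner_Integration.integral_diff[symmetric] duhamel_integrable[OF f b])
 also have "... = (\<integral>r. (\<integral>x. k r x \<partial>lborel) \<partial>lborel)"
 proof (rule Bochner_Integration.integral_cong[OF refl])
  fix r
  show "indicator {0<..<t} r * heat r (f (t - r)) (ereal d) - indicator {0<..<t} r * heat r (f (t - r)) (ereal a) = (\<integral>x. k r x \<partial>lborel)"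
  proof (cases "0 < r \<and> r < t")
   case True
   then have "heat r (f (t - r)) (ereal d) - heat r (f (t - r)) (ereal a) = (\<integral>x. indicator {a..d} x * dheat r (f (t - r)) (ereal x) \<partial>lborel)"
    by (intro heat_diff_eq_integral_dheat[where K=K]) (use b ad in auto)
   then show ?thesis using True by (simp add: k_def)
  qed (auto simp: k_def)
 qed
 also have "... = (\<integral>x. (\<integral>r. k r x \<partial>lborel) \<partial>lborel)"
  using lborel_pair.Fubini_integral[OF i] by simp
 also have "... = (\<integral>x. indicator {a..d} x * duhamel_deriv f t (ereal x) \<partial>lborel)"
  by (simp add: k_def duhamel_deriv_def)
 finally show "duhamel f t (ereal d) - duhamel f t (ereal a) = (\<integral>x. indicator {a..d} x * duhamel_deriv f t (ereal x) \<partial>lborel)" .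
qed

text \<open>When \<open>g\<close> has a bounded derivative, differentiation under the Gaussian
  integral is legitimate, with difference quotients dominated by \<open>K'\<close>. Uniqueness of
  derivatives identifies the result with \<open>dheat\<close>, so the derivative passes from the
  kernel to \<open>g\<close> and the singularity in \<open>r\<close> disappears.\<close>

lemma dheat_eq_heat_deriv:
 fixes g g' :: "ereal => real"
 assumes g: "g \<in> borel_measurable borel" and b: "\<And>y. \<bar>g y\<bar> \<le> K"
  and g': "g' \<in> borel_measurable borel" and b': "\<And>y. \<bar>g' y\<bar> \<le> K'"
  and D: "\<And>x. ((\<lambda>x. g (ereal x)) has_real_derivative g' (ereal x)) (at x)" and r: "r > 0"
 shows "dheat r g (ereal x) = heat r g' (ereal x)"
proof -
 have c: "continuous_on UNIV (\<lambda>x::real. g (ereal x))"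
  using D by (intro continuous_at_imp_continuous_on ballI) (blast intro: DERIV_isCont)
 have lip: "\<bar>g (ereal u) - g (ereal v)\<bar> \<le> K' * \<bar>u - v\<bar>" for u v
  using field_differentiable_bound[of UNIV "\<lambda>x. g (ereal x)" "\<lambda>x. g' (ereal x)" K' u v] D b' by auto
 have "((\<lambda>x. heat r g (ereal x)) has_real_derivative heat r g' (ereal x)) (at x)"
  unfolding has_field_derivative_iff tendsto_at_iff_sequentially comp_def
 proof (intro allI impI)
  fix X assume X: "\<forall>i. X i \<in> UNIV - {x}" "X \<longlonglongrightarrow> x"
  let ?q = "\<lambda>n z. (g (ereal (X n) + ereal (sqrt r * z)) - g (ereal x + ereal (sqrt r * z))) / (X n - x)"
  have eq: "(heat r g (ereal (X n)) - heat r g (ereal x)) / (X n - x) = (\<integral>z. ?q n z \<partial>gauss)" for n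
   unfolding heat_def using heat_integrable[OF g b, of "ereal (X n)" r] heat_integrable[OF g b, of "ereal x" r] by simp
  note [measurable] = g g'
  show "(\<lambda>n. (heat r g (ereal (X n)) - heat r g (ereal x)) / (X n - x)) \<longlonglongrightarrow> heat r g' (ereal x)"
   unfolding eq heat_def[of r g']
  proof (rule integral_dominated_convergence[where w="\<lambda>_. K'"])
   show "AE z in gauss. (\<lambda>n. ?q n z) \<longlonglongrightarrow> g' (ereal x + ereal (sqrt r * z))"
   proof (intro AE_I2)
    fix z
    have "((\<lambda>y. (g (ereal y) - g (ereal (x + sqrt r * z))) / (y - (x + sqrt r * z))) \<longlongrightarrow> g' (ereal (x + sqrt r * z))) (at (x + sqrt r * z))"
     using D[of "x + sqrt r * z"] by (simp add: has_field_derivative_iff)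
    moreover have "(\<lambda>n. X n + sqrt r * z) \<longlonglongrightarrow> x + sqrt r * z"
     using X by (intro tendsto_intros)
    ultimately have "(\<lambda>n. (g (ereal (X n + sqrt r * z)) - g (ereal (x + sqrt r * z))) / (X n + sqrt r * z - (x + sqrt r * z)))
      \<longlonglongrightarrow> g' (ereal (x + sqrt r * z))"
     using X unfolding tendsto_at_iff_sequentially comp_def by (elim allE[of _ "\<lambda>n. X n + sqrt r * z"]) simp
    then show "(\<lambda>n. ?q n z) \<longlonglongrightarrow> g' (ereal x + ereal (sqrt r * z))"
     by simp
   qed
   show "AE z in gauss. norm (?q n z) \<le> K'" for n
   proof (intro AE_I2)
    fix z
    have "X n \<noteq> x" using X by auto
    then show "norm (?q n z) \<le> K'"
     using lip[of "X n + sqrt r * z" "x + sqrt r * z"] by (simp add: abs_divide pos_divide_le_eq)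
   qed
  qed simp_all
 qed
 then show ?thesis
  using heat_has_derivative[OF g b c r] DERIV_unique by blast
qed

text \<open>A derivative along the fixed steps \<open>1 / real (Suc n)\<close>: being a limit of a
  sequence it is jointly measurable at once, and it agrees with the derivative wherever that exists.
  At the infinite points all quotients vanish.\<close>

definition space_deriv :: "(real => ereal => real) => real => ereal => real" where
 "space_deriv w t y = lim (\<lambda>n. (w t (y + ereal (1 / real (Suc n))) - w t y) * real (Suc n))"

lemma space_deriv_measurable:
 fixes w :: "real => ereal => real"
 assumes w: "joint_measurable w"
 shows "joint_measurable (\<lambda>t y. space_deriv w t y)"
proof -
 have [measurable]: "(\<lambda>p. w (fst p) (snd p + ereal (1 / real (Suc n)))) \<in> borel_measurable (borel \<Otimes>\<^sub>M borel)" for n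
  by (rule borel_measurable_uncurry[OF w]) auto
 have [measurable]: "(\<lambda>p. w (fst p) (snd p)) \<in> borel_measurable (borel \<Otimes>\<^sub>M borel)"
  by (rule borel_measurable_uncurry[OF w]) auto
 show ?thesis
  unfolding space_deriv_def case_prod_beta' by measurable
qed

lemma space_deriv_eq:
 assumes "((\<lambda>x. w t (ereal x)) has_real_derivative D) (at x)"
 shows "space_deriv w t (ereal x) = D"
proof -
 have "((\<lambda>d. (w t (ereal (x + d)) - w t (ereal x)) / d) \<longlongrightarrow> D) (at 0)"
  using assms by (simp add: DERIV_def)
 moreover have "(\<lambda>n. 1 / real (Suc n)) \<longlonglongrightarrow> 0"
  using LIMSEQ_inverse_real_of_nat by (simp add: inverse_eq_divide)
 ultimately have "(\<lambda>n. (w t (ereal (x + 1 / real (Suc n))) - w t (ereal x)) / (1 / real (Suc n))) \<longlonglongrightarrow> D"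
  unfolding tendsto_at_iff_sequentially comp_def
  by (elim allE[of _ "\<lambda>n. 1 / real (Suc n)"]) auto
 then show ?thesis
  unfolding space_deriv_def by (intro limI) simp
qed

lemma space_deriv_infinity:
 assumes "\<bar>y\<bar> = \<infinity>" shows "space_deriv w t y = 0"
proof -
 have "y + ereal c = y" for c using assms by (cases y) auto
 then show ?thesis by (simp add: space_deriv_def)
qed

lemma seq_cont_real_shift:
 assumes "seq_cont_real f" "s \<ge> 0"
 shows "seq_cont_real (\<lambda>r y. f (s + r) y)"
 unfolding seq_cont_real_def
proof (intro allI impI, elim conjE)
 fix t x :: real and T X :: "nat => real"
 assume "0 < t" "T \<longlonglongrightarrow> t" "X \<longlonglongrightarrow> x"
 then show "(\<lambda>n. f (s + T n) (ereal (X n))) \<longlonglongrightarrow> f (s + t) (ereal x)"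
  using assms(2) by (intro seq_cont_realD[OF assms(1)] tendsto_intros) auto
qed

text \<open>The pattern common to the two rounds of differentiation: after time \<open>s\<close>,
  \<open>w\<close> is the heat flow of continuous data minus a Duhamel integral. It is instantiated
  with the solution and then with its space derivative.\<close>

locale duhamel_rep =
 fixes w f :: "real => ereal => real" and g :: "ereal => real" and s K H :: real
 assumes g: "g \<in> borel_measurable borel" and g_bound: "\<And>y. \<bar>g y\<bar> \<le> K"
  and g_cont: "continuous_on UNIV (\<lambda>x::real. g (ereal x))"
  and f: "joint_measurable f"
  and f_bound: "\<And>s y. 0 < s ==> \<bar>f s y\<bar> \<le> H" and f_cont: "seq_cont_real f"
  and rep: "\<And>d x. 0 < d ==> w (s + d) (ereal x) = heat d g (ereal x) - duhamel f d (ereal x)"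
begin

lemma has_deriv:
 assumes d: "0 < d"
 shows "((\<lambda>x. w (s + d) (ereal x)) has_real_derivative dheat d g (ereal x) - duhamel_deriv f d (ereal x)) (at x)"
 unfolding rep[OF d]
 by (intro DERIV_diff heat_has_derivative[OF g g_bound g_cont d] duhamel_has_derivative[OF f f_bound f_cont d])

lemma space_deriv: "0 < d ==> space_deriv w (s + d) (ereal x) = dheat d g (ereal x) - duhamel_deriv f d (ereal x)"
 using space_deriv_eq[of w "s + d" "dheat d g (ereal x) - duhamel_deriv f d (ereal x)" x] has_deriv by simp

lemma has_space_deriv:
 "0 < d ==> ((\<lambda>x. w (s + d) (ereal x)) has_real_derivative space_deriv w (s + d) (ereal x)) (at x)"
 using has_deriv space_deriv by simp

lemma K_nonneg: "K \<ge> 0" using order_trans[OF abs_ge_zero g_bound[of 0]] .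

lemma H_nonneg: "H \<ge> 0" using order_trans[OF abs_ge_zero f_bound[of 1 0]] by simp

lemma space_deriv_bound:
 assumes d: "0 < d" shows "\<bar>space_deriv w (s + d) y\<bar> \<le> K / sqrt d + 2 * sqrt d * H"
proof (cases "\<bar>y\<bar> = \<infinity>")
 case True
 then show ?thesis using K_nonneg H_nonneg d by (simp add: space_deriv_infinity)
next
 case False
 then obtain x where y: "y = ereal x" by (cases y) auto
 show ?thesis
  unfolding y space_deriv[OF d]
  using dheat_bound[OF g g_bound, of d "ereal x"] duhamel_deriv_bound[OF f f_bound d, of "ereal x"] d by linarith
qed

lemma space_deriv_tendsto:
 assumes d: "0 < d" and T: "T \<longlonglongrightarrow> s + d" and X: "X \<longlonglongrightarrow> x"
 shows "(\<lambda>n. space_deriv w (T n) (ereal (X n))) \<longlonglongrightarrow> space_deriv w (s + d) (ereal x)"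
proof -
 have T': "(\<lambda>n. T n - s) \<longlonglongrightarrow> d"
  using tendsto_diff[OF T tendsto_const, of s] by simp
 have "(\<lambda>n. dheat (T n - s) g (ereal (X n)) - duhamel_deriv f (T n - s) (ereal (X n)))
   \<longlonglongrightarrow> dheat d g (ereal x) - duhamel_deriv f d (ereal x)"
  by (intro tendsto_diff seq_cont_realD[OF dheat_seq_cont[OF g g_bound g_cont] d T' X]
    seq_cont_realD[OF duhamel_deriv_seq_cont[OF f f_bound f_cont] d T' X])
 then show ?thesis
  unfolding space_deriv[OF d]
 proof (rule Lim_transform_eventually)
  have "eventually (\<lambda>n. 0 < T n - s) sequentially"
   by (rule order_tendstoD(1)[OF T' d])
  then show "\<forall>\<^sub>F n in sequentially. dheat (T n - s) g (ereal (X n)) - duhamel_deriv f (T n - s) (ereal (X n)) = space_deriv w (T n) (ereal (X n))"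
  proof eventually_elim
   case (elim n)
   then show ?case using space_deriv[of "T n - s" "X n"] by simp
  qed
 qed
qed

end

text \<open>
 A bounded flow satisfying the variation-of-constants formula between any two positive times is a
 classical solution: restarting at a positive time makes the data smooth enough to differentiate.
\<close>

locale regular_flow =
 fixes U :: "real => ereal => real" and h h' :: "real => real" and K H H' :: real
 assumes U: "joint_measurable U"
  and U_bound: "\<And>t y. 0 < t ==> \<bar>U t y\<bar> \<le> K"
  and U_cont: "seq_cont_real U"
  and flow: "\<And>s d x. 0 < s ==> 0 < d ==>
    U (s + d) (ereal x) = heat d (U s) (ereal x) - duhamel (\<lambda>r y. h (U (s + r) y)) d (ereal x)"
  and h_deriv: "\<And>v. (h has_real_derivative h' v) (at v)" and h'_cont: "continuous_on UNIV h'"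
  and h_bound: "\<And>t y. 0 < t ==> \<bar>h (U t y)\<bar> \<le> H" and h'_bound: "\<And>t y. 0 < t ==> \<bar>h' (U t y)\<bar> \<le> H'"
begin

lemma h_cont: "continuous_on UNIV h"
 using h_deriv by (intro continuous_at_imp_continuous_on ballI) (blast intro: DERIV_isCont)

lemma U_slice: "U s \<in> borel_measurable borel"
 by (rule borel_measurable_slice[OF U])

lemma shifted_measurable:
 fixes F :: "real => ereal => real"
 assumes "joint_measurable F"
 shows "joint_measurable (\<lambda>r y. F (s + r) y)"
 using borel_measurable_uncurry[OF assms, of "\<lambda>p. s + fst p" "borel \<Otimes>\<^sub>M borel" snd]
 by (simp add: case_prod_beta')

lemma comp_U_measurable:
 assumes "continuous_on UNIV (k :: real => real)"
 shows "joint_measurable (\<lambda>t y. k (U t y))"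
 using measurable_compose[OF U borel_measurable_continuous_onI[OF assms]] by (simp add: case_prod_beta')

lemma comp_U_cont:
 assumes "continuous_on UNIV (k :: real => real)"
 shows "seq_cont_real (\<lambda>t y. k (U t y))"
 unfolding seq_cont_real_def
 using continuous_on_tendsto_compose[OF assms seq_cont_realD[OF U_cont]] by auto

lemma rep1: "0 < s ==> duhamel_rep U (\<lambda>r y. h (U (s + r) y)) (U s) s K H"
 by unfold_locales
   (auto intro!: U_slice U_bound seq_cont_real_slice[OF U_cont] shifted_measurable[OF comp_U_measurable[OF h_cont]]
    h_bound seq_cont_real_shift[OF comp_U_cont[OF h_cont]] flow)

abbreviation "Ux \<equiv> space_deriv U"

lemma Ux: "0 < t ==> ((\<lambda>x. U t (ereal x)) has_real_derivative Ux t (ereal x)) (at x)"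
 using duhamel_rep.has_space_deriv[OF rep1[of "t / 2"], of "t / 2" x] by simp

lemma Ux_cont: "seq_cont_real Ux"
 unfolding seq_cont_real_def
proof (intro allI impI, elim conjE)
 fix t x :: real and T X :: "nat => real"
 assume "0 < t" "T \<longlonglongrightarrow> t" "X \<longlonglongrightarrow> x"
 then show "(\<lambda>n. Ux (T n) (ereal (X n))) \<longlonglongrightarrow> Ux t (ereal x)"
  using duhamel_rep.space_deriv_tendsto[OF rep1[of "t / 2"], of "t / 2" T X x] by simp
qed

lemma Ux_measurable: "joint_measurable Ux"
 by (rule space_deriv_measurable[OF U])

lemma Ux_bound: "0 < e ==> e < t ==> \<bar>Ux t y\<bar> \<le> K / sqrt e + 2 * sqrt e * H"
 using duhamel_rep.space_deriv_bound[OF rep1[of "t - e"], of e y] by simp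

text \<open>The bound obtained by restarting \<open>s / 2\<close> before the current time, hence
  valid at all times from \<open>s\<close> on.\<close>

definition "K1 s = K / sqrt (s / 2) + 2 * sqrt (s / 2) * H"

lemma Ux_bound': "0 < s ==> s \<le> t ==> \<bar>Ux t y\<bar> \<le> K1 s"
 unfolding K1_def by (rule Ux_bound) auto

abbreviation "h'Ux \<equiv> \<lambda>t y. h' (U t y) * Ux t y"

lemma h'Ux_measurable: "joint_measurable h'Ux"
 using borel_measurable_times[OF comp_U_measurable[OF h'_cont] Ux_measurable]
 by (simp add: case_prod_beta')

lemma h'Ux_cont: "seq_cont_real h'Ux"
 using comp_U_cont[OF h'_cont] Ux_cont unfolding seq_cont_real_def by (auto intro!: tendsto_mult)

lemma h'Ux_bound: "0 < s ==> s \<le> t ==> \<bar>h'Ux t y\<bar> \<le> H' * K1 s"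
 using Ux_bound'[of s t y] h'_bound[of t y] by (auto simp: abs_mult intro!: mult_mono order_trans[OF abs_ge_zero h'_bound[of t y]])

lemma h_U_deriv: "0 < t ==> ((\<lambda>x. h (U t (ereal x))) has_real_derivative h'Ux t (ereal x)) (at x)"
 using DERIV_chain2[OF h_deriv Ux] by simp

text \<open>Differentiating the flow formula and moving the derivative from the kernels to
  \<open>U\<close> and \<open>h (U)\<close> shows that \<open>Ux\<close> solves the linearised
  equation with source \<open>h' (U) * Ux\<close>, again in variation-of-constants form. This is
  what allows a second round of differentiation.\<close>

lemma Ux_flow:
 assumes s: "0 < s" and d: "0 < d"
 shows "Ux (s + d) (ereal x) = heat d (Ux s) (ereal x) - duhamel (\<lambda>r y. h'Ux (s + r) y) d (ereal x)"
proof -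
 have "dheat d (U s) (ereal x) = heat d (Ux s) (ereal x)"
  by (rule dheat_eq_heat_deriv[OF U_slice U_bound[OF s] borel_measurable_slice[OF Ux_measurable] Ux_bound'[OF s order_refl] Ux[OF s] d])
 moreover have "duhamel_deriv (\<lambda>r y. h (U (s + r) y)) d (ereal x) = duhamel (\<lambda>r y. h'Ux (s + r) y) d (ereal x)"
  unfolding duhamel_def duhamel_deriv_def
 proof (intro Bochner_Integration.integral_cong refl)
  fix r
  have "dheat r (\<lambda>y. h (U (s + (d - r)) y)) (ereal x) = heat r (\<lambda>y. h'Ux (s + (d - r)) y) (ereal x)" if "0 < r" "r < d"
   by (rule dheat_eq_heat_deriv[where K=H and K'="H' * K1 s"])
     (use that s in \<open>auto intro!: h_bound h'Ux_bound h_U_deriv borel_measurable_slice[OF comp_U_measurable[OF h_cont]]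
      borel_measurable_slice[OF h'Ux_measurable]\<close>)
  then show "indicator {0<..<d} r * dheat r (\<lambda>y. h (U (s + (d - r)) y)) (ereal x)
    = indicator {0<..<d} r * heat r (\<lambda>y. h'Ux (s + (d - r)) y) (ereal x)"
   by (auto simp: indicator_def)
 qed
 ultimately show ?thesis
  using duhamel_rep.space_deriv[OF rep1[OF s] d, of x] by simp
qed

lemma rep2: "0 < s ==> duhamel_rep Ux (\<lambda>r y. h'Ux (s + r) y) (Ux s) s (K1 s) (H' * K1 s)"
 by unfold_locales
   (auto intro!: borel_measurable_slice[OF Ux_measurable] Ux_bound' seq_cont_real_slice[OF Ux_cont]
    shifted_measurable[OF h'Ux_measurable] h'Ux_bound seq_cont_real_shift[OF h'Ux_cont] Ux_flow)

abbreviation "Uxx \<equiv> space_deriv Ux"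

lemma Uxx: "0 < t ==> ((\<lambda>x. Ux t (ereal x)) has_real_derivative Uxx t (ereal x)) (at x)"
 using duhamel_rep.has_space_deriv[OF rep2[of "t / 2"], of "t / 2" x] by simp

lemma Uxx_cont: "seq_cont_real Uxx"
 unfolding seq_cont_real_def
proof (intro allI impI, elim conjE)
 fix t x :: real and T X :: "nat => real"
 assume "0 < t" "T \<longlonglongrightarrow> t" "X \<longlonglongrightarrow> x"
 then show "(\<lambda>n. Uxx (T n) (ereal (X n))) \<longlonglongrightarrow> Uxx t (ereal x)"
  using duhamel_rep.space_deriv_tendsto[OF rep2[of "t / 2"], of "t / 2" T X x] by simp
qed

text \<open>Uniformity over a time neighbourhood of \<open>t\<close> and all of space supplies the
  dominating function for the Taylor remainder below. The restart time \<open>t / 4\<close> keeps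
  distance at least \<open>t / 4\<close> from that neighbourhood.\<close>

lemma Uxx_bound:
 assumes t: "0 < t"
 shows "\<exists>C. \<forall>s y. t / 2 \<le> s \<and> s \<le> 2 * t \<longrightarrow> \<bar>Uxx s y\<bar> \<le> C"
proof -
 define e where "e = t / 4"
 have e: "e > 0" using t by (simp add: e_def)
 let ?C = "K1 e / sqrt e + 2 * sqrt (2 * t) * (H' * K1 e)"
 have "\<bar>Uxx s y\<bar> \<le> ?C" if s: "t / 2 \<le> s" "s \<le> 2 * t" for s y
 proof -
  interpret R: duhamel_rep Ux "\<lambda>r y. h'Ux (e + r) y" "Ux e" e "K1 e" "H' * K1 e"
   by (rule rep2[OF e])
  have d: "e \<le> s - e" "s - e \<le> 2 * t" using s t by (auto simp: e_def)
  have "\<bar>Uxx s y\<bar> \<le> K1 e / sqrt (s - e) + 2 * sqrt (s - e) * (H' * K1 e)"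
   using R.space_deriv_bound[of "s - e" y] d e by simp
  also have "... \<le> ?C"
   using R.K_nonneg R.H_nonneg d e by (intro add_mono divide_left_mono mult_right_mono mult_left_mono) auto
  finally show ?thesis .
 qed
 then show ?thesis by blast
qed

end

text \<open>Substituting \<open>r = e * v\<close> fixes the domain of integration, so that letting
  \<open>e\<close> tend to 0 becomes dominated convergence.\<close>

lemma duhamel_rescale:
 assumes e: "e > 0"
 shows "duhamel f e x / e = (\<integral>v. indicator {0<..<1} v * heat (e * v) (f (e - e * v)) x \<partial>lborel)"
proof -
 have "duhamel f e x = e * (\<integral>v. indicator {0<..<e} (e * v) * heat (e * v) (f (e - e * v)) x \<partial>lborel)"
  unfolding duhamel_def using e lborel_integral_real_affine[of e "\<lambda>r. indicator {0<..<e} r * heat r (f (e - r)) x" 0]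
  by simp
 moreover have "indicator {0<..<e} (e * v) = (indicator {0<..<1} v :: real)" for v
  using e by (auto simp: indicator_def zero_less_mult_iff)
 ultimately show ?thesis using e by simp
qed

lemma Taylor_second_order:
 fixes g g' g'' :: "real => real"
 assumes "\<And>x. (g has_real_derivative g' x) (at x)" "\<And>x. (g' has_real_derivative g'' x) (at x)"
 shows "\<exists>\<theta>. \<bar>\<theta>\<bar> \<le> \<bar>a\<bar> \<and> g (x + a) = g x + a * g' x + a\<^sup>2 / 2 * g'' (x + \<theta>)"
proof (cases "a = 0")
 case False
 define diff where "diff = (\<lambda>m::nat. if m = 0 then g else if m = 1 then g' else g'')"
 have "\<exists>t. (if x + a < x then x + a < t \<and> t < x else x < t \<and> t < x + a) \<and>
   g (x + a) = (\<Sum>m<2. diff m x / fact m * (x + a - x) ^ m) + diff 2 t / fact 2 * (x + a - x) ^ 2"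
  by (rule Taylor[of 2 diff g "x - \<bar>a\<bar>" "x + \<bar>a\<bar>"])
    (use assms False in \<open>auto simp: diff_def less_2_cases_iff\<close>)
 then obtain t where t: "if a < 0 then x + a < t \<and> t < x else x < t \<and> t < x + a"
  and eq: "g (x + a) = (\<Sum>m<2. diff m x / fact m * a ^ m) + diff 2 t / fact 2 * a ^ 2"
  by auto
 show ?thesis
  by (rule exI[of _ "t - x"]) (use t eq in \<open>auto simp: diff_def numeral_2_eq_2 split: if_splits\<close>)
qed simp

section \<open>The time derivative and the classical equation\<close>

context regular_flow
begin

lemma duhamel_average_tendsto:
 assumes t: "0 < t" and S: "S \<longlonglongrightarrow> t" "\<And>n. 0 < S n" and e: "e \<longlonglongrightarrow> 0" "\<And>n. 0 < e n"
 shows "(\<lambda>n. duhamel (\<lambda>r y. h (U (S n + r) y)) (e n) (ereal x) / e n) \<longlonglongrightarrow> h (U t (ereal x))"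
proof -
 have hm: "(\<lambda>y. h (U s y)) \<in> borel_measurable borel" for s
  by (rule borel_measurable_slice[OF comp_U_measurable[OF h_cont]])
 have Hn: "H \<ge> 0" using order_trans[OF abs_ge_zero h_bound[of 1 0]] by simp
 have "(\<lambda>n. \<integral>v. indicator {0<..<1} v * heat (e n * v) (\<lambda>y. h (U (S n + (e n - e n * v)) y)) (ereal x) \<partial>lborel)
   \<longlonglongrightarrow> (\<integral>v. indicator {0<..<1::real} v * h (U t (ereal x)) \<partial>lborel)"
 proof (rule integral_dominated_convergence[where w="\<lambda>v. indicator {0<..<1::real} v * H"])
  show "(\<lambda>v. indicator {0<..<1} v * heat (e n * v) (\<lambda>y. h (U (S n + (e n - e n * v)) y)) (ereal x)) \<in> borel_measurable lborel" for n
  proof -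
   have [measurable]: "(\<lambda>v. heat (e n * v) (\<lambda>y. h (U (S n + (e n - e n * v)) y)) (ereal x)) \<in> borel_measurable lborel"
    by (rule measurable_heat_slice[OF comp_U_measurable[OF h_cont]]) auto
   show ?thesis by measurable
  qed
  show "AE v in lborel. (\<lambda>n. indicator {0<..<1} v * heat (e n * v) (\<lambda>y. h (U (S n + (e n - e n * v)) y)) (ereal x))
    \<longlonglongrightarrow> indicator {0<..<1} v * h (U t (ereal x))"
  proof (intro AE_I2)
   fix v :: real
   show "(\<lambda>n. indicator {0<..<1} v * heat (e n * v) (\<lambda>y. h (U (S n + (e n - e n * v)) y)) (ereal x)) \<longlonglongrightarrow> indicator {0<..<1} v * h (U t (ereal x))"
   proof (cases "v \<in> {0<..<1}")
    case True
    have pos: "0 < S n + (e n - e n * v)" for n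
    proof -
     have "e n * v \<le> e n" using True e(2)[of n] by (intro mult_left_le) auto
     then show ?thesis using S(2)[of n] by linarith
    qed
    have "(\<lambda>n. heat (e n * v) (\<lambda>y. h (U (S n + (e n - e n * v)) y)) (ereal x)) \<longlonglongrightarrow> heat (0 * v) (\<lambda>y. h (U t y)) (ereal x)"
    proof (rule heat_tendsto[where K=H])
     show "AE z in gauss. (\<lambda>n. h (U (S n + (e n - e n * v)) (ereal x + ereal (sqrt (e n * v) * z)))) \<longlonglongrightarrow> h (U t (ereal x + ereal (sqrt (0 * v) * z)))"
     proof (intro AE_I2)
      fix z
      have "(\<lambda>n. S n + (e n - e n * v)) \<longlonglongrightarrow> t + (0 - 0 * v)" "(\<lambda>n. x + sqrt (e n * v) * z) \<longlonglongrightarrow> x + sqrt (0 * v) * z"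
       by (intro tendsto_intros S e)+
      then show "(\<lambda>n. h (U (S n + (e n - e n * v)) (ereal x + ereal (sqrt (e n * v) * z)))) \<longlonglongrightarrow> h (U t (ereal x + ereal (sqrt (0 * v) * z)))"
       using seq_cont_realD[OF comp_U_cont[OF h_cont] t, of "\<lambda>n. S n + (e n - e n * v)" "\<lambda>n. x + sqrt (e n * v) * z" x] by simp
     qed
    qed (use hm h_bound pos in auto)
    then show ?thesis using True by simp
   qed simp
  qed
  show "AE v in lborel. norm (indicator {0<..<1} v * heat (e n * v) (\<lambda>y. h (U (S n + (e n - e n * v)) y)) (ereal x)) \<le> indicator {0<..<1} v * H" for n
  proof (intro AE_I2)
   fix v :: real
   show "norm (indicator {0<..<1} v * heat (e n * v) (\<lambda>y. h (U (S n + (e n - e n * v)) y)) (ereal x)) \<le> indicator {0<..<1} v * H"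
   proof (cases "v \<in> {0<..<1}")
    case True
    have pos: "0 < S n + (e n - e n * v)"
    proof -
     have "e n * v \<le> e n" using True e(2)[of n] by (intro mult_left_le) auto
     then show ?thesis using S(2)[of n] by linarith
    qed
    show ?thesis using heat_bound[OF hm h_bound[OF pos]] True by simp
   qed simp
  qed
 qed auto
 then show ?thesis
  using duhamel_rescale e(2) by simp
qed

text \<open>Second-order Taylor expansion in space under the Gaussian: the first-order term has mean
  0, the second-order term gives half the variance times \<open>Uxx\<close>. The base time
  \<open>S n\<close> is allowed to move, because left difference quotients are computed from a
  restart at the earlier time.\<close>

lemma heat_quotient_tendsto:
 assumes t: "0 < t" and S: "S \<longlonglongrightarrow> t" "\<And>n. t / 2 \<le> S n" "\<And>n. S n \<le> 2 * t" and e: "e \<longlonglongrightarrow> 0" "\<And>n. 0 < e n"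
 shows "(\<lambda>n. (heat (e n) (U (S n)) (ereal x) - U (S n) (ereal x)) / e n) \<longlonglongrightarrow> 1 / 2 * Uxx t (ereal x)"
proof -
 have pos: "0 < S n" for n using S(2)[of n] t by linarith
 obtain C where C: "\<And>s y. t / 2 \<le> s ==> s \<le> 2 * t ==> \<bar>Uxx s y\<bar> \<le> C"
  using Uxx_bound[OF t] by blast
 let ?q = "\<lambda>n z. (U (S n) (ereal x + ereal (sqrt (e n) * z)) - U (S n) (ereal x) - sqrt (e n) * z * Ux (S n) (ereal x)) / e n"
 have m [measurable]: "U s \<in> borel_measurable borel" for s by (rule U_slice)
 have eq: "(heat (e n) (U (S n)) (ereal x) - U (S n) (ereal x)) / e n = (\<integral>z. ?q n z \<partial>gauss)" for n
 proof -
  have i: "integrable gauss (\<lambda>z. U (S n) (ereal x + ereal (sqrt (e n) * z)))"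
   by (rule heat_integrable[OF m U_bound[OF pos]])
  have j: "integrable gauss (\<lambda>z. sqrt (e n) * z * Ux (S n) (ereal x))"
   using integrable_gauss_id by simp
  have "(\<integral>z. ?q n z \<partial>gauss) = (\<integral>z. U (S n) (ereal x + ereal (sqrt (e n) * z)) - U (S n) (ereal x) - sqrt (e n) * z * Ux (S n) (ereal x) \<partial>gauss) / e n"
   by simp
  also have "... = (heat (e n) (U (S n)) (ereal x) - U (S n) (ereal x)) / e n"
   using Bochner_Integration.integral_diff[OF Bochner_Integration.integrable_diff[OF i gauss.integrable_const[of "U (S n) (ereal x)"]] j]
    Bochner_Integration.integral_diff[OF i gauss.integrable_const[of "U (S n) (ereal x)"]]
   by (simp add: heat_def integral_gauss_id gauss.prob_space[simplified])
  finally show ?thesis by (rule sym)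
 qed
 have Tay: "\<exists>\<theta>. \<bar>\<theta>\<bar> \<le> \<bar>sqrt (e n) * z\<bar> \<and> ?q n z = z\<^sup>2 / 2 * Uxx (S n) (ereal (x + \<theta>))" for n z
 proof -
  obtain \<theta> where "\<bar>\<theta>\<bar> \<le> \<bar>sqrt (e n) * z\<bar>" and "U (S n) (ereal (x + sqrt (e n) * z)) = U (S n) (ereal x) + sqrt (e n) * z * Ux (S n) (ereal x) + (sqrt (e n) * z)\<^sup>2 / 2 * Uxx (S n) (ereal (x + \<theta>))"
   using Taylor_second_order[OF Ux[OF pos[of n]] Uxx[OF pos[of n]], of "sqrt (e n) * z" x] by blast
  then show ?thesis
   using e(2)[of n] by (intro exI[of _ \<theta>]) (simp add: power_mult_distrib)
 qed
 have "(\<lambda>n. \<integral>z. ?q n z \<partial>gauss) \<longlonglongrightarrow> (\<integral>z. z\<^sup>2 / 2 * Uxx t (ereal x) \<partial>gauss)"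
 proof (rule integral_dominated_convergence[where w="\<lambda>z. z\<^sup>2 / 2 * C"])
  show "integrable gauss (\<lambda>z. z\<^sup>2 / 2 * C)" using integrable_gauss_power2 by simp
  show "AE z in gauss. (\<lambda>n. ?q n z) \<longlonglongrightarrow> z\<^sup>2 / 2 * Uxx t (ereal x)"
  proof (intro AE_I2)
   fix z
   obtain \<theta> where \<theta>: "\<And>n. \<bar>\<theta> n\<bar> \<le> \<bar>sqrt (e n) * z\<bar>" "\<And>n. ?q n z = z\<^sup>2 / 2 * Uxx (S n) (ereal (x + \<theta> n))"
    using Tay[of _ z] by metis
   have "(\<lambda>n. \<bar>sqrt (e n) * z\<bar>) \<longlonglongrightarrow> \<bar>sqrt 0 * z\<bar>"
    by (intro tendsto_intros e)
   then have "(\<lambda>n. \<bar>sqrt (e n) * z\<bar>) \<longlonglongrightarrow> 0" by simp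
   then have "\<theta> \<longlonglongrightarrow> 0"
    by (rule Lim_null_comparison[rotated]) (use \<theta>(1) in auto)
   then have "(\<lambda>n. x + \<theta> n) \<longlonglongrightarrow> x" using tendsto_add[OF tendsto_const, of \<theta> 0 sequentially x] by simp
   then show "(\<lambda>n. ?q n z) \<longlonglongrightarrow> z\<^sup>2 / 2 * Uxx t (ereal x)"
    unfolding \<theta>(2) by (intro tendsto_mult tendsto_const seq_cont_realD[OF Uxx_cont t S(1)])
  qed
  show "AE z in gauss. norm (?q n z) \<le> z\<^sup>2 / 2 * C" for n
  proof (intro AE_I2)
   fix z
   obtain \<theta> where "?q n z = z\<^sup>2 / 2 * Uxx (S n) (ereal (x + \<theta>))" using Tay[of n z] by blast
   then show "norm (?q n z) \<le> z\<^sup>2 / 2 * C"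
    using C[of "S n" "ereal (x + \<theta>)"] S by (simp only: real_norm_def abs_mult) (simp add: mult_left_mono)
  qed
 qed (measurable)
 then show ?thesis
  unfolding eq by (simp add: integral_gauss_power2)
qed

lemma Ut:
 assumes t: "0 < t"
 shows "((\<lambda>s. U s (ereal x)) has_real_derivative 1 / 2 * Uxx t (ereal x) - h (U t (ereal x))) (at t)"
 unfolding has_field_derivative_iff tendsto_at_iff_sequentially comp_def
proof (intro allI impI)
 fix X assume X: "\<forall>i. X i \<in> UNIV - {t}" "X \<longlonglongrightarrow> t"
 \<comment> \<open>The flow formula only runs forward, so a left difference quotient restarts at
   \<open>X n\<close> and a right one at \<open>t\<close>: \<open>S n\<close> is the earlier of the
   two times and \<open>e n\<close> the gap. The lower cap \<open>t / 2\<close> affects finitely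
   many \<open>n\<close> only.\<close>
 define S where "S = (\<lambda>n. max (t / 2) (min t (X n)))"
 define e where "e = (\<lambda>n. \<bar>X n - t\<bar>)"
 have S: "S \<longlonglongrightarrow> t" "\<And>n. t / 2 \<le> S n" "\<And>n. S n \<le> 2 * t" "\<And>n. 0 < S n"
 proof -
  have "S \<longlonglongrightarrow> max (t / 2) (min t t)"
   unfolding S_def by (intro tendsto_intros X)
  then show "S \<longlonglongrightarrow> t" using t by simp
 qed (use t in \<open>auto simp: S_def\<close>)
 have e: "e \<longlonglongrightarrow> 0" "\<And>n. 0 < e n"
 proof -
  have "e \<longlonglongrightarrow> \<bar>t - t\<bar>" unfolding e_def by (intro tendsto_intros X)
  then show "e \<longlonglongrightarrow> 0" by simp
 qed (use X in \<open>auto simp: e_def\<close>)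
 have "(\<lambda>n. (heat (e n) (U (S n)) (ereal x) - U (S n) (ereal x)) / e n - duhamel (\<lambda>r y. h (U (S n + r) y)) (e n) (ereal x) / e n)
   \<longlonglongrightarrow> 1 / 2 * Uxx t (ereal x) - h (U t (ereal x))"
  by (intro tendsto_diff heat_quotient_tendsto[OF t S(1-3) e] duhamel_average_tendsto[OF t S(1,4) e])
 then show "(\<lambda>n. (U (X n) (ereal x) - U t (ereal x)) / (X n - t)) \<longlonglongrightarrow> 1 / 2 * Uxx t (ereal x) - h (U t (ereal x))"
 proof (rule Lim_transform_eventually)
  have "eventually (\<lambda>n. t / 2 < X n) sequentially"
   by (rule order_tendstoD(1)[OF X(2)]) (use t in simp)
  then show "\<forall>\<^sub>F n in sequentially. (heat (e n) (U (S n)) (ereal x) - U (S n) (ereal x)) / e n - duhamel (\<lambda>r y. h (U (S n + r) y)) (e n) (ereal x) / e n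
    = (U (X n) (ereal x) - U t (ereal x)) / (X n - t)"
  proof eventually_elim
   case (elim n)
   have ne: "X n \<noteq> t" using X by auto
   have "(heat (e n) (U (S n)) (ereal x) - U (S n) (ereal x)) / e n - duhamel (\<lambda>r y. h (U (S n + r) y)) (e n) (ereal x) / e n
     = (U (S n + e n) (ereal x) - U (S n) (ereal x)) / e n"
    using flow[OF S(4)[of n] e(2)[of n], of x] by (simp add: diff_divide_distrib)
   also have "... = (U (X n) (ereal x) - U t (ereal x)) / (X n - t)"
   proof (cases "X n < t")
    case True
    then have "S n = X n" "e n = t - X n" using elim by (auto simp: S_def e_def)
    then show ?thesis using True by (simp add: divide_simps) (simp add: algebra_simps)
   next
    case False
    then have "S n = t" "e n = X n - t" using t by (auto simp: S_def e_def)
    then show ?thesis by simp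
   qed
   finally show ?case .
  qed
 qed
qed

abbreviation "V \<equiv> \<lambda>t x. U t (ereal x)"

lemma deriv_V: "0 < t ==> deriv (V t) = (\<lambda>x. Ux t (ereal x))"
 using Ux by (intro ext DERIV_imp_deriv) auto

lemma deriv_deriv_V: "0 < t ==> deriv (deriv (V t)) = (\<lambda>x. Uxx t (ereal x))"
 using Uxx by (intro ext DERIV_imp_deriv) (simp add: deriv_V)

lemma deriv_time_V: "0 < t ==> deriv (\<lambda>s. V s x) t = 1 / 2 * Uxx t (ereal x) - h (V t x)"
 by (rule DERIV_imp_deriv[OF Ut])

lemma pde: "0 < t ==> deriv (\<lambda>s. V s x) t = 1 / 2 * deriv (deriv (V t)) x - h (V t x)"
 by (simp add: deriv_time_V deriv_deriv_V)

lemma C12: "C12_on ({0<..} \<times> UNIV) V"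
 unfolding C12_on_def
proof (intro conjI ballI)
 fix p :: "real \<times> real" assume "p \<in> {0<..} \<times> UNIV"
 then obtain t x where p: "p = (t, x)" "0 < t" by auto
 show "case p of (t, x) => (\<lambda>s. V s x) differentiable at t \<and> V t differentiable at x \<and> deriv (V t) differentiable at x"
  using Ut[OF p(2)] Ux[OF p(2)] Uxx[OF p(2)] by (auto simp: p deriv_V real_differentiable_def)
next
 show "continuous_on ({0<..} \<times> UNIV) (\<lambda>(t, x). V t x)"
  by (rule seq_cont_real_continuous_on[OF U_cont])
next
 have "continuous_on ({0<..} \<times> UNIV) (\<lambda>(t, x). 1 / 2 * Uxx t (ereal x) - h (V t x))"
  using continuous_on_diff[OF continuous_on_mult[OF continuous_on_const[of _ "1/2"] seq_cont_real_continuous_on[OF Uxx_cont]]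
    seq_cont_real_continuous_on[OF comp_U_cont[OF h_cont]]]
  by (simp add: case_prod_beta')
 then show "continuous_on ({0<..} \<times> UNIV) (\<lambda>(t, x). deriv (\<lambda>s. V s x) t)"
  by (rule continuous_on_eq) (auto simp: deriv_time_V)
next
 show "continuous_on ({0<..} \<times> UNIV) (\<lambda>(t, x). deriv (V t) x)"
  by (rule continuous_on_eq[OF seq_cont_real_continuous_on[OF Ux_cont]]) (auto simp: deriv_V)
next
 show "continuous_on ({0<..} \<times> UNIV) (\<lambda>(t, x). deriv (deriv (V t)) x)"
  by (rule continuous_on_eq[OF seq_cont_real_continuous_on[OF Uxx_cont]]) (auto simp: deriv_deriv_V)
qed

end

section \<open>Uniqueness\<close>

lemma second_deriv_at_max:
 fixes f f' :: "real => real"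
 assumes f: "\<And>x. (f has_real_derivative f' x) (at x)" and f': "(f' has_real_derivative D) (at a)"
  and d: "d > 0" and max: "\<And>x. \<bar>x - a\<bar> < d ==> f x \<le> f a"
 shows "D \<le> 0"
proof (rule ccontr)
 assume "\<not> D \<le> 0"
 then obtain e where e: "e > 0" "\<And>h. 0 < h ==> h < e ==> f' a < f' (a + h)"
  using DERIV_pos_inc_right[OF f'] by auto
 have 0: "f' a = 0"
  by (rule DERIV_local_max[OF f d]) (use max in \<open>auto simp: abs_minus_commute\<close>)
 define h where "h = min d e / 2"
 have h: "0 < h" "h < d" "h < e" using d e by (auto simp: h_def)
 obtain z where z: "a < z" "z < a + h" "f (a + h) - f a = (a + h - a) * f' z"
  using MVT2[of a "a + h" f f'] h(1) f by auto
 then have "f' z > 0" using e(2)[of "z - a"] 0 h by auto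
 then have "f (a + h) > f a" using z h by (simp add: algebra_simps)
 then show False using max[of "a + h"] h by auto
qed

text \<open>The penalty \<open>\<epsilon> * (1 + x^2 + 2 * (t - s))\<close> forces a positive
  maximum into a compact rectangle, because \<open>D\<close> is bounded above. At the maximum the
  space variable gives \<open>Dxx \<le> 2 * \<epsilon>\<close>; the time variable, compared with
  earlier times only since the maximum may lie at \<open>T\<close>, gives
  \<open>Dt \<ge> 2 * \<epsilon>\<close>. This contradicts \<open>Dt \<le> 1 / 2 * Dxx\<close>, an
  inequality required only where \<open>D\<close> is positive.\<close>

lemma parabolic_maximum_principle:
 fixes D Dt Dx Dxx :: "real => real => real"
 assumes cont: "continuous_on ({s..T} \<times> UNIV) (\<lambda>(t, x). D t x)"
  and bound: "\<And>t x. t \<in> {s..T} ==> D t x \<le> C"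
  and init: "\<And>x. D s x \<le> 0"
  and Dt: "\<And>t x. t \<in> {s<..T} ==> ((\<lambda>t. D t x) has_real_derivative Dt t x) (at t)"
  and Dx: "\<And>t x. t \<in> {s<..T} ==> (D t has_real_derivative Dx t x) (at x)"
  and Dxx: "\<And>t x. t \<in> {s<..T} ==> (Dx t has_real_derivative Dxx t x) (at x)"
  and sub: "\<And>t x. t \<in> {s<..T} ==> D t x > 0 ==> Dt t x \<le> 1 / 2 * Dxx t x"
  and t: "t \<in> {s..T}"
 shows "D t x \<le> 0"
proof (rule ccontr)
 assume "\<not> D t x \<le> 0"
 then have pos: "D t x > 0" by simp
 \<comment> \<open>The penalty consumes exactly half of the supposed positive value at
   \<open>(t, x)\<close>.\<close>
 define \<epsilon> where "\<epsilon> = D t x / (2 * (1 + x\<^sup>2 + 2 * (t - s)))"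
 have den: "1 + x\<^sup>2 + 2 * (t - s) > 0" 
 proof -
  have "s \<le> t" using t by simp
  then show ?thesis by (intro add_pos_nonneg) auto
 qed
 then have \<epsilon>: "\<epsilon> > 0" using pos by (simp add: \<epsilon>_def)
 define M where "M = (\<lambda>t x. D t x - \<epsilon> * (1 + x\<^sup>2 + 2 * (t - s)))"
 have M0: "M t x > 0"
 proof -
  have "\<epsilon> * (1 + x\<^sup>2 + 2 * (t - s)) = D t x / 2"
  proof -
   define q where "q = 1 + x\<^sup>2 + 2 * (t - s)"
   show ?thesis using den unfolding \<epsilon>_def q_def[symmetric] by simp
  qed
  then show ?thesis using pos by (simp add: M_def)
 qed
 \<comment> \<open>Large enough that \<open>\<epsilon> * R^2\<close> exceeds
   \<open>\<bar>C\<bar>\<close>, which makes the penalised function negative on the lateral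
   boundary; the summand 1 gives \<open>R \<le> R^2\<close>.\<close>
 define R where "R = \<bar>x\<bar> + \<bar>C\<bar> / \<epsilon> + 1"
 have R: "R \<ge> 1" "\<bar>x\<bar> \<le> R" using \<epsilon> by (auto simp: R_def)
 have out: "M u y < 0" if "u \<in> {s..T}" "\<bar>y\<bar> = R" for u y
 proof -
  have "\<bar>C\<bar> / \<epsilon> < R" using R by (simp add: R_def)
  also have "R \<le> R\<^sup>2" using R mult_left_mono[of 1 R R] by (simp add: power2_eq_square)
  also have "... = y\<^sup>2" using that by (metis power2_abs)
  finally have "\<bar>C\<bar> < \<epsilon> * y\<^sup>2" using \<epsilon> by (simp add: field_simps)
  also have "... \<le> \<epsilon> * (1 + y\<^sup>2 + 2 * (u - s))" using \<epsilon> that by (intro mult_left_mono) auto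
  finally show ?thesis using bound[OF that(1), of y] by (simp add: M_def)
 qed
 have "continuous_on ({s..T} \<times> {-R..R}) (\<lambda>(t, x). M t x)"
 proof -
  have "continuous_on ({s..T} \<times> {-R..R}) (\<lambda>p. (case p of (t, x) => D t x) - \<epsilon> * (1 + (snd p)\<^sup>2 + 2 * (fst p - s)))"
   by (intro continuous_intros continuous_on_subset[OF cont]) auto
  then show ?thesis by (simp add: M_def case_prod_beta')
 qed
 moreover have "compact ({s..T} \<times> {-R..R})" by (intro compact_Times compact_Icc)
 moreover have tx: "(t, x) \<in> {s..T} \<times> {-R..R}" using t R by auto
 ultimately obtain p where p: "p \<in> {s..T} \<times> {-R..R}" "\<And>q. q \<in> {s..T} \<times> {-R..R} ==> (case q of (t, x) => M t x) \<le> (case p of (t, x) => M t x)"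
  using continuous_attains_sup[of "{s..T} \<times> {-R..R}" "\<lambda>(t, x). M t x"] by blast
 obtain t1 x1 where p': "p = (t1, x1)" by (cases p)
 have max: "M u y \<le> M t1 x1" if "u \<in> {s..T}" "y \<in> {-R..R}" for u y
  using p(2)[of "(u, y)"] that p' by simp
 have M1: "M t1 x1 > 0" using max[of t x] M0 tx by auto
 have t1: "t1 \<in> {s..T}" and x1: "x1 \<in> {-R..R}" using p(1) p' by auto
 have D1: "D t1 x1 > 0"
 proof -
  have "0 \<le> \<epsilon> * (1 + x1\<^sup>2 + 2 * (t1 - s))" using \<epsilon> t1 by (intro mult_nonneg_nonneg) auto
  then show ?thesis using M1 by (simp add: M_def)
 qed
 have t1': "t1 \<in> {s<..T}" using t1 D1 init[of x1] by (cases "t1 = s") auto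
 have x1': "\<bar>x1\<bar> < R" using x1 out[OF t1, of x1] M1 by (cases "\<bar>x1\<bar> = R") auto
 have "Dxx t1 x1 - 2 * \<epsilon> \<le> 0"
 proof (rule second_deriv_at_max)
  show "((\<lambda>y. M t1 y) has_real_derivative Dx t1 y - 2 * \<epsilon> * y) (at y)" for y
   unfolding M_def by (auto intro!: derivative_eq_intros Dx[OF t1'])
  show "((\<lambda>y. Dx t1 y - 2 * \<epsilon> * y) has_real_derivative Dxx t1 x1 - 2 * \<epsilon>) (at x1)"
   by (auto intro!: derivative_eq_intros Dxx[OF t1'])
  show "0 < R - \<bar>x1\<bar>" using x1' by simp
  show "M t1 y \<le> M t1 x1" if "\<bar>y - x1\<bar> < R - \<bar>x1\<bar>" for y
   by (rule max[OF t1]) (use that in auto)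
 qed
 moreover have "Dt t1 x1 - 2 * \<epsilon> \<ge> 0"
 proof (rule ccontr)
  assume "\<not> Dt t1 x1 - 2 * \<epsilon> \<ge> 0"
  moreover have "((\<lambda>u. M u x1) has_real_derivative Dt t1 x1 - 2 * \<epsilon>) (at t1)"
   unfolding M_def by (auto intro!: derivative_eq_intros Dt[OF t1'])
  ultimately obtain d where d: "d > 0" "\<And>h. 0 < h ==> h < d ==> M t1 x1 < M (t1 - h) x1"
   using DERIV_neg_dec_left[of "\<lambda>u. M u x1" "Dt t1 x1 - 2 * \<epsilon>" t1] by auto
  define h where "h = min d (t1 - s) / 2"
  have "0 < h" "h < d" "t1 - h \<in> {s..T}" using d t1' by (auto simp: h_def min_def field_simps)
  then show False using d(2)[of h] max[of "t1 - h" x1] x1 by auto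
 qed
 ultimately show False using sub[OF t1' D1] \<epsilon> by simp
qed

lemma heat_tendsto_real:
 fixes w :: "ereal => real"
 assumes w: "w \<in> borel_measurable borel" and b: "\<And>y. \<bar>w y\<bar> \<le> K"
  and c: "continuous_on UNIV (\<lambda>x::real. w (ereal x))" and T: "T \<longlonglongrightarrow> t" and X: "X \<longlonglongrightarrow> x"
 shows "(\<lambda>n. heat (T n) w (ereal (X n))) \<longlonglongrightarrow> heat t w (ereal x)"
proof (rule heat_tendsto[OF w w b])
 show "AE z in gauss. (\<lambda>n. w (ereal (X n) + ereal (sqrt (T n) * z))) \<longlonglongrightarrow> w (ereal x + ereal (sqrt t * z))"
 proof (intro AE_I2)
  fix z
  have "(\<lambda>n. X n + sqrt (T n) * z) \<longlonglongrightarrow> x + sqrt t * z" by (intro tendsto_intros T X)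
  then show "(\<lambda>n. w (ereal (X n) + ereal (sqrt (T n) * z))) \<longlonglongrightarrow> w (ereal x + ereal (sqrt t * z))"
   using continuous_on_tendsto_compose[OF c, of "\<lambda>n. X n + sqrt (T n) * z" "x + sqrt t * z" sequentially] by simp
 qed
qed

text \<open>With vanishing nonlinearity the regularity theory specialises to the heat equation and
  provides the derivatives of the comparison function in the uniqueness proof.\<close>

lemma heat_regular_flow:
 fixes w :: "ereal => real"
 assumes w [measurable]: "w \<in> borel_measurable borel" and b: "\<And>y. \<bar>w y\<bar> \<le> K"
  and c: "continuous_on UNIV (\<lambda>x::real. w (ereal x))"
 shows "regular_flow (\<lambda>t y. heat t w y) (\<lambda>_. 0) (\<lambda>_. 0) K 0 0"
proof unfold_locales
 show "joint_measurable (\<lambda>t y. heat t w y)"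
  using measurable_heat_joint[of "\<lambda>_. w" "borel \<Otimes>\<^sub>M borel" fst snd] by (simp add: case_prod_beta')
 show "seq_cont_real (\<lambda>t y. heat t w y)"
  unfolding seq_cont_real_def using heat_tendsto_real[OF w b c] by blast
 show "heat (s + d) w (ereal x) = heat d (heat s w) (ereal x) - duhamel (\<lambda>r y. 0) d (ereal x)" if "0 < s" "0 < d" for s d x
  using heat_semigroup[OF _ _ w b, of d s "ereal x"] that by (simp add: duhamel_def add.commute)
qed (use heat_bound[OF w b] in auto)

lemma heat_real_continuous_on:
 fixes w :: "ereal => real"
 assumes "w \<in> borel_measurable borel" "\<And>y. \<bar>w y\<bar> \<le> K" "continuous_on UNIV (\<lambda>x::real. w (ereal x))"
 shows "continuous_on A (\<lambda>(t, x). heat (t - s) w (ereal x))"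
 unfolding continuous_on_sequentially
proof (intro allI ballI impI, elim conjE)
 fix X :: "nat => real \<times> real" and a assume a: "X \<longlonglongrightarrow> a"
 have "(\<lambda>n. heat (fst (X n) - s) w (ereal (snd (X n)))) \<longlonglongrightarrow> heat (fst a - s) w (ereal (snd a))"
  by (intro heat_tendsto_real[OF assms] tendsto_intros a)
 then show "((\<lambda>(t, x). heat (t - s) w (ereal x)) \<circ> X) \<longlonglongrightarrow> (case a of (t, x) => heat (t - s) w (ereal x))"
  by (simp add: comp_def case_prod_beta')
qed

text \<open>
 The difference of two bounded solutions, damped by \<open>exp (- L (t - s))\<close>, is a subsolution of the heat
 equation where it is positive, hence dominated by the heat flow of its absolute value at time \<open>s\<close>.
\<close>

lemma FKPP_comparison:
 fixes V1 V2 :: "real => real => real"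
 assumes sol1: "FKPP_solution_upto h U0 T V1" and sol2: "FKPP_solution_upto h U0 T V2"
  and b1: "\<And>t x. 0 \<le> t ==> \<bar>V1 t x\<bar> \<le> C" and b2: "\<And>t x. 0 \<le> t ==> \<bar>V2 t x\<bar> \<le> C"
  and lip: "\<And>a b. \<bar>a\<bar> \<le> C ==> \<bar>b\<bar> \<le> C ==> \<bar>h a - h b\<bar> \<le> L * \<bar>a - b\<bar>" and L: "L \<ge> 0"
  and s: "0 < s" "s < T"
 defines "w \<equiv> \<lambda>y. \<bar>V1 s (real_of_ereal y) - V2 s (real_of_ereal y)\<bar>"
 shows "V1 T x - V2 T x \<le> exp (L * (T - s)) * heat (T - s) w (ereal x)"
  and "w \<in> borel_measurable borel"
proof -
 obtain G1 W1 where 1: "open G1" "{0<..T} \<times> UNIV \<subseteq> G1" "C12_on G1 W1"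
   "\<And>t x. t \<in> {0<..T} ==> W1 t x = V1 t x"
   "\<And>t x. t \<in> {0<..T} ==> deriv (\<lambda>s. W1 s x) t = 1 / 2 * deriv (deriv (W1 t)) x - h (W1 t x)"
  using sol1 unfolding FKPP_solution_upto_def by blast
 obtain G2 W2 where 2: "open G2" "{0<..T} \<times> UNIV \<subseteq> G2" "C12_on G2 W2"
   "\<And>t x. t \<in> {0<..T} ==> W2 t x = V2 t x"
   "\<And>t x. t \<in> {0<..T} ==> deriv (\<lambda>s. W2 s x) t = 1 / 2 * deriv (deriv (W2 t)) x - h (W2 t x)"
  using sol2 unfolding FKPP_solution_upto_def by blast
 have dW: "((\<lambda>s. W s x) has_real_derivative deriv (\<lambda>s. W s x) t) (at t)"
   "(W t has_real_derivative deriv (W t) x) (at x)"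
   "(deriv (W t) has_real_derivative deriv (deriv (W t)) x) (at x)"
  if "C12_on G W" "{0<..T} \<times> UNIV \<subseteq> G" "t \<in> {0<..T}" for G W t x
 proof -
  have "(t, x) \<in> G" using that by auto
  with that(1) have "(\<lambda>s. W s x) differentiable (at t) \<and> W t differentiable (at x) \<and> deriv (W t) differentiable (at x)"
   unfolding C12_on_def by blast
  then show "((\<lambda>s. W s x) has_real_derivative deriv (\<lambda>s. W s x) t) (at t)"
   "(W t has_real_derivative deriv (W t) x) (at x)"
   "(deriv (W t) has_real_derivative deriv (deriv (W t)) x) (at x)"
   by (auto simp: DERIV_deriv_iff_real_differentiable)
 qed
 note d1 = dW[OF 1(3,2)] and d2 = dW[OF 2(3,2)]
 have c1: "continuous_on ({s..T} \<times> UNIV) (\<lambda>(t, x). W1 t x)" and c2: "continuous_on ({s..T} \<times> UNIV) (\<lambda>(t, x). W2 t x)"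
  using 1(2,3) 2(2,3) s unfolding C12_on_def by (auto elim!: continuous_on_subset)
 have sT: "s \<in> {0<..T}" using s by auto
 have wW: "w = (\<lambda>y. \<bar>W1 s (real_of_ereal y) - W2 s (real_of_ereal y)\<bar>)"
  using 1(4)[OF sT] 2(4)[OF sT] by (simp add: w_def)
 have cs: "continuous_on UNIV (\<lambda>x. \<bar>W1 s x - W2 s x\<bar>)"
  using d1(2)[OF sT] d2(2)[OF sT]
  by (intro continuous_intros continuous_at_imp_continuous_on ballI) (blast intro: DERIV_isCont)+
 have wm: "w \<in> borel_measurable borel"
 proof -
  have [measurable]: "(\<lambda>x. \<bar>W1 s x - W2 s x\<bar>) \<in> borel_measurable borel"
   using cs by (rule borel_measurable_continuous_onI)
  show ?thesis unfolding wW by measurable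
 qed
 then show "w \<in> borel_measurable borel" .
 have wb: "\<bar>w y\<bar> \<le> 2 * C" for y
  using b1[of s "real_of_ereal y"] b2[of s "real_of_ereal y"] s by (simp add: w_def)
 have wc: "continuous_on UNIV (\<lambda>x::real. w (ereal x))" using cs by (simp add: wW)
 interpret Z: regular_flow "\<lambda>t y. heat t w y" "\<lambda>_. 0" "\<lambda>_. 0" "2 * C" 0 0
  by (rule heat_regular_flow[OF wm wb wc])
 define E where "E = (\<lambda>t. exp (- L * (t - s)))"
 define D where "D = (\<lambda>t x. E t * (W1 t x - W2 t x) - heat (t - s) w (ereal x))"
 have E: "E t > 0" "(E has_real_derivative - L * E t) (at t)" for t
  unfolding E_def by (auto intro!: derivative_eq_intros)
 have Zt: "((\<lambda>t. heat (t - s) w (ereal x)) has_real_derivative 1 / 2 * Z.Uxx (t - s) (ereal x)) (at t)" if "t \<in> {s<..T}" for t x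
  using DERIV_shift[of "\<lambda>t. heat t w (ereal x)" "1 / 2 * Z.Uxx (t - s) (ereal x)" t "- s"] Z.Ut[of "t - s" x] that
  by simp
 have bW: "\<bar>W1 t x\<bar> \<le> C" "\<bar>W2 t x\<bar> \<le> C" if "t \<in> {s..T}" for t x
  using b1[of t x] b2[of t x] 1(4)[of t x] 2(4)[of t x] that s by auto
 have "D T x \<le> 0"
 proof (rule parabolic_maximum_principle[where s=s and T=T and D=D and C="2 * C + 2 * C"])
  show "continuous_on ({s..T} \<times> UNIV) (\<lambda>(t, x). D t x)"
  proof -
   have "continuous_on ({s..T} \<times> UNIV) (\<lambda>p. E (fst p) * ((case p of (t, x) => W1 t x) - (case p of (t, x) => W2 t x)) - (case p of (t, x) => heat (t - s) w (ereal x)))"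
    unfolding E_def by (intro continuous_intros c1 c2 heat_real_continuous_on[OF wm wb wc])
   then show ?thesis by (simp add: D_def case_prod_beta')
  qed
  show "D t x \<le> 2 * C + 2 * C" if t: "t \<in> {s..T}" for t x
  proof -
   have "E t \<le> 1" using L t by (simp add: E_def)
   then have "\<bar>E t * (W1 t x - W2 t x)\<bar> \<le> 1 * (2 * C)"
    unfolding abs_mult using bW[OF t, of x] E(1)[of t] by (intro mult_mono) auto
   then show ?thesis using heat_bound[OF wm wb, of "t - s" "ereal x"] by (simp add: D_def abs_le_iff)
  qed
  show "D s x \<le> 0" for x by (simp add: D_def E_def wW)
  fix t x assume t: "t \<in> {s<..T}"
  have t0: "t \<in> {0<..T}" using t s by auto
  show "((\<lambda>t. D t x) has_real_derivative E t * (deriv (\<lambda>s. W1 s x) t - deriv (\<lambda>s. W2 s x) t) + - L * E t * (W1 t x - W2 t x) - 1 / 2 * Z.Uxx (t - s) (ereal x)) (at t)"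
   unfolding D_def by (intro DERIV_diff DERIV_mult' E(2) d1(1)[OF t0] d2(1)[OF t0] Zt[OF t])
  have ts: "0 < t - s" using t by simp
  show "(D t has_real_derivative E t * (deriv (W1 t) x - deriv (W2 t) x) - Z.Ux (t - s) (ereal x)) (at x)"
   unfolding D_def by (intro DERIV_diff DERIV_cmult d1(2)[OF t0] d2(2)[OF t0] Z.Ux[OF ts])
  show "((\<lambda>x. E t * (deriv (W1 t) x - deriv (W2 t) x) - Z.Ux (t - s) (ereal x)) has_real_derivative
    E t * (deriv (deriv (W1 t)) x - deriv (deriv (W2 t)) x) - Z.Uxx (t - s) (ereal x)) (at x)"
   by (intro DERIV_diff DERIV_cmult d1(3)[OF t0] d2(3)[OF t0] Z.Uxx[OF ts])
  assume pos: "D t x > 0"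
  have "0 \<le> heat (t - s) w (ereal x)"
   unfolding heat_def by (intro Bochner_Integration.integral_nonneg) (simp add: w_def)
  then have "0 < E t * (W1 t x - W2 t x)" using pos by (simp add: D_def)
  then have W: "W1 t x - W2 t x > 0" using E(1)[of t] by (simp add: zero_less_mult_iff)
  \<comment> \<open>Positivity of \<open>D\<close> forces \<open>W1 > W2\<close> at this point, so
    the Lipschitz bound applies without absolute values, and the damping rate \<open>L\<close>
    absorbs the nonlinear term.\<close>
  have "h (W2 t x) - h (W1 t x) \<le> L * (W1 t x - W2 t x)"
   using lip[OF bW[of t x]] W t by (auto simp: abs_le_iff)
  then have "E t * (h (W2 t x) - h (W1 t x) - L * (W1 t x - W2 t x)) \<le> 0"
   using E(1)[of t] by (simp add: mult_le_0_iff)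
  then show "E t * (deriv (\<lambda>s. W1 s x) t - deriv (\<lambda>s. W2 s x) t) + - L * E t * (W1 t x - W2 t x) - 1 / 2 * Z.Uxx (t - s) (ereal x)
    \<le> 1 / 2 * (E t * (deriv (deriv (W1 t)) x - deriv (deriv (W2 t)) x) - Z.Uxx (t - s) (ereal x))"
   unfolding 1(5)[OF t0] 2(5)[OF t0] by (simp add: algebra_simps)
 qed (use s in auto)
 then have "E T * (W1 T x - W2 T x) \<le> heat (T - s) w (ereal x)" by (simp add: D_def)
 then have "exp (L * (T - s)) * (E T * (W1 T x - W2 T x)) \<le> exp (L * (T - s)) * heat (T - s) w (ereal x)"
  by (intro mult_left_mono) auto
 moreover have "exp (L * (T - s)) * E T = 1" by (simp add: E_def flip: exp_add)
 ultimately show "V1 T x - V2 T x \<le> exp (L * (T - s)) * heat (T - s) w (ereal x)"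
  using 1(4)[of T x] 2(4)[of T x] s by (simp add: mult.assoc[symmetric])
qed

text \<open>Pointwise comparison of normal densities whose variances differ by a factor of at most
  2. It replaces a varying time by a fixed one, so that dominated convergence can run under a single
  kernel.\<close>

lemma heat_le_later:
 fixes w :: "ereal => real"
 assumes w [measurable]: "w \<in> borel_measurable borel" and b: "\<And>y. \<bar>w y\<bar> \<le> K" and pos: "\<And>y. 0 \<le> w y"
  and r: "0 < r" "r \<le> t" "t \<le> 2 * r"
 shows "heat r w (ereal x) \<le> sqrt 2 * heat t w (ereal x)"
proof -
 define F where "F = (\<lambda>y::real. w (ereal y))"
 have [measurable]: "F \<in> borel_measurable borel" unfolding F_def by measurable
 have i: "integrable lborel (\<lambda>y. F y * normal_density x (sqrt r) y)" if "0 < r" for r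
  using heat_integrable[OF w b, of "ereal x" r] gauss_integrable_lborel[of "sqrt r" F x] that
  by (simp add: F_def)
 have h: "heat r w (ereal x) = (\<integral>y. F y * normal_density x (sqrt r) y \<partial>lborel)" if "0 < r" for r
  using gauss_integral_lborel[of "sqrt r" F x] that by (simp add: heat_def F_def)
 have nd: "normal_density x (sqrt r) y \<le> sqrt 2 * normal_density x (sqrt t) y" for y
 proof -
  have "exp (- (y - x)\<^sup>2 / (2 * r)) \<le> exp (- (y - x)\<^sup>2 / (2 * t))"
   using r by (simp add: divide_left_mono)
  moreover have "1 / sqrt (2 * pi * r) \<le> sqrt 2 / sqrt (2 * pi * t)"
  proof -
   have "sqrt (2 * pi * t) \<le> sqrt (2 * (2 * pi * r))" using r by simp
   also have "... = sqrt 2 * sqrt (2 * pi * r)" by (simp only: real_sqrt_mult)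
   finally show ?thesis using r by (simp add: field_simps)
  qed
  ultimately have "1 / sqrt (2 * pi * r) * exp (- (y - x)\<^sup>2 / (2 * r)) \<le> sqrt 2 / sqrt (2 * pi * t) * exp (- (y - x)\<^sup>2 / (2 * t))"
   using r by (intro mult_mono) auto
  then show ?thesis using r by (simp add: normal_density_def)
 qed
 have "heat r w (ereal x) \<le> (\<integral>y. sqrt 2 * (F y * normal_density x (sqrt t) y) \<partial>lborel)"
  unfolding h[OF r(1)]
 proof (rule integral_mono)
  show "F y * normal_density x (sqrt r) y \<le> sqrt 2 * (F y * normal_density x (sqrt t) y)" for y
   using mult_left_mono[OF nd pos[of "ereal y"], of y] by (simp add: F_def mult.left_commute)
 qed (use i r in auto)
 also have "... = sqrt 2 * heat t w (ereal x)"
  unfolding h[of t, OF less_le_trans[OF r(1,2)]] by (rule integral_mult_right_zero)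
 finally show ?thesis .
qed

text \<open>Solutions attain the initial function only at its continuity points, so the comparison
  starts at times \<open>s n\<close> tending to 0. There the difference tends to 0 outside a
  countable set, which the Gaussian does not charge; hence the heat flow of its absolute value,
  taken at time \<open>t\<close>, vanishes in the limit.\<close>

theorem bounded_FKPP_unique:
 fixes V1 V2 :: "real => real => real"
 assumes sol1: "bounded_FKPP_solution h U0 V1" and sol2: "bounded_FKPP_solution h U0 V2"
  and lip: "\<And>C. \<exists>L\<ge>0. \<forall>a b. \<bar>a\<bar> \<le> C \<longrightarrow> \<bar>b\<bar> \<le> C \<longrightarrow> \<bar>h a - h b\<bar> \<le> L * \<bar>a - b\<bar>"
  and disc: "countable {x. \<not> isCont U0 x}" and t: "t \<ge> 0"
 shows "V1 t x = V2 t x"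
proof (cases "t = 0")
 case True
 have "V1 0 x = U0 x" "V2 0 x = U0 x"
  using sol1 sol2 unfolding bounded_FKPP_solution_def FKPP_solution_upto_def by (meson zero_less_one)+
 then show ?thesis using True by simp
next
 case False
 with t have T: "t > 0" by simp
 obtain C1 C2 where C12: "\<And>t x. 0 \<le> t ==> \<bar>V1 t x\<bar> \<le> C1" "\<And>t x. 0 \<le> t ==> \<bar>V2 t x\<bar> \<le> C2"
  using sol1 sol2 unfolding bounded_FKPP_solution_def by blast
 define C where "C = max C1 C2"
 have C: "\<bar>V1 t x\<bar> \<le> C" "\<bar>V2 t x\<bar> \<le> C" if "0 \<le> t" for t x
  using C12[OF that, of x] by (auto simp: C_def)
 obtain L where L: "L \<ge> 0" "\<And>a b. \<bar>a\<bar> \<le> C ==> \<bar>b\<bar> \<le> C ==> \<bar>h a - h b\<bar> \<le> L * \<bar>a - b\<bar>"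
  using lip[of C] by blast
 have up: "FKPP_solution_upto h U0 t V1" "FKPP_solution_upto h U0 t V2"
  using sol1 sol2 T unfolding bounded_FKPP_solution_def by auto
 \<comment> \<open>At most \<open>t / 2\<close>, which keeps \<open>t - s n\<close> within a factor
   2 of \<open>t\<close> for \<open>heat_le_later\<close>.\<close>
 define s where "s = (\<lambda>n. t / (real n + 2))"
 have s: "0 < s n" "s n < t" "s n \<le> t / 2" for n
  using T by (auto simp: s_def field_simps intro: add_pos_nonneg)
 have s0: "s \<longlonglongrightarrow> 0"
 proof -
  have "(\<lambda>n. t * inverse (real (n + 2))) \<longlonglongrightarrow> t * 0"
   by (intro tendsto_mult tendsto_const LIMSEQ_ignore_initial_segment lim_inverse_n)
  then show ?thesis by (simp add: s_def divide_inverse add.commute)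
 qed
 have s0': "filterlim s (at_right 0) sequentially"
  using s0 s(1) less_imp_neq[OF s(1)] by (auto simp: filterlim_at intro!: always_eventually)
 define w where "w = (\<lambda>n y. \<bar>V1 (s n) (real_of_ereal y) - V2 (s n) (real_of_ereal y)\<bar>)"
 have wm: "w n \<in> borel_measurable borel" for n
  unfolding w_def by (rule FKPP_comparison(2)[OF up C L(2,1) s(1,2)])
 have wb: "\<bar>w n y\<bar> \<le> 2 * C" for n y
  using C[of "s n" "real_of_ereal y"] s(1)[of n] by (simp add: w_def)
 have lim: "(\<lambda>n. V1 (s n) y - V2 (s n) y) \<longlonglongrightarrow> 0" if "isCont U0 y" for y
 proof -
  have "((\<lambda>s. V1 s y) \<longlongrightarrow> U0 y) (at_right 0)" "((\<lambda>s. V2 s y) \<longlongrightarrow> U0 y) (at_right 0)"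
   using up that unfolding FKPP_solution_upto_def by auto
  from tendsto_diff[OF this] have "((\<lambda>s. V1 s y - V2 s y) \<longlongrightarrow> 0) (at_right 0)" by simp
  from filterlim_compose[OF this s0'] show ?thesis .
 qed
 have "(\<lambda>n. heat t (w n) (ereal x)) \<longlonglongrightarrow> heat t (\<lambda>_. 0) (ereal x)"
 proof (rule heat_tendsto[OF wm _ wb])
  have "countable ((\<lambda>y. (y - x) / sqrt t) ` {x. \<not> isCont U0 x})" using disc by (rule countable_image)
  from gauss_AE_notin_countable[OF this]
  show "AE z in gauss. (\<lambda>n. w n (ereal x + ereal (sqrt t * z))) \<longlonglongrightarrow> 0"
  proof eventually_elim
   case (elim z)
   have "isCont U0 (x + sqrt t * z)"
    using elim T by (auto simp: image_iff)
   from tendsto_rabs[OF lim[OF this]] show ?case by (simp add: w_def)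
  qed
 qed simp
 then have h0: "(\<lambda>n. exp (L * t) * (sqrt 2 * heat t (w n) (ereal x))) \<longlonglongrightarrow> exp (L * t) * (sqrt 2 * 0)"
  by (intro tendsto_intros) simp
 have wn: "0 \<le> w n y" for n y by (simp add: w_def)
 have hw: "exp (L * (t - s n)) * heat (t - s n) (w n) (ereal x) \<le> exp (L * t) * (sqrt 2 * heat t (w n) (ereal x))" for n
 proof (rule mult_mono)
  show "exp (L * (t - s n)) \<le> exp (L * t)" using L s(1)[of n] by (simp add: mult_left_mono)
  show "heat (t - s n) (w n) (ereal x) \<le> sqrt 2 * heat t (w n) (ereal x)"
   by (rule heat_le_later[OF wm wb wn]) (use s[of n] in auto)
  show "0 \<le> heat (t - s n) (w n) (ereal x)"
   unfolding heat_def by (intro Bochner_Integration.integral_nonneg) (simp add: w_def)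
 qed simp
 have 1: "V1 t x - V2 t x \<le> exp (L * (t - s n)) * heat (t - s n) (w n) (ereal x)" for n
  unfolding w_def by (rule FKPP_comparison(1)[OF up C L(2,1) s(1,2)])
 have 2: "V2 t x - V1 t x \<le> exp (L * (t - s n)) * heat (t - s n) (w n) (ereal x)" for n
  using FKPP_comparison(1)[OF up(2,1) C(2,1) L(2,1) s(1,2), of x n] by (simp add: w_def abs_minus_commute)
 have "\<bar>V1 t x - V2 t x\<bar> \<le> exp (L * t) * (sqrt 2 * 0)"
  by (rule LIMSEQ_le_const[OF h0]) (use order_trans[OF 1 hw] order_trans[OF 2 hw] in \<open>auto simp: abs_le_iff\<close>)
 then show ?thesis by simp
qed

section \<open>Order statistics and jumps\<close>

definition count_le :: "nat => (nat => ereal) => ereal => nat" where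
 "count_le N \<zeta> z = card {i \<in> {1..N}. \<zeta> i \<le> z}"

definition order_stat :: "nat => (nat => ereal) => nat => ereal" where
 "order_stat N z m = z (label_of_quantile N z m)"

lemma count_le_le: "count_le N \<zeta> z \<le> N"
 unfolding count_le_def by (rule order_trans[OF card_mono[of "{1..N}"]]) auto

text \<open>Values and labels together are strictly ordered lexicographically, so the sets of
  predecessors are strictly nested and distinct labels get distinct ranks.\<close>

lemma quantile_bij: "bij_betw (quantile N z) {1..N} {1..N}"
proof -
 define D where "D = (\<lambda>i. {j \<in> {1..N}. z j < z i \<or> (z j = z i \<and> j \<le> i)})"
 have q: "quantile N z i = card (D i)" for i by (simp add: quantile_def D_def)
 have fin: "finite (D i)" for i by (simp add: D_def)
 have lt: "card (D i) < card (D i')" if "i' \<in> {1..N}" "z i < z i' \<or> (z i = z i' \<and> i < i')" for i i'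
 proof (rule psubset_card_mono[OF fin])
  have "D i \<subseteq> D i'" using that unfolding D_def by (auto intro: less_trans)
  moreover have "i' \<in> D i'" "i' \<notin> D i" using that unfolding D_def by auto
  ultimately show "D i \<subset> D i'" by blast
 qed
 have "inj_on (quantile N z) {1..N}"
 proof (rule inj_onI, rule ccontr)
  fix i i' assume i: "i \<in> {1..N}" "i' \<in> {1..N}" "quantile N z i = quantile N z i'" "i \<noteq> i'"
  then have "(z i < z i' \<or> (z i = z i' \<and> i < i')) \<or> (z i' < z i \<or> (z i' = z i \<and> i' < i))"
   by (metis linorder_neqE)
  then show False using lt[of i' i] lt[of i i'] i by (auto simp: q)
 qed
 moreover have "quantile N z ` {1..N} \<subseteq> {1..N}"
 proof
  fix m assume "m \<in> quantile N z ` {1..N}"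
  then obtain i where i: "i \<in> {1..N}" "m = card (D i)" by (auto simp: q)
  have "i \<in> D i" using i by (simp add: D_def)
  then have "card (D i) > 0" using fin[of i] by (auto simp: card_gt_0_iff)
  moreover have "card (D i) \<le> card {1..N}" by (rule card_mono) (auto simp: D_def)
  ultimately show "m \<in> {1..N}" using i by simp
 qed
 ultimately show ?thesis
  unfolding bij_betw_def by (metis card_image card_subset_eq finite_atLeastAtMost)
qed

lemma label_of_quantile:
 assumes "m \<in> {1..N}"
 shows "label_of_quantile N z m \<in> {1..N}" and "quantile N z (label_of_quantile N z m) = m"
proof -
 have "\<exists>!i. i \<in> {1..N} \<and> quantile N z i = m"
  using quantile_bij[of N z] assms unfolding bij_betw_def inj_on_def by (metis (no_types, lifting) imageE)
 from theI'[OF this] show "label_of_quantile N z m \<in> {1..N}" "quantile N z (label_of_quantile N z m) = m"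
  unfolding label_of_quantile_def by auto
qed

lemma le_iff_quantile_le:
 assumes i: "i \<in> {1..N}" shows "\<zeta> i \<le> z \<longleftrightarrow> quantile N \<zeta> i \<le> count_le N \<zeta> z"
proof
 assume "\<zeta> i \<le> z"
 then show "quantile N \<zeta> i \<le> count_le N \<zeta> z"
  unfolding quantile_def count_le_def by (intro card_mono) auto
next
 assume le: "quantile N \<zeta> i \<le> count_le N \<zeta> z"
 show "\<zeta> i \<le> z"
 proof (rule ccontr)
  assume n: "\<not> \<zeta> i \<le> z"
  then have "{j \<in> {1..N}. \<zeta> j \<le> z} \<subset> {j \<in> {1..N}. \<zeta> j < \<zeta> i \<or> (\<zeta> j = \<zeta> i \<and> j \<le> i)}"
   using i by (auto intro: le_less_trans)
  then have "count_le N \<zeta> z < quantile N \<zeta> i"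
   unfolding quantile_def count_le_def by (intro psubset_card_mono) auto
  with le show False by simp
 qed
qed

text \<open>Order statistics are read off from threshold counts. Through this equivalence the effect
  of a jump on a test function is expressed by the empirical distribution alone, without reference
  to labels.\<close>

lemma order_stat_le_iff:
 assumes "m \<in> {1..N}" shows "order_stat N \<zeta> m \<le> z \<longleftrightarrow> m \<le> count_le N \<zeta> z"
 using le_iff_quantile_le[OF label_of_quantile(1)[OF assms, of \<zeta>], of \<zeta> z] label_of_quantile(2)[OF assms, of \<zeta>]
 by (simp add: order_stat_def)

lemma order_stat_shift:
 assumes m: "m \<in> {1..N}" and le: "\<And>i. i \<in> {1..N} ==> \<xi> i \<le> z i + ereal c"
 shows "order_stat N \<xi> m \<le> order_stat N z m + ereal c"
proof -
 have "m \<le> count_le N z (order_stat N z m)"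
  using order_stat_le_iff[OF m] by blast
 also have "... \<le> count_le N \<xi> (order_stat N z m + ereal c)"
  unfolding count_le_def
  by (intro card_mono) (auto intro: order_trans[OF le] add_right_mono)
 finally show ?thesis using order_stat_le_iff[OF m] by blast
qed

text \<open>Shifting every particle by at most \<open>w\<close> moves each order statistic by at
  most \<open>w\<close>, although the label that realises it may change completely.\<close>

lemma order_stat_Lipschitz:
 fixes \<phi> :: "ereal => real"
 assumes m: "m \<in> {1..N}" and c: "\<And>i. i \<in> {1..N} ==> \<bar>c i\<bar> \<le> w"
  and anti: "\<And>y y'. y \<le> y' ==> \<phi> y' \<le> \<phi> y" and lip: "\<And>y d. \<bar>\<phi> (y + ereal d) - \<phi> y\<bar> \<le> \<Lambda> * \<bar>d\<bar>"
 shows "\<bar>\<phi> (order_stat N (\<lambda>i. z i + ereal (c i)) m) - \<phi> (order_stat N z m)\<bar> \<le> \<Lambda> * w"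
proof -
 have w: "w \<ge> 0" using c[OF m] by simp
 let ?a = "order_stat N z m" and ?b = "order_stat N (\<lambda>i. z i + ereal (c i)) m"
 have "?b \<le> ?a + ereal w"
  by (rule order_stat_shift[OF m]) (use c in \<open>auto intro!: add_left_mono simp: abs_le_iff\<close>)
 from anti[OF this] lip[of ?a w] w have 1: "\<phi> ?a - \<Lambda> * w \<le> \<phi> ?b" by (simp add: abs_le_iff)
 have "?a \<le> ?b + ereal w"
 proof (rule order_stat_shift[OF m])
  fix i assume "i \<in> {1..N}"
  then have "0 \<le> c i + w" using c[of i] by (simp add: abs_le_iff)
  then have "z i + 0 \<le> z i + ereal (c i + w)" by (intro add_left_mono) simp
  then show "z i \<le> z i + ereal (c i) + ereal w" by (simp add: add.assoc)
 qed
 from anti[OF this] lip[of ?b w] w have 2: "\<phi> ?b \<le> \<phi> ?a + \<Lambda> * w" by (simp add: abs_le_iff)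
 from 1 2 show ?thesis by (simp add: abs_le_iff)
qed

text \<open>The label \<open>l\<close> that moves is obtained before the function is quantified, so
  the same \<open>l\<close> describes the change of the sum for a function and for its
  square.\<close>

lemma sum_jump:
 fixes \<phi> :: "ereal => real"
 assumes a: "nth_elem A (fst ij) \<in> {1..N}" and b: "nth_elem A (snd ij) \<in> {1..N}"
 obtains l where "l \<in> {1..N}"
  "\<And>\<phi>. (\<Sum>i=1..N. \<phi> (jump N A ij \<xi> i + ereal (c i))) - (\<Sum>i=1..N. \<phi> (\<xi> i + ereal (c i)) :: real)
   = \<phi> (order_stat N \<xi> (nth_elem A (snd ij)) + ereal (c l)) - \<phi> (order_stat N \<xi> (nth_elem A (fst ij)) + ereal (c l))"
proof
 let ?l = "label_of_quantile N \<xi> (nth_elem A (fst ij))"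
 show l: "?l \<in> {1..N}" by (rule label_of_quantile(1)[OF a])
 fix \<phi> :: "ereal => real"
 show "(\<Sum>i=1..N. \<phi> (jump N A ij \<xi> i + ereal (c i))) - (\<Sum>i=1..N. \<phi> (\<xi> i + ereal (c i)))
   = \<phi> (order_stat N \<xi> (nth_elem A (snd ij)) + ereal (c ?l)) - \<phi> (order_stat N \<xi> (nth_elem A (fst ij)) + ereal (c ?l))"
  unfolding sum.remove[OF finite_atLeastAtMost l]
  by (simp add: jump_def order_stat_def)
qed

section \<open>Averaging over the marks of a jump\<close>

definition k_subsets :: "nat => nat => nat set set" where
 "k_subsets N k = {A. A \<subseteq> {1..N} \<and> card A = k}"

lemma finite_k_subsets [simp]: "finite (k_subsets N k)"
 unfolding k_subsets_def by (rule finite_subset[of _ "Pow {1..N}"]) auto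

lemma card_k_subsets: "card (k_subsets N k) = N choose k"
 unfolding k_subsets_def using n_subsets[of "{1..N}" k] by simp

lemma nth_elem_mem:
 assumes "A \<in> k_subsets N k" "1 \<le> i" "i \<le> k" shows "nth_elem A i \<in> A" "nth_elem A i \<in> {1..N}"
proof -
 have fin: "finite A" using assms(1) unfolding k_subsets_def by (auto intro: finite_subset)
 have len: "length (sorted_list_of_set A) = k" using assms fin by (simp add: k_subsets_def)
 then have "nth_elem A i \<in> set (sorted_list_of_set A)"
  unfolding nth_elem_def using assms by (intro nth_mem) auto
 then show "nth_elem A i \<in> A" using fin by simp
 then show "nth_elem A i \<in> {1..N}" using assms(1) by (auto simp: k_subsets_def)
qed

lemma nth_elem_le_iff:
 assumes A: "A \<in> k_subsets N k" and i: "1 \<le> i" "i \<le> k"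
 shows "nth_elem A i \<le> c \<longleftrightarrow> i \<le> card (A \<inter> {1..c})"
proof -
 let ?xs = "sorted_list_of_set A"
 let ?L = "{a. a < k \<and> ?xs ! a \<le> c}"
 have fin: "finite A" using A unfolding k_subsets_def by (auto intro: finite_subset)
 have len: "length ?xs = k" using A fin by (simp add: k_subsets_def)
 have str: "sorted_wrt (<) ?xs" by (rule strict_sorted_list_of_set)
 have nth: "?xs ! a < ?xs ! b \<longleftrightarrow> a < b" if "a < k" "b < k" for a b
  using that len sorted_wrt_nth_less[OF str, of a b] sorted_wrt_nth_less[OF str, of b a]
  by (metis less_asym linorder_neqE_nat)
 have A1: "A \<inter> {1..c} = (!) ?xs ` ?L"
 proof -
  have "A = set ?xs" using fin by simp
  also have "... = (!) ?xs ` {a. a < k}" using len by (auto simp: set_conv_nth)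
  finally have eq: "A = (!) ?xs ` {a. a < k}" .
  have "\<And>x. x \<in> A ==> 1 \<le> x" using A by (auto simp: k_subsets_def)
  then have "A \<inter> {1..c} = {x \<in> A. x \<le> c}" by auto
  moreover have "{x \<in> B. x \<le> c} = f ` {a \<in> D. f a \<le> c}" if "B = f ` D" for B D and f :: "nat => nat"
   using that by auto
  ultimately show ?thesis using eq by simp
 qed
 have inj: "inj_on ((!) ?xs) ?L"
  by (rule inj_on_nth) (use len in auto)
 have card: "card (A \<inter> {1..c}) = card ?L"
  unfolding A1 by (rule card_image[OF inj])
 show ?thesis
 proof
  assume "nth_elem A i \<le> c"
  then have c: "?xs ! (i - 1) \<le> c" by (simp add: nth_elem_def)
  have "{..<i} \<subseteq> ?L"
  proof
   fix a assume a: "a \<in> {..<i}"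
   have "?xs ! a \<le> ?xs ! (i - 1)"
    using nth[of a "i - 1"] a i by (cases "a = i - 1") (auto intro: less_imp_le)
   then show "a \<in> ?L" using a i c by auto
  qed
  from card_mono[OF _ this] show "i \<le> card (A \<inter> {1..c})" unfolding card by simp
 next
  assume le: "i \<le> card (A \<inter> {1..c})"
  show "nth_elem A i \<le> c"
  proof (rule ccontr)
   assume n: "\<not> nth_elem A i \<le> c"
   have "?L \<subseteq> {..<i - 1}"
   proof
    fix a assume a: "a \<in> ?L"
    then have "?xs ! a < ?xs ! (i - 1)" using n by (simp add: nth_elem_def)
    then show "a \<in> {..<i - 1}" using nth[of a "i - 1"] a i by auto
   qed
   from card_mono[OF _ this] show False using le i unfolding card by simp
  qed
 qed
qed

lemma nth_elem_mono:
 assumes A: "A \<in> k_subsets N k" and ij: "1 \<le> i" "i < j" "j \<le> k"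
 shows "nth_elem A i \<le> nth_elem A j"
proof -
 have "j \<le> card (A \<inter> {1..nth_elem A j})" using nth_elem_le_iff[OF A, of j] ij by auto
 then show ?thesis using nth_elem_le_iff[OF A, of i] ij by auto
qed

text \<open>A subset is determined by its traces on \<open>{1..c}\<close> and
  \<open>{c+1..N}\<close>: the hypergeometric count.\<close>

lemma card_k_subsets_inter:
 assumes c: "c \<le> N" and r: "r \<le> k"
 shows "card {A \<in> k_subsets N k. card (A \<inter> {1..c}) = r} = (c choose r) * ((N - c) choose (k - r))"
proof -
 let ?X = "{X. X \<subseteq> {1..c} \<and> card X = r}" and ?Y = "{Y. Y \<subseteq> {c+1..N} \<and> card Y = k - r}"
 have "bij_betw (\<lambda>(X, Y). X \<union> Y) (?X \<times> ?Y) {A \<in> k_subsets N k. card (A \<inter> {1..c}) = r}"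
 proof (rule bij_betw_byWitness[where f'="\<lambda>A. (A \<inter> {1..c}, A \<inter> {c+1..N})"])
  show "\<forall>p\<in>?X \<times> ?Y. (\<lambda>A. (A \<inter> {1..c}, A \<inter> {c+1..N})) ((\<lambda>(X, Y). X \<union> Y) p) = p"
   using c by fastforce
  show "\<forall>A\<in>{A \<in> k_subsets N k. card (A \<inter> {1..c}) = r}. (\<lambda>(X, Y). X \<union> Y) (A \<inter> {1..c}, A \<inter> {c+1..N}) = A"
   using c by (auto simp: k_subsets_def)
  show "(\<lambda>(X, Y). X \<union> Y) ` (?X \<times> ?Y) \<subseteq> {A \<in> k_subsets N k. card (A \<inter> {1..c}) = r}"
  proof safe
   fix X Y assume X: "X \<subseteq> {1..c}" and Y: "Y \<subseteq> {c+1..N}" "card Y = k - card X" and r': "r = card X"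
   have f: "finite X" "finite Y" using X Y by (auto intro: finite_subset)
   have "X \<inter> Y = {}" using X Y by fastforce
   then have "card (X \<union> Y) = k" using card_Un_disjoint[OF f] Y r r' by simp
   moreover have "X \<union> Y \<subseteq> {1..N}" using X Y c by fastforce
   ultimately show "X \<union> Y \<in> k_subsets N k" by (simp add: k_subsets_def)
   have "(X \<union> Y) \<inter> {1..c} = X" using X Y by fastforce
   then show "card ((X \<union> Y) \<inter> {1..c}) = card X" by simp
  qed
  show "(\<lambda>A. (A \<inter> {1..c}, A \<inter> {c+1..N})) ` {A \<in> k_subsets N k. card (A \<inter> {1..c}) = r} \<subseteq> ?X \<times> ?Y"
  proof safe
   fix A assume A: "A \<in> k_subsets N k" "r = card (A \<inter> {1..c})"
   have fA: "finite A" using A unfolding k_subsets_def by (auto intro: finite_subset)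
   have "A = (A \<inter> {1..c}) \<union> (A \<inter> {c+1..N})" using A(1) c by (auto simp: k_subsets_def)
   then have "card A = card (A \<inter> {1..c}) + card (A \<inter> {c+1..N})"
    using card_Un_disjoint[of "A \<inter> {1..c}" "A \<inter> {c+1..N}"] fA by fastforce
   then show "card (A \<inter> {c+1..N}) = k - card (A \<inter> {1..c})" using A by (auto simp: k_subsets_def)
  qed
 qed
 from bij_betw_same_card[OF this] show ?thesis
  by (simp add: card_cartesian_product n_subsets)
qed

definition mark_pairs :: "nat => (nat \<times> nat) set" where
 "mark_pairs k = {(i, j). 1 \<le> i \<and> i < j \<and> j \<le> k}"

lemma finite_mark_pairs [simp]: "finite (mark_pairs k)"
 unfolding mark_pairs_def by (rule finite_subset[of _ "{1..k} \<times> {1..k}"]) auto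

definition mark_mean :: "nat => nat => (nat \<times> nat) pmf => (nat set => nat \<times> nat => real) => real" where
 "mark_mean N k p G = (\<Sum>A\<in>k_subsets N k. \<Sum>ij\<in>mark_pairs k. 1 / real (N choose k) * pmf p ij * G A ij)"

text \<open>The drift at finite \<open>N\<close>: \<open>h_p\<close> at level \<open>c / N\<close>,
  with the binomial weights replaced by the hypergeometric ones of sampling without
  replacement.\<close>

definition h_fin :: "nat => real => (nat \<times> nat) pmf => nat => nat => real" where
 "h_fin k lam p N c = lam * (\<Sum>r=1..k-1. p_hat k p r * (real (c choose r) * real ((N - c) choose (k - r)) / real (N choose k)))"

lemma p_hat_sum: "p_hat k p r = (\<Sum>ij\<in>mark_pairs k. pmf p ij * of_bool (fst ij \<le> r \<and> r < snd ij))" if "r \<le> k"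
proof -
 have "p_hat k p r = (\<Sum>ij\<in>{1..r} \<times> {r+1..k}. pmf p ij)"
  by (simp add: p_hat_def sum.cartesian_product)
 also have "{1..r} \<times> {r+1..k} = {ij \<in> mark_pairs k. fst ij \<le> r \<and> r < snd ij}"
  using that by (auto simp: mark_pairs_def)
 also have "(\<Sum>ij\<in>.... pmf p ij) = (\<Sum>ij\<in>mark_pairs k. pmf p ij * of_bool (fst ij \<le> r \<and> r < snd ij))"
  by (intro sum.mono_neutral_cong_left) auto
 finally show ?thesis .
qed

lemma p_hat_nonneg: "0 \<le> p_hat k p r"
 unfolding p_hat_def by (intro sum_nonneg) auto

lemma p_hat_boundary: "p_hat k p 0 = 0" "p_hat k p k = 0"
 by (auto simp: p_hat_def)

text \<open>The chosen ranks lie on the two sides of level \<open>c\<close> exactly if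
  \<open>i \<le> r < j\<close>, where \<open>r\<close> is the number of sampled ranks among the
  lowest \<open>c\<close>. Given \<open>r\<close> this has probability \<open>p_hat k p r\<close>,
  and \<open>r\<close> is hypergeometric; \<open>r = 0\<close> and \<open>r = k\<close> contribute
  nothing.\<close>

lemma mark_mean_straddle:
 assumes c: "c \<le> N" and lam: "lam > 0"
 shows "mark_mean N k p (\<lambda>A ij. of_bool (nth_elem A (fst ij) \<le> c \<and> c < nth_elem A (snd ij))) = h_fin k lam p N c / lam"
proof -
 let ?h = "\<lambda>r. real (c choose r) * real ((N - c) choose (k - r)) / real (N choose k)"
 have "mark_mean N k p (\<lambda>A ij. of_bool (nth_elem A (fst ij) \<le> c \<and> c < nth_elem A (snd ij)))
   = (\<Sum>A\<in>k_subsets N k. 1 / real (N choose k) * p_hat k p (card (A \<inter> {1..c})))"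
  unfolding mark_mean_def
 proof (rule sum.cong[OF refl])
  fix A assume A: "A \<in> k_subsets N k"
  have "card (A \<inter> {1..c}) \<le> card A"
   by (rule card_mono) (use A in \<open>auto simp: k_subsets_def intro: finite_subset\<close>)
  then have r: "card (A \<inter> {1..c}) \<le> k" using A by (simp add: k_subsets_def)
  show "(\<Sum>ij\<in>mark_pairs k. 1 / real (N choose k) * pmf p ij * of_bool (nth_elem A (fst ij) \<le> c \<and> c < nth_elem A (snd ij)))
    = 1 / real (N choose k) * p_hat k p (card (A \<inter> {1..c}))"
   unfolding p_hat_sum[OF r] sum_distrib_left
  proof (rule sum.cong[OF refl])
   fix ij assume "ij \<in> mark_pairs k"
   then have "nth_elem A (fst ij) \<le> c \<longleftrightarrow> fst ij \<le> card (A \<inter> {1..c})"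
     "nth_elem A (snd ij) \<le> c \<longleftrightarrow> snd ij \<le> card (A \<inter> {1..c})"
    using nth_elem_le_iff[OF A] by (auto simp: mark_pairs_def)
   then show "1 / real (N choose k) * pmf p ij * of_bool (nth_elem A (fst ij) \<le> c \<and> c < nth_elem A (snd ij))
     = 1 / real (N choose k) * (pmf p ij * of_bool (fst ij \<le> card (A \<inter> {1..c}) \<and> card (A \<inter> {1..c}) < snd ij))"
    by (simp add: not_le[symmetric])
  qed
 qed
 also have "... = (\<Sum>r\<in>{0..k}. \<Sum>A\<in>{A \<in> k_subsets N k. card (A \<inter> {1..c}) = r}. 1 / real (N choose k) * p_hat k p (card (A \<inter> {1..c})))"
 proof (rule sum.group[symmetric])
  show "(\<lambda>A. card (A \<inter> {1..c})) ` k_subsets N k \<subseteq> {0..k}"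
  proof (intro image_subsetI)
   fix A assume A: "A \<in> k_subsets N k"
   have "card (A \<inter> {1..c}) \<le> card A"
    by (rule card_mono) (use A in \<open>auto simp: k_subsets_def intro: finite_subset\<close>)
   then show "card (A \<inter> {1..c}) \<in> {0..k}" using A by (simp add: k_subsets_def)
  qed
 qed auto
 also have "... = (\<Sum>r\<in>{0..k}. p_hat k p r * ?h r)"
 proof (rule sum.cong[OF refl])
  fix r assume "r \<in> {0..k}"
  then have "card {A \<in> k_subsets N k. card (A \<inter> {1..c}) = r} = (c choose r) * ((N - c) choose (k - r))"
   using card_k_subsets_inter[OF c] by simp
  then show "(\<Sum>A\<in>{A \<in> k_subsets N k. card (A \<inter> {1..c}) = r}. 1 / real (N choose k) * p_hat k p (card (A \<inter> {1..c})))
    = p_hat k p r * ?h r"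
   by simp
 qed
 also have "... = (\<Sum>r=1..k-1. p_hat k p r * ?h r)"
 proof (rule sum.mono_neutral_right)
  show "\<forall>r\<in>{0..k} - {1..k-1}. p_hat k p r * ?h r = 0"
  proof
   fix r assume "r \<in> {0..k} - {1..k-1}"
   then have "r = 0 \<or> r = k" by auto
   then show "p_hat k p r * ?h r = 0"
    using p_hat_boundary by auto
  qed
 qed auto
 also have "... = h_fin k lam p N c / lam" using lam by (simp add: h_fin_def)
 finally show ?thesis .
qed

section \<open>Sampling with and without replacement\<close>

lemma prod_falling: "real (c choose r) * fact r = (\<Prod>i<r. real c - real i)"
 by (simp add: binomial_gbinomial gbinomial_prod_rev atLeast0LessThan)

text \<open>Products with factors of modulus at most 1 differ by no more than the sum of the
  differences of their factors, and each factor is off by at most \<open>k / N\<close>.\<close>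

lemma prod_falling_close:
 assumes N: "N > 0" and x: "0 \<le> x" "x \<le> real N" and r: "r \<le> k" "k \<le> N"
 shows "\<bar>(\<Prod>i<r. (x - real i) / real N) - (x / real N) ^ r\<bar> \<le> real k * real k / real N"
  and "\<bar>\<Prod>i<r. (x - real i) / real N\<bar> \<le> 1"
proof -
 have b: "\<bar>(x - real i) / real N\<bar> \<le> 1" if "i < r" for i
  using that x r N by (simp add: abs_le_iff divide_le_eq le_divide_eq)
 have "norm ((\<Prod>i<r. (x - real i) / real N) - (\<Prod>i<r. x / real N)) \<le> (\<Sum>i<r. norm ((x - real i) / real N - x / real N))"
  by (rule norm_prod_diff) (use b x N in auto)
 also have "... \<le> (\<Sum>i<r. real k / real N)"
  by (rule sum_mono) (use r N in \<open>auto simp: diff_divide_distrib[symmetric] divide_right_mono\<close>)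
 also have "... \<le> real k * real k / real N"
  using r by (simp add: divide_right_mono mult_right_mono)
 finally show "\<bar>(\<Prod>i<r. (x - real i) / real N) - (x / real N) ^ r\<bar> \<le> real k * real k / real N" by simp
 show "\<bar>\<Prod>i<r. (x - real i) / real N\<bar> \<le> 1"
  unfolding abs_prod by (rule prod_le_1) (use b in auto)
qed

text \<open>The three binomial coefficients, suitably normalised by factorials and powers of
  \<open>N\<close>, are products \<open>A\<close>, \<open>B\<close>, \<open>D\<close> within
  \<open>k^2 / N\<close> of \<open>v^r\<close>, \<open>(1 - v)^(k - r)\<close> and 1. The factor 3
  counts these errors, and \<open>k^k\<close> bounds \<open>1 / D\<close>.\<close>

lemma hypergeometric_close:
 assumes k: "1 \<le> k" "k \<le> N" and c: "c \<le> N" and r: "r \<le> k"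
 shows "\<bar>real (c choose r) * real ((N - c) choose (k - r)) / real (N choose k)
   - real (k choose r) * (real c / real N) ^ r * (1 - real c / real N) ^ (k - r)\<bar>
  \<le> real (k choose r) * (3 * real k ^ (k + 2) / real N)"
proof -
 have N: "N > 0" using k by simp
 define v where "v = real c / real N"
 define A where "A = (\<Prod>i<r. (real c - real i) / real N)"
 define B where "B = (\<Prod>i<k-r. (real (N - c) - real i) / real N)"
 define D where "D = (\<Prod>i<k. (real N - real i) / real N)"
 have cA: "real (c choose r) = A * real N ^ r / fact r"
  using prod_falling[of c r] N by (simp add: A_def prod_dividef field_simps)
 have cB: "real ((N - c) choose (k - r)) = B * real N ^ (k - r) / fact (k - r)"
  using prod_falling[of "N - c" "k - r"] N by (simp add: B_def prod_dividef field_simps)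
 have cD: "real (N choose k) = D * real N ^ k / fact k"
  using prod_falling[of N k] N by (simp add: D_def prod_dividef field_simps)
 have ck: "real (k choose r) = fact k / (fact r * fact (k - r))"
  by (rule binomial_fact[OF r])
 \<comment> \<open>Each factor is at least \<open>1 / k\<close>, since \<open>i \<le> k - 1\<close>
   and \<open>k \<le> N\<close>: a bound away from 0 that does not ask \<open>N\<close> to be
   large.\<close>
 have Dpos: "D \<ge> (1 / real k) ^ k"
 proof -
  have "(1 / real k) ^ k = (\<Prod>i<k. 1 / real k)" by simp
  also have "... \<le> D"
   unfolding D_def
  proof (rule prod_mono)
   fix i assume i: "i \<in> {..<k}"
   have "real N * 1 \<le> real k * (real N - real i)"
   proof -
    have "real N \<ge> real k" using k by simp
    have "real i \<le> real k - 1" using i by (simp add: of_nat_diff[symmetric] Suc_le_eq)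
    then have "real k * real i \<le> real k * (real k - 1)" by (intro mult_left_mono) auto
    also have "... \<le> real N * (real k - 1)" using k by (intro mult_right_mono) auto
    finally show ?thesis by (simp add: algebra_simps)
   qed
   then show "0 \<le> 1 / real k \<and> 1 / real k \<le> (real N - real i) / real N"
    using N k by (simp add: divide_simps mult.commute)
  qed
  finally show ?thesis .
 qed
 have kk: "(1 / real k) ^ k > 0" using k by simp
 then have D0: "D > 0" using Dpos by linarith
 have invD: "1 / D \<le> real k ^ k"
 proof -
  have "1 / D \<le> 1 / ((1 / real k) ^ k)" using Dpos kk D0 by (intro divide_left_mono) auto
  then show ?thesis by (simp add: power_divide)
 qed
 have "real (c choose r) * real ((N - c) choose (k - r)) / real (N choose k) = real (k choose r) * (A * B / D)"
  unfolding cA cB cD ck using N r by (simp add: field_simps power_add[symmetric])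
 moreover have "\<bar>A * B / D - v ^ r * (1 - v) ^ (k - r)\<bar> \<le> 3 * real k ^ (k + 2) / real N"
 proof -
  define e where "e = real k * real k / real N"
  have e: "e \<ge> 0" by (simp add: e_def)
  have v01: "0 \<le> v" "v \<le> 1" using c N by (auto simp: v_def)
  have v1: "1 - v = real (N - c) / real N" using c N by (simp add: v_def diff_divide_distrib of_nat_diff)
  have a: "\<bar>A - v ^ r\<bar> \<le> e" "\<bar>A\<bar> \<le> 1"
   unfolding A_def v_def e_def using prod_falling_close[OF N, of "real c" r k] c r k by auto
  have b: "\<bar>B - (1 - v) ^ (k - r)\<bar> \<le> e" "\<bar>B\<bar> \<le> 1"
   unfolding B_def v1 e_def using prod_falling_close[OF N, of "real (N - c)" "k - r" k] k by auto
  have d: "\<bar>D - 1\<bar> \<le> e"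
   unfolding D_def e_def using prod_falling_close[OF N, of "real N" k k] k N by auto
  let ?w = "v ^ r * (1 - v) ^ (k - r)"
  have w: "0 \<le> ?w" "?w \<le> 1" using v01 by (auto intro!: mult_le_one power_le_one)
  have "A * B - ?w = (A - v ^ r) * B + v ^ r * (B - (1 - v) ^ (k - r))" by (simp add: algebra_simps)
  then have "\<bar>A * B - ?w\<bar> \<le> \<bar>(A - v ^ r) * B\<bar> + \<bar>v ^ r * (B - (1 - v) ^ (k - r))\<bar>" by linarith
  also have "... \<le> e * 1 + 1 * e"
   unfolding abs_mult using a b e v01 by (intro add_mono mult_mono) (auto simp: power_abs[symmetric] power_le_one)
  finally have ab: "\<bar>A * B - ?w\<bar> \<le> 2 * e" by simp
  have "A * B / D - ?w = (A * B - ?w - ?w * (D - 1)) / D" using D0 by (simp add: field_simps)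
  moreover have "\<bar>A * B - ?w - ?w * (D - 1)\<bar> \<le> 3 * e"
  proof -
   have "\<bar>?w * (D - 1)\<bar> \<le> 1 * e" unfolding abs_mult using w d by (intro mult_mono) auto
   then show ?thesis using ab by linarith
  qed
  ultimately have "\<bar>A * B / D - ?w\<bar> \<le> 3 * e / D" using D0 by (simp add: abs_divide divide_right_mono)
  also have "... = 3 * e * (1 / D)" by simp
  also have "... \<le> 3 * e * real k ^ k" using e invD by (intro mult_left_mono) auto
  also have "... = 3 * real k ^ (k + 2) / real N" by (simp add: e_def power_add power2_eq_square)
  finally show ?thesis .
 qed
 then have "real (k choose r) * \<bar>A * B / D - v ^ r * (1 - v) ^ (k - r)\<bar> \<le> real (k choose r) * (3 * real k ^ (k + 2) / real N)"
  by (intro mult_left_mono) auto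
 moreover have "real (k choose r) * (real c / real N) ^ r * (1 - real c / real N) ^ (k - r) = real (k choose r) * (v ^ r * (1 - v) ^ (k - r))"
  by (simp add: v_def)
 ultimately show ?thesis
  by (simp only: right_diff_distrib[symmetric] abs_mult abs_of_nat)
qed

definition h_fin_const :: "nat => real => (nat \<times> nat) pmf => real" where
 "h_fin_const k lam p = lam * (\<Sum>r=1..k-1. p_hat k p r * (real (k choose r) * (3 * real k ^ (k + 2))))"

lemma h_fin_const_nonneg: "lam > 0 ==> 0 \<le> h_fin_const k lam p"
 unfolding h_fin_const_def by (intro mult_nonneg_nonneg sum_nonneg p_hat_nonneg) auto

lemma h_fin_close:
 assumes k: "1 \<le> k" "k \<le> N" and c: "c \<le> N" and lam: "lam > 0"
 shows "\<bar>h_fin k lam p N c - h_p k lam p (real c / real N)\<bar> \<le> h_fin_const k lam p / real N"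
proof -
 have eq: "h_fin k lam p N c - h_p k lam p (real c / real N) = lam * (\<Sum>r=1..k-1. p_hat k p r *
   (real (c choose r) * real ((N - c) choose (k - r)) / real (N choose k)
    - real (k choose r) * (real c / real N) ^ r * (1 - real c / real N) ^ (k - r)))"
  unfolding h_fin_def h_p_def right_diff_distrib[symmetric] sum_subtractf[symmetric]
  by (simp add: right_diff_distrib mult.assoc)
 have "\<bar>h_fin k lam p N c - h_p k lam p (real c / real N)\<bar>
   \<le> lam * (\<Sum>r=1..k-1. p_hat k p r * (real (k choose r) * (3 * real k ^ (k + 2) / real N)))"
  unfolding eq abs_mult[of lam] abs_of_pos[OF lam]
 proof (rule mult_left_mono)
  show "\<bar>\<Sum>r=1..k-1. p_hat k p r *
   (real (c choose r) * real ((N - c) choose (k - r)) / real (N choose k)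
    - real (k choose r) * (real c / real N) ^ r * (1 - real c / real N) ^ (k - r))\<bar>
   \<le> (\<Sum>r=1..k-1. p_hat k p r * (real (k choose r) * (3 * real k ^ (k + 2) / real N)))"
  proof (intro order_trans[OF sum_abs] sum_mono)
   fix r assume "r \<in> {1..k-1}"
   then have r: "r \<le> k" by auto
   show "\<bar>p_hat k p r *
     (real (c choose r) * real ((N - c) choose (k - r)) / real (N choose k)
      - real (k choose r) * (real c / real N) ^ r * (1 - real c / real N) ^ (k - r))\<bar>
     \<le> p_hat k p r * (real (k choose r) * (3 * real k ^ (k + 2) / real N))"
    unfolding abs_mult[of "p_hat k p r"] abs_of_nonneg[OF p_hat_nonneg]
    by (rule mult_left_mono[OF hypergeometric_close[OF k c r] p_hat_nonneg])
  qed
 qed (use lam in auto)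
 also have "... = h_fin_const k lam p / real N"
  unfolding h_fin_const_def times_divide_eq_right[symmetric] sum_divide_distrib by simp
 finally show ?thesis .
qed

section \<open>The nonlinearity\<close>

definition h_p' :: "nat => real => (nat \<times> nat) pmf => real => real" where
 "h_p' k lam p v = lam * (\<Sum>r=1..k-1. p_hat k p r * real (k choose r) *
   (real r * v ^ (r - 1) * (1 - v) ^ (k - r) - v ^ r * (real (k - r) * (1 - v) ^ (k - r - 1))))"

lemma h_p_deriv: "(h_p k lam p has_real_derivative h_p' k lam p v) (at v)"
 unfolding h_p_def[abs_def] h_p'_def
 by (auto intro!: derivative_eq_intros DERIV_cmult sum.cong simp: algebra_simps)

lemma h_p'_cont: "continuous_on A (h_p' k lam p)"
 unfolding h_p'_def[abs_def] by (intro continuous_intros)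

lemma h_p_Lipschitz:
 "\<exists>L\<ge>0. \<forall>a b. \<bar>a\<bar> \<le> C \<longrightarrow> \<bar>b\<bar> \<le> C \<longrightarrow> \<bar>h_p k lam p a - h_p k lam p b\<bar> \<le> L * \<bar>a - b\<bar>"
proof -
 have "compact (h_p' k lam p ` {-C..C})"
  by (intro compact_continuous_image h_p'_cont compact_Icc)
 then obtain L where L: "\<And>v. v \<in> {-C..C} ==> \<bar>h_p' k lam p v\<bar> \<le> L"
  using compact_imp_bounded bounded_iff by (metis imageI real_norm_def)
 show ?thesis
 proof (intro exI[of _ "max L 0"] conjI allI impI)
  fix a b :: real assume "\<bar>a\<bar> \<le> C" "\<bar>b\<bar> \<le> C"
  then have "norm (h_p k lam p a - h_p k lam p b) \<le> max L 0 * norm (a - b)"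
   using L by (intro field_differentiable_bound[of "{-C..C}" _ "h_p' k lam p"])
    (auto intro: has_field_derivative_at_within[OF h_p_deriv] le_max_iff_disj[THEN iffD2])
  then show "\<bar>h_p k lam p a - h_p k lam p b\<bar> \<le> max L 0 * \<bar>a - b\<bar>" by simp
 qed simp
qed

definition clip :: "real => real" where "clip v = max 0 (min 1 v)"

lemma clip_simps: "0 \<le> clip v" "clip v \<le> 1" "0 \<le> v ==> v \<le> 1 ==> clip v = v" "\<bar>clip a - clip b\<bar> \<le> \<bar>a - b\<bar>"
 by (auto simp: clip_def)

lemma h_p_clip:
 obtains L H where "L > 0" "H \<ge> 0" "\<And>a b. \<bar>h_p k lam p (clip a) - h_p k lam p (clip b)\<bar> \<le> L * \<bar>a - b\<bar>"
  "\<And>a. \<bar>h_p k lam p (clip a)\<bar> \<le> H"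
proof -
 obtain L where L: "L \<ge> 0" "\<And>a b. \<bar>a\<bar> \<le> 1 ==> \<bar>b\<bar> \<le> 1 ==> \<bar>h_p k lam p a - h_p k lam p b\<bar> \<le> L * \<bar>a - b\<bar>"
  using h_p_Lipschitz[of 1 k lam p] by blast
 have lip: "\<bar>h_p k lam p (clip a) - h_p k lam p (clip b)\<bar> \<le> (L + 1) * \<bar>a - b\<bar>" for a b
 proof -
  have "\<bar>h_p k lam p (clip a) - h_p k lam p (clip b)\<bar> \<le> L * \<bar>clip a - clip b\<bar>"
   using clip_simps by (intro L(2)) (auto simp: abs_le_iff intro: order_trans[of _ 0])
  also have "... \<le> (L + 1) * \<bar>a - b\<bar>"
   using clip_simps(4)[of a b] L(1) by (intro mult_mono) auto
  finally show ?thesis .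
 qed
 have "\<bar>h_p k lam p (clip a)\<bar> \<le> L + \<bar>h_p k lam p 0\<bar>" for a
 proof -
  have "\<bar>h_p k lam p (clip a) - h_p k lam p 0\<bar> \<le> L * \<bar>clip a - 0\<bar>"
   using clip_simps by (intro L(2)) (auto simp: abs_le_iff intro: order_trans[of _ 0])
  also have "... \<le> L * 1" using L(1) clip_simps[of a] by (intro mult_left_mono) auto
  finally show ?thesis by simp
 qed
 \<comment> \<open>\<open>L + 1\<close> makes the Lipschitz constant strictly positive, because the
   weighted norm of the Picard iteration divides by it.\<close>
 with lip L(1) show ?thesis by (intro that[of "L + 1" "L + \<bar>h_p k lam p 0\<bar>"]) auto
qed

section \<open>Test functions\<close>

text \<open>\<open>test r x y\<close> is the probability that a Brownian motion started at \<open>y\<close> is at most \<open>x\<close> at time \<open>r\<close>.\<close>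

definition test :: "real => ereal => ereal => real" where
 "test r x y = heat r (\<lambda>u. of_bool (y \<le> u)) x"

lemma ereal_add_le_iff: "(y::ereal) + ereal a \<le> x + ereal b \<longleftrightarrow> y \<le> x + ereal (b - a)"
 by (cases y; cases x) auto

lemma test_indicator_measurable [measurable]: "(\<lambda>u. of_bool (y \<le> u)) \<in> borel_measurable (borel :: ereal measure)"
 by measurable

lemma test_01: "0 \<le> test r x y" "test r x y \<le> 1"
proof -
 show "0 \<le> test r x y" unfolding test_def heat_def by (intro Bochner_Integration.integral_nonneg) auto
 show "test r x y \<le> 1" using heat_bound[of "\<lambda>u. of_bool (y \<le> u)" 1 r x] unfolding test_def by (auto simp: abs_le_iff)
qed

lemma test_abs: "\<bar>test r x y\<bar> \<le> 1" using test_01[of r x y] by simp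

lemma test_antimono: "y \<le> y' ==> test r x y' \<le> test r x y"
 unfolding test_def by (rule heat_mono[where K=1 and K'=1]) auto

lemma test_measurable [measurable]: "test r x \<in> borel_measurable borel"
proof -
 have "(\<lambda>(y, u). of_bool (y \<le> u) :: real) \<in> borel_measurable (borel \<Otimes>\<^sub>M (borel :: ereal measure))" by measurable
 then show ?thesis
  unfolding test_def[abs_def] by (rule measurable_heat_joint) simp_all
qed

lemma test_shift: "test r x (y + ereal c) = heat r (\<lambda>u. of_bool (y \<le> u)) (x + ereal (- c))"
proof -
 have "(y + ereal c \<le> x + ereal z) = (y \<le> x + ereal (- c) + ereal z)" for z
  using ereal_add_le_iff[of y c x z] by (simp add: add.assoc)
 then show ?thesis by (simp add: test_def heat_def)
qed

lemma test_Lipschitz: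
 assumes r: "r > 0" shows "\<bar>test r x (y + ereal c) - test r x y\<bar> \<le> 1 / sqrt r * \<bar>c\<bar>"
 using heat_Lipschitz[of "\<lambda>u. of_bool (y \<le> u)" 1 r x "- c"] r
 unfolding test_shift by (simp add: test_def)

lemma gauss_integral_uminus: 
 fixes f :: "real => real"
 assumes [measurable]: "f \<in> borel_measurable borel" shows "(\<integral>z. f (- z) \<partial>gauss) = (\<integral>z. f z \<partial>gauss)"
 using lborel_integral_real_affine[of "-1" "\<lambda>z. std_normal_density z * f z" 0]
 by (simp add: integral_gauss normal_density_def)

text \<open>By symmetry of the Gaussian, the heat flow in the starting point \<open>y\<close> equals
  the heat flow in the threshold \<open>x\<close>. Thus test functions stay test functions when
  evolved, with the ages added.\<close>

lemma heat_test:
 assumes r: "r \<ge> 0" and d: "d \<ge> 0" shows "heat d (test r x) y = test (r + d) x y"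
proof -
 have "heat d (test r x) y = (\<integral>w. heat r (\<lambda>u. of_bool (y \<le> u)) (x + ereal (sqrt d * (- w))) \<partial>gauss)"
  unfolding heat_def[of d] test_shift by simp
 also have "... = (\<integral>w. heat r (\<lambda>u. of_bool (y \<le> u)) (x + ereal (sqrt d * w)) \<partial>gauss)"
  by (rule gauss_integral_uminus) measurable
 also have "... = heat d (heat r (\<lambda>u. of_bool (y \<le> u))) x" by (simp add: heat_def[of d])
 also have "... = heat (d + r) (\<lambda>u. of_bool (y \<le> u)) x"
  by (rule heat_semigroup[OF d r, where K=1]) auto
 finally show ?thesis by (simp add: test_def add.commute)
qed

text \<open>The empirical distribution function with thresholds in the extended line, where the heat
  semigroup acts.\<close>

definition emp :: "nat => (nat => ereal) => ereal => real" where
 "emp N \<zeta> z = real (count_le N \<zeta> z) / real N"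

lemma emp_01: "0 \<le> emp N \<zeta> z" "emp N \<zeta> z \<le> 1"
 using count_le_le[of N \<zeta> z] by (auto simp: emp_def divide_le_eq)

lemma emp_sum: "emp N \<zeta> z = (\<Sum>i=1..N. of_bool (\<zeta> i \<le> z)) / real N"
proof -
 have "(\<Sum>i=1..N. of_bool (\<zeta> i \<le> z) :: real) = real (card ({1..N} \<inter> {i. \<zeta> i \<le> z}))" by (subst sum_of_bool_eq) auto
 also have "{1..N} \<inter> {i. \<zeta> i \<le> z} = {i \<in> {1..N}. \<zeta> i \<le> z}" by auto
 finally show ?thesis by (simp add: emp_def count_le_def)
qed

lemma emp_measurable [measurable]: "emp N z \<in> borel_measurable borel"
 unfolding emp_sum[abs_def] by measurable

text \<open>Duality: smoothing the empirical distribution function in its threshold is the same as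
  averaging the smoothed test function over the particles.\<close>

lemma heat_emp: "heat r (emp N \<zeta>) x = (\<Sum>i=1..N. test r x (\<zeta> i)) / real N"
proof -
 have "heat r (emp N \<zeta>) x = (\<integral>z. (\<Sum>i=1..N. of_bool (\<zeta> i \<le> x + ereal (sqrt r * z))) \<partial>gauss) / real N"
  by (simp add: heat_def emp_sum)
 also have "(\<integral>z. (\<Sum>i=1..N. of_bool (\<zeta> i \<le> x + ereal (sqrt r * z))) \<partial>gauss) = (\<Sum>i=1..N. test r x (\<zeta> i))"
  unfolding test_def heat_def
  by (intro Bochner_Integration.integral_sum heat_integrable[where K=1]) auto
 finally show ?thesis .
qed

lemma count_le_measurable: "(\<lambda>u. real (f (count_le N z u))) \<in> borel_measurable borel"
proof -
 have "real (count_le N z u) = (\<Sum>i=1..N. of_bool (z i \<le> u))" for u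
 proof -
  have "(\<Sum>i=1..N. of_bool (z i \<le> u) :: real) = real (card ({1..N} \<inter> {i. z i \<le> u}))" by (subst sum_of_bool_eq) auto
  also have "{1..N} \<inter> {i. z i \<le> u} = {i \<in> {1..N}. z i \<le> u}" by auto
  finally show ?thesis by (simp add: count_le_def)
 qed
 then have "(\<lambda>u. real (count_le N z u)) \<in> borel_measurable borel" by simp
 then have "(\<lambda>u. nat \<lfloor>real (count_le N z u)\<rfloor>) \<in> measurable borel (count_space UNIV)" by measurable
 then have [measurable]: "count_le N z \<in> measurable borel (count_space UNIV)" by simp
 show ?thesis by measurable
qed

lemma count_le_measurable' [measurable]:
 fixes F :: "nat => real"
 shows "(\<lambda>u. F (count_le N z u)) \<in> borel_measurable borel"
proof -
 have "(\<lambda>u. nat \<lfloor>real (id (count_le N z u))\<rfloor>) \<in> measurable borel (count_space UNIV)"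
  using count_le_measurable[of id N z] by measurable
 then have [measurable]: "count_le N z \<in> measurable borel (count_space UNIV)" by simp
 show ?thesis by measurable
qed

text \<open>Written as a Gaussian average over thresholds, the change of the test function is minus
  the indicator that the threshold count separates the two chosen ranks; averaging over the marks
  inside the integral gives \<open>h_fin\<close>.\<close>

lemma mark_mean_test:
 assumes lam: "lam > 0"
 shows "mark_mean N k p (\<lambda>A ij. test r x (order_stat N \<zeta> (nth_elem A (snd ij))) - test r x (order_stat N \<zeta> (nth_elem A (fst ij))))
  = - heat r (\<lambda>u. h_fin k lam p N (count_le N \<zeta> u)) x / lam"
proof -
 define c where "c = (\<lambda>z. count_le N \<zeta> (x + ereal (sqrt r * z)))"
 have [measurable]: "(\<lambda>z. F (c z)) \<in> borel_measurable gauss" for F :: "nat => real"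
  unfolding c_def by measurable
 have i: "integrable gauss (\<lambda>z. F (c z))" for F :: "nat => real"
 proof (rule gauss.integrable_const_bound)
  show "AE z in gauss. norm (F (c z)) \<le> Max ((\<lambda>m. \<bar>F m\<bar>) ` {..N})"
   unfolding c_def by (intro AE_I2) (auto intro!: Max_ge simp: count_le_le)
 qed simp
 have diff: "test r x (order_stat N \<zeta> (nth_elem A (snd ij))) - test r x (order_stat N \<zeta> (nth_elem A (fst ij)))
   = - (\<integral>z. of_bool (nth_elem A (fst ij) \<le> c z \<and> c z < nth_elem A (snd ij)) \<partial>gauss)"
  if A: "A \<in> k_subsets N k" and ij: "ij \<in> mark_pairs k" for A ij
 proof -
  have m: "nth_elem A (fst ij) \<in> {1..N}" "nth_elem A (snd ij) \<in> {1..N}" "nth_elem A (fst ij) \<le> nth_elem A (snd ij)"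
   using ij nth_elem_mem(2)[OF A] nth_elem_mono[OF A] by (auto simp: mark_pairs_def)
  have t: "test r x (order_stat N \<zeta> m) = (\<integral>z. of_bool (m \<le> c z) \<partial>gauss)" if "m \<in> {1..N}" for m
   unfolding test_def heat_def c_def using order_stat_le_iff[OF that] by simp
  have "test r x (order_stat N \<zeta> (nth_elem A (snd ij))) - test r x (order_stat N \<zeta> (nth_elem A (fst ij)))
    = (\<integral>z. of_bool (nth_elem A (snd ij) \<le> c z) - of_bool (nth_elem A (fst ij) \<le> c z) \<partial>gauss)"
   unfolding t[OF m(1)] t[OF m(2)]
   by (rule Bochner_Integration.integral_diff[symmetric]) (rule i)+
  also have "... = (\<integral>z. - of_bool (nth_elem A (fst ij) \<le> c z \<and> c z < nth_elem A (snd ij)) \<partial>gauss)"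
   by (intro Bochner_Integration.integral_cong refl) (use m(3) in auto)
  finally show ?thesis by simp
 qed
 have "mark_mean N k p (\<lambda>A ij. test r x (order_stat N \<zeta> (nth_elem A (snd ij))) - test r x (order_stat N \<zeta> (nth_elem A (fst ij))))
   = (\<Sum>A\<in>k_subsets N k. \<Sum>ij\<in>mark_pairs k. (\<integral>z. - (1 / real (N choose k) * pmf p ij * of_bool (nth_elem A (fst ij) \<le> c z \<and> c z < nth_elem A (snd ij))) \<partial>gauss))"
  unfolding mark_mean_def by (intro sum.cong refl) (simp add: diff)
 also have "... = (\<integral>z. (\<Sum>A\<in>k_subsets N k. \<Sum>ij\<in>mark_pairs k. - (1 / real (N choose k) * pmf p ij * of_bool (nth_elem A (fst ij) \<le> c z \<and> c z < nth_elem A (snd ij)))) \<partial>gauss)"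
 proof -
  have ii: "integrable gauss (\<lambda>z. - (1 / real (N choose k) * pmf p ij * of_bool (nth_elem A (fst ij) \<le> c z \<and> c z < nth_elem A (snd ij))))" for A ij
   by (rule i[of "\<lambda>m. - (1 / real (N choose k) * pmf p ij * of_bool (nth_elem A (fst ij) \<le> m \<and> m < nth_elem A (snd ij)))"])
  show ?thesis
   by (rule trans[OF sum.cong[OF refl Bochner_Integration.integral_sum[symmetric]] Bochner_Integration.integral_sum[symmetric]])
     (intro Bochner_Integration.integrable_sum ii)+
 qed
 also have "... = (\<integral>z. - (h_fin k lam p N (c z) / lam) \<partial>gauss)"
 proof (rule Bochner_Integration.integral_cong[OF refl])
  fix z
  have "c z \<le> N" by (simp add: c_def count_le_le)
  from mark_mean_straddle[OF this lam, of k p]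
  show "(\<Sum>A\<in>k_subsets N k. \<Sum>ij\<in>mark_pairs k. - (1 / real (N choose k) * pmf p ij * of_bool (nth_elem A (fst ij) \<le> c z \<and> c z < nth_elem A (snd ij))))
    = - (h_fin k lam p N (c z) / lam)"
   unfolding mark_mean_def by (simp add: sum_negf)
 qed
 also have "... = - heat r (\<lambda>u. h_fin k lam p N (count_le N \<zeta> u)) x / lam"
  by (simp add: heat_def c_def)
 finally show ?thesis .
qed

section \<open>Independence\<close>

text \<open>Freezing: a variable independent of the sub-sigma-algebra \<open>F\<close> may be
  integrated out with everything \<open>F\<close>-measurable held fixed. This takes the place of
  conditional expectations throughout.\<close>

lemma (in prob_space) indep_integral:
 fixes f :: "'a \<times> 'b => real"
 assumes sF: "space F = space M" and F: "sets F \<subseteq> events" and D [measurable]: "D \<in> measurable M E"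
  and ind: "\<And>A B. A \<in> sets F ==> B \<in> sets E ==> prob (A \<inter> (D -` B \<inter> space M)) = prob A * prob (D -` B \<inter> space M)"
  and f [measurable]: "f \<in> borel_measurable (F \<Otimes>\<^sub>M E)" and b: "\<And>x. \<bar>f x\<bar> \<le> C"
 shows "(\<integral>w. f (w, D w) \<partial>M) = (\<integral>w. (\<integral>y. f (w, y) \<partial>distr M E D) \<partial>M)"
proof -
 have id [measurable]: "(\<lambda>w. w) \<in> measurable M F"
  using F sets.sets_into_space by (intro measurableI) (auto simp: sF Int_absorb2)
 interpret A: prob_space "distr M F (\<lambda>w. w)" by (rule prob_space_distr[OF id])
 interpret B: prob_space "distr M E D" by (rule prob_space_distr[OF D])
 interpret P: pair_prob_space "distr M F (\<lambda>w. w)" "distr M E D" ..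
 have eq: "distr M F (\<lambda>w. w) \<Otimes>\<^sub>M distr M E D = distr M (F \<Otimes>\<^sub>M E) (\<lambda>w. (w, D w))"
 proof (rule pair_measure_eqI)
  fix A B assume "A \<in> sets (distr M F (\<lambda>w. w))" "B \<in> sets (distr M E D)"
  then have AB: "A \<in> sets F" "B \<in> sets E" by auto
  have "(\<lambda>w. (w, D w)) -` (A \<times> B) \<inter> space M = A \<inter> (D -` B \<inter> space M)"
   using sets.sets_into_space[OF AB(1)] by (auto simp: sF)
  moreover have "(\<lambda>w. w) -` A \<inter> space M = A"
   using sets.sets_into_space[OF AB(1)] by (auto simp: sF)
  ultimately show "emeasure (distr M F (\<lambda>w. w)) A * emeasure (distr M E D) B = emeasure (distr M (F \<Otimes>\<^sub>M E) (\<lambda>w. (w, D w))) (A \<times> B)"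
   using AB ind[OF AB] by (simp add: emeasure_distr emeasure_eq_measure ennreal_mult)
 qed (auto intro: A.sigma_finite_measure_axioms B.sigma_finite_measure_axioms)
 have "(\<integral>w. f (w, D w) \<partial>M) = integral\<^sup>L (distr M (F \<Otimes>\<^sub>M E) (\<lambda>w. (w, D w))) f"
  by (subst integral_distr) auto
 also have "... = integral\<^sup>L (distr M F (\<lambda>w. w) \<Otimes>\<^sub>M distr M E D) f" by (simp only: eq)
 also have "... = (\<integral>x. (\<integral>y. f (x, y) \<partial>distr M E D) \<partial>distr M F (\<lambda>w. w))"
  by (rule P.integral_fst'[symmetric]) (use b in \<open>auto intro!: P.integrable_const_bound[where B=C]\<close>)
 also have "... = (\<integral>w. (\<integral>y. f (w, y) \<partial>distr M E D) \<partial>M)"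
  by (rule integral_distr[OF id]) measurable
 finally show ?thesis .
qed

text \<open>Independence of increments along one monotone grid, turned into independence of the last
  increment from finitely many earlier positions, which are sums of increments.\<close>

lemma (in prob_space) increments_indep_past:
 assumes W: "std_brownian_motion M W" and s: "0 \<le> s" "s < s'" and J: "finite J" "J \<subseteq> {0..s}"
  and A: "\<And>r. r \<in> J ==> A r \<in> sets borel" and D: "D \<in> sets borel"
 shows "prob ({w \<in> space M. \<forall>r\<in>J. W r w \<in> A r} \<inter> {w \<in> space M. W s' w - W s w \<in> D})
  = prob {w \<in> space M. \<forall>r\<in>J. W r w \<in> A r} * prob {w \<in> space M. W s' w - W s w \<in> D}"
proof -
 let ?I = "{w \<in> space M. W s' w - W s w \<in> D}" and ?C = "{w \<in> space M. \<forall>r\<in>J. W r w \<in> A r}" and ?b = "\<lambda>_. borel :: real measure"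
 have Wm [measurable]: "W r \<in> borel_measurable M" if "0 \<le> r" for r
  using W that unfolding std_brownian_motion_def by blast
 \<comment> \<open>0 is added so that positions are sums of increments from the origin, and
   \<open>s\<close> so that the increment after the last of these grid points is
   \<open>W s' - W s\<close>.\<close>
 define xs where "xs = sorted_list_of_set (insert 0 (insert s J))"
 define n where "n = length xs"
 have set_xs: "set xs = insert 0 (insert s J)" unfolding xs_def using J by (subst set_sorted_list_of_set) auto
 have sorted: "sorted xs" by (simp add: xs_def)
 have ne: "xs \<noteq> []" using set_xs by auto
 have n: "n > 0" using ne by (simp add: n_def)
 have rng: "0 \<le> xs ! j" "xs ! j \<le> s" if "j < n" for j
  using nth_mem[of j xs] that set_xs J s by (auto simp: n_def)
 \<comment> \<open>The definition of Brownian motion asks for a monotone sequence of times indexed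
   by all of \<open>nat\<close>; it is constant \<open>s'\<close> from index \<open>n\<close>
   on.\<close>
 define t where "t = (\<lambda>j. if j < n then xs ! j else s')"
 have mono_t: "mono t"
 proof (rule monoI)
  fix a b :: nat assume "a \<le> b"
  then show "t a \<le> t b"
   using sorted_nth_mono[OF sorted, of a b] rng[of a] s by (auto simp: t_def n_def)
 qed
 have t0: "t 0 = 0"
 proof -
  obtain j where j: "j < n" "xs ! j = 0" using set_xs by (metis insertI1 in_set_conv_nth n_def)
  then show ?thesis
   using sorted_nth_mono[OF sorted, of 0 j] rng(1)[OF n] n by (simp add: t_def n_def)
 qed
 have tl: "t (n - 1) = s"
 proof -
  obtain j where j: "j < n" "xs ! j = s" using set_xs by (metis insertI1 insertI2 in_set_conv_nth n_def)
  then show ?thesis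
   using sorted_nth_mono[OF sorted, of j "n - 1"] rng(2)[of "n - 1"] n by (simp add: t_def n_def)
 qed
 have tpos: "0 \<le> t j" for j using monoD[OF mono_t, of 0 j] t0 by simp
 define X where "X = (\<lambda>m w. W (t (Suc m)) w - W (t m) w)"
 have Xm [measurable]: "X m \<in> borel_measurable M" for m
  unfolding X_def by (intro borel_measurable_diff Wm tpos)
 have "indep_vars (\<lambda>_. borel) X {..<n}"
  using W mono_t t0 unfolding std_brownian_motion_def X_def by auto
 then have iv: "indep_var (PiM {..<n-1} (\<lambda>_. borel)) (\<lambda>w. restrict (\<lambda>i. X i w) {..<n-1})
   (PiM {n-1} (\<lambda>_. borel)) (\<lambda>w. restrict (\<lambda>i. X i w) {n-1})"
  by (rule indep_var_restrict) (use n in auto)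
 have XD: "X (n - Suc 0) w = W s' w - W s w" for w
  using n tl by (simp add: X_def t_def)
 define ix where "ix = (\<lambda>r. SOME j. j < n \<and> xs ! j = r)"
 have ix: "ix r < n" "xs ! ix r = r" if "r \<in> J" for r
 proof -
  have "\<exists>j. j < n \<and> xs ! j = r" using that set_xs by (metis insertI2 in_set_conv_nth n_def)
  from someI_ex[OF this] show "ix r < n" "xs ! ix r = r" by (auto simp: ix_def)
 qed
 have W0: "AE w in M. W 0 w = 0" using W unfolding std_brownian_motion_def by blast
 define E where "E = {x \<in> space (PiM {..<n-1} ?b). \<forall>r\<in>J. (\<Sum>m<ix r. x m) \<in> A r}"
 have sum_in: "(\<lambda>x. \<Sum>m<ix r. x m) \<in> borel_measurable (PiM {..<n-1} ?b)" if "r \<in> J" for r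
  using ix(1)[OF that] by (intro borel_measurable_sum measurable_component_singleton) auto
 have Em: "E \<in> sets (PiM {..<n-1} (\<lambda>_. borel))"
  unfolding E_def using J(1)
 proof (rule sets.sets_Collect_finite_All[rotated])
  fix r assume "r \<in> J"
  then show "{x \<in> space (PiM {..<n-1} ?b). (\<Sum>m<ix r. x m) \<in> A r} \<in> sets (PiM {..<n-1} (\<lambda>_. borel))"
   using measurable_sets[OF sum_in A] by (simp add: vimage_def Int_def conj_commute)
 qed
 let ?R = "\<lambda>w. restrict (\<lambda>i. X i w) {..<n-1}" and ?R' = "\<lambda>w. restrict (\<lambda>i. X i w) {n-1}"
 let ?E' = "?R -` E \<inter> space M"
 have E'm: "?E' \<in> events" using measurable_sets[OF indep_var_rv1[OF iv] Em] .
 have D': "?R' -` {x \<in> space (PiM {n-1} ?b). x (n-1) \<in> D} \<inter> space M = ?I"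
  using XD by (auto simp: space_PiM)
 have D'm: "{x \<in> space (PiM {n-1} ?b). x (n-1) \<in> D} \<in> sets (PiM {n-1} (\<lambda>_. borel))"
  using measurable_sets[OF measurable_component_singleton[of "n-1" "{n-1}" "\<lambda>_. borel :: real measure"] D]
  by (simp add: vimage_def Int_def conj_commute)
 have Dev: "?I \<in> events"
  using measurable_sets[OF indep_var_rv2[OF iv] D'm] unfolding D' .
 have evm: "?C \<in> events"
  using J(1)
 proof (rule sets.sets_Collect_finite_All[rotated])
  fix r assume r: "r \<in> J"
  then have "0 \<le> r" using J by auto
  from measurable_sets[OF Wm[OF this] A[OF r]]
  show "{w \<in> space M. W r w \<in> A r} \<in> events" by (simp add: vimage_def Int_def conj_commute)
 qed
 \<comment> \<open>\<open>W 0\<close> vanishes only almost surely, so the cylinder event and its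
   description by increments agree up to a null set.\<close>
 have AEeq: "AE w in M. w \<in> ?C \<longleftrightarrow> w \<in> ?E'"
  using W0 AE_space
 proof eventually_elim
  case (elim w)
  have "W r w = (\<Sum>m<ix r. ?R w m)" if r: "r \<in> J" for r
  proof -
   have "(\<Sum>m<ix r. ?R w m) = (\<Sum>m<ix r. W (t (Suc m)) w - W (t m) w)"
    using ix(1)[OF r] by (intro sum.cong) (auto simp: X_def)
   also have "... = W (t (ix r)) w - W (t 0) w" by (rule sum_lessThan_telescope)
   also have "... = W r w" using ix[OF r] elim by (simp add: t0) (simp add: t_def)
   finally show ?thesis by simp
  qed
  then show ?case using elim by (auto simp: E_def space_PiM)
 qed
 have "prob (?C \<inter> ?I)
   = prob (?E' \<inter> ?I)"
  by (rule finite_measure_eq_AE) (use AEeq evm Dev E'm in auto)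
 also have "?E' \<inter> ?I
   = (\<lambda>x. (?R x, ?R' x)) -` (E \<times> {x \<in> space (PiM {n-1} ?b). x (n-1) \<in> D}) \<inter> space M"
  unfolding D'[symmetric] by auto
 also have "prob ... = prob ?E' * prob ?I"
  unfolding indep_varD[OF iv Em D'm] D' by simp
 also have "prob ?E' = prob ?C"
  by (rule finite_measure_eq_AE[symmetric]) (use AEeq evm E'm in auto)
 finally show ?thesis .
qed

section \<open>The driving noise\<close>

locale np_bbm_driven = prob_space M for M :: "'a measure" +
 fixes k :: nat and lam :: real and p :: "(nat \<times> nat) pmf" and N :: nat
  and Y :: "real => 'a => nat => ereal" and B :: "nat => real => 'a => real"
  and \<tau> :: "nat => 'a => real" and S :: "nat => 'a => nat set" and q :: "nat => 'a => nat \<times> nat"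
 assumes k: "2 \<le> k" "k \<le> N" and lam: "0 < lam" and p: "set_pmf p \<subseteq> mark_pairs k"
  and driven: "np_BBM_driven_by k lam p N M Y B \<tau> S q"
begin

abbreviation "evs \<equiv> source_events N M (Y 0) B \<tau> S q"

definition src_sigma :: "source set => 'a measure" where
 "src_sigma I = sigma (space M) (\<Union>i\<in>I. evs i)"

lemma N: "N > 0" using k by simp

lemma indep: "indep_sets evs (sources N)"
 using driven unfolding np_BBM_driven_by_def by blast

lemma ev_events: "i \<in> sources N ==> evs i \<subseteq> events"
 using indep unfolding indep_sets_def by blast

lemma ev_Pow: "evs i \<subseteq> Pow (space M)"
 by (cases i) (auto dest!: sets.sets_into_space)

lemma ev_Int_stable: "Int_stable (evs i)"
 by (cases i) (auto simp: Int_stable_def)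

lemma space_src_sigma [simp]: "space (src_sigma I) = space M"
 unfolding src_sigma_def using ev_Pow by (intro space_measure_of) auto

lemma sets_src_sigma: "sets (src_sigma I) = sigma_sets (space M) (\<Union>i\<in>I. evs i)"
 unfolding src_sigma_def using ev_Pow by (intro sets_measure_of) auto

lemma src_sigma_events: "I \<subseteq> sources N ==> sets (src_sigma I) \<subseteq> events"
 unfolding sets_src_sigma using ev_events by (intro sets.sigma_sets_subset) auto

lemma ev_src_sigma: "i \<in> I ==> evs i \<subseteq> sets (src_sigma I)"
 unfolding sets_src_sigma by (auto intro: sigma_sets.Basic)

lemma indep_src_sigma:
 assumes "I \<subseteq> sources N" "J \<subseteq> sources N" "I \<inter> J = {}" "A \<in> sets (src_sigma I)" "C \<in> sets (src_sigma J)"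
 shows "prob (A \<inter> C) = prob A * prob C"
proof -
 have "indep_sets (\<lambda>b. sigma_sets (space M) (\<Union>i\<in>case_bool I J b. evs i)) UNIV"
  by (rule indep_sets_collect_sigma)
    (use assms in \<open>auto intro!: indep_sets_mono_index[OF _ indep] ev_Int_stable
     simp: disjoint_family_on_def split: bool.splits\<close>)
 then have "indep_set (sets (src_sigma I)) (sets (src_sigma J))"
  unfolding indep_set_def sets_src_sigma
  by (rule arg_cong[where f="\<lambda>F. indep_sets F UNIV", THEN iffD1, rotated]) (auto simp: fun_eq_iff split: bool.split)
 then show ?thesis using assms unfolding indep_sets2_eq by blast
qed

lemma measurable_src:
 assumes f: "f \<in> space M \<rightarrow> space E" and sub: "sets (vimage_algebra (space M) f E) \<subseteq> sets F" and sp: "space F = space M"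
 shows "f \<in> measurable F E"
proof (rule measurableI)
 show "f x \<in> space E" if "x \<in> space F" for x using f that sp by auto
 fix A assume "A \<in> sets E"
 then have "f -` A \<inter> space M \<in> sets (vimage_algebra (space M) f E)" by (rule in_vimage_algebra)
 then show "f -` A \<inter> space F \<in> sets F" using sub sp by auto
qed

lemma measurable_clock: "Clock n \<in> I ==> \<tau> n \<in> borel_measurable (src_sigma I)"
 by (rule measurable_src) (use ev_src_sigma[of "Clock n" I] in auto)

lemma measurable_subset: "Subset n \<in> I ==> S n \<in> measurable (src_sigma I) (count_space UNIV)"
 by (rule measurable_src) (use ev_src_sigma[of "Subset n" I] in auto)

lemma measurable_pair: "Pair n \<in> I ==> q n \<in> measurable (src_sigma I) (count_space UNIV)"
 by (rule measurable_src) (use ev_src_sigma[of "Pair n" I] in auto)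

lemma measurable_motion:
 assumes "Motion i \<in> I" "0 \<le> t" shows "B i t \<in> borel_measurable (src_sigma I)"
proof -
 have "(\<lambda>w. \<lambda>t\<in>{0..}. B i t w) \<in> measurable (src_sigma I) (Pi\<^sub>M {0..} (\<lambda>_. borel))"
  by (rule measurable_src) (use ev_src_sigma[OF assms(1)] in \<open>auto simp: space_PiM\<close>)
 from measurable_compose[OF this measurable_component_singleton[of t]] assms(2)
 show ?thesis by simp
qed

lemma measurable_initial:
 assumes "Initial \<in> I" "i \<in> {1..N}" shows "(\<lambda>w. Y 0 w i) \<in> borel_measurable (src_sigma I)"
proof -
 have "(\<lambda>w. restrict (Y 0 w) {1..N}) \<in> measurable (src_sigma I) (Pi\<^sub>M {1..N} (\<lambda>_. borel))"
  by (rule measurable_src) (use ev_src_sigma[OF assms(1)] in \<open>auto simp: space_PiM\<close>)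
 from measurable_compose[OF this measurable_component_singleton[OF assms(2)]] assms(2)
 show ?thesis by simp
qed

lemma measurable_src_sigma_M: "f \<in> measurable (src_sigma I) E ==> I \<subseteq> sources N ==> f \<in> measurable M E"
 using src_sigma_events[of I] unfolding measurable_def by auto

lemma brownian: "i \<in> {1..N} ==> std_brownian_motion M (B i)"
 using driven unfolding np_BBM_driven_by_def by blast

definition rate :: real where "rate = lam * real N"

lemma rate: "rate > 0" using lam N by (simp add: rate_def)

lemma clock_distributed: "distributed M lborel (\<tau> n) (exponential_density rate)"
 using driven unfolding np_BBM_driven_by_def rate_def by blast

text \<open>
 \<open>past_sigma i s\<close> contains the whole noise except the increments of the \<open>i\<close>-th Brownian motion
 after time \<open>s\<close>.
\<close>

definition past_gen :: "nat => real => 'a set set" where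
 "past_gen i s = {C \<inter> {w \<in> space M. \<forall>r\<in>J. B i r w \<in> A r} | C J A.
   C \<in> sets (src_sigma (sources N - {Motion i})) \<and> finite J \<and> J \<subseteq> {0..s} \<and> (\<forall>r\<in>J. A r \<in> sets borel)}"

definition past_sigma :: "nat => real => 'a measure" where
 "past_sigma i s = sigma (space M) (past_gen i s)"

lemma past_gen_Pow: "past_gen i s \<subseteq> Pow (space M)"
 unfolding past_gen_def by auto

lemma space_past_sigma [simp]: "space (past_sigma i s) = space M"
 unfolding past_sigma_def using past_gen_Pow by (rule space_measure_of)

lemma sets_past_sigma: "sets (past_sigma i s) = sigma_sets (space M) (past_gen i s)"
 unfolding past_sigma_def using past_gen_Pow by (rule sets_measure_of)

lemma cylinder_measurable:
 assumes "finite J" "\<And>r. r \<in> J ==> B i r \<in> borel_measurable F" "\<And>r. r \<in> J ==> A r \<in> sets borel" "space F = space M"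
 shows "{w \<in> space M. \<forall>r\<in>J. B i r w \<in> A r} \<in> sets F"
 unfolding assms(4)[symmetric] using assms(1)
proof (rule sets.sets_Collect_finite_All[rotated])
 fix r assume "r \<in> J"
 from measurable_sets[OF assms(2,3)[OF this]]
 show "{w \<in> space F. B i r w \<in> A r} \<in> sets F" by (simp add: vimage_def Int_def conj_commute)
qed

lemma past_gen_Int_stable: "Int_stable (past_gen i s)"
proof (rule Int_stableI)
 fix a b assume "a \<in> past_gen i s" "b \<in> past_gen i s"
 then obtain C J A C' J' A' where a: "a = C \<inter> {w \<in> space M. \<forall>r\<in>J. B i r w \<in> A r}"
   "C \<in> sets (src_sigma (sources N - {Motion i}))" "finite J" "J \<subseteq> {0..s}" "\<forall>r\<in>J. A r \<in> sets borel"
  and b: "b = C' \<inter> {w \<in> space M. \<forall>r\<in>J'. B i r w \<in> A' r}"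
   "C' \<in> sets (src_sigma (sources N - {Motion i}))" "finite J'" "J' \<subseteq> {0..s}" "\<forall>r\<in>J'. A' r \<in> sets borel"
  unfolding past_gen_def by blast
 let ?A = "\<lambda>r. (if r \<in> J then A r else UNIV) \<inter> (if r \<in> J' then A' r else UNIV)"
 have "a \<inter> b = (C \<inter> C') \<inter> {w \<in> space M. \<forall>r\<in>J \<union> J'. B i r w \<in> ?A r}"
  unfolding a b by auto
 moreover have "C \<inter> C' \<in> sets (src_sigma (sources N - {Motion i}))" using a b by auto
 moreover have "\<forall>r\<in>J \<union> J'. ?A r \<in> sets borel" using a b by auto
 ultimately show "a \<inter> b \<in> past_gen i s"
  unfolding past_gen_def using a(3,4) b(3,4)
  by (intro CollectI exI[of _ "C \<inter> C'"] exI[of _ "J \<union> J'"] exI[of _ ?A]) auto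
qed

lemma motion_source: "i \<in> {1..N} ==> Motion i \<in> sources N"
 by (auto simp: sources_def)

lemma past_gen_events: assumes i: "i \<in> {1..N}" shows "past_gen i s \<subseteq> events"
proof
 fix a assume "a \<in> past_gen i s"
 then obtain C J A where a: "a = C \<inter> {w \<in> space M. \<forall>r\<in>J. B i r w \<in> A r}"
   "C \<in> sets (src_sigma (sources N - {Motion i}))" "finite J" "J \<subseteq> {0..s}" "\<forall>r\<in>J. A r \<in> sets borel"
  unfolding past_gen_def by blast
 have "B i r \<in> borel_measurable M" if "r \<in> J" for r
  using that a(4) i by (intro measurable_src_sigma_M[OF measurable_motion[of i "{Motion i}"]]) (auto simp: motion_source)
 then have "{w \<in> space M. \<forall>r\<in>J. B i r w \<in> A r} \<in> events"
  using a by (intro cylinder_measurable) auto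
 moreover have "C \<in> events" using a(2) src_sigma_events[of "sources N - {Motion i}"] by auto
 ultimately show "a \<in> events" using a by auto
qed

lemma past_sigma_events: "i \<in> {1..N} ==> sets (past_sigma i s) \<subseteq> events"
 unfolding sets_past_sigma using past_gen_events by (intro sets.sigma_sets_subset)

lemma src_sigma_past_sigma: "I \<subseteq> sources N - {Motion i} ==> sets (src_sigma I) \<subseteq> sets (past_sigma i s)"
proof
 fix C assume I: "I \<subseteq> sources N - {Motion i}" and C: "C \<in> sets (src_sigma I)"
 have "sets (src_sigma I) \<subseteq> sets (src_sigma (sources N - {Motion i}))"
  unfolding sets_src_sigma using I by (intro sigma_sets_mono') auto
 then have "C \<in> past_gen i s"
  unfolding past_gen_def using C sets.sets_into_space[OF C]
  by (intro CollectI exI[of _ C] exI[of _ "{}"]) (auto simp: Int_absorb2)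
 then show "C \<in> sets (past_sigma i s)"
  unfolding sets_past_sigma by (rule sigma_sets.Basic)
qed

lemma measurable_src_past:
 "f \<in> measurable (src_sigma I) E ==> I \<subseteq> sources N - {Motion i} ==> f \<in> measurable (past_sigma i s) E"
 using src_sigma_past_sigma[of I i s] unfolding measurable_def by auto

lemma measurable_motion_past:
 assumes "0 \<le> r" "r \<le> s" shows "B i r \<in> borel_measurable (past_sigma i s)"
proof (rule measurableI)
 fix A :: "real set" assume A: "A \<in> sets borel"
 have "space M \<in> sets (src_sigma (sources N - {Motion i}))"
  using sets.top[of "src_sigma (sources N - {Motion i})"] by simp
 then have "B i r -` A \<inter> space M \<in> past_gen i s"
  unfolding past_gen_def using A assms
  by (intro CollectI exI[of _ "space M"] exI[of _ "{r}"] exI[of _ "\<lambda>_. A"]) auto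
 then show "B i r -` A \<inter> space (past_sigma i s) \<in> sets (past_sigma i s)"
  unfolding sets_past_sigma by (auto intro: sigma_sets.Basic)
qed simp

text \<open>On the generating intersections, \<open>C\<close> is independent of the whole path of
  \<open>B i\<close>, and the cylinder event of that path is independent of the increment; stability
  under intersections extends this to the generated sigma-algebra.\<close>

lemma increment_indep_past_sigma:
 assumes i: "i \<in> {1..N}" and s: "0 \<le> s" "s < s'" and A: "A \<in> sets (past_sigma i s)" and D: "D \<in> sets borel"
 shows "prob (A \<inter> ((\<lambda>w. B i s' w - B i s w) -` D \<inter> space M)) = prob A * prob ((\<lambda>w. B i s' w - B i s w) -` D \<inter> space M)"
proof -
 let ?X = "\<lambda>w. B i s' w - B i s w"
 let ?G = "{?X -` D \<inter> space M | D. D \<in> sets borel}"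
 have Bm: "B i r \<in> borel_measurable (src_sigma {Motion i})" if "0 \<le> r" for r
  using that by (intro measurable_motion) auto
 have Xm: "?X \<in> borel_measurable (src_sigma {Motion i})"
  using s by (intro borel_measurable_diff Bm) auto
 have G: "?G \<subseteq> sets (src_sigma {Motion i})"
  using measurable_sets[OF Xm] by auto
 have GE: "?G \<subseteq> events" using G src_sigma_events[of "{Motion i}"] motion_source[OF i] by auto
 have "indep_set (sigma_sets (space M) (past_gen i s)) (sigma_sets (space M) ?G)"
 proof (rule indep_set_sigma_sets[OF _ past_gen_Int_stable])
  show "Int_stable ?G"
  proof (rule Int_stableI)
   fix a b assume "a \<in> ?G" "b \<in> ?G"
   then obtain D D' where "a = ?X -` D \<inter> space M" "D \<in> sets borel" "b = ?X -` D' \<inter> space M" "D' \<in> sets borel" by blast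
   then show "a \<inter> b \<in> ?G" by (intro CollectI exI[of _ "D \<inter> D'"]) auto
  qed
  show "indep_set (past_gen i s) ?G"
   unfolding indep_sets2_eq
  proof (intro conjI ballI past_gen_events[OF i] GE)
   fix a b assume "a \<in> past_gen i s" "b \<in> ?G"
   then obtain C J A D where a: "a = C \<inter> {w \<in> space M. \<forall>r\<in>J. B i r w \<in> A r}"
     "C \<in> sets (src_sigma (sources N - {Motion i}))" "finite J" "J \<subseteq> {0..s}" "\<forall>r\<in>J. A r \<in> sets borel"
    and b: "b = ?X -` D \<inter> space M" "D \<in> sets borel"
    unfolding past_gen_def by blast
   let ?E = "{w \<in> space M. \<forall>r\<in>J. B i r w \<in> A r}"
   have E: "?E \<in> sets (src_sigma {Motion i})"
    using a by (intro cylinder_measurable Bm) auto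
   have bG: "b \<in> sets (src_sigma {Motion i})" using G b by auto
   have sub: "sources N - {Motion i} \<subseteq> sources N" "{Motion i} \<subseteq> sources N" "(sources N - {Motion i}) \<inter> {Motion i} = {}"
    using motion_source[OF i] by auto
   have "prob (a \<inter> b) = prob (C \<inter> (?E \<inter> b))" unfolding a by (simp add: Int_assoc)
   also have "... = prob C * prob (?E \<inter> b)"
    by (rule indep_src_sigma[OF sub a(2)]) (use E bG in auto)
   also have "prob (?E \<inter> b) = prob ?E * prob b"
   proof -
    have "b = {w \<in> space M. B i s' w - B i s w \<in> D}" unfolding b by auto
    then show ?thesis
     using increments_indep_past[OF brownian[OF i] s a(3,4) _ b(2)] a(5) by simp
   qed
   also have "prob C * (prob ?E * prob b) = prob (C \<inter> ?E) * prob b"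
    using indep_src_sigma[OF sub a(2) E] by simp
   finally show "prob (a \<inter> b) = prob a * prob b" by (simp add: a(1))
  qed
 qed
 then show ?thesis
  using A D unfolding indep_sets2_eq sets_past_sigma by (blast intro: sigma_sets.Basic)
qed

text \<open>The increment after \<open>s\<close> is replaced by a scaled standard Gaussian that is
  integrated pointwise; this is how \<open>heat\<close> enters the particle system.\<close>

lemma increment_integral:
 fixes f :: "'a \<times> real => real"
 assumes i: "i \<in> {1..N}" and s: "0 \<le> s" "s < s'" and f: "f \<in> borel_measurable (past_sigma i s \<Otimes>\<^sub>M borel)" and b: "\<And>x. \<bar>f x\<bar> \<le> C"
 shows "(\<integral>w. f (w, B i s' w - B i s w) \<partial>M) = (\<integral>w. (\<integral>z. f (w, sqrt (s' - s) * z) \<partial>gauss) \<partial>M)"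
proof -
 let ?X = "\<lambda>w. B i s' w - B i s w"
 have dX: "distributed M lborel ?X (normal_density 0 (sqrt (s' - s)))"
  using brownian[OF i] s unfolding std_brownian_motion_def by blast
 then have X: "?X \<in> borel_measurable M" by (auto simp: distributed_def)
 have "distr M borel ?X = distr M lborel ?X" by (rule distr_cong) auto
 also have "... = density lborel (normal_density 0 (sqrt (s' - s)))" using dX by (simp add: distributed_def)
 also have "... = distr gauss borel (\<lambda>z. sqrt (s' - s) * z)"
  using gauss_distr_scale[of "sqrt (s' - s)"] s by simp
 finally have law: "distr M borel ?X = distr gauss borel (\<lambda>z. sqrt (s' - s) * z)" .
 have "(\<integral>w. f (w, ?X w) \<partial>M) = (\<integral>w. (\<integral>y. f (w, y) \<partial>distr M borel ?X) \<partial>M)"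
  by (rule indep_integral[OF space_past_sigma past_sigma_events[OF i] X increment_indep_past_sigma[OF i s] f b])
 also have "... = (\<integral>w. (\<integral>z. f (w, sqrt (s' - s) * z) \<partial>gauss) \<partial>M)"
  unfolding law
 proof (rule Bochner_Integration.integral_cong[OF refl])
  fix w assume "w \<in> space M"
  then have "(\<lambda>y. f (w, y)) \<in> borel_measurable borel"
   using measurable_Pair2[OF f, of w] by simp
  then show "(\<integral>y. f (w, y) \<partial>distr gauss borel (\<lambda>z. sqrt (s' - s) * z)) = (\<integral>z. f (w, sqrt (s' - s) * z) \<partial>gauss)"
   by (intro integral_distr) auto
 qed
 finally show ?thesis .
qed

end

section \<open>Dependence of ranks and jumps on the configuration\<close>

lemma quantile_cong: "(\<And>j. j \<in> {1..N} ==> z j = \<xi> j) ==> i \<in> {1..N} ==> quantile N z i = quantile N \<xi> i"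
 unfolding quantile_def by (intro arg_cong[where f=card] Collect_cong) auto

lemma label_of_quantile_cong:
 assumes "\<And>j. j \<in> {1..N} ==> z j = \<xi> j" shows "label_of_quantile N z m = label_of_quantile N \<xi> m"
 unfolding label_of_quantile_def using quantile_cong[OF assms]
 by (intro arg_cong[where f=The] ext) auto

lemma jump_cong:
 assumes eq: "\<And>j. j \<in> {1..N} ==> z j = \<xi> j" and A: "A \<in> k_subsets N k" and ij: "ij \<in> mark_pairs k" and i: "i \<in> {1..N}"
 shows "jump N A ij z i = jump N A ij \<xi> i"
proof -
 have "nth_elem A (snd ij) \<in> {1..N}" using nth_elem_mem(2)[OF A] ij by (auto simp: mark_pairs_def)
 then have "label_of_quantile N \<xi> (nth_elem A (snd ij)) \<in> {1..N}" by (rule label_of_quantile(1))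
 moreover have "label_of_quantile N z m = label_of_quantile N \<xi> m" for m
  by (rule label_of_quantile_cong[OF eq])
 ultimately show ?thesis using eq i by (simp add: jump_def)
qed

lemma measurable_quantile:
 assumes W: "\<And>i. i \<in> {1..N} ==> (\<lambda>w. W w i) \<in> borel_measurable F" and a: "a \<in> {1..N}"
 shows "(\<lambda>w. quantile N (W w) a) \<in> measurable F (count_space UNIV)"
proof -
 have eq: "quantile N (W w) a = (\<Sum>j\<in>{1..N}. if W w j < W w a \<or> (W w j = W w a \<and> j \<le> a) then 1 else 0)" for w
  unfolding quantile_def by (subst sum.inter_filter[symmetric]) auto
 note [measurable] = W[OF a]
 have [measurable]: "(\<lambda>w. if W w j < W w a \<or> (W w j = W w a \<and> j \<le> a) then 1 else 0 :: nat) \<in> measurable F (count_space UNIV)"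
  if "j \<in> {1..N}" for j
 proof -
  note [measurable] = W[OF that]
  show ?thesis by measurable
 qed
 show ?thesis
  unfolding eq by (intro measurable_sum_nat) auto
qed

lemma measurable_label:
 assumes W: "\<And>i. i \<in> {1..N} ==> (\<lambda>w. W w i) \<in> borel_measurable F" and m: "m \<in> {1..N}"
 shows "(\<lambda>w. label_of_quantile N (W w) m) \<in> measurable F (count_space {1..N})"
proof (rule measurable_count_space_eq_countable[THEN iffD2, rotated], intro conjI allI impI ballI)
 show "(\<lambda>w. label_of_quantile N (W w) m) \<in> space F \<rightarrow> {1..N}"
  using label_of_quantile(1)[OF m] by auto
 fix a assume a: "a \<in> {1..N}"
 have eq: "(\<lambda>w. label_of_quantile N (W w) m) -` {a} \<inter> space F = (\<lambda>w. quantile N (W w) a) -` {m} \<inter> space F"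
 proof -
  have "label_of_quantile N (W w) m = a \<longleftrightarrow> quantile N (W w) a = m" for w
   using label_of_quantile[OF m, of "W w"] a quantile_bij[of N "W w"] unfolding bij_betw_def inj_on_def by metis
  then show ?thesis by auto
 qed
 show "(\<lambda>w. label_of_quantile N (W w) m) -` {a} \<inter> space F \<in> sets F"
 proof -
  have "(\<lambda>w. quantile N (W w) a) \<in> measurable F (count_space UNIV)" by (rule measurable_quantile[OF W a])
  from measurable_sets[OF this, of "{m}"] eq show ?thesis by simp
 qed
qed auto

lemma measurable_jump:
 assumes W: "\<And>i. i \<in> {1..N} ==> (\<lambda>w. W w i) \<in> borel_measurable F" and i: "i \<in> {1..N}"
  and A: "A \<in> measurable F (count_space (k_subsets N k))" and ij: "ij \<in> measurable F (count_space (mark_pairs k))"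
 shows "(\<lambda>w. jump N (A w) (ij w) (W w) i) \<in> borel_measurable F"
proof -
 have fixed: "(\<lambda>w. jump N A ij (W w) i) \<in> borel_measurable F" if A: "A \<in> k_subsets N k" and ij: "ij \<in> mark_pairs k" for A ij
 proof -
  have a: "nth_elem A (fst ij) \<in> {1..N}" and b: "nth_elem A (snd ij) \<in> {1..N}"
   using nth_elem_mem(2)[OF A] ij by (auto simp: mark_pairs_def)
  have la: "(\<lambda>w. label_of_quantile N (W w) (nth_elem A (fst ij))) \<in> measurable F (count_space UNIV)"
   using measurable_compose[OF measurable_label[OF W a] measurable_count_space] by simp
  have lb: "(\<lambda>w. W w (label_of_quantile N (W w) (nth_elem A (snd ij)))) \<in> borel_measurable F"
   by (rule measurable_compose_countable'[OF W measurable_label[OF W b]]) auto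
  note [measurable] = la lb W[OF i]
  show ?thesis unfolding jump_def fun_upd_def by measurable
 qed
 have "(\<lambda>w. jump N A (ij w) (W w) i) \<in> borel_measurable F" if A: "A \<in> k_subsets N k" for A
  by (rule measurable_compose_countable'[OF fixed[OF A] ij]) (auto intro: countable_finite)
 then show ?thesis
  by (rule measurable_compose_countable'[OF _ A]) (auto intro: countable_finite)
qed

section \<open>Clocks, jump times and the memoryless property\<close>

context np_bbm_driven
begin

abbreviation "T \<equiv> jump_time \<tau>"

lemma T_0 [simp]: "T 0 w = 0" by (simp add: jump_time_def)

lemma T_Suc: "T (Suc n) w = T n w + \<tau> n w" by (simp add: jump_time_def)

lemma T_measurable:
 assumes "\<And>m. m < n ==> \<tau> m \<in> borel_measurable F" shows "T n \<in> borel_measurable F"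
 unfolding jump_time_def[abs_def] using assms by (intro borel_measurable_sum) auto

lemma clock_source: "Clock n \<in> sources N" by (auto simp: sources_def)

lemma tau_measurable [measurable]: "\<tau> n \<in> borel_measurable M"
 by (rule measurable_src_sigma_M[OF measurable_clock[of n "{Clock n}"]]) (auto simp: clock_source)

lemma T_measurable_M [measurable]: "T n \<in> borel_measurable M"
 by (rule T_measurable) simp

lemma tau_gt: "0 \<le> a ==> prob {w \<in> space M. a < \<tau> n w} = exp (- a * rate)"
 using exponential_distributedD_gt[OF clock_distributed _ rate] by simp

lemma tau_pos: "AE w in M. \<forall>n. 0 < \<tau> n w"
proof (subst AE_all_countable, intro allI)
 fix n
 have "prob {w \<in> space M. 0 < \<tau> n w} = 1" using tau_gt[of 0 n] by simp
 then show "AE w in M. 0 < \<tau> n w" by (rule prob_Collect_eq_1[THEN iffD1, rotated]) measurable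
qed

lemma clock_indep:
 assumes I: "I \<subseteq> sources N" "Clock n \<notin> I" and A: "A \<in> sets (src_sigma I)" and D: "D \<in> sets borel"
 shows "prob (A \<inter> (\<tau> n -` D \<inter> space M)) = prob A * prob (\<tau> n -` D \<inter> space M)"
proof (rule indep_src_sigma[OF I(1), of "{Clock n}"])
 show "\<tau> n -` D \<inter> space M \<in> sets (src_sigma {Clock n})"
  using measurable_sets[OF measurable_clock[of n "{Clock n}"] D] by simp
qed (use I A in \<open>auto simp: clock_source\<close>)

lemma clock_integral:
 fixes f :: "'a \<times> real => real"
 assumes I: "I \<subseteq> sources N" "Clock n \<notin> I" and f: "f \<in> borel_measurable (src_sigma I \<Otimes>\<^sub>M borel)" and b: "\<And>x. \<bar>f x\<bar> \<le> C"
 shows "(\<integral>w. f (w, \<tau> n w) \<partial>M) = (\<integral>w. (\<integral>y. f (w, y) \<partial>distr M borel (\<tau> n)) \<partial>M)"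
 by (rule indep_integral[OF space_src_sigma src_sigma_events[OF I(1)] tau_measurable clock_indep[OF I] f b])

text \<open>\<open>exp (- T n)\<close> has mean at most \<open>\<rho>^n\<close> by independence of
  the clocks, so Markov's inequality bounds the probability that all jump times stay below
  \<open>m\<close> by \<open>exp m * \<rho>^n\<close>, for every \<open>n\<close>.\<close>

lemma T_unbounded: "AE w in M. \<forall>s. \<exists>n. s < T n w"
proof -
 \<comment> \<open>A clock exceeds 1 with probability \<open>exp (- rate)\<close>, and then its
   exponential weight is at most \<open>exp (- 1)\<close>.\<close>
 define \<rho> where "\<rho> = 1 - (1 - exp (- 1)) * exp (- rate)"
 have \<rho>: "0 \<le> \<rho>" "\<rho> < 1"
 proof -
  have "(1 - exp (- 1)) * exp (- rate) \<le> 1 * (1::real)" using rate by (intro mult_mono) auto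
  then show "0 \<le> \<rho>" by (simp add: \<rho>_def)
  have "0 < (1 - exp (- 1)) * exp (- rate :: real)" by simp
  then show "\<rho> < 1" by (simp add: \<rho>_def)
 qed
 \<comment> \<open>Truncation at 0 bounds the weight by 1 everywhere; positivity of the clocks is
   only almost sure.\<close>
 let ?e = "\<lambda>x::real. exp (- max 0 x)"
 have e1: "\<bar>?e x\<bar> \<le> 1" for x by simp
 have c: "(\<integral>w. ?e (\<tau> n w) \<partial>M) \<le> \<rho>" for n
 proof -
  have "(\<integral>w. ?e (\<tau> n w) \<partial>M) \<le> (\<integral>w. 1 - (1 - exp (- 1)) * indicator {w \<in> space M. 1 < \<tau> n w} w \<partial>M)"
   by (rule integral_mono)
     (auto intro!: integrable_const_bound[where B=1] simp: indicator_def split: if_splits)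
  also have "... = 1 - (1 - exp (- 1)) * prob {w \<in> space M. 1 < \<tau> n w}"
  proof -
   have "integrable M (indicator {w \<in> space M. 1 < \<tau> n w} :: _ => real)"
    by (rule integrable_const_bound[where B=1]) (auto simp: indicator_def)
   then show ?thesis
    by (subst Bochner_Integration.integral_diff) (auto simp: prob_space)
  qed
  also have "... = \<rho>" using tau_gt[of 1 n] by (simp add: \<rho>_def)
  finally show ?thesis .
 qed
 have E: "(\<integral>w. ?e (T n w) \<partial>M) \<le> \<rho> ^ n" for n
 proof (induction n)
  case (Suc n)
  have Tn: "T n \<in> borel_measurable (src_sigma (Clock ` {..<n}))"
   by (intro T_measurable measurable_clock) auto
  note [measurable] = Tn
  have "(\<integral>w. ?e (T (Suc n) w) \<partial>M) = (\<integral>w. ?e (T n w) * ?e (\<tau> n w) \<partial>M)"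
  proof (rule integral_cong_AE)
   show "AE w in M. ?e (T (Suc n) w) = ?e (T n w) * ?e (\<tau> n w)"
    using tau_pos
   proof eventually_elim
    case (elim w)
    have "0 \<le> T n w" unfolding jump_time_def using elim by (intro sum_nonneg) (auto intro: less_imp_le)
    then show ?case using elim[rule_format, of n] by (simp add: T_Suc exp_add[symmetric] del: exp_add)
   qed
  qed simp_all
  also have "... = (\<integral>w. (\<integral>y. ?e (T n w) * ?e y \<partial>distr M borel (\<tau> n)) \<partial>M)"
   using clock_integral[of "Clock ` {..<n}" n "\<lambda>(w, y). ?e (T n w) * ?e y" 1]
   by (simp add: image_subset_iff clock_source image_iff split_beta' abs_mult mult_le_one)
  also have "... = (\<integral>w. ?e (T n w) \<partial>M) * (\<integral>w. ?e (\<tau> n w) \<partial>M)"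
   by (simp add: integral_distr)
  also have "... \<le> \<rho> ^ n * \<rho>"
   using c[of n] Suc \<rho> by (intro mult_mono) (auto intro!: integral_nonneg)
  finally show ?case by (simp add: mult.commute)
 qed (simp add: prob_space)
 have z: "AE w in M. \<exists>n. real m < T n w" for m :: nat
 proof -
  let ?A = "{w \<in> space M. \<forall>n. T n w \<le> real m}"
  have Am: "?A \<in> events" by measurable
  have "prob ?A \<le> exp (real m) * \<rho> ^ n" for n
  proof -
   have "prob ?A * exp (- real m) = (\<integral>w. exp (- real m) * indicator ?A w \<partial>M)"
    using Am by simp
   also have "... \<le> (\<integral>w. ?e (T n w) \<partial>M)"
    by (rule integral_mono)
      (use Am in \<open>auto intro!: integrable_const_bound[where B=1] simp: indicator_def split: if_splits\<close>)
   also have "... \<le> \<rho> ^ n" by (rule E)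
   finally show ?thesis by (simp add: exp_minus field_simps)
  qed
  moreover have "(\<lambda>n. exp (real m) * \<rho> ^ n) \<longlonglongrightarrow> exp (real m) * 0"
   by (intro tendsto_intros LIMSEQ_realpow_zero \<rho>)
  ultimately have "prob ?A \<le> exp (real m) * 0"
   by (intro LIMSEQ_le_const[of "\<lambda>n. exp (real m) * \<rho> ^ n"]) auto
  then have "prob ?A = 0" using measure_nonneg[of M ?A] by simp
  then have "AE w in M. w \<notin> ?A" using Am by (simp add: prob_eq_0)
  then show ?thesis using AE_space by eventually_elim (auto simp: not_le)
 qed
 have "AE w in M. \<forall>m::nat. \<exists>n. real m < T n w" using z by (simp add: AE_all_countable)
 then show ?thesis
 proof eventually_elim
  case (elim w)
  show ?case
  proof
   fix s
   obtain m :: nat where "s \<le> real m" using real_arch_simple by blast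
   then show "\<exists>n. s < T n w" using elim[rule_format, of m] by (auto intro: le_less_trans)
  qed
 qed
qed

definition jump_prob :: "real => real" where "jump_prob d = 1 - exp (- rate * d)"

lemma jump_prob_bounds: "0 \<le> d ==> 0 \<le> jump_prob d" "0 \<le> d ==> jump_prob d \<le> rate * d" "jump_prob d \<le> 1"
 using rate exp_ge_add_one_self[of "- rate * d"] by (auto simp: jump_prob_def)

lemma exponential_window:
 assumes "0 \<le> a" "0 \<le> d"
 shows "(\<integral>y. of_bool (a < y \<and> y \<le> a + d) \<partial>distr M borel (\<tau> n)) = jump_prob d * (\<integral>y. of_bool (a < y) \<partial>distr M borel (\<tau> n) :: real)"
proof -
 have gt: "(\<integral>y. of_bool (a < y) \<partial>distr M borel (\<tau> n)) = (exp (- a * rate) :: real)" if "0 \<le> a" for a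
 proof -
  have "(\<integral>y. of_bool (a < y) \<partial>distr M borel (\<tau> n)) = (\<integral>w. of_bool (a < \<tau> n w) \<partial>M :: real)"
   by (rule integral_distr) auto
  also have "... = (\<integral>w. indicator {w \<in> space M. a < \<tau> n w} w \<partial>M)"
   by (intro Bochner_Integration.integral_cong) (auto simp: indicator_def)
  also have "... = exp (- a * rate)" using tau_gt[OF that, of n] by simp
  finally show ?thesis .
 qed
 interpret D: prob_space "distr M borel (\<tau> n)" by (rule prob_space_distr) simp
 have "(\<integral>y. of_bool (a < y \<and> y \<le> a + d) \<partial>distr M borel (\<tau> n)) = (\<integral>y. of_bool (a < y) - of_bool (a + d < y) \<partial>distr M borel (\<tau> n) :: real)"
  by (intro Bochner_Integration.integral_cong) (use assms in auto)
 also have "... = exp (- a * rate) - exp (- (a + d) * rate)"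
  using gt[of a] gt[of "a + d"] assms
  by (subst Bochner_Integration.integral_diff) (auto intro!: D.integrable_const_bound[where B=1])
 also have "... = jump_prob d * exp (- a * rate)"
  by (simp add: jump_prob_def algebra_simps exp_add[symmetric])
 finally show ?thesis using gt[OF assms(1)] by simp
qed

text \<open>The statement is unnormalised, so no conditional probabilities occur. \<open>X\<close>
  may involve all of the noise except the running clock, including the marks attached to its ring;
  the proof freezes everything but that clock.\<close>

lemma memoryless:
 assumes X: "X \<in> borel_measurable (src_sigma (sources N - {Clock n}))" and b: "\<And>w. \<bar>X w\<bar> \<le> C" and s: "0 \<le> s" "s \<le> s'"
 shows "(\<integral>w. X w * of_bool (T n w \<le> s \<and> s < T (Suc n) w \<and> T (Suc n) w \<le> s') \<partial>M)
  = jump_prob (s' - s) * (\<integral>w. X w * of_bool (T n w \<le> s \<and> s < T (Suc n) w) \<partial>M)"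
proof -
 let ?I = "sources N - {Clock n}"
 note [measurable] = X
 have Tn [measurable]: "T n \<in> borel_measurable (src_sigma ?I)"
  by (intro T_measurable measurable_clock) (auto simp: clock_source)
 have I: "?I \<subseteq> sources N" "Clock n \<notin> ?I" by auto
 have C: "0 \<le> C" using order_trans[OF abs_ge_zero b] .
 have 1: "(\<integral>w. X w * of_bool (T n w \<le> s \<and> s < T (Suc n) w \<and> T (Suc n) w \<le> s') \<partial>M)
   = (\<integral>w. (\<integral>y. X w * of_bool (T n w \<le> s \<and> s < T n w + y \<and> T n w + y \<le> s') \<partial>distr M borel (\<tau> n)) \<partial>M)"
  using clock_integral[OF I, of "\<lambda>(w, y). X w * of_bool (T n w \<le> s \<and> s < T n w + y \<and> T n w + y \<le> s')" C] b C
  by (auto simp: T_Suc abs_mult split_beta')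
 have 2: "(\<integral>w. X w * of_bool (T n w \<le> s \<and> s < T (Suc n) w) \<partial>M)
   = (\<integral>w. (\<integral>y. X w * of_bool (T n w \<le> s \<and> s < T n w + y) \<partial>distr M borel (\<tau> n)) \<partial>M)"
  using clock_integral[OF I, of "\<lambda>(w, y). X w * of_bool (T n w \<le> s \<and> s < T n w + y)" C] b C
  by (auto simp: T_Suc abs_mult split_beta')
 have 3: "(\<integral>y. X w * of_bool (T n w \<le> s \<and> s < T n w + y \<and> T n w + y \<le> s') \<partial>distr M borel (\<tau> n))
   = jump_prob (s' - s) * (\<integral>y. X w * of_bool (T n w \<le> s \<and> s < T n w + y) \<partial>distr M borel (\<tau> n))" for w
 proof (cases "T n w \<le> s")
  case True
  have "(s < T n w + y \<and> T n w + y \<le> s') = (s - T n w < y \<and> y \<le> (s - T n w) + (s' - s))" "(s < T n w + y) = (s - T n w < y)" for y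
   by auto
  then show ?thesis
   using exponential_window[of "s - T n w" "s' - s" n] True s by simp
 qed simp
 show ?thesis unfolding 1 2 3 by simp
qed

end

lemma measurable_order_stat:
 assumes W: "\<And>i. i \<in> {1..N} ==> (\<lambda>w. W w i) \<in> borel_measurable F" and m: "m \<in> {1..N}"
 shows "(\<lambda>w. order_stat N (W w) m) \<in> borel_measurable F"
 unfolding order_stat_def
 by (rule measurable_compose_countable'[OF W measurable_label[OF W m]]) auto

lemma ceiling_dyadic_tendsto: "(\<lambda>l. real_of_int \<lceil>r * 2 ^ l\<rceil> / 2 ^ l) \<longlonglongrightarrow> r"
proof -
 have "(\<lambda>l. (1 / 2) ^ l) \<longlonglongrightarrow> (0::real)" by (intro LIMSEQ_realpow_zero) auto
 then have "(\<lambda>l. real_of_int \<lceil>r * 2 ^ l\<rceil> / 2 ^ l - r) \<longlonglongrightarrow> 0"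
 proof (rule Lim_null_comparison[rotated], intro always_eventually allI)
  fix l :: nat
  have "\<bar>real_of_int \<lceil>r * 2 ^ l\<rceil> - r * 2 ^ l\<bar> \<le> 1" by linarith
  then have "\<bar>real_of_int \<lceil>r * 2 ^ l\<rceil> - r * 2 ^ l\<bar> / 2 ^ l \<le> 1 / 2 ^ l" by (rule divide_right_mono) simp
  moreover have "real_of_int \<lceil>r * 2 ^ l\<rceil> / 2 ^ l - r = (real_of_int \<lceil>r * 2 ^ l\<rceil> - r * 2 ^ l) / 2 ^ l"
   by (simp add: diff_divide_distrib)
  ultimately show "norm (real_of_int \<lceil>r * 2 ^ l\<rceil> / 2 ^ l - r) \<le> (1 / 2) ^ l"
   by (simp add: power_divide abs_divide)
 qed
 then show ?thesis by (simp add: Lim_null[symmetric])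
qed

context np_bbm_driven
begin

section \<open>The configuration as a function of the noise\<close>

text \<open>
 \<open>Bm i s r\<close> is a version of \<open>B i r\<close>, for \<open>r \<le> s\<close>, that is jointly measurable in time and randomness and
 depends only on the path up to time \<open>s\<close>; it permits evaluation of the path at jump times.
\<close>

definition Bm :: "nat => real => real => 'a => real" where
 "Bm i s r w = lim (\<lambda>l. B i (max 0 (min s (real_of_int \<lceil>r * 2 ^ l\<rceil> / 2 ^ l))) w)"

lemma Bm_measurable:
 assumes "\<And>r. 0 \<le> r ==> r \<le> s ==> B i r \<in> borel_measurable F" and s: "0 \<le> s"
 shows "(\<lambda>x. Bm i s (fst x) (snd x)) \<in> borel_measurable (borel \<Otimes>\<^sub>M F)"
 unfolding Bm_def
proof (rule borel_measurable_lim_metric)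
 fix l :: nat
 have "(\<lambda>x. B i (max 0 (min s (real_of_int j / 2 ^ l))) (snd x)) \<in> borel_measurable ((borel :: real measure) \<Otimes>\<^sub>M F)" for j :: int
  by (rule measurable_compose[OF measurable_snd]) (use s in \<open>auto intro: assms(1)\<close>)
 moreover have "(\<lambda>x. \<lceil>(fst x :: real) * 2 ^ l\<rceil>) \<in> measurable ((borel :: real measure) \<Otimes>\<^sub>M F) (count_space UNIV)"
  by measurable
 ultimately show "(\<lambda>x. B i (max 0 (min s (real_of_int \<lceil>(fst x :: real) * 2 ^ l\<rceil> / 2 ^ l))) (snd x)) \<in> borel_measurable (borel \<Otimes>\<^sub>M F)"
  by (rule measurable_compose_countable)
qed

lemma Bm_eq:
 assumes c: "continuous_on {0..} (\<lambda>t. B i t w)" and r: "0 \<le> r" "r \<le> s"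
 shows "Bm i s r w = B i r w"
proof -
 have "(\<lambda>l. max 0 (min s (real_of_int \<lceil>r * 2 ^ l\<rceil> / 2 ^ l))) \<longlonglongrightarrow> max 0 (min s r)"
  by (intro tendsto_intros ceiling_dyadic_tendsto)
 then have "(\<lambda>l. max 0 (min s (real_of_int \<lceil>r * 2 ^ l\<rceil> / 2 ^ l))) \<longlonglongrightarrow> r" using r by simp
 then have "(\<lambda>l. B i (max 0 (min s (real_of_int \<lceil>r * 2 ^ l\<rceil> / 2 ^ l))) w) \<longlonglongrightarrow> B i r w"
  by (rule continuous_on_tendsto_compose[OF c]) (use r in auto)
 then show ?thesis unfolding Bm_def by (rule limI)
qed

text \<open>Marks are admissible only almost surely. The default values, here \<open>{1..k}\<close>
  and below the pair \<open>(1, 2)\<close>, make every statement about jumps valid at each sample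
  point and confine the marks to finite sets.\<close>

definition S' :: "nat => 'a => nat set" where
 "S' n w = (if S n w \<in> k_subsets N k then S n w else {1..k})"

definition q' :: "nat => 'a => nat \<times> nat" where
 "q' n w = (if q n w \<in> mark_pairs k then q n w else (1, 2))"

lemma S'_mem: "S' n w \<in> k_subsets N k"
 using k by (auto simp: S'_def k_subsets_def)

lemma q'_mem: "q' n w \<in> mark_pairs k"
 using k by (auto simp: q'_def mark_pairs_def)

lemma S'_measurable:
 assumes "S n \<in> measurable F (count_space UNIV)"
 shows "S' n \<in> measurable F (count_space (k_subsets N k))"
proof (rule measurable_count_space_eq_countable[THEN iffD2, rotated], intro conjI ballI)
 show "S' n \<in> space F \<rightarrow> k_subsets N k" using S'_mem by auto
 fix A assume A: "A \<in> k_subsets N k"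
 have "S' n -` {A} \<inter> space F = S n -` (if A = {1..k} then insert A (- k_subsets N k) else {A}) \<inter> space F"
 proof (intro set_eqI)
  fix w show "w \<in> S' n -` {A} \<inter> space F \<longleftrightarrow> w \<in> S n -` (if A = {1..k} then insert A (- k_subsets N k) else {A}) \<inter> space F"
   using A by (cases "S n w \<in> k_subsets N k") (simp_all add: S'_def, auto)
 qed
 then show "S' n -` {A} \<inter> space F \<in> sets F" using measurable_sets[OF assms] by simp
qed (auto intro: countable_finite)

lemma q'_measurable:
 assumes "q n \<in> measurable F (count_space UNIV)"
 shows "q' n \<in> measurable F (count_space (mark_pairs k))"
proof (rule measurable_count_space_eq_countable[THEN iffD2, rotated], intro conjI ballI)
 show "q' n \<in> space F \<rightarrow> mark_pairs k" using q'_mem by auto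
 fix A assume A: "A \<in> mark_pairs k"
 have "q' n -` {A} \<inter> space F = q n -` (if A = (1, 2) then insert A (- mark_pairs k) else {A}) \<inter> space F"
 proof (intro set_eqI)
  fix w show "w \<in> q' n -` {A} \<inter> space F \<longleftrightarrow> w \<in> q n -` (if A = (1, 2) then insert A (- mark_pairs k) else {A}) \<inter> space F"
   using A by (cases "q n w \<in> mark_pairs k") (simp_all add: q'_def, auto)
 qed
 then show "q' n -` {A} \<inter> space F \<in> sets F" using measurable_sets[OF assms] by simp
qed (auto intro: countable_finite)

text \<open>The configuration right after \<open>n\<close> jumps, computed with Brownian paths up to
  time \<open>s\<close> only; it is the true one if those jumps have happened by time
  \<open>s\<close>.\<close>

primrec Z :: "real => nat => 'a => nat => ereal" where
 "Z s 0 w = Y 0 w"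
| "Z s (Suc n) w = jump N (S' n w) (q' n w) (\<lambda>i. Z s n w i + ereal (Bm i s (T (Suc n) w) w - Bm i s (T n w) w))"

definition Yn :: "real => nat => 'a => nat => ereal" where
 "Yn s n w i = Z s n w i + ereal (B i s w - Bm i s (T n w) w)"

text \<open>The number of jumps up to time \<open>s\<close>; with the strict inequality a jump
  exactly at \<open>s\<close> is counted, in line with the configuration after a jump being the one
  at the jump time.\<close>

definition cnt :: "real => 'a => nat" where
 "cnt s w = (LEAST n. s < T (Suc n) w)"

text \<open>\<open>Y\<close> is tied to its driving noise by an almost sure identity and is assumed
  measurable only with respect to \<open>M\<close>. \<open>Yhat\<close> equals it almost surely on
  the labels \<open>{1..N}\<close> and is measurable with respect to the noise it is built from, as
  the independence arguments require.\<close>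

definition Yhat :: "real => 'a => nat => ereal" where
 "Yhat s w i = Yn s (cnt s w) w i"

lemma Bm_T_measurable:
 assumes "\<And>r. 0 \<le> r ==> r \<le> s ==> B i r \<in> borel_measurable F" and s: "0 \<le> s"
  and T: "\<And>m. m < n ==> \<tau> m \<in> borel_measurable F"
 shows "(\<lambda>w. Bm i s (T n w) w) \<in> borel_measurable F"
proof -
 have "(\<lambda>w. (T n w, w)) \<in> measurable F (borel \<Otimes>\<^sub>M F)"
  using T_measurable[OF T] by measurable
 from measurable_compose[OF this Bm_measurable[OF assms(1) s]] show ?thesis by simp
qed

lemma Z_measurable:
 assumes s: "0 \<le> s" and Y0: "\<And>i. i \<in> {1..N} ==> (\<lambda>w. Y 0 w i) \<in> borel_measurable F"
  and B: "\<And>i r. i \<in> {1..N} ==> 0 \<le> r ==> r \<le> s ==> B i r \<in> borel_measurable F"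
  and tau: "\<And>m. m < n ==> \<tau> m \<in> borel_measurable F"
  and S: "\<And>m. m < n ==> S m \<in> measurable F (count_space UNIV)"
  and q: "\<And>m. m < n ==> q m \<in> measurable F (count_space UNIV)"
  and i: "i \<in> {1..N}"
 shows "(\<lambda>w. Z s n w i) \<in> borel_measurable F"
 using tau S q i
proof (induction n arbitrary: i)
 case 0
 then show ?case using Y0 by simp
next
 case (Suc n)
 have "(\<lambda>w. Z s n w j + ereal (Bm j s (T (Suc n) w) w - Bm j s (T n w) w)) \<in> borel_measurable F" if "j \<in> {1..N}" for j
  by (intro borel_measurable_ereal_add borel_measurable_ereal borel_measurable_diff
    Suc.IH[OF _ _ _ that] Bm_T_measurable[OF B[OF that] s]) (use Suc.prems in auto)
 then show ?case
  unfolding Z.simps using Suc.prems by (intro measurable_jump[where k=k] S'_measurable q'_measurable) auto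
qed

lemma Yn_measurable:
 assumes s: "0 \<le> s" and Y0: "\<And>i. i \<in> {1..N} ==> (\<lambda>w. Y 0 w i) \<in> borel_measurable F"
  and B: "\<And>i r. i \<in> {1..N} ==> 0 \<le> r ==> r \<le> s ==> B i r \<in> borel_measurable F"
  and tau: "\<And>m. m < n ==> \<tau> m \<in> borel_measurable F"
  and S: "\<And>m. m < n ==> S m \<in> measurable F (count_space UNIV)"
  and q: "\<And>m. m < n ==> q m \<in> measurable F (count_space UNIV)"
  and i: "i \<in> {1..N}"
 shows "(\<lambda>w. Yn s n w i) \<in> borel_measurable F"
 unfolding Yn_def
 by (intro borel_measurable_ereal_add borel_measurable_ereal borel_measurable_diff B Bm_T_measurable Z_measurable Y0 tau S q)
   (use s i in auto)

lemma cnt_measurable: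
 assumes tau: "\<And>m. \<tau> m \<in> borel_measurable F"
 shows "cnt s \<in> measurable F (count_space UNIV)"
proof -
 have [measurable]: "T m \<in> borel_measurable F" for m by (rule T_measurable[OF tau])
 show ?thesis unfolding cnt_def[abs_def] by measurable
qed

lemma Yhat_measurable:
 assumes s: "0 \<le> s" and Y0: "\<And>i. i \<in> {1..N} ==> (\<lambda>w. Y 0 w i) \<in> borel_measurable F"
  and B: "\<And>i r. i \<in> {1..N} ==> 0 \<le> r ==> r \<le> s ==> B i r \<in> borel_measurable F"
  and tau: "\<And>m. \<tau> m \<in> borel_measurable F"
  and S: "\<And>m. S m \<in> measurable F (count_space UNIV)"
  and q: "\<And>m. q m \<in> measurable F (count_space UNIV)"
  and i: "i \<in> {1..N}"
 shows "(\<lambda>w. Yhat s w i) \<in> borel_measurable F"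
 unfolding Yhat_def
 by (rule measurable_compose_countable[OF Yn_measurable[OF s Y0 B tau S q i] cnt_measurable[OF tau]])

lemma source_memI [simp]: "Initial \<in> sources N" "Clock n \<in> sources N" "Subset n \<in> sources N" "Pair n \<in> sources N"
 "i \<in> {1..N} ==> Motion i \<in> sources N"
 by (auto simp: sources_def)

lemma Yhat_past_measurable:
 assumes s: "0 \<le> s" and j: "j \<in> {1..N}" and i: "i \<in> {1..N}"
 shows "(\<lambda>w. Yhat s w j) \<in> borel_measurable (past_sigma i s)"
proof (rule Yhat_measurable[OF s _ _ _ _ _ j])
 let ?I = "sources N - {Motion i}"
 show "(\<lambda>w. Y 0 w j) \<in> borel_measurable (past_sigma i s)" if "j \<in> {1..N}" for j
  by (rule measurable_src_past[OF measurable_initial[OF _ that, of ?I]]) auto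
 show "B j r \<in> borel_measurable (past_sigma i s)" if "j \<in> {1..N}" "0 \<le> r" "r \<le> s" for j r
 proof (cases "j = i")
  case True
  then show ?thesis using that by (simp add: measurable_motion_past)
 next
  case False
  then show ?thesis
   by (intro measurable_src_past[OF measurable_motion[of j ?I]]) (use that in auto)
 qed
 show "\<tau> m \<in> borel_measurable (past_sigma i s)" for m
  by (rule measurable_src_past[OF measurable_clock[of m ?I]]) auto
 show "S m \<in> measurable (past_sigma i s) (count_space UNIV)" for m
  by (rule measurable_src_past[OF measurable_subset[of m ?I]]) auto
 show "q m \<in> measurable (past_sigma i s) (count_space UNIV)" for m
  by (rule measurable_src_past[OF measurable_pair[of m ?I]]) auto
qed

lemma B_measurable_M: "i \<in> {1..N} ==> 0 \<le> r ==> B i r \<in> borel_measurable M"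
 using brownian unfolding std_brownian_motion_def by blast

lemma Y_measurable_M: "i \<in> {1..N} ==> 0 \<le> t ==> (\<lambda>w. Y t w i) \<in> borel_measurable M"
 using driven unfolding np_BBM_driven_by_def by blast

lemma S_measurable_M [measurable]: "S n \<in> measurable M (count_space UNIV)"
 by (rule measurable_src_sigma_M[OF measurable_subset[of n "{Subset n}"]]) auto

lemma q_measurable_M [measurable]: "q n \<in> measurable M (count_space UNIV)"
 by (rule measurable_src_sigma_M[OF measurable_pair[of n "{Pair n}"]]) auto

lemma cnt_measurable_M [measurable]: "cnt s \<in> measurable M (count_space UNIV)"
 by (rule cnt_measurable) simp

lemma Yhat_measurable_M: "0 \<le> s ==> i \<in> {1..N} ==> (\<lambda>w. Yhat s w i) \<in> borel_measurable M"
 by (rule Yhat_measurable) (auto intro: Y_measurable_M B_measurable_M)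

text \<open>All almost sure properties of the noise and of the path in one predicate, so that the
  comparison of \<open>Yhat\<close> with \<open>Y\<close> and the analysis of a cell are
  pathwise.\<close>

definition good :: "'a => bool" where
 "good w \<longleftrightarrow> (\<forall>i\<in>{1..N}. continuous_on {0..} (\<lambda>t. B i t w)) \<and> (\<forall>n. 0 < \<tau> n w) \<and> (\<forall>s. \<exists>n. s < T n w) \<and>
   (\<forall>n. S n w \<in> k_subsets N k \<and> q n w \<in> mark_pairs k) \<and>
   (\<forall>n. \<forall>i\<in>{1..N}.
    (\<forall>t. T n w \<le> t \<and> t < T (Suc n) w \<longrightarrow> Y t w i = Y (T n w) w i + ereal (B i t w - B i (T n w) w)) \<and>
    Y (T (Suc n) w) w i = jump N (S n w) (q n w) (\<lambda>i. Y (T n w) w i + ereal (B i (T (Suc n) w) w - B i (T n w) w)) i)"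

lemma distr_S: "distr M (count_space UNIV) (S n) = measure_pmf (pmf_of_set (k_subsets N k))"
 using driven unfolding np_BBM_driven_by_def k_subsets_def by blast

lemma distr_q: "distr M (count_space UNIV) (q n) = measure_pmf p"
 using driven unfolding np_BBM_driven_by_def by blast

lemma k_subsets_ne: "k_subsets N k \<noteq> {}"
 using S'_mem by blast

lemma good_AE: "AE w in M. good w"
proof -
 have "AE w in M. continuous_on {0..} (\<lambda>t. B i t w)" if "i \<in> {1..N}" for i
  using brownian[OF that] unfolding std_brownian_motion_def by blast
 then have 1: "AE w in M. \<forall>i\<in>{1..N}. continuous_on {0..} (\<lambda>t. B i t w)"
  by (intro AE_finite_allI) auto
 have S: "AE w in M. S n w \<in> k_subsets N k" for n
 proof -
  have "AE A in distr M (count_space UNIV) (S n). A \<in> k_subsets N k"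
   unfolding distr_S by (auto simp: AE_measure_pmf_iff set_pmf_of_set[OF k_subsets_ne])
  then show ?thesis by (subst (asm) AE_distr_iff) auto
 qed
 have q: "AE w in M. q n w \<in> mark_pairs k" for n
 proof -
  have "AE A in distr M (count_space UNIV) (q n). A \<in> mark_pairs k"
   unfolding distr_q using p by (auto simp: AE_measure_pmf_iff)
  then show ?thesis by (subst (asm) AE_distr_iff) auto
 qed
 have 2: "AE w in M. \<forall>n. S n w \<in> k_subsets N k \<and> q n w \<in> mark_pairs k"
  using S q by (subst AE_all_countable) auto
 have 3: "AE w in M. \<forall>n. \<forall>i\<in>{1..N}.
    (\<forall>t. T n w \<le> t \<and> t < T (Suc n) w \<longrightarrow> Y t w i = Y (T n w) w i + ereal (B i t w - B i (T n w) w)) \<and>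
    Y (T (Suc n) w) w i = jump N (S n w) (q n w) (\<lambda>i. Y (T n w) w i + ereal (B i (T (Suc n) w) w - B i (T n w) w)) i"
  using driven unfolding np_BBM_driven_by_def Let_def by blast
 show ?thesis
  unfolding good_def using 1 2 3 tau_pos T_unbounded by eventually_elim blast
qed

lemma good_T_mono:
 assumes g: "good w" and "m \<le> n" shows "T m w \<le> T n w"
 using assms(2)
proof (induction n rule: dec_induct)
 case (step n)
 have "0 < \<tau> n w" using g unfolding good_def by blast
 then show ?case using step by (simp add: T_Suc)
qed simp

lemma good_T_nonneg: "good w ==> 0 \<le> T n w"
 using good_T_mono[of w 0 n] by simp

lemma good_cnt:
 assumes g: "good w" and s: "0 \<le> s"
 shows "T (cnt s w) w \<le> s" "s < T (Suc (cnt s w)) w"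
proof -
 obtain n where "s < T n w" using g unfolding good_def by blast
 then have "s < T (Suc n) w" using good_T_mono[OF g, of n "Suc n"] by simp
 then show "s < T (Suc (cnt s w)) w" unfolding cnt_def by (rule LeastI)
 show "T (cnt s w) w \<le> s"
 proof (cases "cnt s w")
  case (Suc m)
  then have "m < (LEAST n. s < T (Suc n) w)" by (simp add: cnt_def)
  from not_less_Least[OF this] show ?thesis using Suc by simp
 qed (use s in simp)
qed

lemma good_cnt_eq:
 assumes g: "good w" and s: "0 \<le> s"
 shows "cnt s w = n \<longleftrightarrow> T n w \<le> s \<and> s < T (Suc n) w"
proof
 assume n: "T n w \<le> s \<and> s < T (Suc n) w"
 show "cnt s w = n"
 proof (rule ccontr)
  assume "cnt s w \<noteq> n"
  then consider "Suc (cnt s w) \<le> n" | "Suc n \<le> cnt s w" by linarith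
  then show False
   using good_cnt[OF g s] good_T_mono[OF g, of "Suc (cnt s w)" n] good_T_mono[OF g, of "Suc n" "cnt s w"] n
   by cases linarith+
 qed
qed (use good_cnt[OF g s] in auto)

lemma good_Z:
 assumes g: "good w" and s: "T n w \<le> s" and i: "i \<in> {1..N}"
 shows "Z s n w i = Y (T n w) w i"
 using s i
proof (induction n arbitrary: i)
 case (Suc n)
 have le: "T n w \<le> T (Suc n) w" by (rule good_T_mono[OF g]) simp
 have eq: "Z s n w j + ereal (Bm j s (T (Suc n) w) w - Bm j s (T n w) w)
   = Y (T n w) w j + ereal (B j (T (Suc n) w) w - B j (T n w) w)" if "j \<in> {1..N}" for j
 proof -
  have "continuous_on {0..} (\<lambda>t. B j t w)" using g that unfolding good_def by blast
  then show ?thesis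
   using Suc.IH[OF order_trans[OF le Suc.prems(1)] that] Bm_eq[of j w _ s] good_T_nonneg[OF g] Suc.prems(1) le by simp
 qed
 have SS: "S' n w = S n w" "q' n w = q n w" using g by (auto simp: good_def S'_def q'_def)
 have "Z s (Suc n) w i = jump N (S n w) (q n w) (\<lambda>i. Y (T n w) w i + ereal (B i (T (Suc n) w) w - B i (T n w) w)) i"
  unfolding Z.simps SS by (rule jump_cong[of N _ _ _ k]) (use eq g Suc.prems(2) in \<open>auto simp: good_def\<close>)
 also have "... = Y (T (Suc n) w) w i" using g Suc.prems(2) unfolding good_def by simp
 finally show ?case .
qed simp

lemma good_Yn:
 assumes g: "good w" and s: "T n w \<le> s" "s < T (Suc n) w" and i: "i \<in> {1..N}"
 shows "Yn s n w i = Y s w i"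
proof -
 have "continuous_on {0..} (\<lambda>t. B i t w)" using g i unfolding good_def by blast
 then have "Bm i s (T n w) w = B i (T n w) w" using good_T_nonneg[OF g] s by (intro Bm_eq) auto
 moreover have "Y s w i = Y (T n w) w i + ereal (B i s w - B i (T n w) w)"
  using g s i unfolding good_def by blast
 ultimately show ?thesis using good_Z[OF g s(1) i] by (simp add: Yn_def)
qed

lemma good_Yhat: "good w ==> 0 \<le> s ==> i \<in> {1..N} ==> Yhat s w i = Y s w i"
 unfolding Yhat_def by (intro good_Yn good_cnt)

end

section \<open>One time step\<close>

definition gm :: "nat => (ereal => real) => (nat => ereal) => real" where
 "gm N \<phi> z = (\<Sum>i=1..N. \<phi> (z i)) / real N"

text \<open>
 The squared error minus its diagonal part. Without the diagonal it is affine in every single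
 coordinate, so that Brownian motion acts on it through the heat semigroup on \<open>\<phi>\<close>.
\<close>

definition fm :: "nat => (ereal => real) => real => (nat => ereal) => real" where
 "fm N \<phi> u z = (gm N \<phi> z - u)\<^sup>2 - (\<Sum>i=1..N. (\<phi> (z i))\<^sup>2) / (real N)\<^sup>2"

definition mark_gain :: "nat => (ereal => real) => (nat => ereal) => nat set => nat \<times> nat => real" where
 "mark_gain N \<phi> z A ij = \<phi> (order_stat N z (nth_elem A (snd ij))) - \<phi> (order_stat N z (nth_elem A (fst ij)))"

locale step_test =
 fixes \<phi> :: "ereal => real" and N :: nat
 assumes \<phi>01: "\<And>y. 0 \<le> \<phi> y" "\<And>y. \<phi> y \<le> 1" and \<phi>_anti: "\<And>y y'. y \<le> y' ==> \<phi> y' \<le> \<phi> y"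
  and \<phi>_meas [measurable]: "\<phi> \<in> borel_measurable borel" and N_pos: "N > 0"
begin

lemma gm_01: "0 \<le> gm N \<phi> z" "gm N \<phi> z \<le> 1"
proof -
 show "0 \<le> gm N \<phi> z" unfolding gm_def using \<phi>01 by (intro divide_nonneg_nonneg sum_nonneg) auto
 have "(\<Sum>i=1..N. \<phi> (z i)) \<le> (\<Sum>i=1..N. 1)" using \<phi>01 by (intro sum_mono) auto
 then show "gm N \<phi> z \<le> 1" unfolding gm_def using N_pos by (simp add: divide_le_eq)
qed

lemma gm_u: "\<bar>gm N \<phi> z - u\<bar> \<le> 1 + \<bar>u\<bar>"
 using gm_01[of z] by (simp add: abs_le_iff) linarith

lemma diag_01: "0 \<le> (\<Sum>i=1..N. (\<phi> (z i))\<^sup>2) / (real N)\<^sup>2" "(\<Sum>i=1..N. (\<phi> (z i))\<^sup>2) / (real N)\<^sup>2 \<le> 1 / real N"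
proof -
 show "0 \<le> (\<Sum>i=1..N. (\<phi> (z i))\<^sup>2) / (real N)\<^sup>2" by (intro divide_nonneg_nonneg sum_nonneg) auto
 have "(\<Sum>i=1..N. (\<phi> (z i))\<^sup>2) \<le> (\<Sum>i=1..N. 1)" using \<phi>01 by (intro sum_mono power_le_one) auto
 then show "(\<Sum>i=1..N. (\<phi> (z i))\<^sup>2) / (real N)\<^sup>2 \<le> 1 / real N"
  using N_pos by (simp add: power2_eq_square divide_simps)
qed

lemma fm_bounds: "fm N \<phi> u z \<le> (1 + \<bar>u\<bar>)\<^sup>2" "- 1 \<le> fm N \<phi> u z"
proof -
 have "(gm N \<phi> z - u)\<^sup>2 \<le> (1 + \<bar>u\<bar>)\<^sup>2" using gm_u[of z u] by (simp add: abs_le_square_iff[symmetric])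
 then show "fm N \<phi> u z \<le> (1 + \<bar>u\<bar>)\<^sup>2" using diag_01(1)[of z] by (simp add: fm_def)
 have "1 / real N \<le> 1" using N_pos by simp
 then show "- 1 \<le> fm N \<phi> u z" using diag_01(2)[of z] zero_le_power2[of "gm N \<phi> z - u"] unfolding fm_def by linarith
qed

lemma mark_gain_abs: "\<bar>mark_gain N \<phi> z A ij\<bar> \<le> 1"
 using \<phi>01[of "order_stat N z (nth_elem A (snd ij))"] \<phi>01[of "order_stat N z (nth_elem A (fst ij))"]
 by (simp add: mark_gain_def abs_le_iff)

text \<open>\<open>c\<close> and \<open>c'\<close> are the displacements before and after the jump.
  Compared with the same motion without the jump, the mean \<open>gm\<close> changes by some
  \<open>R\<close> of modulus at most \<open>1 / N\<close>, so the square changes by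
  \<open>2 * (gm - u) * R + R^2\<close>. Both factors of the mixed term are frozen at the
  configuration \<open>z\<close> at the start of the cell, at a cost proportional to the total
  displacement \<open>osc\<close>; \<open>R^2\<close> and the change of the diagonal give
  \<open>2 / N^2\<close>.\<close>

lemma jump_effect:
 fixes c c' :: "nat => real"
 assumes lip: "\<And>y d. \<bar>\<phi> (y + ereal d) - \<phi> y\<bar> \<le> \<Lambda> * \<bar>d\<bar>" and \<Lambda>: "0 \<le> \<Lambda>"
  and A: "A \<in> k_subsets N k" and ij: "ij \<in> mark_pairs k"
 defines "osc \<equiv> (\<Sum>i=1..N. min 1 (\<Lambda> * \<bar>c i\<bar>)) + (\<Sum>i=1..N. min 1 (\<Lambda> * \<bar>c' i\<bar>))"
 shows "fm N \<phi> u (\<lambda>i. jump N A ij (\<lambda>i. z i + ereal (c i)) i + ereal (c' i))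
  \<le> fm N \<phi> u (\<lambda>i. z i + ereal (c i + c' i)) + 2 / real N * ((gm N \<phi> z - u) * mark_gain N \<phi> z A ij)
   + 2 / (real N)\<^sup>2 + (6 + 4 * \<bar>u\<bar>) * osc"
proof -
 let ?\<xi> = "\<lambda>i. z i + ereal (c i)"
 let ?a = "nth_elem A (fst ij)" and ?b = "nth_elem A (snd ij)"
 let ?new = "\<lambda>i. jump N A ij ?\<xi> i + ereal (c' i)" and ?base = "\<lambda>i. ?\<xi> i + ereal (c' i)"
 have a: "?a \<in> {1..N}" and b: "?b \<in> {1..N}"
  using nth_elem_mem(2)[OF A] ij by (auto simp: mark_pairs_def)
 obtain l where l: "l \<in> {1..N}" and sj: "\<And>\<phi>. (\<Sum>i=1..N. \<phi> (?new i)) - (\<Sum>i=1..N. \<phi> (?base i) :: real)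
   = \<phi> (order_stat N ?\<xi> ?b + ereal (c' l)) - \<phi> (order_stat N ?\<xi> ?a + ereal (c' l))"
  using sum_jump[OF a b] by blast
 have osc0: "0 \<le> osc" unfolding osc_def using \<Lambda> by (intro add_nonneg_nonneg sum_nonneg) auto
 \<comment> \<open>If \<open>osc < 1\<close>, no minimum takes the value 1 and the displacements are
   genuinely small. Otherwise the bounds below hold because \<open>\<phi>\<close> lies between 0 and
   1; this is why the displacements may be capped.\<close>
 have small: "\<Lambda> * \<bar>c i\<bar> \<le> osc" "\<Lambda> * \<bar>c' i\<bar> \<le> osc" "\<Lambda> * (\<Sum>i=1..N. \<bar>c i\<bar>) + \<Lambda> * \<bar>c' i\<bar> \<le> osc" if "osc < 1" "i \<in> {1..N}" for i
 proof -
  have t0: "0 \<le> min 1 (\<Lambda> * \<bar>d\<bar>)" for d using \<Lambda> by simp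
  have 1: "min 1 (\<Lambda> * \<bar>c j\<bar>) \<le> (\<Sum>i=1..N. min 1 (\<Lambda> * \<bar>c i\<bar>))" if "j \<in> {1..N}" for j
   by (rule member_le_sum[OF that]) (use t0 in auto)
  have 2: "min 1 (\<Lambda> * \<bar>c' j\<bar>) \<le> (\<Sum>i=1..N. min 1 (\<Lambda> * \<bar>c' i\<bar>))" if "j \<in> {1..N}" for j
   by (rule member_le_sum[OF that]) (use t0 in auto)
  have 3: "0 \<le> (\<Sum>i=1..N. min 1 (\<Lambda> * \<bar>c i\<bar>))" "0 \<le> (\<Sum>i=1..N. min 1 (\<Lambda> * \<bar>c' i\<bar>))"
   using t0 by (auto intro!: sum_nonneg)
  have m: "min 1 (\<Lambda> * \<bar>c j\<bar>) = \<Lambda> * \<bar>c j\<bar>" "min 1 (\<Lambda> * \<bar>c' j\<bar>) = \<Lambda> * \<bar>c' j\<bar>" if "j \<in> {1..N}" for j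
   using 1[OF that] 2[OF that] 3 \<open>osc < 1\<close> unfolding osc_def by linarith+
  have "\<Lambda> * (\<Sum>i=1..N. \<bar>c i\<bar>) = (\<Sum>i=1..N. min 1 (\<Lambda> * \<bar>c i\<bar>))"
   unfolding sum_distrib_left by (intro sum.cong refl) (simp add: m)
  then show "\<Lambda> * (\<Sum>i=1..N. \<bar>c i\<bar>) + \<Lambda> * \<bar>c' i\<bar> \<le> osc" "\<Lambda> * \<bar>c i\<bar> \<le> osc" "\<Lambda> * \<bar>c' i\<bar> \<le> osc"
   using 1[OF that(2)] 2[OF that(2)] 3 m[OF that(2)] unfolding osc_def by linarith+
 qed
 have os: "\<bar>\<phi> (order_stat N ?\<xi> m + ereal (c' l)) - \<phi> (order_stat N z m)\<bar> \<le> osc" if m: "m \<in> {1..N}" for m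
 proof (cases "osc < 1")
  case True
  have "\<bar>\<phi> (order_stat N ?\<xi> m) - \<phi> (order_stat N z m)\<bar> \<le> \<Lambda> * (\<Sum>i=1..N. \<bar>c i\<bar>)"
   by (rule order_stat_Lipschitz[OF m _ \<phi>_anti lip]) (auto intro!: member_le_sum)
  moreover have "\<bar>\<phi> (order_stat N ?\<xi> m + ereal (c' l)) - \<phi> (order_stat N ?\<xi> m)\<bar> \<le> \<Lambda> * \<bar>c' l\<bar>" by (rule lip)
  ultimately show ?thesis using small(3)[OF True l] by linarith
 next
  case False
  then show ?thesis using \<phi>01[of "order_stat N ?\<xi> m + ereal (c' l)"] \<phi>01[of "order_stat N z m"] by (simp add: abs_le_iff)
 qed
 have gb: "\<bar>gm N \<phi> ?base - gm N \<phi> z\<bar> \<le> osc"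
 proof (cases "osc < 1")
  case True
  have t0: "0 \<le> min 1 (\<Lambda> * \<bar>d\<bar>)" for d using \<Lambda> by simp
  have "\<bar>\<phi> (?base i) - \<phi> (z i)\<bar> \<le> osc" if "i \<in> {1..N}" for i
  proof -
   have "\<bar>\<phi> (?base i) - \<phi> (?\<xi> i)\<bar> \<le> \<Lambda> * \<bar>c' i\<bar>" "\<bar>\<phi> (?\<xi> i) - \<phi> (z i)\<bar> \<le> \<Lambda> * \<bar>c i\<bar>" by (rule lip)+
   moreover have "\<Lambda> * \<bar>c i\<bar> \<le> \<Lambda> * (\<Sum>i=1..N. \<bar>c i\<bar>)"
    using \<Lambda> that by (intro mult_left_mono member_le_sum) auto
   ultimately show ?thesis using small(3)[OF True that] by linarith
  qed
  then have "(\<Sum>i=1..N. \<bar>\<phi> (?base i) - \<phi> (z i)\<bar>) \<le> (\<Sum>i=1..N. osc)" by (intro sum_mono) auto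
  then have "(\<Sum>i=1..N. \<bar>\<phi> (?base i) - \<phi> (z i)\<bar>) \<le> real N * osc" by simp
  moreover have "\<bar>gm N \<phi> ?base - gm N \<phi> z\<bar> \<le> (\<Sum>i=1..N. \<bar>\<phi> (?base i) - \<phi> (z i)\<bar>) / real N"
   unfolding gm_def diff_divide_distrib[symmetric] sum_subtractf[symmetric] abs_divide abs_of_nat
   by (rule divide_right_mono[OF sum_abs]) simp
  ultimately show ?thesis using N_pos by (simp add: divide_le_eq mult.commute) (smt (verit) mult.commute pos_divide_le_eq of_nat_0_less_iff)
 next
  case False
  then show ?thesis using gm_01[of ?base] gm_01[of z] by (simp add: abs_le_iff)
 qed
 define R where "R = gm N \<phi> ?new - gm N \<phi> ?base"
 define P where "P = mark_gain N \<phi> z A ij"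
 have RN: "real N * R = \<phi> (order_stat N ?\<xi> ?b + ereal (c' l)) - \<phi> (order_stat N ?\<xi> ?a + ereal (c' l))"
  using sj[of \<phi>] N_pos by (simp add: R_def gm_def diff_divide_distrib[symmetric])
 have R1: "\<bar>real N * R\<bar> \<le> 1"
  unfolding RN using \<phi>01[of "order_stat N ?\<xi> ?b + ereal (c' l)"] \<phi>01[of "order_stat N ?\<xi> ?a + ereal (c' l)"] by (simp add: abs_le_iff)
 have RP: "\<bar>real N * R - P\<bar> \<le> 2 * osc"
  using os[OF a] os[OF b] unfolding RN P_def mark_gain_def by linarith
 have diag: "\<bar>(\<Sum>i=1..N. (\<phi> (?new i))\<^sup>2) - (\<Sum>i=1..N. (\<phi> (?base i))\<^sup>2)\<bar> \<le> 1"
 proof -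
  have "0 \<le> (\<phi> y)\<^sup>2" "(\<phi> y)\<^sup>2 \<le> 1" for y using \<phi>01 by (auto intro: power_le_one)
  then show ?thesis unfolding sj[of "\<lambda>y. (\<phi> y)\<^sup>2"] by (smt (verit))
 qed
 let ?gb = "gm N \<phi> ?base - u" and ?g = "gm N \<phi> z - u"
 have N1: "real N \<ge> 1" using N_pos by simp
 have "fm N \<phi> u ?new = fm N \<phi> u ?base + 2 * ?gb * R + R\<^sup>2 - ((\<Sum>i=1..N. (\<phi> (?new i))\<^sup>2) - (\<Sum>i=1..N. (\<phi> (?base i))\<^sup>2)) / (real N)\<^sup>2"
 proof -
  have "gm N \<phi> ?new - u = ?gb + R" by (simp add: R_def)
  then show ?thesis unfolding fm_def by (simp only: power2_sum diff_divide_distrib)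
 qed
 moreover have "- ((\<Sum>i=1..N. (\<phi> (?new i))\<^sup>2) - (\<Sum>i=1..N. (\<phi> (?base i))\<^sup>2)) / (real N)\<^sup>2 \<le> 1 / (real N)\<^sup>2"
  using diag by (intro divide_right_mono) auto
 moreover have "R\<^sup>2 \<le> 1 / (real N)\<^sup>2"
 proof -
  have "(real N * R)\<^sup>2 \<le> 1\<^sup>2" using R1 by (simp only: abs_le_square_iff[symmetric] abs_one)
  then show ?thesis using N_pos by (simp add: power_mult_distrib field_simps)
 qed
 moreover have "2 * ?gb * R \<le> 2 / real N * (?g * P) + (6 + 4 * \<bar>u\<bar>) * osc"
 proof -
  have "?gb * (real N * R) - ?g * P = (gm N \<phi> ?base - gm N \<phi> z) * (real N * R) + ?g * (real N * R - P)"
   by (simp add: algebra_simps)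
  also have "... \<le> \<bar>(gm N \<phi> ?base - gm N \<phi> z) * (real N * R)\<bar> + \<bar>?g * (real N * R - P)\<bar>" by linarith
  also have "... \<le> osc * 1 + (1 + \<bar>u\<bar>) * (2 * osc)"
   unfolding abs_mult using gb R1 RP gm_u[of z u] osc0 by (intro add_mono mult_mono) auto
  finally have "?gb * (real N * R) \<le> ?g * P + (3 + 2 * \<bar>u\<bar>) * osc" by (simp add: algebra_simps)
  then have "2 / real N * (?gb * (real N * R)) \<le> 2 / real N * (?g * P + (3 + 2 * \<bar>u\<bar>) * osc)"
   using N_pos by (intro mult_left_mono) auto
  moreover have "2 / real N * (?gb * (real N * R)) = 2 * ?gb * R" using N_pos by simp
  moreover have "2 / real N * ((3 + 2 * \<bar>u\<bar>) * osc) \<le> 2 * ((3 + 2 * \<bar>u\<bar>) * osc)"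
   using N1 osc0 by (intro mult_right_mono) (auto simp: divide_le_eq)
  ultimately show ?thesis by (simp add: algebra_simps)
 qed
 ultimately have "fm N \<phi> u ?new \<le> fm N \<phi> u ?base + 2 / real N * (?g * P) + 2 / (real N)\<^sup>2 + (6 + 4 * \<bar>u\<bar>) * osc"
  by (simp add: minus_divide_left[symmetric]) (simp add: diff_divide_distrib)
 moreover have "?base = (\<lambda>i. z i + ereal (c i + c' i))" by (simp add: add.assoc)
 ultimately show ?thesis by (simp add: P_def)
qed

end

section \<open>The number of jumps in a cell\<close>

context np_bbm_driven
begin

definition next_jump :: "real => 'a => real" where
 "next_jump s w = T (Suc (cnt s w)) w"

definition J1 :: "real => real => 'a => bool" where
 "J1 s s' w \<longleftrightarrow> next_jump s w \<le> s'"

definition J2 :: "real => real => 'a => bool" where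
 "J2 s s' w \<longleftrightarrow> T (Suc (Suc (cnt s w))) w \<le> s'"

lemma next_jump_measurable:
 assumes "\<And>m. \<tau> m \<in> borel_measurable F" shows "next_jump s \<in> borel_measurable F"
 unfolding next_jump_def[abs_def]
 by (rule measurable_compose_countable[OF T_measurable[OF assms] cnt_measurable[OF assms]])

lemma next_jump_measurable_M [measurable]: "next_jump s \<in> borel_measurable M"
 by (rule next_jump_measurable) simp

lemma J1_measurable [measurable]: "Measurable.pred M (J1 s s')"
 unfolding J1_def[abs_def] by measurable

lemma J2_measurable [measurable]: "Measurable.pred M (J2 s s')"
proof -
 have "(\<lambda>w. T (Suc (Suc (cnt s w))) w) \<in> borel_measurable M"
  by (rule measurable_compose_countable[OF T_measurable_M cnt_measurable_M])
 then show ?thesis unfolding J2_def[abs_def] by measurable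
qed

abbreviation "at_n s n w \<equiv> T n w \<le> s \<and> s < T (Suc n) w"

text \<open>The clock running at time \<open>s\<close> has the random index \<open>cnt s\<close>.
  Splitting by the value of that index reduces statements about it to clocks and marks of fixed
  index, to which independence applies.\<close>

lemma integral_partition:
 fixes G :: "'a => real"
 assumes G [measurable]: "G \<in> borel_measurable M" and b: "\<And>\<omega>. \<bar>G \<omega>\<bar> \<le> C" and s: "0 \<le> s"
 shows "(\<lambda>n. \<integral>\<omega>. G \<omega> * of_bool (at_n s n \<omega>) \<partial>M) sums (\<integral>\<omega>. G \<omega> \<partial>M)"
 unfolding sums_def
proof -
 have i: "integrable M (\<lambda>\<omega>. G \<omega> * of_bool (at_n s n \<omega>))" for n
  by (rule integrable_const_bound[where B=C]) (use b order_trans[OF abs_ge_zero b] in \<open>auto simp: abs_mult\<close>)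
 have "(\<lambda>m. \<integral>\<omega>. (\<Sum>n<m. G \<omega> * of_bool (at_n s n \<omega>)) \<partial>M) \<longlonglongrightarrow> (\<integral>\<omega>. G \<omega> \<partial>M)"
 proof (rule integral_dominated_convergence[where w="\<lambda>_. C"])
  have eq: "AE \<omega> in M. \<forall>m. (\<Sum>n<m. G \<omega> * of_bool (at_n s n \<omega>)) = (if cnt s \<omega> < m then G \<omega> else 0)"
   using good_AE
  proof eventually_elim
   case (elim \<omega>)
   show ?case
   proof
    fix m
    have "(\<Sum>n<m. G \<omega> * of_bool (at_n s n \<omega>)) = (\<Sum>n<m. if cnt s \<omega> = n then G \<omega> else 0)"
     using good_cnt_eq[OF elim s] by (intro sum.cong refl) auto
    then show "(\<Sum>n<m. G \<omega> * of_bool (at_n s n \<omega>)) = (if cnt s \<omega> < m then G \<omega> else 0)" by simp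
   qed
  qed
  show "AE \<omega> in M. norm (\<Sum>n<m. G \<omega> * of_bool (at_n s n \<omega>)) \<le> C" for m
   using eq by eventually_elim (use b order_trans[OF abs_ge_zero b] in auto)
  show "AE \<omega> in M. (\<lambda>m. \<Sum>n<m. G \<omega> * of_bool (at_n s n \<omega>)) \<longlonglongrightarrow> G \<omega>"
   using eq
  proof eventually_elim
   case (elim \<omega>)
   have "(\<lambda>m. if cnt s \<omega> < m then G \<omega> else 0) \<longlonglongrightarrow> G \<omega>"
    by (rule tendsto_eventually) (auto simp: eventually_at_top_dense)
   then show ?case using elim by simp
  qed
 qed auto
 then show "(\<lambda>m. \<Sum>n<m. \<integral>\<omega>. G \<omega> * of_bool (at_n s n \<omega>) \<partial>M) \<longlonglongrightarrow> (\<integral>\<omega>. G \<omega> \<partial>M)"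
  using i by (subst (asm) Bochner_Integration.integral_sum) auto
qed

lemma measurable_at_cnt:
 fixes G :: "nat => 'a => real"
 assumes G: "\<And>n. G n \<in> borel_measurable M"
 shows "(\<lambda>w. G (cnt s w) w) \<in> borel_measurable M"
 by (rule measurable_compose_countable[OF G cnt_measurable_M])

lemma next_jump_integral:
 fixes X :: "nat => 'a => real"
 assumes X: "\<And>n. X n \<in> borel_measurable (src_sigma (sources N - {Clock n}))" and b: "\<And>n w. \<bar>X n w\<bar> \<le> C"
  and s: "0 \<le> s" "s \<le> s'"
 shows "(\<integral>w. X (cnt s w) w * of_bool (J1 s s' w) \<partial>M) = jump_prob (s' - s) * (\<integral>w. X (cnt s w) w \<partial>M)"
proof -
 have XM [measurable]: "X n \<in> borel_measurable M" for n
  by (rule measurable_src_sigma_M[OF X]) auto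
 have G [measurable]: "(\<lambda>w. X (cnt s w) w) \<in> borel_measurable M"
  by (rule measurable_at_cnt[OF XM])
 have C: "0 \<le> C" using order_trans[OF abs_ge_zero b] .
 have 1: "(\<lambda>n. \<integral>w. X (cnt s w) w * of_bool (J1 s s' w) * of_bool (at_n s n w) \<partial>M) sums (\<integral>w. X (cnt s w) w * of_bool (J1 s s' w) \<partial>M)"
  by (rule integral_partition[where C=C]) (use b C s in \<open>auto simp: abs_mult\<close>)
 have 2: "(\<lambda>n. \<integral>w. X (cnt s w) w * of_bool (at_n s n w) \<partial>M) sums (\<integral>w. X (cnt s w) w \<partial>M)"
  by (rule integral_partition[where C=C]) (use b s in auto)
 have "(\<integral>w. X (cnt s w) w * of_bool (J1 s s' w) * of_bool (at_n s n w) \<partial>M) = jump_prob (s' - s) * (\<integral>w. X (cnt s w) w * of_bool (at_n s n w) \<partial>M)" for n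
 proof -
  have "(\<integral>w. X (cnt s w) w * of_bool (J1 s s' w) * of_bool (at_n s n w) \<partial>M)
    = (\<integral>w. X n w * of_bool (T n w \<le> s \<and> s < T (Suc n) w \<and> T (Suc n) w \<le> s') \<partial>M)"
  proof (rule integral_cong_AE)
   show "AE w in M. X (cnt s w) w * of_bool (J1 s s' w) * of_bool (at_n s n w) = X n w * of_bool (T n w \<le> s \<and> s < T (Suc n) w \<and> T (Suc n) w \<le> s')"
    using good_AE
   proof eventually_elim
    case (elim w)
    show ?case using good_cnt_eq[OF elim s(1), of n] by (auto simp: J1_def next_jump_def)
   qed
  qed measurable
  also have "... = jump_prob (s' - s) * (\<integral>w. X n w * of_bool (at_n s n w) \<partial>M)"
   by (rule memoryless[OF X b s])
  also have "(\<integral>w. X n w * of_bool (at_n s n w) \<partial>M) = (\<integral>w. X (cnt s w) w * of_bool (at_n s n w) \<partial>M)"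
  proof (rule integral_cong_AE)
   show "AE w in M. X n w * of_bool (at_n s n w) = X (cnt s w) w * of_bool (at_n s n w)"
    using good_AE
   proof eventually_elim
    case (elim w)
    show ?case using good_cnt_eq[OF elim s(1), of n] by auto
   qed
  qed measurable
  finally show ?thesis .
 qed
 then have "(\<lambda>n. jump_prob (s' - s) * (\<integral>w. X (cnt s w) w * of_bool (at_n s n w) \<partial>M)) sums (\<integral>w. X (cnt s w) w * of_bool (J1 s s' w) \<partial>M)"
  using 1 by simp
 from sums_unique2[OF this sums_mult[OF 2]] show ?thesis .
qed

lemma J1_prob:
 assumes s: "0 \<le> s" "s \<le> s'" shows "(\<integral>w. of_bool (J1 s s' w) \<partial>M) = jump_prob (s' - s)"
 using next_jump_integral[of "\<lambda>_ _. 1" 1, OF _ _ s] by (simp add: prob_space)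

lemma clock_window_prob:
 assumes "0 \<le> d" shows "(\<integral>w. of_bool (\<tau> n w \<le> d) \<partial>M) = jump_prob d"
proof -
 have "(\<integral>w. of_bool (\<tau> n w \<le> d) \<partial>M) = (\<integral>w. 1 - indicator {w \<in> space M. d < \<tau> n w} w \<partial>M :: real)"
  by (intro Bochner_Integration.integral_cong) (auto simp: indicator_def)
 also have "... = 1 - prob {w \<in> space M. d < \<tau> n w}"
 proof -
  have "integrable M (indicator {w \<in> space M. d < \<tau> n w} :: _ => real)"
   by (rule integrable_const_bound[where B=1]) (auto simp: indicator_def)
  then show ?thesis by (subst Bochner_Integration.integral_diff) (auto simp: prob_space)
 qed
 also have "... = jump_prob d" using tau_gt[OF assms, of n] by (simp add: jump_prob_def mult.commute)
 finally show ?thesis .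
qed

text \<open>Two jumps in the cell require, besides the first, that the following clock is at most as
  long as the whole cell. That clock may be held fixed while the memoryless property treats the
  first jump, and its own law gives the second factor.\<close>

lemma J2_prob:
 assumes s: "0 \<le> s" "s \<le> s'" shows "(\<integral>w. of_bool (J2 s s' w) \<partial>M) \<le> (jump_prob (s' - s))\<^sup>2"
proof -
 let ?d = "s' - s"
 have X: "(\<lambda>w. of_bool (\<tau> (Suc n) w \<le> ?d) :: real) \<in> borel_measurable (src_sigma (sources N - {Clock n}))" for n
 proof -
  have [measurable]: "\<tau> (Suc n) \<in> borel_measurable (src_sigma (sources N - {Clock n}))"
   by (rule measurable_clock) auto
  show ?thesis by measurable
 qed
 have XM [measurable]: "(\<lambda>w. of_bool (\<tau> (Suc (cnt s w)) w \<le> ?d) :: real) \<in> borel_measurable M"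
  by (rule measurable_compose_countable[OF _ cnt_measurable_M]) measurable
 have "(\<integral>w. of_bool (J2 s s' w) \<partial>M) \<le> (\<integral>w. of_bool (\<tau> (Suc (cnt s w)) w \<le> ?d) * of_bool (J1 s s' w) \<partial>M :: real)"
 proof (rule integral_mono_AE)
  show "AE w in M. of_bool (J2 s s' w) \<le> (of_bool (\<tau> (Suc (cnt s w)) w \<le> ?d) * of_bool (J1 s s' w) :: real)"
   using good_AE
  proof eventually_elim
   case (elim w)
   have "0 < \<tau> (Suc (cnt s w)) w" using elim unfolding good_def by blast
   then show ?case using good_cnt[OF elim s(1)] by (auto simp: J1_def J2_def next_jump_def T_Suc)
  qed
 qed (auto intro!: integrable_const_bound[where B=1])
 also have "... = jump_prob ?d * (\<integral>w. of_bool (\<tau> (Suc (cnt s w)) w \<le> ?d) \<partial>M)"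
  using next_jump_integral[of "\<lambda>n w. of_bool (\<tau> (Suc n) w \<le> ?d)" 1, OF X _ s] by simp
 also have "(\<integral>w. of_bool (\<tau> (Suc (cnt s w)) w \<le> ?d) \<partial>M) = jump_prob ?d"
 proof -
  have "(\<lambda>n. \<integral>w. of_bool (\<tau> (Suc (cnt s w)) w \<le> ?d) * of_bool (at_n s n w) \<partial>M) sums (\<integral>w. of_bool (\<tau> (Suc (cnt s w)) w \<le> ?d) \<partial>M :: real)"
   by (rule integral_partition[where C=1]) (use s in auto)
  moreover have "(\<integral>w. of_bool (\<tau> (Suc (cnt s w)) w \<le> ?d) * of_bool (at_n s n w) \<partial>M) = jump_prob ?d * (\<integral>w. 1 * of_bool (at_n s n w) \<partial>M)" for n
  proof -
   let ?I = "sources N - {Clock (Suc n)}"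
   have Tm [measurable]: "T n \<in> borel_measurable (src_sigma ?I)" "T (Suc n) \<in> borel_measurable (src_sigma ?I)"
    by (intro T_measurable measurable_clock; auto)+
   have "(\<integral>w. of_bool (\<tau> (Suc (cnt s w)) w \<le> ?d) * of_bool (at_n s n w) \<partial>M) = (\<integral>w. of_bool (at_n s n w) * of_bool (\<tau> (Suc n) w \<le> ?d) \<partial>M :: real)"
   proof (rule integral_cong_AE)
    show "AE w in M. of_bool (\<tau> (Suc (cnt s w)) w \<le> ?d) * of_bool (at_n s n w) = (of_bool (at_n s n w) * of_bool (\<tau> (Suc n) w \<le> ?d) :: real)"
     using good_AE
    proof eventually_elim
     case (elim w)
     show ?case using good_cnt_eq[OF elim s(1), of n] by auto
    qed
   qed measurable
   also have "... = (\<integral>w. (\<integral>y. of_bool (at_n s n w) * of_bool (y \<le> ?d) \<partial>distr M borel (\<tau> (Suc n))) \<partial>M)"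
    using clock_integral[of ?I "Suc n" "\<lambda>(w, y). of_bool (at_n s n w) * of_bool (y \<le> ?d)" 1]
    by (auto simp: split_beta')
   also have "... = (\<integral>w. of_bool (at_n s n w) * (\<integral>w. of_bool (\<tau> (Suc n) w \<le> ?d) \<partial>M) \<partial>M)"
    by (simp add: integral_distr)
   also have "... = jump_prob ?d * (\<integral>w. 1 * of_bool (at_n s n w) \<partial>M)"
    using clock_window_prob[of ?d "Suc n"] s by simp
   finally show ?thesis .
  qed
  moreover have "(\<lambda>n. jump_prob ?d * (\<integral>w. 1 * of_bool (at_n s n w) \<partial>M)) sums (jump_prob ?d * (\<integral>w. 1 \<partial>M))"
   by (intro sums_mult integral_partition[where C=1]) (use s in auto)
  ultimately show ?thesis using sums_unique2 by (fastforce simp: prob_space)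
 qed
 finally show ?thesis by (simp add: power2_eq_square)
qed

end

section \<open>Marks and displacements at a jump\<close>

context np_bbm_driven
begin

lemma event_integral:
 fixes W :: "'a => real"
 assumes I: "I \<subseteq> sources N" "J \<subseteq> sources N" "I \<inter> J = {}" and E: "E \<in> sets (src_sigma J)"
  and W: "W \<in> borel_measurable (src_sigma I)" and b: "\<And>w. \<bar>W w\<bar> \<le> C"
 shows "(\<integral>w. of_bool (w \<in> E) * W w \<partial>M) = prob E * (\<integral>w. W w \<partial>M)"
proof -
 have EM: "E \<in> events" using E src_sigma_events[OF I(2)] by auto
 have Es: "E \<subseteq> space M" using sets.sets_into_space[OF EM] .
 have D: "(\<lambda>w. w \<in> E) \<in> measurable M (count_space UNIV)" using EM by simp
 have pre: "(\<lambda>w. w \<in> E) -` X \<inter> space M \<in> sets (src_sigma J)" for X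
 proof -
  have "(\<lambda>w. w \<in> E) -` X \<inter> space M = (if True \<in> X then E else {}) \<union> (if False \<in> X then space (src_sigma J) - E else {})"
  proof (rule set_eqI)
   fix w
   show "w \<in> (\<lambda>w. w \<in> E) -` X \<inter> space M \<longleftrightarrow> w \<in> (if True \<in> X then E else {}) \<union> (if False \<in> X then space (src_sigma J) - E else {})"
    using Es by (cases "w \<in> E") auto
  qed
  moreover have "(if True \<in> X then E else {}) \<in> sets (src_sigma J)" "(if False \<in> X then space (src_sigma J) - E else {}) \<in> sets (src_sigma J)"
   using E sets.compl_sets[OF E] by (auto simp del: space_src_sigma)
  ultimately show ?thesis by (simp only: sets.Un)
 qed
 note [measurable] = W
 have f: "(\<lambda>(w, b). of_bool b * W w) \<in> borel_measurable (src_sigma I \<Otimes>\<^sub>M count_space UNIV)" by measurable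
 have C: "0 \<le> C" using order_trans[OF abs_ge_zero b] .
 have fb: "\<bar>case x of (w, b) => of_bool b * W w\<bar> \<le> C" for x using b C by (cases x) (auto simp: abs_mult)
 have "(\<integral>w. of_bool (w \<in> E) * W w \<partial>M) = (\<integral>w. (\<integral>b. of_bool b * W w \<partial>distr M (count_space UNIV) (\<lambda>w. w \<in> E)) \<partial>M)"
  using indep_integral[OF space_src_sigma src_sigma_events[OF I(1)] D indep_src_sigma[OF I _ pre] f fb] by simp
 also have "... = (\<integral>w. prob E * W w \<partial>M)"
 proof (rule Bochner_Integration.integral_cong[OF refl])
  fix w
  have "(\<integral>b. of_bool b * W w \<partial>distr M (count_space UNIV) (\<lambda>w. w \<in> E)) = (\<integral>w'. of_bool (w' \<in> E) * W w \<partial>M)"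
   by (rule integral_distr[OF D]) simp
  also have "... = (\<integral>w'. indicator E w' * W w \<partial>M)" by (simp add: indicator_def)
  also have "... = prob E * W w" using EM by simp
  finally show "(\<integral>b. of_bool b * W w \<partial>distr M (count_space UNIV) (\<lambda>w. w \<in> E)) = prob E * W w" .
 qed
 also have "... = prob E * (\<integral>w. W w \<partial>M)" by simp
 finally show ?thesis .
qed

lemma mark_prob:
 fixes n :: nat
 assumes A: "A \<in> k_subsets N k" and ij: "ij \<in> mark_pairs k"
 defines "E \<equiv> {w \<in> space M. S' n w = A} \<inter> {w \<in> space M. q' n w = ij}"
 shows "E \<in> sets (src_sigma {Subset n, Pair n})" and "prob E = 1 / real (N choose k) * pmf p ij"
proof -
 let ?q = "{w \<in> space M. q' n w = ij}" and ?S = "{w \<in> space M. S' n w = A}"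
 have sS: "?S \<in> sets (src_sigma I)" if "Subset n \<in> I" for I
  using measurable_sets[OF S'_measurable[OF measurable_subset[OF that]], of "{A}"] A
  by (simp add: vimage_def Int_def conj_commute)
 have sq: "?q \<in> sets (src_sigma I)" if "Pair n \<in> I" for I
  using measurable_sets[OF q'_measurable[OF measurable_pair[OF that]], of "{ij}"] ij
  by (simp add: vimage_def Int_def conj_commute)
 show "E \<in> sets (src_sigma {Subset n, Pair n})"
  unfolding E_def by (intro sets.Int sS sq) auto
 have "prob E = prob ?S * prob ?q"
  unfolding E_def by (rule indep_src_sigma[of "{Subset n}" "{Pair n}"]) (auto intro: sS sq)
 moreover have "prob ?S = 1 / real (N choose k)"
 proof -
  have "prob ?S = prob (S n -` {A} \<inter> space M)"
  proof (rule finite_measure_eq_AE)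
   show "AE w in M. (w \<in> ?S) = (w \<in> S n -` {A} \<inter> space M)"
    using good_AE AE_space by eventually_elim (auto simp: good_def S'_def)
   show "?S \<in> events"
    using sS[of "{Subset n}"] src_sigma_events[of "{Subset n}"] by auto
  qed (rule measurable_sets[OF S_measurable_M], simp)
  also have "... = measure (distr M (count_space UNIV) (S n)) {A}" by (simp add: measure_distr)
  also have "... = pmf (pmf_of_set (k_subsets N k)) A" unfolding distr_S by (simp add: measure_pmf_single)
  also have "... = 1 / real (N choose k)" using A k_subsets_ne by (simp add: card_k_subsets)
  finally show ?thesis .
 qed
 moreover have "prob ?q = pmf p ij"
 proof -
  have "prob ?q = prob (q n -` {ij} \<inter> space M)"
  proof (rule finite_measure_eq_AE)
   show "AE w in M. (w \<in> ?q) = (w \<in> q n -` {ij} \<inter> space M)"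
    using good_AE AE_space by eventually_elim (auto simp: good_def q'_def)
   show "?q \<in> events"
    using sq[of "{Pair n}"] src_sigma_events[of "{Pair n}"] by auto
  qed (rule measurable_sets[OF q_measurable_M], simp)
  also have "... = measure (distr M (count_space UNIV) (q n)) {ij}" by (simp add: measure_distr)
  also have "... = pmf p ij" unfolding distr_q by (simp add: measure_pmf_single)
  finally show ?thesis .
 qed
 ultimately show "prob E = 1 / real (N choose k) * pmf p ij" by simp
qed

text \<open>The marks of jump \<open>n\<close> are independent of all other noise and take finitely
  many values, so they average out to the finite sum \<open>mark_mean\<close>.\<close>

lemma mark_integral:
 fixes W :: "nat set => nat \<times> nat => 'a => real"
 assumes W: "\<And>A ij. A \<in> k_subsets N k ==> ij \<in> mark_pairs k ==> W A ij \<in> borel_measurable (src_sigma (sources N - {Subset n, Pair n}))"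
  and b: "\<And>A ij w. \<bar>W A ij w\<bar> \<le> C"
 shows "(\<integral>w. W (S' n w) (q' n w) w \<partial>M) = (\<integral>w. mark_mean N k p (\<lambda>A ij. W A ij w) \<partial>M)"
proof -
 let ?I = "sources N - {Subset n, Pair n}" and ?J = "{Subset n, Pair n}"
 have IJ: "?I \<subseteq> sources N" "?J \<subseteq> sources N" "?I \<inter> ?J = {}" by auto
 let ?E = "\<lambda>A ij. {w \<in> space M. S' n w = A} \<inter> {w \<in> space M. q' n w = ij}"
 have C: "0 \<le> C" using order_trans[OF abs_ge_zero b] .
 have WM: "W A ij \<in> borel_measurable M" if "A \<in> k_subsets N k" "ij \<in> mark_pairs k" for A ij
  by (rule measurable_src_sigma_M[OF W[OF that]]) auto
 have EM: "?E A ij \<in> events" if "A \<in> k_subsets N k" "ij \<in> mark_pairs k" for A ij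
  using mark_prob(1)[OF that] src_sigma_events[OF IJ(2)] by auto
 have i: "integrable M (\<lambda>w. of_bool (w \<in> ?E A ij) * W A ij w)" if "A \<in> k_subsets N k" "ij \<in> mark_pairs k" for A ij
 proof (rule integrable_const_bound[where B=C])
  have "(\<lambda>w. indicator (?E A ij) w * W A ij w) \<in> borel_measurable M"
   using EM[OF that] WM[OF that] by measurable
  then show "(\<lambda>w. of_bool (w \<in> ?E A ij) * W A ij w) \<in> borel_measurable M" by (simp add: indicator_def)
 qed (use b C in \<open>auto simp: abs_mult\<close>)
 have "(\<integral>w. W (S' n w) (q' n w) w \<partial>M) = (\<integral>w. (\<Sum>A\<in>k_subsets N k. \<Sum>ij\<in>mark_pairs k. of_bool (w \<in> ?E A ij) * W A ij w) \<partial>M)"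
 proof (rule Bochner_Integration.integral_cong[OF refl])
  fix w assume w: "w \<in> space M"
  have "(\<Sum>A\<in>k_subsets N k. \<Sum>ij\<in>mark_pairs k. of_bool (w \<in> ?E A ij) * W A ij w)
    = (\<Sum>A\<in>k_subsets N k. if S' n w = A then (\<Sum>ij\<in>mark_pairs k. if q' n w = ij then W A ij w else 0) else 0)"
   using w by (intro sum.cong refl) (auto intro!: sum.cong)
  then show "W (S' n w) (q' n w) w = (\<Sum>A\<in>k_subsets N k. \<Sum>ij\<in>mark_pairs k. of_bool (w \<in> ?E A ij) * W A ij w)"
   using S'_mem[of n w] q'_mem[of n w] by simp
 qed
 also have "... = (\<Sum>A\<in>k_subsets N k. \<Sum>ij\<in>mark_pairs k. (\<integral>w. of_bool (w \<in> ?E A ij) * W A ij w \<partial>M))"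
  using i by (subst Bochner_Integration.integral_sum, intro Bochner_Integration.integrable_sum, simp)
    (intro sum.cong refl Bochner_Integration.integral_sum, simp)
 also have "... = (\<Sum>A\<in>k_subsets N k. \<Sum>ij\<in>mark_pairs k. (\<integral>w. 1 / real (N choose k) * pmf p ij * W A ij w \<partial>M))"
 proof (intro sum.cong refl)
  fix A ij assume m: "A \<in> k_subsets N k" "ij \<in> mark_pairs k"
  show "(\<integral>w. of_bool (w \<in> ?E A ij) * W A ij w \<partial>M) = (\<integral>w. 1 / real (N choose k) * pmf p ij * W A ij w \<partial>M)"
   unfolding event_integral[OF IJ mark_prob(1)[OF m] W[OF m] b] mark_prob(2)[OF m] by simp
 qed
 also have "... = (\<integral>w. mark_mean N k p (\<lambda>A ij. W A ij w) \<partial>M)"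
 proof -
  have j: "integrable M (\<lambda>w. 1 / real (N choose k) * pmf p ij * W A ij w)" if "A \<in> k_subsets N k" "ij \<in> mark_pairs k" for A ij
   by (intro integrable_mult_right integrable_const_bound[where B=C] WM that) (use b in auto)
  show ?thesis
   unfolding mark_mean_def using j
   by (subst Bochner_Integration.integral_sum, intro Bochner_Integration.integrable_sum, simp)
     (intro sum.cong refl Bochner_Integration.integral_sum[symmetric], simp)
 qed
 finally show ?thesis .
qed

text \<open>The jump time is a function of the clocks and hence independent of the Brownian paths.
  Freezing it at a value \<open>r\<close> reduces displacements at a random time to displacements at
  a fixed time.\<close>

lemma next_jump_indep_motion:
 fixes h :: "'a \<times> real => real"
 assumes h: "h \<in> borel_measurable (src_sigma (Motion ` {1..N}) \<Otimes>\<^sub>M borel)" and h01: "\<And>x. 0 \<le> h x" "\<And>x. h x \<le> 1"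
  and s: "0 \<le> s" "s < s'" and K: "\<And>r. s < r ==> r \<le> s' ==> (\<integral>w. h (w, r) \<partial>M) \<le> K"
 shows "(\<integral>w. of_bool (J1 s s' w) * h (w, next_jump s w) \<partial>M) \<le> jump_prob (s' - s) * K"
proof -
 let ?I = "Motion ` {1..N}" and ?J = "range Clock"
 have IJ: "?I \<subseteq> sources N" "?J \<subseteq> sources N" "?I \<inter> ?J = {}" by auto
 have R: "next_jump s \<in> borel_measurable (src_sigma ?J)"
  by (rule next_jump_measurable[OF measurable_clock]) auto
 let ?R = "distr M borel (next_jump s)"
 interpret R: prob_space ?R by (rule prob_space_distr) simp
 interpret P: pair_prob_space M ?R ..
 let ?f = "\<lambda>(w, r). of_bool (s < r \<and> r \<le> s') * h (w, r)"
 note [measurable] = h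
 have fF: "?f \<in> borel_measurable (src_sigma ?I \<Otimes>\<^sub>M borel)" by measurable
 have hM: "h \<in> borel_measurable (M \<Otimes>\<^sub>M borel)"
 proof -
  have "sets (src_sigma ?I \<Otimes>\<^sub>M (borel :: real measure)) \<subseteq> sets (M \<Otimes>\<^sub>M borel)"
   unfolding sets_pair_measure space_src_sigma using src_sigma_events[OF IJ(1)] by (intro sigma_sets_mono') auto
  then show ?thesis using h unfolding measurable_def by (auto simp: space_pair_measure)
 qed
 have fM: "?f \<in> borel_measurable (M \<Otimes>\<^sub>M ?R)" using hM by measurable
 have fb: "\<bar>?f x\<bar> \<le> 1" for x using h01 by (cases x) (auto simp: abs_mult)
 have ip: "integrable (M \<Otimes>\<^sub>M ?R) ?f" by (rule P.integrable_const_bound[OF _ fM, where B=1]) (use fb in auto)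
 have nj: "AE w in M. of_bool (J1 s s' w) = (of_bool (s < next_jump s w \<and> next_jump s w \<le> s') :: real)"
  using good_AE by eventually_elim (use good_cnt(2)[OF _ s(1)] in \<open>auto simp: J1_def next_jump_def\<close>)
 have hm [measurable]: "(\<lambda>w. h (w, next_jump s w)) \<in> borel_measurable M"
  using measurable_compose[OF measurable_Pair[OF measurable_ident next_jump_measurable_M] hM] by simp
 have "(\<integral>w. of_bool (J1 s s' w) * h (w, next_jump s w) \<partial>M) = (\<integral>w. ?f (w, next_jump s w) \<partial>M)"
  by (rule integral_cong_AE) (use nj in auto)
 also have "... = (\<integral>w. (\<integral>r. ?f (w, r) \<partial>?R) \<partial>M)"
 proof (rule indep_integral[OF space_src_sigma src_sigma_events[OF IJ(1)] next_jump_measurable_M _ fF fb])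
  fix A D assume A: "A \<in> sets (src_sigma ?I)" and D: "D \<in> sets (borel :: real measure)"
  show "prob (A \<inter> (next_jump s -` D \<inter> space M)) = prob A * prob (next_jump s -` D \<inter> space M)"
   by (rule indep_src_sigma[OF IJ A]) (use measurable_sets[OF R D] in simp)
 qed
 also have "... = (\<integral>r. (\<integral>w. ?f (w, r) \<partial>M) \<partial>?R)"
  using P.Fubini_integral[of "\<lambda>w r. ?f (w, r)"] ip by (simp add: split_beta')
 also have "... \<le> (\<integral>r. of_bool (s < r \<and> r \<le> s') * K \<partial>?R)"
 proof (rule integral_mono)
  show "integrable ?R (\<lambda>r. \<integral>w. ?f (w, r) \<partial>M)" using P.integrable_snd[of "\<lambda>w r. ?f (w, r)"] ip by (simp add: split_beta')
  show "integrable ?R (\<lambda>r. of_bool (s < r \<and> r \<le> s') * K)"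
   by (rule R.integrable_const_bound[where B="\<bar>K\<bar>"]) (auto simp: abs_mult)
  show "(\<integral>w. ?f (w, r) \<partial>M) \<le> of_bool (s < r \<and> r \<le> s') * K" for r
   using K[of r] by auto
 qed
 also have "... = (\<integral>w. of_bool (s < next_jump s w \<and> next_jump s w \<le> s') * K \<partial>M)"
  by (rule integral_distr) auto
 also have "... = (\<integral>w. of_bool (J1 s s' w) * K \<partial>M)"
  by (rule integral_cong_AE) (use nj in auto)
 also have "... = jump_prob (s' - s) * K" using J1_prob[of s s'] s by simp
 finally show ?thesis .
qed

lemma increment_abs_bound:
 assumes i: "i \<in> {1..N}" and r: "0 \<le> s" "s \<le> r" and \<Lambda>: "0 \<le> \<Lambda>"
 shows "(\<integral>w. min 1 (\<Lambda> * \<bar>B i r w - B i s w\<bar>) \<partial>M) \<le> \<Lambda> * sqrt (r - s)"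
proof (cases "s = r")
 case False
 then have sr: "s < r" using r by simp
 have "(\<integral>w. min 1 (\<Lambda> * \<bar>B i r w - B i s w\<bar>) \<partial>M) = (\<integral>w. (\<integral>z. min 1 (\<Lambda> * \<bar>sqrt (r - s) * z\<bar>) \<partial>gauss) \<partial>M)"
  using increment_integral[OF i r(1) sr, of "\<lambda>(w, y). min 1 (\<Lambda> * \<bar>y\<bar>)" 1] \<Lambda> by (auto simp: split_beta')
 also have "... = (\<integral>z. min 1 (\<Lambda> * \<bar>sqrt (r - s) * z\<bar>) \<partial>gauss)" by (simp add: prob_space)
 also have "... \<le> (\<integral>z. \<Lambda> * sqrt (r - s) * \<bar>z\<bar> \<partial>gauss)"
  using \<Lambda> sr integrable_gauss_abs by (intro integral_mono') (auto simp: abs_mult)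
 also have "... \<le> \<Lambda> * sqrt (r - s) * 1"
  using \<Lambda> sr integral_gauss_abs_le_1 by (simp add: mult_left_le)
 finally show ?thesis by simp
qed simp

lemma motion_sigma_measurable:
 "i \<in> {1..N} ==> 0 \<le> r ==> B i r \<in> borel_measurable (src_sigma (Motion ` {1..N}))"
 by (rule measurable_motion) auto

lemma Bm_AE: "i \<in> {1..N} ==> 0 \<le> r ==> r \<le> s ==> AE w in M. Bm i s r w = B i r w"
 using good_AE by eventually_elim (auto simp: good_def intro!: Bm_eq)

lemma Bm_measurable_M:
 assumes i: "i \<in> {1..N}" and s: "0 \<le> s" shows "(\<lambda>w. Bm i s r w) \<in> borel_measurable M"
proof -
 have "(\<lambda>x. Bm i s (fst x) (snd x)) \<in> borel_measurable (borel \<Otimes>\<^sub>M M)"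
  by (rule Bm_measurable[OF B_measurable_M[OF i] s])
 from measurable_compose[OF measurable_Pair[OF measurable_const[of r borel M] measurable_ident] this]
 show ?thesis by simp
qed

lemma oscillation_before:
 assumes i: "i \<in> {1..N}" and s: "0 \<le> s" "s < s'" and \<Lambda>: "0 \<le> \<Lambda>"
 shows "(\<integral>w. of_bool (J1 s s' w) * min 1 (\<Lambda> * \<bar>Bm i s' (next_jump s w) w - B i s w\<bar>) \<partial>M) \<le> jump_prob (s' - s) * (\<Lambda> * sqrt (s' - s))"
proof -
 let ?F = "src_sigma (Motion ` {1..N})"
 let ?h = "\<lambda>(w, r). min 1 (\<Lambda> * \<bar>Bm i s' r w - B i s w\<bar>)"
 have m1: "(\<lambda>x. Bm i s' (fst x) (snd x)) \<in> borel_measurable (borel \<Otimes>\<^sub>M ?F)"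
  by (rule Bm_measurable[OF motion_sigma_measurable[OF i]]) (use s in auto)
 have [measurable]: "(\<lambda>x. Bm i s' (snd x) (fst x)) \<in> borel_measurable (?F \<Otimes>\<^sub>M borel)"
  using measurable_compose[OF measurable_pair_swap' m1] by (simp add: split_beta')
 have [measurable]: "B i s \<in> borel_measurable ?F" by (rule motion_sigma_measurable[OF i s(1)])
 have "(\<integral>w. of_bool (J1 s s' w) * ?h (w, next_jump s w) \<partial>M) \<le> jump_prob (s' - s) * (\<Lambda> * sqrt (s' - s))"
 proof (rule next_jump_indep_motion[OF _ _ _ s])
  show "?h \<in> borel_measurable (?F \<Otimes>\<^sub>M borel)" unfolding split_beta' by measurable
  fix r assume r: "s < r" "r \<le> s'"
  have [measurable]: "B i r \<in> borel_measurable M" "B i s \<in> borel_measurable M" "(\<lambda>w. Bm i s' r w) \<in> borel_measurable M"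
   using s r by (auto intro!: B_measurable_M[OF i] Bm_measurable_M[OF i])
  have "(\<integral>w. ?h (w, r) \<partial>M) = (\<integral>w. min 1 (\<Lambda> * \<bar>B i r w - B i s w\<bar>) \<partial>M)"
   by (rule integral_cong_AE) (use Bm_AE[OF i, of r s'] r s in auto)
  also have "... \<le> \<Lambda> * sqrt (r - s)" by (rule increment_abs_bound[OF i]) (use s r \<Lambda> in auto)
  also have "... \<le> \<Lambda> * sqrt (s' - s)" using r \<Lambda> by (intro mult_left_mono) auto
  finally show "(\<integral>w. ?h (w, r) \<partial>M) \<le> \<Lambda> * sqrt (s' - s)" .
 qed (use \<Lambda> in auto)
 then show ?thesis by simp
qed

lemma oscillation_after:
 assumes i: "i \<in> {1..N}" and s: "0 \<le> s" "s < s'" and \<Lambda>: "0 \<le> \<Lambda>"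
 shows "(\<integral>w. of_bool (J1 s s' w) * min 1 (\<Lambda> * \<bar>B i s' w - Bm i s' (next_jump s w) w\<bar>) \<partial>M) \<le> jump_prob (s' - s) * (\<Lambda> * sqrt (s' - s))"
proof -
 let ?F = "src_sigma (Motion ` {1..N})"
 let ?h = "\<lambda>(w, r). min 1 (\<Lambda> * \<bar>B i s' w - Bm i s' r w\<bar>)"
 have m1: "(\<lambda>x. Bm i s' (fst x) (snd x)) \<in> borel_measurable (borel \<Otimes>\<^sub>M ?F)"
  by (rule Bm_measurable[OF motion_sigma_measurable[OF i]]) (use s in auto)
 have [measurable]: "(\<lambda>x. Bm i s' (snd x) (fst x)) \<in> borel_measurable (?F \<Otimes>\<^sub>M borel)"
  using measurable_compose[OF measurable_pair_swap' m1] by (simp add: split_beta')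
 have [measurable]: "B i s' \<in> borel_measurable ?F" by (rule motion_sigma_measurable[OF i]) (use s in simp)
 have "(\<integral>w. of_bool (J1 s s' w) * ?h (w, next_jump s w) \<partial>M) \<le> jump_prob (s' - s) * (\<Lambda> * sqrt (s' - s))"
 proof (rule next_jump_indep_motion[OF _ _ _ s])
  show "?h \<in> borel_measurable (?F \<Otimes>\<^sub>M borel)" unfolding split_beta' by measurable
  fix r assume r: "s < r" "r \<le> s'"
  have [measurable]: "B i r \<in> borel_measurable M" "B i s' \<in> borel_measurable M" "(\<lambda>w. Bm i s' r w) \<in> borel_measurable M"
   using s r by (auto intro!: B_measurable_M[OF i] Bm_measurable_M[OF i])
  have "(\<integral>w. ?h (w, r) \<partial>M) = (\<integral>w. min 1 (\<Lambda> * \<bar>B i s' w - B i r w\<bar>) \<partial>M)"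
   by (rule integral_cong_AE) (use Bm_AE[OF i, of r s'] r s in auto)
  also have "... \<le> \<Lambda> * sqrt (s' - r)" by (rule increment_abs_bound[OF i]) (use s r \<Lambda> in auto)
  also have "... \<le> \<Lambda> * sqrt (s' - s)" using r \<Lambda> by (intro mult_left_mono) auto
  finally show "(\<integral>w. ?h (w, r) \<partial>M) \<le> \<Lambda> * sqrt (s' - s)" .
 qed (use \<Lambda> in auto)
 then show ?thesis by simp
qed

end

section \<open>Brownian motion and marks over one cell\<close>

lemma measurable_gm:
 assumes [measurable]: "\<phi> \<in> borel_measurable borel" and W: "\<And>i. i \<in> {1..N} ==> (\<lambda>w. W w i) \<in> borel_measurable F"
 shows "(\<lambda>w. gm N \<phi> (W w)) \<in> borel_measurable F"
 unfolding gm_def using W by (intro borel_measurable_divide borel_measurable_sum borel_measurable_const) auto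

lemma measurable_fm:
 assumes [measurable]: "\<phi> \<in> borel_measurable borel" and W: "\<And>i. i \<in> {1..N} ==> (\<lambda>w. W w i) \<in> borel_measurable F"
 shows "(\<lambda>w. fm N \<phi> u (W w)) \<in> borel_measurable F"
proof -
 have [measurable]: "(\<lambda>w. gm N \<phi> (W w)) \<in> borel_measurable F" by (rule measurable_gm[OF _ W]) auto
 have [measurable]: "(\<lambda>w. \<Sum>i=1..N. (\<phi> (W w i))\<^sup>2) \<in> borel_measurable F"
 proof (rule borel_measurable_sum)
  fix i assume "i \<in> {1..N}"
  note [measurable] = W[OF this]
  show "(\<lambda>w. (\<phi> (W w i))\<^sup>2) \<in> borel_measurable F" by measurable
 qed
 show ?thesis unfolding fm_def by measurable
qed

lemma measurable_mark_gain:
 assumes [measurable]: "\<phi> \<in> borel_measurable borel" and W: "\<And>i. i \<in> {1..N} ==> (\<lambda>w. W w i) \<in> borel_measurable F"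
  and A: "A \<in> k_subsets N k" and ij: "ij \<in> mark_pairs k"
 shows "(\<lambda>w. mark_gain N \<phi> (W w) A ij) \<in> borel_measurable F"
proof -
 have "nth_elem A (fst ij) \<in> {1..N}" "nth_elem A (snd ij) \<in> {1..N}"
  using nth_elem_mem(2)[OF A] ij by (auto simp: mark_pairs_def)
 note [measurable] = measurable_order_stat[OF W this(1)] measurable_order_stat[OF W this(2)]
 show ?thesis unfolding mark_gain_def by measurable
qed

lemma fm_cong: "(\<And>i. i \<in> {1..N} ==> z i = \<xi> i) ==> fm N \<phi> u z = fm N \<phi> u \<xi>"
proof -
 assume a: "\<And>i. i \<in> {1..N} ==> z i = \<xi> i"
 have "(\<Sum>i=1..N. f (z i)) = (\<Sum>i=1..N. f (\<xi> i))" for f :: "ereal => real"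
  using a by (intro sum.cong) auto
 from this[of \<phi>] this[of "\<lambda>y. (\<phi> y)\<^sup>2"] show ?thesis by (simp only: fm_def gm_def)
qed

text \<open>Only products over distinct labels remain, so each term involves the increments of at
  most two particles, and each of them once.\<close>

lemma fm_off_diagonal:
 assumes N: "N > 0"
 shows "fm N \<phi> u z = (\<Sum>i=1..N. \<Sum>j\<in>{1..N}-{i}. \<phi> (z i) * \<phi> (z j)) / (real N)\<^sup>2 - 2 * u * (\<Sum>i=1..N. \<phi> (z i)) / real N + u\<^sup>2"
proof -
 let ?s = "\<Sum>i=1..N. \<phi> (z i)"
 have "?s\<^sup>2 = (\<Sum>i=1..N. \<Sum>j=1..N. \<phi> (z i) * \<phi> (z j))"
  by (simp add: power2_eq_square sum_product)
 also have "... = (\<Sum>i=1..N. (\<phi> (z i))\<^sup>2 + (\<Sum>j\<in>{1..N}-{i}. \<phi> (z i) * \<phi> (z j)))"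
  by (intro sum.cong refl) (subst sum.remove, auto simp: power2_eq_square)
 also have "... = (\<Sum>i=1..N. (\<phi> (z i))\<^sup>2) + (\<Sum>i=1..N. \<Sum>j\<in>{1..N}-{i}. \<phi> (z i) * \<phi> (z j))"
  by (rule sum.distrib)
 finally have eq: "?s\<^sup>2 = (\<Sum>i=1..N. (\<phi> (z i))\<^sup>2) + (\<Sum>i=1..N. \<Sum>j\<in>{1..N}-{i}. \<phi> (z i) * \<phi> (z j))" .
 have "(?s / real N - u)\<^sup>2 = ?s\<^sup>2 / (real N)\<^sup>2 - 2 * u * ?s / real N + u\<^sup>2"
  by (simp add: power2_diff power_divide)
 then show ?thesis unfolding fm_def gm_def eq by (simp add: add_divide_distrib)
qed

lemma (in np_bbm_driven) mark_mean_abs: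
 assumes G: "\<And>A ij. \<bar>G A ij\<bar> \<le> C" shows "\<bar>mark_mean N k p G\<bar> \<le> C"
proof -
 have pm: "(\<Sum>ij\<in>mark_pairs k. pmf p ij) \<le> 1"
  by (rule order_trans[OF _ measure_pmf.prob_le_1[of p "mark_pairs k"]]) (simp add: measure_measure_pmf_finite)
 have C0: "0 \<le> C" using order_trans[OF abs_ge_zero G] .
 have "\<bar>mark_mean N k p G\<bar> \<le> (\<Sum>A\<in>k_subsets N k. \<Sum>ij\<in>mark_pairs k. 1 / real (N choose k) * pmf p ij * C)"
  unfolding mark_mean_def using G
  by (intro order_trans[OF sum_abs] sum_mono order_trans[OF sum_abs]) (auto simp: abs_mult intro!: mult_left_mono divide_right_mono)
 also have "... = real (card (k_subsets N k)) * (1 / real (N choose k) * (\<Sum>ij\<in>mark_pairs k. pmf p ij) * C)"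
  by (simp add: sum_distrib_left sum_distrib_right)
 also have "... = (\<Sum>ij\<in>mark_pairs k. pmf p ij) * C"
  using k by (simp add: card_k_subsets)
 also have "... \<le> 1 * C" using pm C0 by (rule mult_right_mono)
 finally show ?thesis by simp
qed

locale bbm_step = np_bbm_driven M k lam p N Y B \<tau> S q + step_test \<phi> N
 for M :: "'a measure" and k lam p N Y B \<tau> S q and \<phi> :: "ereal => real" +
 fixes s s' :: real
 assumes s: "0 \<le> s" "s < s'"
begin

abbreviation "\<delta> \<equiv> s' - s"

abbreviation "dB \<equiv> \<lambda>i w. B i s' w - B i s w"

abbreviation "Ybase \<equiv> \<lambda>w i. Yhat s w i + ereal (dB i w)"

lemma s': "0 \<le> s'" using s by simp

lemma Yhat_M: "i \<in> {1..N} ==> (\<lambda>w. Yhat s w i) \<in> borel_measurable M"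
 using Yhat_measurable_M s by simp

lemma dB_M: "i \<in> {1..N} ==> dB i \<in> borel_measurable M"
 by (intro borel_measurable_diff B_measurable_M) (use s in auto)

lemma Ybase_M: "i \<in> {1..N} ==> (\<lambda>w. Ybase w i) \<in> borel_measurable M"
 by (intro borel_measurable_ereal_add borel_measurable_ereal Yhat_M dB_M)

lemma brownian_one:
 assumes i: "i \<in> {1..N}" and X: "X \<in> borel_measurable (past_sigma i s)" and b: "\<And>w. \<bar>X w\<bar> \<le> 1"
 shows "(\<integral>w. X w * \<phi> (Ybase w i) \<partial>M) = (\<integral>w. X w * heat \<delta> \<phi> (Yhat s w i) \<partial>M)"
proof -
 note [measurable] = X Yhat_past_measurable[OF s(1) i i]
 have "(\<integral>w. X w * \<phi> (Ybase w i) \<partial>M) = (\<integral>w. (\<integral>z. X w * \<phi> (Yhat s w i + ereal (sqrt \<delta> * z)) \<partial>gauss) \<partial>M)"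
 proof -
  have "\<bar>X w * \<phi> y\<bar> \<le> 1" for w y
   unfolding abs_mult using b[of w] \<phi>01[of y] by (intro mult_le_one) auto
  then show ?thesis
   using increment_integral[OF i s, of "\<lambda>(w, y). X w * \<phi> (Yhat s w i + ereal y)" 1] by (simp add: split_beta')
 qed
 then show ?thesis by (simp add: heat_def)
qed

lemma heat_\<phi>: "0 \<le> heat \<delta> \<phi> y" "heat \<delta> \<phi> y \<le> 1" "heat \<delta> \<phi> \<in> borel_measurable borel"
proof -
 show "0 \<le> heat \<delta> \<phi> y" unfolding heat_def using \<phi>01 by (intro Bochner_Integration.integral_nonneg) auto
 show "heat \<delta> \<phi> y \<le> 1" using heat_bound[OF \<phi>_meas, of 1 \<delta> y] \<phi>01 by (simp add: abs_le_iff)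
qed measurable

text \<open>The increments of all other particles belong to the past of particle \<open>i\<close>;
  this is why \<open>past_sigma\<close> withholds the future of a single particle only.\<close>

lemma measurable_other_past:
 assumes i: "i \<in> {1..N}" and j: "j \<in> {1..N}" "j \<noteq> i" shows "(\<lambda>w. Ybase w j) \<in> borel_measurable (past_sigma i s)"
proof (intro borel_measurable_ereal_add borel_measurable_ereal borel_measurable_diff)
 show "(\<lambda>w. Yhat s w j) \<in> borel_measurable (past_sigma i s)" by (rule Yhat_past_measurable[OF s(1) j(1) i])
 have "B j r \<in> borel_measurable (past_sigma i s)" if "0 \<le> r" for r
  by (rule measurable_src_past[OF measurable_motion[of j "sources N - {Motion i}"]]) (use that j in auto)
 then show "(\<lambda>w. B j s' w) \<in> borel_measurable (past_sigma i s)" "(\<lambda>w. B j s w) \<in> borel_measurable (past_sigma i s)"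
  using s by auto
qed

text \<open>In each product the increments are integrated out one label at a time: first that of
  \<open>i\<close>, with the displaced particle \<open>j\<close> frozen, then that of
  \<open>j\<close>, with the smoothed value at particle \<open>i\<close> frozen.\<close>

lemma brownian_step:
 "(\<integral>w. fm N \<phi> u (Ybase w) \<partial>M) = (\<integral>w. fm N (heat \<delta> \<phi>) u (Yhat s w) \<partial>M)"
proof -
 let ?\<psi> = "heat \<delta> \<phi>"
 note heat_\<phi>(3)[measurable]
 have one: "(\<integral>w. \<phi> (Ybase w i) \<partial>M) = (\<integral>w. ?\<psi> (Yhat s w i) \<partial>M)" if i: "i \<in> {1..N}" for i
  using brownian_one[OF i, of "\<lambda>_. 1"] by simp
 have two: "(\<integral>w. \<phi> (Ybase w i) * \<phi> (Ybase w j) \<partial>M) = (\<integral>w. ?\<psi> (Yhat s w i) * ?\<psi> (Yhat s w j) \<partial>M)"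
  if i: "i \<in> {1..N}" and j: "j \<in> {1..N}" "j \<noteq> i" for i j
 proof -
  have "(\<integral>w. \<phi> (Ybase w j) * \<phi> (Ybase w i) \<partial>M) = (\<integral>w. \<phi> (Ybase w j) * ?\<psi> (Yhat s w i) \<partial>M)"
  proof (rule brownian_one[OF i])
   note [measurable] = measurable_other_past[OF i j]
   show "(\<lambda>w. \<phi> (Ybase w j)) \<in> borel_measurable (past_sigma i s)" by measurable
  qed (use \<phi>01 in simp)
  moreover have "(\<integral>w. ?\<psi> (Yhat s w i) * \<phi> (Ybase w j) \<partial>M) = (\<integral>w. ?\<psi> (Yhat s w i) * ?\<psi> (Yhat s w j) \<partial>M)"
  proof (rule brownian_one[OF j(1)])
   note [measurable] = Yhat_past_measurable[OF s(1) i j(1)]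
   show "(\<lambda>w. ?\<psi> (Yhat s w i)) \<in> borel_measurable (past_sigma j s)" by measurable
  qed (use heat_\<phi> in simp)
  ultimately show ?thesis by (simp add: mult.commute)
 qed
 have expand: "(\<integral>w. fm N f u (W w) \<partial>M) = (\<Sum>i=1..N. \<Sum>j\<in>{1..N}-{i}. (\<integral>w. f (W w i) * f (W w j) \<partial>M)) / (real N)\<^sup>2
   - 2 * u * (\<Sum>i=1..N. (\<integral>w. f (W w i) \<partial>M)) / real N + u\<^sup>2"
  if f: "f \<in> borel_measurable borel" "\<And>y. 0 \<le> f y" "\<And>y. f y \<le> 1" and W: "\<And>i. i \<in> {1..N} ==> (\<lambda>w. W w i) \<in> borel_measurable M" for f W
 proof -
  have fW: "(\<lambda>w. f (W w i)) \<in> borel_measurable M" if "i \<in> {1..N}" for i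
   by (rule measurable_compose[OF W[OF that] f(1)])
  have i1: "integrable M (\<lambda>w. f (W w i))" if "i \<in> {1..N}" for i
   by (rule integrable_const_bound[where B=1]) (use fW[OF that] f in auto)
  have i2: "integrable M (\<lambda>w. f (W w i) * f (W w j))" if "i \<in> {1..N}" "j \<in> {1..N}" for i j
   by (rule integrable_const_bound[where B=1]) (use fW that f in \<open>auto simp: abs_mult intro!: mult_le_one\<close>)
  have I2: "integrable M (\<lambda>w. \<Sum>j\<in>{1..N}-{i}. f (W w i) * f (W w j))" if "i \<in> {1..N}" for i
   by (rule Bochner_Integration.integrable_sum) (use i2 that in auto)
  have I1: "integrable M (\<lambda>w. \<Sum>i=1..N. f (W w i))"
   by (rule Bochner_Integration.integrable_sum) (use i1 in auto)
  have I3: "integrable M (\<lambda>w. \<Sum>i=1..N. \<Sum>j\<in>{1..N}-{i}. f (W w i) * f (W w j))"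
   by (rule Bochner_Integration.integrable_sum) (use I2 in auto)
  have "(\<integral>w. fm N f u (W w) \<partial>M) = (\<integral>w. (\<Sum>i=1..N. \<Sum>j\<in>{1..N}-{i}. f (W w i) * f (W w j)) / (real N)\<^sup>2 - 2 * u * (\<Sum>i=1..N. f (W w i)) / real N + u\<^sup>2 \<partial>M)"
   by (simp add: fm_off_diagonal[OF N_pos])
  also have "... = (\<integral>w. (\<Sum>i=1..N. \<Sum>j\<in>{1..N}-{i}. f (W w i) * f (W w j)) \<partial>M) / (real N)\<^sup>2 - 2 * u * (\<integral>w. (\<Sum>i=1..N. f (W w i)) \<partial>M) / real N + u\<^sup>2"
   using I1 I3 by (simp add: prob_space)
  also have "(\<integral>w. (\<Sum>i=1..N. f (W w i)) \<partial>M) = (\<Sum>i=1..N. (\<integral>w. f (W w i) \<partial>M))"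
   by (rule Bochner_Integration.integral_sum) (use i1 in auto)
  also have "(\<integral>w. (\<Sum>i=1..N. \<Sum>j\<in>{1..N}-{i}. f (W w i) * f (W w j)) \<partial>M) = (\<Sum>i=1..N. (\<integral>w. (\<Sum>j\<in>{1..N}-{i}. f (W w i) * f (W w j)) \<partial>M))"
   by (rule Bochner_Integration.integral_sum) (use I2 in auto)
  also have "... = (\<Sum>i=1..N. \<Sum>j\<in>{1..N}-{i}. (\<integral>w. f (W w i) * f (W w j) \<partial>M))"
   by (intro sum.cong refl Bochner_Integration.integral_sum) (use i2 in auto)
  finally show ?thesis .
 qed
 show ?thesis
  apply (subst expand[of \<phi> Ybase, OF \<phi>_meas \<phi>01 Ybase_M], assumption)
  apply (subst expand[of ?\<psi> "Yhat s", OF heat_\<phi>(3,1,2) Yhat_M], assumption)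
  apply (intro arg_cong2[where f="(+)"] arg_cong2[where f="(-)"] arg_cong2[where f="(/)"] arg_cong2[where f="(*)"] sum.cong refl one two; simp)
  done
qed

text \<open>When \<open>n\<close> jumps precede \<open>s\<close>, the configuration at
  \<open>s\<close> uses only marks of index below \<open>n\<close>. Hence the marks of index
  \<open>n\<close> can be averaged out, and by the memoryless property the ring of clock
  \<open>n\<close> within the cell contributes the factor \<open>jump_prob \<delta>\<close>.\<close>

lemma mark_step:
 "(\<integral>w. of_bool (J1 s s' w) * ((gm N \<phi> (Yhat s w) - u) * mark_gain N \<phi> (Yhat s w) (S' (cnt s w) w) (q' (cnt s w) w)) \<partial>M)
  = jump_prob \<delta> * (\<integral>w. (gm N \<phi> (Yhat s w) - u) * mark_mean N k p (mark_gain N \<phi> (Yhat s w)) \<partial>M)"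
proof -
 define W where "W = (\<lambda>n A ij w. (gm N \<phi> (Yn s n w) - u) * mark_gain N \<phi> (Yn s n w) A ij)"
 define C where "C = 1 + \<bar>u\<bar>"
 have Wb: "\<bar>W n A ij w\<bar> \<le> C" for n A ij w
 proof -
  have "\<bar>W n A ij w\<bar> \<le> (1 + \<bar>u\<bar>) * 1"
   unfolding W_def abs_mult using gm_u mark_gain_abs by (intro mult_mono) auto
  then show ?thesis by (simp add: C_def)
 qed
 have C0: "0 \<le> C" by (simp add: C_def)
 have Yn: "(\<lambda>w. Yn s n w i) \<in> borel_measurable (src_sigma I)"
  if i: "i \<in> {1..N}" and I: "Initial \<in> I" "Motion ` {1..N} \<subseteq> I" "Clock ` {..<n} \<subseteq> I" "Subset ` {..<n} \<subseteq> I" "Pair ` {..<n} \<subseteq> I" for i n I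
  by (rule Yn_measurable[OF s(1) _ _ _ _ _ i])
    (use I in \<open>auto intro!: measurable_initial measurable_motion measurable_clock measurable_subset measurable_pair\<close>)
 have Wm: "W n A ij \<in> borel_measurable (src_sigma I)"
  if A: "A \<in> k_subsets N k" and ij: "ij \<in> mark_pairs k" and I: "Initial \<in> I" "Motion ` {1..N} \<subseteq> I" "Clock ` {..<n} \<subseteq> I" "Subset ` {..<n} \<subseteq> I" "Pair ` {..<n} \<subseteq> I" for n A ij I
  unfolding W_def
  by (intro borel_measurable_times borel_measurable_diff measurable_gm measurable_mark_gain[OF _ _ A ij] Yn[OF _ I]) auto
 let ?X = "\<lambda>n w. W n (S' n w) (q' n w) w"
 have X: "?X n \<in> borel_measurable (src_sigma (sources N - {Clock n}))" for n
 proof -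
  let ?F = "src_sigma (sources N - {Clock n})"
  have 1: "(\<lambda>w. W n A (q' n w) w) \<in> borel_measurable ?F" if A: "A \<in> k_subsets N k" for A
   by (rule measurable_compose_countable'[OF Wm[OF A] q'_measurable[OF measurable_pair]])
     (auto intro: countable_finite)
  show ?thesis
   by (rule measurable_compose_countable'[OF 1 S'_measurable[OF measurable_subset]]) (auto intro: countable_finite)
 qed
 have XM: "?X n \<in> borel_measurable M" for n by (rule measurable_src_sigma_M[OF X]) auto
 let ?V = "\<lambda>n w. mark_mean N k p (\<lambda>A ij. W n A ij w)"
 have Vb: "\<bar>?V n w\<bar> \<le> C" for n w by (rule mark_mean_abs[OF Wb])
 have VM: "?V n \<in> borel_measurable M" for n
  unfolding mark_mean_def
  by (intro borel_measurable_sum borel_measurable_times borel_measurable_const measurable_src_sigma_M[OF Wm[of _ _ "sources N"]]) auto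
 have E: "(\<integral>w. ?X (cnt s w) w \<partial>M) = (\<integral>w. ?V (cnt s w) w \<partial>M)"
 proof -
  have c1: "(\<lambda>n. \<integral>w. ?X (cnt s w) w * of_bool (at_n s n w) \<partial>M) sums (\<integral>w. ?X (cnt s w) w \<partial>M)"
   by (rule integral_partition[OF measurable_at_cnt[OF XM] Wb s(1)])
  have c2: "(\<lambda>n. \<integral>w. ?V (cnt s w) w * of_bool (at_n s n w) \<partial>M) sums (\<integral>w. ?V (cnt s w) w \<partial>M)"
   by (rule integral_partition[OF measurable_at_cnt[OF VM] Vb s(1)])
  have "(\<integral>w. ?X (cnt s w) w * of_bool (at_n s n w) \<partial>M) = (\<integral>w. ?V (cnt s w) w * of_bool (at_n s n w) \<partial>M)" for n
  proof -
   let ?I = "sources N - {Subset n, Pair n}"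
   have Tm [measurable]: "T n \<in> borel_measurable (src_sigma ?I)" "T (Suc n) \<in> borel_measurable (src_sigma ?I)"
    by (intro T_measurable measurable_clock; auto)+
   note [measurable] = measurable_at_cnt[OF XM, where s=s] measurable_at_cnt[OF VM, where s=s] XM VM
   have "(\<integral>w. ?X (cnt s w) w * of_bool (at_n s n w) \<partial>M) = (\<integral>w. ?X n w * of_bool (at_n s n w) \<partial>M)"
   proof (rule integral_cong_AE)
    show "AE w in M. ?X (cnt s w) w * of_bool (at_n s n w) = ?X n w * of_bool (at_n s n w)"
     using good_AE
    proof eventually_elim
     case (elim w)
     show ?case using good_cnt_eq[OF elim s(1), of n] by auto
    qed
   qed measurable
   also have "... = (\<integral>w. mark_mean N k p (\<lambda>A ij. W n A ij w * of_bool (at_n s n w)) \<partial>M)"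
   proof (rule mark_integral[where C=C])
    fix A ij assume m: "A \<in> k_subsets N k" "ij \<in> mark_pairs k"
    have [measurable]: "W n A ij \<in> borel_measurable (src_sigma ?I)" by (rule Wm[OF m]) auto
    show "(\<lambda>w. W n A ij w * of_bool (at_n s n w)) \<in> borel_measurable (src_sigma ?I)" by measurable
   qed (use Wb C0 in \<open>auto simp: abs_mult\<close>)
   also have "... = (\<integral>w. ?V n w * of_bool (at_n s n w) \<partial>M)"
    by (simp add: mark_mean_def sum_distrib_right mult.assoc)
   also have "... = (\<integral>w. ?V (cnt s w) w * of_bool (at_n s n w) \<partial>M)"
   proof (rule integral_cong_AE)
    show "AE w in M. ?V n w * of_bool (at_n s n w) = ?V (cnt s w) w * of_bool (at_n s n w)"
     using good_AE
    proof eventually_elim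
     case (elim w)
     show ?case using good_cnt_eq[OF elim s(1), of n] by auto
    qed
   qed measurable
   finally show ?thesis .
  qed
  with c1 c2 show ?thesis using sums_unique2 by simp
 qed
 have "(\<integral>w. ?X (cnt s w) w * of_bool (J1 s s' w) \<partial>M) = jump_prob \<delta> * (\<integral>w. ?V (cnt s w) w \<partial>M)"
  using next_jump_integral[of ?X C, OF X Wb s(1)] s E by simp
 moreover have "W (cnt s w) A ij w = (gm N \<phi> (Yhat s w) - u) * mark_gain N \<phi> (Yhat s w) A ij" for A ij w
 proof -
  have "Yhat s w = Yn s (cnt s w) w" by (rule ext) (simp add: Yhat_def)
  then show ?thesis by (simp add: W_def)
 qed
 moreover have "mark_mean N k p (\<lambda>A ij. c * f A ij) = c * mark_mean N k p f" for c f
  by (simp add: mark_mean_def sum_distrib_left mult.left_commute)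
 ultimately show ?thesis by (simp add: mult.commute)
qed

end

section \<open>Change of the error functional over one cell\<close>

context bbm_step
begin

definition osc :: "real => 'a => real" where
 "osc \<Lambda> w = (\<Sum>i=1..N. min 1 (\<Lambda> * \<bar>Bm i s' (next_jump s w) w - B i s w\<bar>))
   + (\<Sum>i=1..N. min 1 (\<Lambda> * \<bar>B i s' w - Bm i s' (next_jump s w) w\<bar>))"

definition gain :: "real => 'a => real" where
 "gain u w = (gm N \<phi> (Yhat s w) - u) * mark_gain N \<phi> (Yhat s w) (S' (cnt s w) w) (q' (cnt s w) w)"

lemma gain_abs: "\<bar>gain u w\<bar> \<le> 1 + \<bar>u\<bar>"
proof -
 have "\<bar>gain u w\<bar> \<le> (1 + \<bar>u\<bar>) * 1"
  unfolding gain_def abs_mult using gm_u mark_gain_abs by (intro mult_mono) auto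
 then show ?thesis by simp
qed

lemma J2_imp_J1:
 assumes "good w" "J2 s s' w" shows "J1 s s' w"
 using good_T_mono[OF assms(1), of "Suc (cnt s w)" "Suc (Suc (cnt s w))"] assms(2)
 by (simp add: J1_def J2_def next_jump_def)

lemma step_no_jump:
 assumes g: "good w" and "\<not> J1 s s' w" and i: "i \<in> {1..N}"
 shows "Yhat s' w i = Ybase w i"
proof -
 let ?n = "cnt s w"
 have t: "T ?n w \<le> s" "s < T (Suc ?n) w" "s' < T (Suc ?n) w"
  using good_cnt[OF g s(1)] assms(2) by (auto simp: J1_def next_jump_def)
 have "Y r w i = Y (T ?n w) w i + ereal (B i r w - B i (T ?n w) w)" if "r = s \<or> r = s'" for r
  using g t i s that unfolding good_def by force
 then show ?thesis
  using good_Yhat[OF g s(1) i] good_Yhat[OF g s' i] by (simp add: add.assoc)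
qed

lemma step_one_jump:
 assumes g: "good w" and J: "J1 s s' w" "\<not> J2 s s' w" and i: "i \<in> {1..N}"
 shows "Yhat s' w i = jump N (S' (cnt s w) w) (q' (cnt s w) w)
   (\<lambda>i. Yhat s w i + ereal (Bm i s' (next_jump s w) w - B i s w)) i + ereal (B i s' w - Bm i s' (next_jump s w) w)"
proof -
 let ?n = "cnt s w" and ?t = "next_jump s w"
 have t: "T ?n w \<le> s" "s < ?t" "?t \<le> s'" "s' < T (Suc (Suc ?n)) w"
  using good_cnt[OF g s(1)] J by (auto simp: J1_def J2_def next_jump_def)
 have SS: "S' ?n w = S ?n w" "q' ?n w = q ?n w" "S ?n w \<in> k_subsets N k" "q ?n w \<in> mark_pairs k"
  using g by (auto simp: good_def S'_def q'_def)
 have B: "Bm j s' ?t w = B j ?t w" if "j \<in> {1..N}" for j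
  using g that t s by (intro Bm_eq) (auto simp: good_def)
 have "Y s' w i = Y ?t w i + ereal (B i s' w - B i ?t w)"
  using g t i unfolding good_def next_jump_def by blast
 moreover have "Y ?t w i = jump N (S ?n w) (q ?n w) (\<lambda>i. Y (T ?n w) w i + ereal (B i ?t w - B i (T ?n w) w)) i"
  using g i unfolding good_def next_jump_def by blast
 moreover have "... = jump N (S ?n w) (q ?n w) (\<lambda>i. Yhat s w i + ereal (Bm i s' ?t w - B i s w)) i"
 proof (rule jump_cong[OF _ SS(3,4) i])
  fix j assume j: "j \<in> {1..N}"
  have "Y s w j = Y (T ?n w) w j + ereal (B j s w - B j (T ?n w) w)"
   using g t j unfolding good_def next_jump_def by blast
  then show "Y (T ?n w) w j + ereal (B j ?t w - B j (T ?n w) w) = Yhat s w j + ereal (Bm j s' ?t w - B j s w)"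
   using good_Yhat[OF g s(1) j] B[OF j] by (simp add: add.assoc)
 qed
 ultimately show ?thesis using good_Yhat[OF g s' i] B[OF i] SS by simp
qed

lemma step_pathwise:
 assumes g: "good w" and lip: "\<And>y d. \<bar>\<phi> (y + ereal d) - \<phi> y\<bar> \<le> \<Lambda> * \<bar>d\<bar>" and \<Lambda>: "0 \<le> \<Lambda>"
 shows "fm N \<phi> u (Yhat s' w) \<le> fm N \<phi> u (Ybase w)
  + of_bool (J1 s s' w) * (2 / real N * gain u w + 2 / (real N)\<^sup>2 + (6 + 4 * \<bar>u\<bar>) * osc \<Lambda> w)
  + of_bool (J2 s s' w) * ((1 + \<bar>u\<bar>)\<^sup>2 + 1 + 2 * (1 + \<bar>u\<bar>))"
proof -
 have o: "0 \<le> osc \<Lambda> w" unfolding osc_def using \<Lambda> by (intro add_nonneg_nonneg sum_nonneg) auto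
 consider "\<not> J1 s s' w" | "J1 s s' w" "\<not> J2 s s' w" | "J2 s s' w" by blast
 then show ?thesis
 proof cases
  case 1
  have "fm N \<phi> u (Yhat s' w) = fm N \<phi> u (Ybase w)"
   by (rule fm_cong) (rule step_no_jump[OF g 1])
  with 1 show ?thesis using J2_imp_J1[OF g] by auto
 next
  case 2
  have "fm N \<phi> u (Yhat s' w) = fm N \<phi> u (\<lambda>i. jump N (S' (cnt s w) w) (q' (cnt s w) w)
   (\<lambda>i. Yhat s w i + ereal (Bm i s' (next_jump s w) w - B i s w)) i + ereal (B i s' w - Bm i s' (next_jump s w) w))"
   by (rule fm_cong) (rule step_one_jump[OF g 2])
  with jump_effect[OF lip \<Lambda> S'_mem q'_mem, of u "cnt s w" w "cnt s w" w "Yhat s w" "\<lambda>i. Bm i s' (next_jump s w) w - B i s w"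
    "\<lambda>i. B i s' w - Bm i s' (next_jump s w) w"] 2
  show ?thesis by (simp add: gain_def osc_def)
 next
  case 3
  \<comment> \<open>With two or more jumps nothing is computed: the range of \<open>fm\<close>
    bounds the change, and the extra \<open>2 * (1 + \<bar>u\<bar>)\<close> compensates a possibly
    negative gain term on the right.\<close>
  have "\<bar>2 / real N * gain u w\<bar> \<le> 2 * (1 + \<bar>u\<bar>)"
   unfolding abs_mult using gain_abs N_pos by (intro mult_mono) (auto simp: divide_le_eq)
  then have "- (2 * (1 + \<bar>u\<bar>)) \<le> 2 / real N * gain u w" by linarith
  moreover have "0 \<le> (6 + 4 * \<bar>u\<bar>) * osc \<Lambda> w" "0 \<le> 2 / (real N)\<^sup>2" using o by auto
  ultimately have "fm N \<phi> u (Yhat s' w) \<le> fm N \<phi> u (Ybase w)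
   + (2 / real N * gain u w + 2 / (real N)\<^sup>2 + (6 + 4 * \<bar>u\<bar>) * osc \<Lambda> w) + ((1 + \<bar>u\<bar>)\<^sup>2 + 1 + 2 * (1 + \<bar>u\<bar>))"
   using fm_bounds[of u "Yhat s' w"] fm_bounds[of u "Ybase w"] by linarith
  with 3 J2_imp_J1[OF g 3] show ?thesis by simp
 qed
qed

text \<open>Valid for discontinuous \<open>\<phi>\<close> too; this version serves the cell in which
  the test function is the indicator itself.\<close>

lemma step_pathwise_crude:
 assumes g: "good w"
 shows "fm N \<phi> u (Yhat s' w) \<le> fm N \<phi> u (Ybase w) + of_bool (J1 s s' w) * ((1 + \<bar>u\<bar>)\<^sup>2 + 1)"
proof (cases "J1 s s' w")
 case True
 then show ?thesis using fm_bounds[of u "Yhat s' w"] fm_bounds[of u "Ybase w"] by simp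
next
 case False
 have "fm N \<phi> u (Yhat s' w) = fm N \<phi> u (Ybase w)"
  by (rule fm_cong) (rule step_no_jump[OF g False])
 with False show ?thesis by simp
qed

lemma fm_integrable:
 assumes W: "\<And>i. i \<in> {1..N} ==> (\<lambda>w. W w i) \<in> borel_measurable M"
 shows "integrable M (\<lambda>w. fm N \<phi> u (W w))"
proof (rule integrable_const_bound)
 show "AE w in M. norm (fm N \<phi> u (W w)) \<le> (1 + \<bar>u\<bar>)\<^sup>2 + 1"
  using fm_bounds[of u "W _"] by (intro AE_I2) (simp add: abs_le_iff, smt (verit) zero_le_power2)
qed (rule measurable_fm[OF \<phi>_meas W])

lemma one_step_crude:
 "(\<integral>w. fm N \<phi> u (Yhat s' w) \<partial>M) \<le> (\<integral>w. fm N (heat \<delta> \<phi>) u (Yhat s w) \<partial>M) + ((1 + \<bar>u\<bar>)\<^sup>2 + 1) * jump_prob \<delta>"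
proof -
 have J: "integrable M (\<lambda>w. of_bool (J1 s s' w) :: real)"
  by (rule integrable_const_bound[where B=1]) auto
 have b: "integrable M (\<lambda>w. fm N \<phi> u (Ybase w))" by (rule fm_integrable[OF Ybase_M])
 have "(\<integral>w. fm N \<phi> u (Yhat s' w) \<partial>M) \<le> (\<integral>w. fm N \<phi> u (Ybase w) + of_bool (J1 s s' w) * ((1 + \<bar>u\<bar>)\<^sup>2 + 1) \<partial>M)"
 proof (rule integral_mono_AE)
  show "AE w in M. fm N \<phi> u (Yhat s' w) \<le> fm N \<phi> u (Ybase w) + of_bool (J1 s s' w) * ((1 + \<bar>u\<bar>)\<^sup>2 + 1)"
   using good_AE by eventually_elim (rule step_pathwise_crude)
  show "integrable M (\<lambda>w. fm N \<phi> u (Yhat s' w))"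
   by (rule fm_integrable) (use Yhat_measurable_M s' in auto)
 qed (use J b in auto)
 also have "... = (\<integral>w. fm N \<phi> u (Ybase w) \<partial>M) + (\<integral>w. of_bool (J1 s s' w) \<partial>M) * ((1 + \<bar>u\<bar>)\<^sup>2 + 1)"
  using J b by (subst Bochner_Integration.integral_add) auto
 finally show ?thesis using brownian_step J1_prob s by (simp add: mult.commute)
qed

lemma gain_measurable: "gain u \<in> borel_measurable M"
proof -
 have [measurable]: "(\<lambda>w. gm N \<phi> (Yhat s w)) \<in> borel_measurable M" by (rule measurable_gm[OF \<phi>_meas Yhat_M])
 have "(\<lambda>w. mark_gain N \<phi> (Yhat s w) (S' n w) (q' n w)) \<in> borel_measurable M" for n
 proof -
  have 1: "(\<lambda>w. mark_gain N \<phi> (Yhat s w) A (q' n w)) \<in> borel_measurable M" if A: "A \<in> k_subsets N k" for A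
   by (rule measurable_compose_countable'[OF measurable_mark_gain[OF \<phi>_meas Yhat_M A] q'_measurable[OF measurable_src_sigma_M[OF measurable_pair[of n "{Pair n}"]]]])
     (auto intro: countable_finite)
  show ?thesis
   by (rule measurable_compose_countable'[OF 1 S'_measurable[OF measurable_src_sigma_M[OF measurable_subset[of n "{Subset n}"]]]])
     (auto intro: countable_finite)
 qed
 then have [measurable]: "(\<lambda>w. mark_gain N \<phi> (Yhat s w) (S' (cnt s w) w) (q' (cnt s w) w)) \<in> borel_measurable M"
  by (rule measurable_at_cnt)
 show ?thesis unfolding gain_def by measurable
qed

text \<open>Expectation of the pathwise bound. The displacement terms are paid only when a jump
  occurs, and the jump time is independent of the motion, so they contribute
  \<open>jump_prob \<delta>\<close> times a multiple of
  \<open>N * \<Lambda> * sqrt \<delta>\<close>: for fixed \<open>N\<close> this is of smaller order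
  than \<open>\<delta>\<close>.\<close>

lemma one_step:
 assumes lip: "\<And>y d. \<bar>\<phi> (y + ereal d) - \<phi> y\<bar> \<le> \<Lambda> * \<bar>d\<bar>" and \<Lambda>: "0 \<le> \<Lambda>"
 shows "(\<integral>w. fm N \<phi> u (Yhat s' w) \<partial>M) \<le> (\<integral>w. fm N (heat \<delta> \<phi>) u (Yhat s w) \<partial>M)
  + jump_prob \<delta> * (2 / real N * (\<integral>w. (gm N \<phi> (Yhat s w) - u) * mark_mean N k p (mark_gain N \<phi> (Yhat s w)) \<partial>M) + 2 / (real N)\<^sup>2
   + (6 + 4 * \<bar>u\<bar>) * (2 * real N * \<Lambda> * sqrt \<delta>) + ((1 + \<bar>u\<bar>)\<^sup>2 + 1 + 2 * (1 + \<bar>u\<bar>)) * jump_prob \<delta>)"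
proof -
 let ?a = "\<lambda>i w. min 1 (\<Lambda> * \<bar>Bm i s' (next_jump s w) w - B i s w\<bar>)" and ?b = "\<lambda>i w. min 1 (\<Lambda> * \<bar>B i s' w - Bm i s' (next_jump s w) w\<bar>)"
 let ?J1 = "\<lambda>w. of_bool (J1 s s' w) :: real" and ?J2 = "\<lambda>w. of_bool (J2 s s' w) :: real"
 let ?K = "(1 + \<bar>u\<bar>)\<^sup>2 + 1 + 2 * (1 + \<bar>u\<bar>)" and ?c = "6 + 4 * \<bar>u\<bar>"
 note [measurable] = gain_measurable
 have J: "integrable M ?J1" "integrable M ?J2"
  by (rule integrable_const_bound[where B=1]; simp)+
 have b: "integrable M (\<lambda>w. fm N \<phi> u (Ybase w))" by (rule fm_integrable[OF Ybase_M])
 have G: "integrable M (\<lambda>w. ?J1 w * gain u w)"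
  by (rule integrable_const_bound[where B="1 + \<bar>u\<bar>"]) (use gain_abs in auto)
 have BmM: "(\<lambda>w. Bm i s' (next_jump s w) w) \<in> borel_measurable M" if i: "i \<in> {1..N}" for i
  using measurable_compose[OF measurable_Pair[OF next_jump_measurable_M measurable_ident] Bm_measurable[OF B_measurable_M[OF i] s']]
  by simp
 have "integrable M (\<lambda>w. ?J1 w * ?a i w)"
   "integrable M (\<lambda>w. ?J1 w * ?b i w)" if i: "i \<in> {1..N}" for i
 proof -
  note [measurable] = BmM[OF i] B_measurable_M[OF i s'] B_measurable_M[OF i s(1)]
  show "integrable M (\<lambda>w. ?J1 w * ?a i w)"
   "integrable M (\<lambda>w. ?J1 w * ?b i w)"
   by (rule integrable_const_bound[where B=1]; use \<Lambda> in simp)+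
 qed
 then have oi: "integrable M (\<lambda>w. \<Sum>i=1..N. ?J1 w * ?a i w)"
   "integrable M (\<lambda>w. \<Sum>i=1..N. ?J1 w * ?b i w)"
  and oe: "(\<integral>w. (\<Sum>i=1..N. ?J1 w * ?a i w) \<partial>M) \<le> (\<Sum>i=1..N. jump_prob \<delta> * (\<Lambda> * sqrt \<delta>))"
   "(\<integral>w. (\<Sum>i=1..N. ?J1 w * ?b i w) \<partial>M) \<le> (\<Sum>i=1..N. jump_prob \<delta> * (\<Lambda> * sqrt \<delta>))"
  using oscillation_before[OF _ s \<Lambda>] oscillation_after[OF _ s \<Lambda>]
  by (auto simp del: sum_of_bool_mult_eq sum_mult_of_bool_eq sum_constant simp: Bochner_Integration.integral_sum intro!: Bochner_Integration.integrable_sum sum_mono)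
 have od: "?J1 w * osc \<Lambda> w = (\<Sum>i=1..N. ?J1 w * ?a i w)
   + (\<Sum>i=1..N. ?J1 w * ?b i w)" for w
  by (simp add: osc_def sum_distrib_left distrib_left)
 have O: "integrable M (\<lambda>w. ?J1 w * osc \<Lambda> w)" "(\<integral>w. ?J1 w * osc \<Lambda> w \<partial>M) \<le> jump_prob \<delta> * (2 * real N * \<Lambda> * sqrt \<delta>)"
  unfolding od using oi oe by (auto simp: algebra_simps)
 have "(\<integral>w. fm N \<phi> u (Yhat s' w) \<partial>M) \<le> (\<integral>w. fm N \<phi> u (Ybase w)
  + (2 / real N * (?J1 w * gain u w) + (2 / (real N)\<^sup>2) * ?J1 w + ?c * (?J1 w * osc \<Lambda> w)) + ?K * ?J2 w \<partial>M)"
 proof (rule integral_mono_AE)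
  show "AE w in M. fm N \<phi> u (Yhat s' w) \<le> fm N \<phi> u (Ybase w)
   + (2 / real N * (?J1 w * gain u w) + (2 / (real N)\<^sup>2) * ?J1 w + ?c * (?J1 w * osc \<Lambda> w)) + ?K * ?J2 w"
   using good_AE
  proof eventually_elim
   case (elim w)
   show ?case using step_pathwise[OF elim lip \<Lambda>, of u] by (simp add: algebra_simps of_bool_def split: if_splits)
  qed
  show "integrable M (\<lambda>w. fm N \<phi> u (Yhat s' w))"
   by (rule fm_integrable) (use Yhat_measurable_M s' in auto)
 qed (use J b G O in simp)
 also have "... = (\<integral>w. fm N \<phi> u (Ybase w) \<partial>M)
  + (2 / real N * (\<integral>w. ?J1 w * gain u w \<partial>M) + (2 / (real N)\<^sup>2) * (\<integral>w. ?J1 w \<partial>M) + ?c * (\<integral>w. ?J1 w * osc \<Lambda> w \<partial>M)) + ?K * (\<integral>w. ?J2 w \<partial>M)"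
  using J b G O by (simp del: of_bool_eq)
 also have "... \<le> (\<integral>w. fm N \<phi> u (Ybase w) \<partial>M)
  + (2 / real N * (\<integral>w. ?J1 w * gain u w \<partial>M) + (2 / (real N)\<^sup>2) * jump_prob \<delta> + ?c * (jump_prob \<delta> * (2 * real N * \<Lambda> * sqrt \<delta>))) + ?K * (jump_prob \<delta>)\<^sup>2"
  using J1_prob[of s s'] J2_prob[of s s'] s O(2) by (intro add_mono mult_left_mono) auto
 also have "(\<integral>w. ?J1 w * gain u w \<partial>M) = jump_prob \<delta> * (\<integral>w. (gm N \<phi> (Yhat s w) - u) * mark_mean N k p (mark_gain N \<phi> (Yhat s w)) \<partial>M)"
  unfolding gain_def by (rule mark_step)
 finally show ?thesis unfolding brownian_step by (simp add: algebra_simps power2_eq_square)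
qed

end

section \<open>The mean square error\<close>

lemma gm_test: "gm N (test r x) z = heat r (emp N z) x"
 by (simp add: gm_def heat_emp)

lemma gm_test_shift:
 assumes r: "r > 0" and d: "d \<ge> 0" and N: "N > 0"
 shows "\<bar>gm N (test r x) z - gm N (test (r + d) x) z\<bar> \<le> sqrt d / sqrt r"
proof -
 have "\<bar>test r x y - test (r + d) x y\<bar> \<le> sqrt d / sqrt r" for y
  using heat_minus_self_Lipschitz[of "test r x" 1 d "1 / sqrt r" y] test_Lipschitz[OF r] test_abs d r
  by (simp add: heat_test abs_minus_commute)
 then have "(\<Sum>i=1..N. \<bar>test r x (z i) - test (r + d) x (z i)\<bar>) \<le> (\<Sum>i=1..N. sqrt d / sqrt r)" by (intro sum_mono)
 then have "(\<Sum>i=1..N. \<bar>test r x (z i) - test (r + d) x (z i)\<bar>) / real N \<le> sqrt d / sqrt r"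
  using N by (simp add: divide_le_eq mult.commute)
 moreover have "\<bar>gm N (test r x) z - gm N (test (r + d) x) z\<bar> \<le> (\<Sum>i=1..N. \<bar>test r x (z i) - test (r + d) x (z i)\<bar>) / real N"
  unfolding gm_def diff_divide_distrib[symmetric] sum_subtractf[symmetric] abs_divide abs_of_nat
  by (rule divide_right_mono[OF sum_abs]) simp
 ultimately show ?thesis by linarith
qed

locale bbm_mild = np_bbm_driven M k lam p N Y B \<tau> S q + mild_problem U0 "\<lambda>v. h_p k lam p (clip v)" 1 L H
 for M :: "'a measure" and k lam p N Y B \<tau> S q U0 L H
begin

abbreviation "hc \<equiv> \<lambda>v. h_p k lam p (clip v)"

abbreviation "hfc \<equiv> h_fin_const k lam p"

lemma N_pos: "N > 0" using k by simp

lemma step_test_test: "step_test (test r x) N"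
 by (unfold_locales; use test_01 test_antimono N_pos in auto)

lemma h_fin_hc:
 assumes "\<bar>v\<bar> \<le> K"
 shows "\<bar>hc v - h_fin k lam p N (count_le N z y)\<bar> \<le> L * \<bar>emp N z y - v\<bar> + hfc / real N"
proof -
 have "\<bar>h_fin k lam p N (count_le N z y) - h_p k lam p (emp N z y)\<bar> \<le> hfc / real N"
  unfolding emp_def by (rule h_fin_close) (use k lam count_le_le in auto)
 moreover have "\<bar>hc v - hc (emp N z y)\<bar> \<le> L * \<bar>v - emp N z y\<bar>" by (rule h_lip)
 moreover have "hc (emp N z y) = h_p k lam p (emp N z y)" using emp_01 by (simp add: clip_simps)
 ultimately show ?thesis by (simp add: abs_minus_commute)
qed

text \<open>Two drifts must cancel up to Lipschitz terms. With \<open>g - u\<close> the smoothed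
  error at age \<open>r + d\<close>, the jumps contribute \<open>- 2 * d * (g - u) * hfx\<close>,
  and moving the target from \<open>u'\<close> to \<open>u\<close> contributes
  \<open>2 * d * (g - u) * hcx\<close>. Their sum is controlled by
  \<open>\<bar>hcx - hfx\<bar> \<le> L * a' + hfc / N\<close> and
  \<open>2 * a * a' \<le> a^2 + a'^2\<close>, where Jensen's inequality turns the squares into
  smoothed squared errors, one of age \<open>r + d\<close> and one of age \<open>r\<close>.\<close>

lemma cell_config:
 fixes x :: ereal and s d r K c b :: real and z :: "nat => ereal"
 assumes s: "0 \<le> s" "0 \<le> d" "0 < r" and b: "0 \<le> b" "b \<le> rate * d" "rate * d - b \<le> (rate * d)\<^sup>2"
  and K: "\<And>y. \<bar>mild s y\<bar> \<le> K" "\<And>y. \<bar>mild (s + d) y\<bar> \<le> K"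
  and c: "\<And>y. \<bar>mild (s + d) y - heat d (mild s) y + d * hc (mild s y)\<bar> \<le> c"
 defines "\<phi> \<equiv> test r x" and "\<psi> \<equiv> test (r + d) x" and "u' \<equiv> heat r (mild (s + d)) x" and "u \<equiv> heat (r + d) (mild s) x"
  and "W \<equiv> \<lambda>y. emp N z y - mild s y"
 shows "fm N \<psi> u' z + b * (2 / real N * ((gm N \<phi> z - u') * mark_mean N k p (mark_gain N \<phi> z)))
  \<le> fm N \<psi> u z + d * L * (heat (r + d) (\<lambda>y. (W y)\<^sup>2) x + heat r (\<lambda>y. (W y)\<^sup>2) x) + 2 * (1 + K) * d * hfc / real N
   + 2 * (1 + K) * c + (H * d)\<^sup>2 + 2 * (1 + K) * (rate * d)\<^sup>2 + 2 * (rate * d) * (sqrt d / sqrt r + H * d)"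
proof -
 have K0: "0 \<le> K" using K(1)[of 0] by linarith
 have e1: "\<bar>emp N z y\<bar> \<le> 1" for y using emp_01[of N z y] by simp
 have Wb: "\<bar>W y\<bar> \<le> 1 + K" for y unfolding W_def using e1[of y] K(1)[of y] by linarith
 have [measurable]: "W \<in> borel_measurable borel" unfolding W_def by measurable
 define hf where "hf y = h_fin k lam p N (count_le N z y)" for y
 have [measurable]: "hf \<in> borel_measurable borel" unfolding hf_def by measurable
 have hcb: "\<bar>hc (mild s y)\<bar> \<le> H" for y by (rule h_bound)
 have hcm [measurable]: "(\<lambda>y. hc (mild s y)) \<in> borel_measurable borel" by (rule measurable_compose[OF mild_slice_measurable h_measurable])
 have hd: "\<bar>hc (mild s y) - hf y\<bar> \<le> L * \<bar>W y\<bar> + hfc / real N" for y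
  using h_fin_hc[OF K(1)[of y], where z=z and y=y] by (simp add: hf_def W_def)
 have hdb: "\<bar>hc (mild s y) - hf y\<bar> \<le> L * (1 + K) + hfc / real N" for y
  using hd[of y] mult_left_mono[OF Wb[of y], of L] L by linarith
 have hfb: "\<bar>hf y\<bar> \<le> H + (L * (1 + K) + hfc / real N)" for y
  using hcb[of y] hdb[of y] by linarith
 define g where "g = gm N \<psi> z"
 define g' where "g' = gm N \<phi> z"
 define MM where "MM = mark_mean N k p (mark_gain N \<phi> z)"
 interpret step_test \<phi> N unfolding \<phi>_def by (rule step_test_test)
 have gu: "g - u = heat (r + d) W x"
  unfolding W_def g_def \<psi>_def u_def gm_test by (rule heat_diff[symmetric, OF _ _ e1 K(1)]) auto
 have gub: "\<bar>g - u\<bar> \<le> 1 + K" unfolding gu by (rule heat_bound[OF _ Wb]) measurable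
 have ub: "\<bar>u'\<bar> \<le> K" unfolding u'_def by (rule heat_bound[OF _ K(2)]) measurable
 have gub': "\<bar>g' - u'\<bar> \<le> 1 + K" using gm_u[of z u'] ub by (simp add: g'_def)
 have usg: "u = heat r (heat d (mild s)) x" unfolding u_def by (rule heat_semigroup[symmetric, OF _ _ _ K(1)]) (use s in auto)
 have hsb: "\<bar>heat d (mild s) y\<bar> \<le> K" for y by (rule heat_bound[OF _ K(1)]) measurable
 have uu: "u' - u = heat r (\<lambda>y. mild (s + d) y - heat d (mild s) y) x"
  unfolding usg u'_def by (rule heat_diff[symmetric, OF _ _ K(2) hsb]) auto
 have uub: "\<bar>u' - u\<bar> \<le> H * d"
  unfolding uu by (rule heat_bound) (use mild_step_bound s in auto)
 define hcx where "hcx = heat r (\<lambda>y. hc (mild s y)) x"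
 define hfx where "hfx = heat r hf x"
 have ucons: "\<bar>(u - u') - d * hcx\<bar> \<le> c"
 proof -
  have sb: "\<bar>mild (s + d) y - heat d (mild s) y\<bar> \<le> H * d" for y by (rule mild_step_bound) (use s in auto)
  have eb: "\<bar>d * hc (mild s y)\<bar> \<le> d * H" for y unfolding abs_mult using hcb s by (intro mult_mono) auto
  have "(u' - u) + d * hcx = heat r (\<lambda>y. (mild (s + d) y - heat d (mild s) y) + d * hc (mild s y)) x"
   unfolding uu hcx_def heat_cmult[symmetric] by (rule heat_add[symmetric, OF _ _ sb eb]) measurable
  moreover have "\<bar>heat r (\<lambda>y. (mild (s + d) y - heat d (mild s) y) + d * hc (mild s y)) x\<bar> \<le> c"
   by (rule heat_bound[OF _ c]) measurable
  ultimately show ?thesis by linarith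
 qed
 have hx: "\<bar>hcx - hfx\<bar> \<le> L * heat r (\<lambda>y. \<bar>W y\<bar>) x + hfc / real N"
 proof -
  have hf0: "0 \<le> hfc / real N" using h_fin_const_nonneg[OF lam] by simp
  have LW: "\<bar>L * \<bar>W y\<bar>\<bar> \<le> L * (1 + K)" "\<bar>L * \<bar>W y\<bar> + hfc / real N\<bar> \<le> L * (1 + K) + hfc / real N" for y
   using mult_left_mono[OF Wb[of y], of L] mult_nonneg_nonneg[of L "\<bar>W y\<bar>"] L hf0 by (auto simp del: mult_nonneg_nonneg)
  have "hcx - hfx = heat r (\<lambda>y. hc (mild s y) - hf y) x"
   unfolding hcx_def hfx_def by (rule heat_diff[symmetric, OF _ _ hcb hfb]) measurable
  moreover have "\<bar>heat r (\<lambda>y. hc (mild s y) - hf y) x\<bar> \<le> heat r (\<lambda>y. L * \<bar>W y\<bar> + hfc / real N) x"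
   by (rule heat_le_abs[OF _ _ hdb LW(2) hd]) measurable
  moreover have "heat r (\<lambda>y. L * \<bar>W y\<bar> + hfc / real N) x = L * heat r (\<lambda>y. \<bar>W y\<bar>) x + hfc / real N"
   using heat_add[of "\<lambda>y. L * \<bar>W y\<bar>" "\<lambda>_. hfc / real N" "L * (1 + K)" "hfc / real N" r x] LW hf0 by (simp add: heat_cmult)
  ultimately show ?thesis by simp
 qed
 have MM: "MM = - hfx / lam"
  unfolding MM_def \<phi>_def mark_gain_def[abs_def] hfx_def hf_def by (rule mark_mean_test[OF lam])
 have MM1: "\<bar>MM\<bar> \<le> 1" unfolding MM_def by (rule mark_mean_abs[OF mark_gain_abs])
 have g'g: "\<bar>g' - g\<bar> \<le> sqrt d / sqrt r"
  unfolding g'_def g_def \<phi>_def \<psi>_def by (rule gm_test_shift) (use s N_pos in auto)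
 have N2: "2 / real N \<le> 2" "0 \<le> 2 / real N" using N_pos by (auto simp: divide_le_eq)
 have 1: "b * (2 / real N * ((g' - u') * MM)) \<le> - 2 * d * ((g - u) * hfx)
   + 2 * (1 + K) * (rate * d)\<^sup>2 + 2 * (rate * d) * (sqrt d / sqrt r + H * d)"
 proof -
  have gg: "\<bar>(g' - u') - (g - u)\<bar> \<le> sqrt d / sqrt r + H * d" using g'g uub by linarith
  have "b * (2 / real N * ((g' - u') * MM)) - rate * d * (2 / real N * ((g - u) * MM))
    = (2 / real N) * ((b - rate * d) * ((g' - u') * MM) + rate * d * (((g' - u') - (g - u)) * MM))"
   by (simp add: algebra_simps)
  also have "... \<le> (2 / real N) * (\<bar>(b - rate * d) * ((g' - u') * MM)\<bar> + \<bar>rate * d * (((g' - u') - (g - u)) * MM)\<bar>)"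
   using N2 by (intro mult_left_mono) linarith+
  also have "... \<le> 2 * ((rate * d)\<^sup>2 * ((1 + K) * 1) + rate * d * ((sqrt d / sqrt r + H * d) * 1))"
   unfolding abs_mult using b gub' gg MM1 N2 rate s K0 H_nonneg
   by (intro mult_mono add_mono add_nonneg_nonneg mult_nonneg_nonneg) auto
  finally have "b * (2 / real N * ((g' - u') * MM)) \<le> rate * d * (2 / real N * ((g - u) * MM))
   + 2 * (1 + K) * (rate * d)\<^sup>2 + 2 * (rate * d) * (sqrt d / sqrt r + H * d)"
   by (simp add: algebra_simps)
  \<comment> \<open>The jump rate \<open>lam * N\<close> cancels the \<open>1 / N\<close> of a
    single jump and the \<open>1 / lam\<close> of \<open>mark_mean_test\<close>.\<close>
  moreover have "rate * d * (2 / real N * ((g - u) * MM)) = - 2 * d * ((g - u) * hfx)"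
   unfolding MM using lam N_pos by (simp add: rate_def field_simps)
  ultimately show ?thesis by simp
 qed
 have 2: "fm N \<psi> u' z \<le> fm N \<psi> u z + 2 * d * ((g - u) * hcx) + 2 * (1 + K) * c + (H * d)\<^sup>2"
 proof -
  have "fm N \<psi> u' z = fm N \<psi> u z + 2 * (g - u) * (u - u') + (u - u')\<^sup>2"
   unfolding fm_def g_def by (simp add: power2_eq_square algebra_simps)
  moreover have "(u - u')\<^sup>2 \<le> (H * d)\<^sup>2"
   using uub by (metis abs_ge_zero abs_minus_commute power2_abs power_mono)
  moreover have "2 * (g - u) * (u - u') = 2 * d * ((g - u) * hcx) + 2 * ((g - u) * ((u - u') - d * hcx))"
   by (simp add: algebra_simps)
  moreover have "(g - u) * ((u - u') - d * hcx) \<le> (1 + K) * c"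
  proof -
   have "\<bar>(g - u) * ((u - u') - d * hcx)\<bar> \<le> (1 + K) * c"
    unfolding abs_mult using gub ucons K0 by (intro mult_mono) auto
   then show ?thesis by linarith
  qed
  ultimately show ?thesis by linarith
 qed
 have 3: "2 * d * ((g - u) * hcx) - 2 * d * ((g - u) * hfx)
  \<le> d * L * (heat (r + d) (\<lambda>y. (W y)\<^sup>2) x + heat r (\<lambda>y. (W y)\<^sup>2) x) + 2 * (1 + K) * d * hfc / real N"
 proof -
  define a where "a = heat (r + d) (\<lambda>y. \<bar>W y\<bar>) x"
  define a' where "a' = heat r (\<lambda>y. \<bar>W y\<bar>) x"
  have "a\<^sup>2 \<le> heat (r + d) (\<lambda>y. \<bar>W y\<bar>\<^sup>2) x" "a'\<^sup>2 \<le> heat r (\<lambda>y. \<bar>W y\<bar>\<^sup>2) x"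
   unfolding a_def a'_def by (rule heat_power2_le[where K="1 + K"]; use Wb in simp)+
  then have sq: "2 * a * a' \<le> heat (r + d) (\<lambda>y. (W y)\<^sup>2) x + heat r (\<lambda>y. (W y)\<^sup>2) x"
   using sum_squares_bound[of a a'] by simp
  have ga: "\<bar>g - u\<bar> \<le> a"
   unfolding gu a_def by (rule heat_le_abs[where K="1 + K" and K'="1 + K"]) (use Wb in auto)
  have a': "0 \<le> a'" unfolding a'_def heat_def by (intro Bochner_Integration.integral_nonneg) auto
  have "(g - u) * (hcx - hfx) \<le> \<bar>g - u\<bar> * \<bar>hcx - hfx\<bar>" by (metis abs_ge_self abs_mult)
  also have "... \<le> \<bar>g - u\<bar> * (L * a' + hfc / real N)" using hx unfolding a'_def by (intro mult_left_mono) auto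
  also have "... = \<bar>g - u\<bar> * (L * a') + \<bar>g - u\<bar> * (hfc / real N)" by (simp add: distrib_left)
  also have "... \<le> a * (L * a') + (1 + K) * (hfc / real N)"
   using ga gub a' L h_fin_const_nonneg[OF lam] by (intro add_mono mult_right_mono) auto
  finally have "2 * ((g - u) * (hcx - hfx)) \<le> 2 * (a * (L * a') + (1 + K) * (hfc / real N))" by (rule mult_left_mono) simp
  also have "... = L * (2 * a * a') + 2 * ((1 + K) * (hfc / real N))" by (simp only: distrib_left) simp
  also have "... \<le> L * (heat (r + d) (\<lambda>y. (W y)\<^sup>2) x + heat r (\<lambda>y. (W y)\<^sup>2) x) + 2 * ((1 + K) * (hfc / real N))"
   using sq L by simp
  finally have "d * (2 * ((g - u) * (hcx - hfx)))
   \<le> d * (L * (heat (r + d) (\<lambda>y. (W y)\<^sup>2) x + heat r (\<lambda>y. (W y)\<^sup>2) x) + 2 * ((1 + K) * (hfc / real N)))"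
   using s by (intro mult_left_mono) auto
  then show ?thesis by (simp add: algebra_simps)
 qed
 show ?thesis using 1 2 3 unfolding g'_def[symmetric] MM_def[symmetric] by linarith
qed

definition sq_err :: "real => ereal => real" where
 "sq_err s x = (\<integral>w. (emp N (Yhat s w) x - mild s x)\<^sup>2 \<partial>M)"

lemma emp_Yhat_measurable:
 assumes s: "0 \<le> s"
 shows "(\<lambda>(w, y). emp N (Yhat s w) y) \<in> borel_measurable (M \<Otimes>\<^sub>M borel)"
proof -
 have "(\<lambda>z. of_bool (Yhat s (fst z) i \<le> snd z) :: real) \<in> borel_measurable (M \<Otimes>\<^sub>M borel)" if i: "i \<in> {1..N}" for i
 proof -
  have [measurable]: "(\<lambda>w. Yhat s w i) \<in> borel_measurable M" by (rule Yhat_measurable_M[OF s i])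
  show ?thesis by measurable
 qed
 then show ?thesis unfolding emp_sum case_prod_beta' by (intro borel_measurable_divide borel_measurable_sum borel_measurable_const)
qed

text \<open>By Fubini the smoothed squared error has as its mean the heat flow of
  \<open>sq_err\<close>, so a bound uniform in the threshold survives smoothing. This is why the
  estimate is run for all thresholds simultaneously.\<close>

lemma expectation_heat_sq:
 assumes s: "0 \<le> s" and K: "\<And>y. \<bar>mild s y\<bar> \<le> K" and \<beta>: "\<And>y. sq_err s y \<le> \<beta>"
 shows "(\<integral>w. heat r (\<lambda>y. (emp N (Yhat s w) y - mild s y)\<^sup>2) x \<partial>M) \<le> \<beta>"
  and "integrable M (\<lambda>w. heat r (\<lambda>y. (emp N (Yhat s w) y - mild s y)\<^sup>2) x)"
  and "sq_err s y \<ge> 0"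
proof -
 let ?F = "\<lambda>w y. (emp N (Yhat s w) y - mild s y)\<^sup>2"
 note [measurable] = emp_Yhat_measurable[OF s]
 have Fb: "\<bar>?F w y\<bar> \<le> (1 + K)\<^sup>2" for w y
 proof -
  have "\<bar>emp N (Yhat s w) y - mild s y\<bar> \<le> 1 + K" using emp_01[of N "Yhat s w" y] K[of y] by linarith
  from power_mono[OF this abs_ge_zero, of 2] show ?thesis by simp
 qed
 have [measurable]: "(\<lambda>(w, y). ?F w y) \<in> borel_measurable (M \<Otimes>\<^sub>M borel)"
  by measurable
 interpret P: pair_sigma_finite M gauss ..
 interpret PP: pair_prob_space M gauss ..
 have "integrable (M \<Otimes>\<^sub>M gauss) (\<lambda>(w, z). ?F w (x + ereal (sqrt r * z)))"
  by (rule PP.integrable_const_bound[where B="(1 + K)\<^sup>2"]) (use Fb in auto)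
 then have "(\<integral>w. heat r (?F w) x \<partial>M) = (\<integral>z. sq_err s (x + ereal (sqrt r * z)) \<partial>gauss)"
  and i: "integrable M (\<lambda>w. heat r (?F w) x)"
  using P.Fubini_integral[of "\<lambda>w z. ?F w (x + ereal (sqrt r * z))"] P.integrable_fst'[of "\<lambda>(w, z). ?F w (x + ereal (sqrt r * z))"]
  by (auto simp: heat_def sq_err_def)
 moreover have m: "sq_err s \<in> borel_measurable borel" unfolding sq_err_def by measurable
 moreover have nn: "0 \<le> sq_err s y" for y unfolding sq_err_def by (intro Bochner_Integration.integral_nonneg) auto
 moreover have "heat r (sq_err s) x \<le> heat r (\<lambda>_. \<beta>) x"
  by (rule heat_mono[where K=\<beta> and K'="\<bar>\<beta>\<bar>"]) (use m \<beta> nn in \<open>auto simp: abs_of_nonneg\<close>)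
 ultimately show "(\<integral>w. heat r (?F w) x \<partial>M) \<le> \<beta>" "integrable M (\<lambda>w. heat r (?F w) x)" "sq_err s y \<ge> 0"
  by (simp_all add: heat_def)
qed

end

text \<open>Telescoping of square roots. Summed over \<open>n\<close> cells of mesh
  \<open>d\<close>, the singular weights contribute a multiple of \<open>d * sqrt n\<close>, which
  is of order \<open>sqrt d\<close> when \<open>n * d\<close> is bounded.\<close>

lemma sum_inverse_sqrt_le: "(\<Sum>i<n. 1 / sqrt (real i + 1)) \<le> 2 * sqrt (real n)"
proof (induction n)
 case (Suc n)
 have "1 = (sqrt (real n + 1) - sqrt (real n)) * (sqrt (real n + 1) + sqrt (real n))"
  by (simp add: algebra_simps)
 also have "... \<le> (sqrt (real n + 1) - sqrt (real n)) * (2 * sqrt (real n + 1))"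
  by (intro mult_left_mono) auto
 finally have "1 / sqrt (real n + 1) \<le> 2 * (sqrt (real n + 1) - sqrt (real n))"
  by (simp add: divide_le_eq) (simp add: algebra_simps)
 with Suc show ?case by (simp add: add.commute)
qed simp

context bbm_mild
begin

lemma jump_prob_lower: assumes d: "0 \<le> d" shows "rate * d - jump_prob d \<le> (rate * d)\<^sup>2"
proof -
 define x where "x = rate * d"
 have x: "0 \<le> x" using rate d by (simp add: x_def)
 have "exp (- x) \<le> 1 / (1 + x)"
  using exp_ge_add_one_self[of x] x by (simp add: exp_minus field_simps)
 also have "... \<le> 1 - x + x\<^sup>2"
 proof -
  have "1 \<le> 1 + x ^ 3" using x by simp
  also have "... = (1 - x + x\<^sup>2) * (1 + x)" by (simp add: algebra_simps power2_eq_square power3_eq_cube)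
  finally show ?thesis using x by (simp add: divide_le_eq)
 qed
 finally show ?thesis by (simp add: jump_prob_def x_def)
qed

lemma fm_Yhat_integrable:
 assumes s: "0 \<le> s" shows "integrable M (\<lambda>w. fm N (test r x) u (Yhat s w))"
proof -
 interpret step_test "test r x" N by (rule step_test_test)
 show ?thesis
 proof (rule integrable_const_bound)
  show "AE w in M. norm (fm N (test r x) u (Yhat s w)) \<le> (1 + \<bar>u\<bar>)\<^sup>2 + 1"
   using fm_bounds[of u "Yhat s _"] by (intro AE_I2) (simp add: abs_le_iff, smt (verit) zero_le_power2)
 qed (rule measurable_fm[OF \<phi>_meas], use Yhat_measurable_M s in auto)
qed

text \<open>The mean of the diagonal-free squared error, seen through an age \<open>r\<close>. Along
  the estimate \<open>r + s\<close> stays fixed: each cell lowers the time by \<open>d\<close> and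
  raises the age by \<open>d\<close>, until time 0 is reached.\<close>

definition energy :: "real => real => ereal => real" where
 "energy r s x = (\<integral>w. fm N (test r x) (heat r (mild s) x) (Yhat s w) \<partial>M)"

text \<open>In the \<open>1 / N\<close> term, \<open>2 * lam\<close> stems from the squared jump and
  the change of the diagonal, of size \<open>2 / N^2\<close> at rate \<open>lam * N\<close>;
  \<open>hfc\<close> stems from sampling without replacement. Summed over all cells, the terms of
  the last bracket vanish with the mesh.\<close>

lemma cell:
 assumes sd: "0 \<le> s" "0 < d" "0 < r" and K: "\<And>y. \<bar>mild s y\<bar> \<le> K" "\<And>y. \<bar>mild (s + d) y\<bar> \<le> K"
  and c: "\<And>y. \<bar>mild (s + d) y - heat d (mild s) y + d * hc (mild s y)\<bar> \<le> c" and \<beta>: "\<And>y. sq_err s y \<le> \<beta>"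
 shows "energy r (s + d) x \<le> energy (r + d) s x + 2 * d * L * \<beta> + d * (2 * lam + 2 * (1 + K) * hfc) / real N
  + (2 * (1 + K) * c + (H * d)\<^sup>2 + 2 * (1 + K) * (rate * d)\<^sup>2 + 2 * (rate * d) * (sqrt d / sqrt r + H * d)
   + rate * d * ((6 + 4 * K) * (2 * real N * (sqrt d / sqrt r)) + ((1 + K)\<^sup>2 + 1 + 2 * (1 + K)) * (rate * d)))"
proof -
 define u' where "u' = heat r (mild (s + d)) x"
 define u where "u = heat (r + d) (mild s) x"
 define b where "b = jump_prob d"
 let ?\<phi> = "test r x" and ?\<psi> = "test (r + d) x" and ?W = "\<lambda>w y. (emp N (Yhat s w) y - mild s y)\<^sup>2"
 let ?mm = "\<lambda>w. (gm N ?\<phi> (Yhat s w) - u') * mark_mean N k p (mark_gain N ?\<phi> (Yhat s w))"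
 have K0: "0 \<le> K" using K(1)[of 0] by linarith
 have ub: "\<bar>u'\<bar> \<le> K" unfolding u'_def by (rule heat_bound[OF _ K(2)]) measurable
 interpret bbm_step M k lam p N Y B \<tau> S q "test r x" s "s + d"
  by (intro bbm_step.intro step_test_test np_bbm_driven_axioms bbm_step_axioms.intro) (use sd in auto)
 have r: "0 \<le> r" using sd by simp
 have b: "0 \<le> b" "b \<le> rate * d" "rate * d - b \<le> (rate * d)\<^sup>2"
  unfolding b_def using jump_prob_bounds jump_prob_lower sd by auto
 have h\<phi>: "heat d ?\<phi> = ?\<psi>" using sd by (intro ext heat_test r) auto
 note psi_int = fm_Yhat_integrable[OF sd(1), of "r + d" x]
 have mm: "integrable M ?mm"
 proof (rule integrable_const_bound)
  have "\<bar>?mm w\<bar> \<le> (1 + \<bar>u'\<bar>) * 1" for w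
   unfolding abs_mult using gm_u mark_mean_abs[OF mark_gain_abs] by (intro mult_mono) auto
  then show "AE w in M. norm (?mm w) \<le> (1 + \<bar>u'\<bar>) * 1" by simp
  show "?mm \<in> borel_measurable M"
   unfolding mark_mean_def
   by (intro borel_measurable_times borel_measurable_diff borel_measurable_sum borel_measurable_const
     measurable_gm[OF \<phi>_meas Yhat_M] measurable_mark_gain[OF \<phi>_meas Yhat_M])
 qed
 have split: "(\<integral>w. fm N ?\<psi> u' (Yhat s w) + b * (2 / real N * ?mm w) \<partial>M)
   = (\<integral>w. fm N ?\<psi> u' (Yhat s w) \<partial>M) + b * (2 / real N * (\<integral>w. ?mm w \<partial>M))"
  using psi_int mm by simp
 note hW = expectation_heat_sq[OF sd(1) K(1) \<beta>]
 have "energy r (s + d) x \<le> (\<integral>w. fm N ?\<psi> u' (Yhat s w) \<partial>M) + b * (2 / real N * (\<integral>w. ?mm w \<partial>M) + 2 / (real N)\<^sup>2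
   + (6 + 4 * \<bar>u'\<bar>) * (2 * real N * (1 / sqrt r) * sqrt d) + ((1 + \<bar>u'\<bar>)\<^sup>2 + 1 + 2 * (1 + \<bar>u'\<bar>)) * b)"
  using one_step[OF test_Lipschitz[OF sd(3)], of u'] sd unfolding energy_def u'_def[symmetric] b_def by (simp add: h\<phi>)
 also have "... = (\<integral>w. fm N ?\<psi> u' (Yhat s w) + b * (2 / real N * ?mm w) \<partial>M)
   + b * (2 / (real N)\<^sup>2) + b * ((6 + 4 * \<bar>u'\<bar>) * (2 * real N * (sqrt d / sqrt r)) + ((1 + \<bar>u'\<bar>)\<^sup>2 + 1 + 2 * (1 + \<bar>u'\<bar>)) * b)"
  unfolding split by (simp add: algebra_simps)
 also have "(\<integral>w. fm N ?\<psi> u' (Yhat s w) + b * (2 / real N * ?mm w) \<partial>M)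
  \<le> (\<integral>w. fm N ?\<psi> u (Yhat s w) + d * L * (heat (r + d) (?W w) x + heat r (?W w) x) + (2 * (1 + K) * d * hfc / real N
   + 2 * (1 + K) * c + (H * d)\<^sup>2 + 2 * (1 + K) * (rate * d)\<^sup>2 + 2 * (rate * d) * (sqrt d / sqrt r + H * d)) \<partial>M)"
  unfolding u_def u'_def
 proof (rule integral_mono)
  fix w
  show "fm N ?\<psi> (heat r (mild (s + d)) x) (Yhat s w) + b * (2 / real N * ((gm N ?\<phi> (Yhat s w) - heat r (mild (s + d)) x) * mark_mean N k p (mark_gain N ?\<phi> (Yhat s w))))
   \<le> fm N ?\<psi> (heat (r + d) (mild s) x) (Yhat s w) + d * L * (heat (r + d) (?W w) x + heat r (?W w) x) + (2 * (1 + K) * d * hfc / real N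
   + 2 * (1 + K) * c + (H * d)\<^sup>2 + 2 * (1 + K) * (rate * d)\<^sup>2 + 2 * (rate * d) * (sqrt d / sqrt r + H * d))"
   using cell_config[OF sd(1) less_imp_le[OF sd(2)] sd(3) b K c, where x=x and z="Yhat s w"] by linarith
 qed (use psi_int mm hW(2) in \<open>auto simp: u'_def\<close>)
 also have "... = energy (r + d) s x + d * L * ((\<integral>w. heat (r + d) (?W w) x \<partial>M) + (\<integral>w. heat r (?W w) x \<partial>M)) + (2 * (1 + K) * d * hfc / real N
   + 2 * (1 + K) * c + (H * d)\<^sup>2 + 2 * (1 + K) * (rate * d)\<^sup>2 + 2 * (rate * d) * (sqrt d / sqrt r + H * d))"
  using psi_int hW(2) by (simp add: energy_def u_def prob_space)
 also have "d * L * ((\<integral>w. heat (r + d) (?W w) x \<partial>M) + (\<integral>w. heat r (?W w) x \<partial>M)) \<le> d * L * (\<beta> + \<beta>)"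
  using hW(1) sd L by (intro mult_left_mono add_mono) auto
 also have "b * (2 / (real N)\<^sup>2) \<le> rate * d * (2 / (real N)\<^sup>2)" using b by (intro mult_right_mono) auto
 also have "... = 2 * d * lam / real N" using N_pos by (simp add: rate_def power2_eq_square)
 also have "b * ((6 + 4 * \<bar>u'\<bar>) * (2 * real N * (sqrt d / sqrt r)) + ((1 + \<bar>u'\<bar>)\<^sup>2 + 1 + 2 * (1 + \<bar>u'\<bar>)) * b)
  \<le> rate * d * ((6 + 4 * K) * (2 * real N * (sqrt d / sqrt r)) + ((1 + K)\<^sup>2 + 1 + 2 * (1 + K)) * (rate * d))"
  using b ub K0 sd rate by (intro mult_mono add_mono power_mono add_nonneg_nonneg mult_nonneg_nonneg) auto
 finally show ?thesis by (simp add: add_divide_distrib algebra_simps)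
qed

text \<open>At age 0 the test function is an indicator and has no Lipschitz constant. A loss of
  order \<open>d\<close> is harmless because it occurs once.\<close>

lemma last_cell:
 assumes sd: "0 \<le> s" "0 < d" and K: "\<And>y. \<bar>mild s y\<bar> \<le> K" "\<And>y. \<bar>mild (s + d) y\<bar> \<le> K"
 shows "energy 0 (s + d) x \<le> energy d s x + (2 * (1 + K) * (H * d) + (H * d)\<^sup>2 + ((1 + K)\<^sup>2 + 1) * (rate * d))"
proof -
 define u' where "u' = mild (s + d) x"
 define u where "u = heat d (mild s) x"
 let ?\<psi> = "test d x"
 have K0: "0 \<le> K" using K(1)[of 0] by linarith
 interpret bbm_step M k lam p N Y B \<tau> S q "test 0 x" s "s + d"
  by (intro bbm_step.intro step_test_test np_bbm_driven_axioms bbm_step_axioms.intro) (use sd in auto)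
 interpret \<psi>: step_test ?\<psi> N by (rule step_test_test)
 have h\<phi>: "heat d (test 0 x) = ?\<psi>" using s heat_test[of 0 d x] by (intro ext) auto
 note psi_int = fm_Yhat_integrable[OF sd(1), of "d" x]
 have uu: "\<bar>u - u'\<bar> \<le> H * d" using mild_step_bound[of s d x] sd by (simp add: u_def u'_def)
 have "energy 0 (s + d) x \<le> (\<integral>w. fm N ?\<psi> u' (Yhat s w) \<partial>M) + ((1 + \<bar>u'\<bar>)\<^sup>2 + 1) * jump_prob d"
  using one_step_crude[of u'] by (simp add: energy_def u'_def h\<phi>)
 also have "(\<integral>w. fm N ?\<psi> u' (Yhat s w) \<partial>M) \<le> (\<integral>w. fm N ?\<psi> u (Yhat s w) + (2 * (1 + K) * (H * d) + (H * d)\<^sup>2) \<partial>M)"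
 proof (rule integral_mono)
  fix w
  let ?g = "gm N ?\<psi> (Yhat s w)"
  have "\<bar>u\<bar> \<le> K" unfolding u_def by (rule heat_bound[OF _ K(1)]) measurable
  then have g: "\<bar>?g - u\<bar> \<le> 1 + K" using \<psi>.gm_u[of "Yhat s w" u] by linarith
  have "fm N ?\<psi> u' (Yhat s w) = fm N ?\<psi> u (Yhat s w) + 2 * ((?g - u) * (u - u')) + (u - u')\<^sup>2"
   unfolding fm_def by (simp add: power2_eq_square algebra_simps)
  moreover have "(u - u')\<^sup>2 \<le> (H * d)\<^sup>2" using power_mono[OF uu abs_ge_zero, of 2] by simp
  moreover have "\<bar>(?g - u) * (u - u')\<bar> \<le> (1 + K) * (H * d)"
   unfolding abs_mult using g uu K0 by (intro mult_mono) auto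
  ultimately show "fm N ?\<psi> u' (Yhat s w) \<le> fm N ?\<psi> u (Yhat s w) + (2 * (1 + K) * (H * d) + (H * d)\<^sup>2)" by linarith
 qed (use psi_int in auto)
 also have "... = energy d s x + (2 * (1 + K) * (H * d) + (H * d)\<^sup>2)"
  using psi_int by (simp add: energy_def u_def prob_space)
 also have "((1 + \<bar>u'\<bar>)\<^sup>2 + 1) * jump_prob d \<le> ((1 + K)\<^sup>2 + 1) * (rate * d)"
  using K(2)[of x] jump_prob_bounds[of d] sd K0 by (intro mult_mono add_mono power_mono) (auto simp: u'_def)
 finally show ?thesis by linarith
qed

text \<open>At age 0 smoothing is the identity, and putting back the diagonal costs at most
  \<open>1 / N\<close>.\<close>

lemma energy_0:
 assumes s: "0 \<le> s" shows "sq_err s x \<le> energy 0 s x + 1 / real N"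
proof -
 interpret step_test "test 0 x" N by (rule step_test_test)
 note I = fm_Yhat_integrable[OF s, of 0 x "mild s x"]
 have "sq_err s x \<le> (\<integral>w. fm N (test 0 x) (mild s x) (Yhat s w) + 1 / real N \<partial>M)"
  unfolding sq_err_def
 proof (rule integral_mono)
  fix w
  have "gm N (test 0 x) (Yhat s w) = emp N (Yhat s w) x" by (simp add: gm_test)
  then show "(emp N (Yhat s w) x - mild s x)\<^sup>2 \<le> fm N (test 0 x) (mild s x) (Yhat s w) + 1 / real N"
   using diag_01(2)[of "Yhat s w"] by (simp add: fm_def)
 next
  have m: "\<bar>mild s y\<bar> \<le> 1 + H * s" for y by (rule mild_bound[OF s])
  show "integrable M (\<lambda>w. (emp N (Yhat s w) x - mild s x)\<^sup>2)"
  proof (rule integrable_const_bound)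
   note [measurable] = emp_Yhat_measurable[OF s]
   show "(\<lambda>w. (emp N (Yhat s w) x - mild s x)\<^sup>2) \<in> borel_measurable M" by measurable
   have "\<bar>emp N (Yhat s w) x - mild s x\<bar> \<le> 1 + (1 + H * s)" for w using emp_01[of N "Yhat s w" x] m[of x] by linarith
   from power_mono[OF this abs_ge_zero, where n=2]
   show "AE w in M. norm ((emp N (Yhat s w) x - mild s x)\<^sup>2) \<le> (1 + (1 + H * s))\<^sup>2" by simp
  qed
 qed (use I in auto)
 then show ?thesis using I by (simp add: energy_def prob_space)
qed

text \<open>Jensen's inequality and Fubini; dropping the diagonal only lowers the left side. It
  closes the chain of cells at time 0.\<close>

lemma energy_le:
 assumes s: "0 \<le> s" and \<beta>: "\<And>y. sq_err s y \<le> \<beta>"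
 shows "energy r s x \<le> \<beta>"
proof -
 have m: "\<bar>mild s y\<bar> \<le> 1 + H * s" for y by (rule mild_bound[OF s])
 note hW = expectation_heat_sq[OF s m \<beta>]
 interpret step_test "test r x" N by (rule step_test_test)
 have "energy r s x \<le> (\<integral>w. heat r (\<lambda>y. (emp N (Yhat s w) y - mild s y)\<^sup>2) x \<partial>M)"
  unfolding energy_def
 proof (rule integral_mono[OF _ hW(2)[where r=r and x=x]])
  fix w
  let ?W = "\<lambda>y. emp N (Yhat s w) y - mild s y"
  have e1: "\<bar>emp N (Yhat s w) y\<bar> \<le> 1" for y using emp_01[of N _ y] by simp
  have "gm N (test r x) (Yhat s w) - heat r (mild s) x = heat r ?W x"
   unfolding gm_test by (rule heat_diff[symmetric, OF _ _ e1 m]) auto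
  moreover have "(heat r ?W x)\<^sup>2 \<le> heat r (\<lambda>y. (?W y)\<^sup>2) x"
  proof (rule heat_power2_le)
   show "\<bar>?W y\<bar> \<le> 1 + (1 + H * s)" for y using e1[of y] m[of y] by linarith
  qed measurable
  ultimately show "fm N (test r x) (heat r (mild s) x) (Yhat s w) \<le> heat r (\<lambda>y. (?W y)\<^sup>2) x"
   using diag_01(1)[of "Yhat s w"] by (simp add: fm_def)
 qed (rule fm_Yhat_integrable[OF s])
 with hW(1)[of r x] show ?thesis by linarith
qed

end

context bbm_mild
begin

text \<open>The coefficient of \<open>d / N\<close> in \<open>cell\<close>, with
  \<open>1 + H * t\<close> as the bound on the mild solution up to time \<open>t\<close>.\<close>

definition cell_const :: "real => real" where
 "cell_const t = 2 * lam + 2 * (1 + (1 + H * t)) * hfc"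

lemma mild_bound_upto: "0 \<le> s ==> s \<le> t ==> \<bar>mild s y\<bar> \<le> 1 + H * t"
 using mild_bound[of s y] mult_left_mono[of s t H] H_nonneg by linarith

text \<open>Away from time 0, \<open>sqrt d / sqrt (i * d)\<close> is at most
  \<open>2 / sqrt (i + 1)\<close>. In the first cell no Lipschitz constant is available at time 0,
  but the trivial error \<open>2 * H * d\<close> fits the same bound because the weight is 1
  there.\<close>

lemma cell_consistency:
 assumes d: "0 < d" and t: "(real i + 1) * d \<le> t"
 shows "\<bar>mild (real i * d + d) y - heat d (mild (real i * d)) y + d * hc (mild (real i * d) y)\<bar>
  \<le> (4 * L + 4 * L * H * sqrt t + L * H + 2 * H) * (d * (1 / sqrt (real i + 1) + sqrt d + d))"
proof -
 have t0: "0 < t" using t d by (smt (verit) mult_pos_pos of_nat_0_le_iff)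
 note nn = L H_nonneg d t0
 let ?w = "1 / sqrt (real i + 1)"
 show ?thesis
 proof (cases "i = 0")
  case True
  have "\<bar>mild d y - heat d (mild 0) y\<bar> \<le> H * d" using mild_step_bound[of 0 d y] d by simp
  moreover have "\<bar>d * hc (mild 0 y)\<bar> \<le> d * H" unfolding abs_mult using h_bound d by (intro mult_mono) auto
  ultimately have "\<bar>mild d y - heat d (mild 0) y + d * hc (mild 0 y)\<bar> \<le> H * d + d * H" by linarith
  also have "... = (2 * H) * (d * 1)" by simp
  also have "... \<le> (4 * L + 4 * L * H * sqrt t + L * H + 2 * H) * (d * (1 / sqrt (real i + 1) + sqrt d + d))"
   using nn True by (intro mult_mono mult_left_mono) auto
  finally show ?thesis using True by simp
 next
  case False
  let ?s = "real i * d"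
  have s: "0 < ?s" using False d by simp
  have sq: "sqrt d / sqrt ?s \<le> 2 * ?w"
  proof -
   have "sqrt (real i + 1) \<le> sqrt (4 * real i)" using False by (intro real_sqrt_le_mono) auto
   also have "... = 2 * sqrt (real i)" by (simp add: real_sqrt_mult)
   finally show ?thesis using False d by (simp add: real_sqrt_mult field_simps)
  qed
  have st: "sqrt ?s \<le> sqrt t" using t d by (intro real_sqrt_le_mono) (simp add: algebra_simps)
  have "\<bar>mild (?s + d) y - heat d (mild ?s) y + d * hc (mild ?s y)\<bar> \<le> L * d * (2 * (1 / sqrt ?s + 2 * H * sqrt ?s) * sqrt d + H * d)"
   by (rule mild_consistency[OF s]) (use d in simp)
  also have "2 * (1 / sqrt ?s + 2 * H * sqrt ?s) * sqrt d = 2 * (sqrt d / sqrt ?s) + 4 * H * sqrt ?s * sqrt d"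
   by (simp add: algebra_simps)
  also have "L * d * (2 * (sqrt d / sqrt ?s) + 4 * H * sqrt ?s * sqrt d + H * d) \<le> L * d * (2 * (2 * ?w) + 4 * H * sqrt t * sqrt d + H * d)"
   using nn sq st by (intro mult_left_mono add_mono mult_right_mono) auto
  also have "... = (4 * L) * (d * ?w) + (4 * L * H * sqrt t) * (d * sqrt d) + (L * H) * (d * d)"
   by (simp add: algebra_simps)
  also have "... \<le> (4 * L) * (d * (?w + sqrt d + d)) + (4 * L * H * sqrt t) * (d * (?w + sqrt d + d)) + (L * H) * (d * (?w + sqrt d + d))"
   using nn by (intro add_mono mult_left_mono) auto
  also have "... \<le> ... + 2 * H * (d * (?w + sqrt d + d))" using nn by simp
  finally show ?thesis by (simp add: distrib_right)
 qed
qed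

text \<open>\<open>Q\<close> depends on \<open>t\<close> and grows with \<open>N\<close>, but it is
  uniform in the mesh, the cell, the age, the threshold and the bound \<open>\<beta>\<close>; its
  contribution disappears when the mesh tends to 0.\<close>

lemma cell_error:
 assumes t: "0 \<le> t"
 obtains Q where "0 \<le> Q"
  and "\<And>d i l x \<beta>. 0 < d ==> (real i + 1) * d \<le> t ==> (\<And>y. sq_err (real i * d) y \<le> \<beta>) ==>
   energy ((real l + 1) * d) ((real i + 1) * d) x \<le> energy ((real l + 2) * d) (real i * d) x + 2 * d * L * \<beta>
    + d * cell_const t / real N + Q * (d * (1 / sqrt (real i + 1) + 1 / sqrt (real l + 1) + sqrt d + d))"
  and "\<And>d i x. 0 < d ==> (real i + 1) * d \<le> t ==> energy 0 ((real i + 1) * d) x \<le> energy d (real i * d) x + Q * d"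
proof -
 define K where "K = 1 + H * t"
 define Qc where "Qc = 4 * L + 4 * L * H * sqrt t + L * H + 2 * H"
 define K3 where "K3 = (1 + K)\<^sup>2 + 1 + 2 * (1 + K)"
 define A where "A = 2 * (1 + K) * Qc"
 define A' where "A' = H\<^sup>2 + 2 * (1 + K) * rate\<^sup>2 + 2 * rate * H + rate\<^sup>2 * K3"
 define A'' where "A'' = 2 * rate + rate * (6 + 4 * K) * (2 * real N)"
 define Q2 where "Q2 = 2 * (1 + K) * H + H\<^sup>2 * t + ((1 + K)\<^sup>2 + 1) * rate"
 note nn = L H_nonneg t rate
 have K0: "0 \<le> K" "0 \<le> Qc" "0 \<le> K3" using nn by (auto simp: K_def Qc_def K3_def)
 then have Q0: "0 \<le> A" "0 \<le> A'" "0 \<le> A''" "0 \<le> Q2" using nn by (auto simp: A_def A'_def A''_def Q2_def)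
 show thesis
 proof (rule that[of "A + A' + A'' + Q2"])
  show "0 \<le> A + A' + A'' + Q2" using Q0 by simp
 next
  fix d i l x \<beta>
  assume d: "0 < d" and it: "(real i + 1) * d \<le> t" and \<beta>: "\<And>y. sq_err (real i * d) y \<le> \<beta>"
  define w where "w = 1 / sqrt (real i + 1)"
  define v where "v = 1 / sqrt (real l + 1)"
  have s: "0 \<le> real i * d" "real i * d \<le> t" "0 \<le> real i * d + d" "real i * d + d \<le> t" "0 < (real l + 1) * d"
   using d it by (auto simp: algebra_simps intro!: add_pos_nonneg)
  have sr: "sqrt d / sqrt ((real l + 1) * d) = v" using d by (simp add: v_def real_sqrt_mult)
  have wv: "0 \<le> w" "0 \<le> v" by (auto simp: w_def v_def)
  have "energy ((real l + 1) * d) (real i * d + d) x \<le> energy ((real l + 1) * d + d) (real i * d) x + 2 * d * L * \<beta>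
   + d * cell_const t / real N + (2 * (1 + K) * (Qc * (d * (w + sqrt d + d))) + (H * d)\<^sup>2 + 2 * (1 + K) * (rate * d)\<^sup>2 + 2 * (rate * d) * (v + H * d)
   + rate * d * ((6 + 4 * K) * (2 * real N * v) + K3 * (rate * d)))"
   using cell[OF s(1) d s(5) mild_bound_upto[OF s(1,2)] mild_bound_upto[OF s(3,4)] cell_consistency[OF d it] \<beta>]
   unfolding sr w_def[symmetric] Qc_def[symmetric] K_def[symmetric] K3_def[symmetric] cell_const_def .
  also have "2 * (1 + K) * (Qc * (d * (w + sqrt d + d))) + (H * d)\<^sup>2 + 2 * (1 + K) * (rate * d)\<^sup>2 + 2 * (rate * d) * (v + H * d)
   + rate * d * ((6 + 4 * K) * (2 * real N * v) + K3 * (rate * d))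
   = A * (d * (w + sqrt d + d)) + A' * (d * d) + A'' * (d * v)"
   by (simp add: A_def A'_def A''_def power2_eq_square algebra_simps)
  also have "... \<le> A * (d * (w + v + sqrt d + d)) + A' * (d * (w + v + sqrt d + d)) + A'' * (d * (w + v + sqrt d + d))"
   using Q0 wv d by (intro add_mono mult_left_mono) auto
  also have "... \<le> ... + Q2 * (d * (w + v + sqrt d + d))" using Q0 wv d by simp
  finally have E: "energy ((real l + 1) * d) (real i * d + d) x \<le> energy ((real l + 1) * d + d) (real i * d) x + 2 * d * L * \<beta>
    + d * cell_const t / real N + (A * (d * (w + v + sqrt d + d)) + A' * (d * (w + v + sqrt d + d)) + A'' * (d * (w + v + sqrt d + d))
    + Q2 * (d * (w + v + sqrt d + d)))"
   by (simp only: add_left_mono)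
  have 1: "real i * d + d = (real i + 1) * d" "(real l + 1) * d + d = (real l + 2) * d" by (simp_all add: algebra_simps)
  show "energy ((real l + 1) * d) ((real i + 1) * d) x \<le> energy ((real l + 2) * d) (real i * d) x + 2 * d * L * \<beta>
    + d * cell_const t / real N + (A + A' + A'' + Q2) * (d * (1 / sqrt (real i + 1) + 1 / sqrt (real l + 1) + sqrt d + d))"
   using E unfolding 1 w_def v_def by (simp only: distrib_right)
 next
  fix d :: real and i x
  assume d: "0 < d" and it: "(real i + 1) * d \<le> t"
  have s: "0 \<le> real i * d" "real i * d \<le> t" "0 \<le> real i * d + d" "real i * d + d \<le> t"
   using d it by (auto simp: algebra_simps)
  then have "d \<le> t" by linarith
  have "energy 0 (real i * d + d) x \<le> energy d (real i * d) x + (2 * (1 + K) * (H * d) + (H * d)\<^sup>2 + ((1 + K)\<^sup>2 + 1) * (rate * d))"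
   using last_cell[OF s(1) d mild_bound_upto[OF s(1,2)] mild_bound_upto[OF s(3,4)]] unfolding K_def .
  also have "(H * d)\<^sup>2 \<le> H\<^sup>2 * t * d"
   unfolding power_mult_distrib power2_eq_square[of d] mult.assoc using \<open>d \<le> t\<close> d by (intro mult_left_mono mult_right_mono) auto
  also have "2 * (1 + K) * (H * d) + H\<^sup>2 * t * d + ((1 + K)\<^sup>2 + 1) * (rate * d) = Q2 * d"
   by (simp add: Q2_def algebra_simps)
  also have "Q2 * d \<le> (A + A' + A'' + Q2) * d" using Q0 d by (intro mult_right_mono) auto
  also have "real i * d + d = (real i + 1) * d" by (simp add: algebra_simps)
  finally show "energy 0 ((real i + 1) * d) x \<le> energy d (real i * d) x + (A + A' + A'' + Q2) * d" by simp
 qed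
qed

text \<open>The summands \<open>2 * d * L * \<beta> i\<close> feed the Gronwall argument. The
  singular weights in \<open>i\<close> come from the initial function and those in \<open>l\<close>
  from the test function; along the chain they run through the same values in opposite order, which
  explains the factor 2 in front of their sum.\<close>

lemma grid_error:
 assumes t: "0 \<le> t"
 obtains Q where "0 \<le> Q"
  and "\<And>d j x \<beta>. 0 < d ==> (real j + 1) * d \<le> t ==> (\<And>i y. i \<le> j ==> sq_err (real i * d) y \<le> \<beta> i) ==>
   sq_err ((real j + 1) * d) x \<le> \<beta> 0 + (\<Sum>i<j. 2 * d * L * \<beta> i) + (1 + t * cell_const t) / real N + Q * (sqrt d + d)"
proof -
 obtain Q where Q: "0 \<le> Q"
  and step: "\<And>d i l x \<beta>. 0 < d ==> (real i + 1) * d \<le> t ==> (\<And>y. sq_err (real i * d) y \<le> \<beta>) ==>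
   energy ((real l + 1) * d) ((real i + 1) * d) x \<le> energy ((real l + 2) * d) (real i * d) x + 2 * d * L * \<beta>
    + d * cell_const t / real N + Q * (d * (1 / sqrt (real i + 1) + 1 / sqrt (real l + 1) + sqrt d + d))"
  and last: "\<And>d i x. 0 < d ==> (real i + 1) * d \<le> t ==> energy 0 ((real i + 1) * d) x \<le> energy d (real i * d) x + Q * d"
  using cell_error[OF t] by blast
 have cc: "0 \<le> cell_const t" unfolding cell_const_def using lam h_fin_const_nonneg[OF lam, of k p] H_nonneg t by auto
 show thesis
 proof (rule that[of "Q * (4 * sqrt t + t + 1)"])
  show "0 \<le> Q * (4 * sqrt t + t + 1)" using Q t by simp
  fix d j x \<beta>
  assume d: "0 < d" and jt: "(real j + 1) * d \<le> t" and \<beta>: "\<And>i y. i \<le> j ==> sq_err (real i * d) y \<le> \<beta> i"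
  let ?w = "\<lambda>i::nat. 1 / sqrt (real i + 1)"
  \<comment> \<open>Unrolling down to time 0: the time index \<open>i\<close> decreases while the
    age index \<open>l\<close> increases, and \<open>i + l\<close> is constant.\<close>
  have chain: "i \<le> j ==> energy ((real l + 1) * d) (real i * d) x \<le> energy ((real (i + l) + 1) * d) 0 x
    + (\<Sum>n<i. 2 * d * L * \<beta> n) + real i * (d * cell_const t / real N)
    + Q * (d * ((\<Sum>n<i. ?w n) + (\<Sum>n<i. ?w (l + n)) + real i * (sqrt d + d)))" for i l
  proof (induction i arbitrary: l)
   case (Suc i)
   have "(real i + 1) * d \<le> (real j + 1) * d" using Suc.prems d by (intro mult_right_mono) auto
   then have it: "(real i + 1) * d \<le> t" using jt by linarith
   have e: "real (Suc l) + 1 = real l + 2" "i + Suc l = Suc i + l" by auto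
   have sh: "(\<Sum>n<Suc i. ?w (l + n)) = ?w l + (\<Sum>n<i. ?w (Suc l + n))"
    by (subst sum.lessThan_Suc_shift) simp
   have "energy ((real l + 1) * d) ((real i + 1) * d) x \<le> energy ((real l + 2) * d) (real i * d) x + 2 * d * L * \<beta> i
    + d * cell_const t / real N + Q * (d * (?w i + ?w l + sqrt d + d))"
    by (rule step[OF d it]) (use \<beta> Suc.prems in auto)
   also have "energy ((real l + 2) * d) (real i * d) x \<le> energy ((real (Suc i + l) + 1) * d) 0 x
    + (\<Sum>n<i. 2 * d * L * \<beta> n) + real i * (d * cell_const t / real N)
    + Q * (d * ((\<Sum>n<i. ?w n) + (\<Sum>n<i. ?w (Suc l + n)) + real i * (sqrt d + d)))"
    using Suc.IH[of "Suc l"] Suc.prems unfolding e by simp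
   finally show ?case unfolding sh by (simp add: algebra_simps add_divide_distrib)
  qed simp
  have "sq_err ((real j + 1) * d) x \<le> energy 0 ((real j + 1) * d) x + 1 / real N"
   by (rule energy_0) (use d in auto)
  also have "energy 0 ((real j + 1) * d) x \<le> energy d (real j * d) x + Q * d" by (rule last[OF d jt])
  also have "energy d (real j * d) x \<le> energy ((real j + 1) * d) 0 x
    + (\<Sum>n<j. 2 * d * L * \<beta> n) + real j * (d * cell_const t / real N)
    + Q * (d * (2 * (\<Sum>n<j. ?w n) + real j * (sqrt d + d)))"
   using chain[of j 0] by simp
  also have "energy ((real j + 1) * d) 0 x \<le> \<beta> 0" by (rule energy_le) (use \<beta>[of 0] in auto)
  also have "real j * (d * cell_const t / real N) \<le> t * cell_const t / real N"
  proof -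
   have "real j * d \<le> t" using jt d by (simp add: algebra_simps)
   then have "real j * d * cell_const t \<le> t * cell_const t" using cc by (rule mult_right_mono)
   then show ?thesis by (simp add: divide_right_mono mult.assoc)
  qed
  also have "d * (2 * (\<Sum>n<j. ?w n) + real j * (sqrt d + d)) \<le> 4 * sqrt t * sqrt d + t * (sqrt d + d)"
  proof -
   have jd: "real j * d \<le> t" using jt d by (simp add: algebra_simps)
   have "d * (\<Sum>n<j. ?w n) \<le> d * (2 * sqrt (real j))" using sum_inverse_sqrt_le d by (intro mult_left_mono) auto
   also have "... = 2 * sqrt (real j * d) * sqrt d" using d by (simp add: real_sqrt_mult)
   also have "... \<le> 2 * sqrt t * sqrt d" using jd d by (intro mult_right_mono mult_left_mono real_sqrt_le_mono) auto
   finally have 1: "2 * (d * (\<Sum>n<j. ?w n)) \<le> 4 * sqrt t * sqrt d" by linarith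
   have "real j * d * (sqrt d + d) \<le> t * (sqrt d + d)" using jd d by (intro mult_right_mono) auto
   with 1 show ?thesis by (simp add: algebra_simps)
  qed
  finally have "sq_err ((real j + 1) * d) x \<le> \<beta> 0 + (\<Sum>n<j. 2 * d * L * \<beta> n) + t * cell_const t / real N
   + Q * (4 * sqrt t * sqrt d + t * (sqrt d + d)) + Q * d + 1 / real N" using Q by (simp add: mult_left_mono)
  moreover have "Q * (4 * sqrt t * sqrt d + t * (sqrt d + d)) + Q * d \<le> Q * (4 * sqrt t + t + 1) * (sqrt d + d)"
  proof -
   have "4 * sqrt t * sqrt d + t * (sqrt d + d) + d \<le> (4 * sqrt t + t + 1) * (sqrt d + d)"
    using t d by (simp add: algebra_simps)
   from mult_left_mono[OF this Q] show ?thesis by (simp add: algebra_simps)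
  qed
  ultimately show "sq_err ((real j + 1) * d) x \<le> \<beta> 0 + (\<Sum>i<j. 2 * d * L * \<beta> i) + (1 + t * cell_const t) / real N
   + Q * (4 * sqrt t + t + 1) * (sqrt d + d)" by (simp add: add_divide_distrib)
 qed
qed

text \<open>Discrete Gronwall inequality on \<open>Suc n\<close> cells of length
  \<open>t / Suc n\<close>, followed by the limit in \<open>n\<close>, in which the contribution of
  \<open>Q\<close> vanishes.\<close>

lemma sq_err_bound:
 assumes t: "0 < t" and \<beta>: "\<And>y. sq_err 0 y \<le> \<beta>"
 shows "sq_err t x \<le> (\<beta> + (1 + t * cell_const t) / real N) * exp (2 * L * t)"
proof -
 obtain Q where Q: "0 \<le> Q"
  and grid: "\<And>d j x \<beta>. 0 < d ==> (real j + 1) * d \<le> t ==> (\<And>i y. i \<le> j ==> sq_err (real i * d) y \<le> \<beta> i) ==>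
   sq_err ((real j + 1) * d) x \<le> \<beta> 0 + (\<Sum>i<j. 2 * d * L * \<beta> i) + (1 + t * cell_const t) / real N + Q * (sqrt d + d)"
  using grid_error[of t] t by (metis less_imp_le)
 have cc: "0 \<le> cell_const t" unfolding cell_const_def using lam h_fin_const_nonneg[OF lam, of k p] H_nonneg t by auto
 define \<kappa> where "\<kappa> = (1 + t * cell_const t) / real N"
 have \<kappa>: "0 \<le> \<kappa>" using cc t by (simp add: \<kappa>_def)
 have \<beta>0: "0 \<le> \<beta>" using \<beta>[of 0] expectation_heat_sq(3)[OF _ mild_bound \<beta>, of 0] by (metis order.refl order_trans)
 have "sq_err t x \<le> (\<beta> + \<kappa> + Q * (sqrt (t / real (Suc n)) + t / real (Suc n))) * exp (2 * L * t)" for n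
 proof -
  define d where "d = t / real (Suc n)"
  define A where "A = \<beta> + \<kappa> + Q * (sqrt d + d)"
  have d: "0 < d" using t by (simp add: d_def)
  have A: "0 \<le> A" "\<beta> \<le> A" using \<beta>0 \<kappa> Q d by (auto simp: A_def)
  let ?q = "1 + 2 * d * L"
  have q: "1 \<le> ?q" using d L by simp
  \<comment> \<open>Strong induction, as the bound at one grid time involves all earlier
    ones.\<close>
  have "m \<le> Suc n ==> sq_err (real m * d) y \<le> A * ?q ^ m" for m y
  proof (induction m arbitrary: y rule: less_induct)
   case (less m)
   show ?case
   proof (cases m)
    case 0
    then show ?thesis using \<beta>[of y] A(2) by simp
   next
    case (Suc j)
    have "(real j + 1) * d \<le> real (Suc n) * d" using less.prems Suc d by (intro mult_right_mono) auto
    then have jt: "(real j + 1) * d \<le> t" by (simp add: d_def)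
    \<comment> \<open>At time 0 the sharper value \<open>\<beta>\<close> is kept, because
      \<open>A\<close> already is the sum of \<open>\<beta>\<close> and the grid errors.\<close>
    define \<beta>' where "\<beta>' i = (if i = 0 then \<beta> else A * ?q ^ i)" for i :: nat
    have "sq_err ((real j + 1) * d) y \<le> \<beta>' 0 + (\<Sum>i<j. 2 * d * L * \<beta>' i) + (1 + t * cell_const t) / real N + Q * (sqrt d + d)"
     by (rule grid[OF d jt]) (use less Suc \<beta> in \<open>auto simp: \<beta>'_def\<close>)
    also have "... = A + (\<Sum>i<j. 2 * d * L * \<beta>' i)" by (simp add: A_def \<kappa>_def \<beta>'_def)
    also have "(\<Sum>i<j. 2 * d * L * \<beta>' i) \<le> (\<Sum>i<j. 2 * d * L * (A * ?q ^ i))"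
     using d L A by (intro sum_mono mult_left_mono) (auto simp: \<beta>'_def)
    also have "... = A * ((?q - 1) * (\<Sum>i<j. ?q ^ i))" by (simp add: sum_distrib_left mult_ac)
    also have "(?q - 1) * (\<Sum>i<j. ?q ^ i) = ?q ^ j - 1" by (rule power_diff_1_eq[symmetric])
    also have "A + A * (?q ^ j - 1) = A * ?q ^ j" by (simp add: algebra_simps)
    also have "... \<le> A * ?q ^ Suc j" using A q by (intro mult_left_mono power_increasing) auto
    finally show ?thesis using Suc by (simp add: add.commute)
   qed
  qed
  from this[of "Suc n" x] have "sq_err t x \<le> A * ?q ^ Suc n" by (simp add: d_def)
  also have "?q ^ Suc n \<le> exp (2 * d * L) ^ Suc n"
   using q exp_ge_add_one_self[of "2 * d * L"] by (intro power_mono) auto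
  also have "exp (2 * d * L) ^ Suc n = exp (2 * L * t)"
   unfolding exp_of_nat_mult[symmetric] by (simp add: d_def field_simps)
  finally show ?thesis using A unfolding A_def d_def by (simp add: mult_left_mono)
 qed
 moreover have "(\<lambda>n. (\<beta> + \<kappa> + Q * (sqrt (t / real (Suc n)) + t / real (Suc n))) * exp (2 * L * t)) \<longlonglongrightarrow> (\<beta> + \<kappa> + Q * (sqrt 0 + 0)) * exp (2 * L * t)"
  by (intro tendsto_intros tendsto_divide_0[OF tendsto_const] filterlim_compose[OF filterlim_at_top_imp_at_infinity[OF filterlim_real_sequentially] filterlim_Suc])
 ultimately have "sq_err t x \<le> (\<beta> + \<kappa> + Q * (sqrt 0 + 0)) * exp (2 * L * t)"
  by (intro LIMSEQ_le_const[where X="\<lambda>n. (\<beta> + \<kappa> + Q * (sqrt (t / real (Suc n)) + t / real (Suc n))) * exp (2 * L * t)"]) auto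
 then show ?thesis by (simp add: \<kappa>_def)
qed

end

section \<open>Back to the given particle system\<close>

context bbm_mild
begin

lemma emp_Y_measurable:
 assumes s: "0 \<le> s" shows "(\<lambda>w. emp N (Y s w) x) \<in> borel_measurable M"
proof -
 have "(\<lambda>w. of_bool (Y s w i \<le> x) :: real) \<in> borel_measurable M" if i: "i \<in> {1..N}" for i
 proof -
  have [measurable]: "(\<lambda>w. Y s w i) \<in> borel_measurable M" by (rule Y_measurable_M[OF i s])
  show ?thesis by measurable
 qed
 then show ?thesis unfolding emp_sum by (intro borel_measurable_divide borel_measurable_sum borel_measurable_const)
qed

lemma sq_err_Y:
 assumes s: "0 \<le> s" shows "sq_err s x = (\<integral>w. (emp N (Y s w) x - mild s x)\<^sup>2 \<partial>M)"
 unfolding sq_err_def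
proof (rule integral_cong_AE)
 note [measurable] = emp_Y_measurable[OF s] emp_Yhat_measurable[OF s]
 show "(\<lambda>w. (emp N (Yhat s w) x - mild s x)\<^sup>2) \<in> borel_measurable M"
  "(\<lambda>w. (emp N (Y s w) x - mild s x)\<^sup>2) \<in> borel_measurable M" by measurable
 show "AE w in M. (emp N (Yhat s w) x - mild s x)\<^sup>2 = (emp N (Y s w) x - mild s x)\<^sup>2"
  using good_AE
 proof eventually_elim
  case (elim w)
  have "emp N (Yhat s w) x = emp N (Y s w) x"
   unfolding emp_sum using good_Yhat[OF elim s] by (intro arg_cong2[where f="(/)"] sum.cong) auto
  then show ?case by simp
 qed
qed

lemma Y_sq_err_bound:
 assumes t: "0 < t" and \<beta>: "\<And>y. (\<integral>w. (emp N (Y 0 w) y - U0 y)\<^sup>2 \<partial>M) \<le> \<beta>"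
 shows "(\<integral>w. (emp N (Y t w) x - mild t x)\<^sup>2 \<partial>M) \<le> (\<beta> + (1 + t * cell_const t) / real N) * exp (2 * L * t)"
 using sq_err_bound[OF t, of \<beta> x] \<beta> t by (simp add: sq_err_Y mild_0)

end

section \<open>The limit\<close>

lemma empirical_cdf_emp: "empirical_cdf N z x = emp N z (ereal x)"
 by (simp add: empirical_cdf_def emp_def count_le_def)

lemma emp_mono: "x \<le> y ==> emp N z x \<le> emp N z y"
 unfolding emp_sum by (intro divide_right_mono sum_mono) (auto intro: order_trans)

lemma emp_tendsto:
 assumes "\<And>i. \<forall>\<^sub>F y in F. (z i \<le> g y) = (z i \<le> x)"
 shows "((\<lambda>y. emp N z (g y)) \<longlongrightarrow> emp N z x) F"
proof (rule tendsto_eventually)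
 have "\<forall>\<^sub>F y in F. \<forall>i\<in>{1..N}. (z i \<le> g y) = (z i \<le> x)"
  using assms by (intro eventually_ball_finite) auto
 then show "\<forall>\<^sub>F y in F. emp N z (g y) = emp N z x"
  by eventually_elim (auto simp: emp_sum intro!: arg_cong2[where f="(/)"] sum.cong)
qed

lemma emp_right_cont: "((\<lambda>y. emp N z (ereal y)) \<longlongrightarrow> emp N z (ereal x)) (at_right x)"
proof (rule emp_tendsto)
 fix i
 show "\<forall>\<^sub>F y in at_right x. (z i \<le> ereal y) = (z i \<le> ereal x)"
 proof (cases "z i \<le> ereal x")
  case True
  have "\<forall>\<^sub>F y in at_right x. x < y" by (simp add: eventually_at_right_less)
  then show ?thesis by eventually_elim (use True in \<open>auto intro: order_trans\<close>)
 next
  case False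
  then obtain b where b: "x < b" "ereal b \<le> z i"
   by (metis ereal_dense2 less_ereal.simps(1) not_le order.strict_implies_order)
  have "\<forall>\<^sub>F y in at_right x. y < b" using b(1) by (auto simp: eventually_at_right_field)
  then show ?thesis
  proof eventually_elim
   case (elim y)
   then have "\<not> z i \<le> ereal y" using b(2) by (metis ereal_less_eq(3) not_le order_trans)
   with False show ?case by simp
  qed
 qed
qed

lemma emp_infinity: "N > 0 ==> emp N z \<infinity> = 1"
 by (simp add: emp_sum)

lemma emp_tendsto_MInfty: "(\<lambda>n. emp N z (ereal (- real n))) \<longlonglongrightarrow> emp N z (-\<infinity>)"
proof (rule emp_tendsto)
 fix i
 show "\<forall>\<^sub>F n in sequentially. (z i \<le> ereal (- real n)) = (z i \<le> -\<infinity>)"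
 proof (cases "z i")
  case (real r)
  obtain m :: nat where "- r < real m" using reals_Archimedean2 by blast
  then have "\<forall>\<^sub>F n in sequentially. - r < real n" by (auto simp: eventually_sequentially intro!: exI[of _ m])
  then show ?thesis by eventually_elim (simp add: real)
 qed auto
qed

locale extended_cdf = prob_space \<mu> for \<mu> :: "ereal measure" +
 assumes sets_\<mu>: "sets \<mu> = sets borel" and no_infinity: "emeasure \<mu> {\<infinity>} = 0"
begin

abbreviation "u0 \<equiv> \<lambda>y. measure \<mu> {..y}"

lemma in_sets [simp]: "A \<in> sets borel ==> A \<in> sets \<mu>" by (simp add: sets_\<mu>)

lemma u0_mono: "x \<le> y ==> u0 x \<le> u0 y"
 by (intro finite_measure_mono) auto

lemma u0_01: "0 \<le> u0 y" "u0 y \<le> 1" by auto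

lemma u0_infinity: "u0 \<infinity> = 1"
proof -
 have "{..\<infinity>} = space \<mu>" using sets_eq_imp_space_eq[OF sets_\<mu>] by auto
 then show ?thesis by (simp only: prob_space)
qed

lemma u0_tendsto_infinity: "(\<lambda>n. u0 (ereal (real n))) \<longlonglongrightarrow> u0 \<infinity>"
proof -
 have "(\<lambda>n. u0 (ereal (real n))) \<longlonglongrightarrow> prob (\<Union>n. {..ereal (real n)})"
  by (rule finite_Lim_measure_incseq) (auto simp: incseq_def)
 also have "(\<Union>n. {..ereal (real n)}) = UNIV - {\<infinity>}"
 proof (intro set_eqI)
  fix y :: ereal
  show "y \<in> (\<Union>n. {..ereal (real n)}) \<longleftrightarrow> y \<in> UNIV - {\<infinity>}"
   by (cases y) (auto simp: real_arch_simple)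
 qed
 also have "prob (UNIV - {\<infinity>}) = prob UNIV"
  using no_infinity sets_eq_imp_space_eq[OF sets_\<mu>] by (subst finite_measure_Diff) (auto simp: measure_def)
 also have "UNIV = {..\<infinity>::ereal}" by auto
 finally show ?thesis .
qed

lemma u0_tendsto_MInfty: "(\<lambda>n. u0 (ereal (- real n))) \<longlonglongrightarrow> u0 (-\<infinity>)"
proof -
 have "(\<lambda>n. u0 (ereal (- real n))) \<longlonglongrightarrow> prob (\<Inter>n. {..ereal (- real n)})"
  by (rule finite_Lim_measure_decseq) (auto simp: decseq_def)
 also have "(\<Inter>n. {..ereal (- real n)}) = {..-\<infinity>}"
 proof (intro set_eqI)
  fix y :: ereal
  show "y \<in> (\<Inter>n. {..ereal (- real n)}) \<longleftrightarrow> y \<in> {..-\<infinity>}"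
  proof (cases y)
   case (real r)
   obtain m :: nat where "- r < real m" using reals_Archimedean2 by blast
   then show ?thesis by (auto simp: real intro!: exI[of _ m])
  qed auto
 qed
 finally show ?thesis .
qed

lemma u0_right_cont: "((\<lambda>y. u0 (ereal y)) \<longlongrightarrow> u0 (ereal x)) (at_right x)"
proof (rule tendsto_at_right_sequentially[of x "x + 1"])
 fix S :: "nat => real" assume S: "\<And>n. x < S n" "decseq S" "S \<longlonglongrightarrow> x"
 have "(\<lambda>n. u0 (ereal (S n))) \<longlonglongrightarrow> prob (\<Inter>n. {..ereal (S n)})"
  using S(2) by (intro finite_Lim_measure_decseq) (auto simp: decseq_def intro: order_trans)
 also have "(\<Inter>n. {..ereal (S n)}) = {..ereal x}"
 proof -
  have "y \<le> ereal x" if "\<And>n. y \<le> ereal (S n)" for y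
   by (rule LIMSEQ_le_const[of "\<lambda>n. ereal (S n)"]) (use S(3) that in \<open>auto simp: lim_ereal\<close>)
  moreover have "y \<le> ereal (S n)" if "y \<le> ereal x" for y n
   using that S(1)[of n] by (metis ereal_less_eq(3) less_imp_le order_trans)
  ultimately show ?thesis by auto
 qed
 finally show "(\<lambda>n. u0 (ereal (S n))) \<longlonglongrightarrow> u0 (ereal x)" .
qed simp

text \<open>At \<open>\<infinity>\<close> continuity holds because \<open>\<mu>\<close> has no mass
  there; at \<open>-\<infinity>\<close> it is continuity of the measure from above, whatever the
  mass of that point. It makes the heat flow continuous up to the ends of the extended line, as the
  outermost cells of the final grid argument require.\<close>

lemma u0_tendsto_infinite:
 assumes X: "(X \<longlongrightarrow> x) F" and x: "\<bar>x\<bar> = \<infinity>"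
 shows "((\<lambda>n. u0 (X n)) \<longlongrightarrow> u0 x) F"
proof (rule order_tendstoI)
 fix a assume a: "a < u0 x"
 show "\<forall>\<^sub>F n in F. a < u0 (X n)"
 proof (cases "x = \<infinity>")
  case True
  then obtain m :: nat where m: "a < u0 (ereal (real m))"
   using order_tendstoD(1)[OF u0_tendsto_infinity, of a] a by (auto simp: eventually_sequentially)
  have "\<forall>\<^sub>F n in F. ereal (real m) < X n" using order_tendstoD(1)[OF X] True by simp
  then show ?thesis
  proof eventually_elim
   case (elim n)
   then show ?case by (rule less_le_trans[OF m u0_mono[OF less_imp_le]])
  qed
 next
  case False
  then have "x = -\<infinity>" using x by auto
  then have "u0 x \<le> u0 (X n)" for n by (intro u0_mono) simp
  then show ?thesis using a by (intro always_eventually allI) (rule less_le_trans)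
 qed
next
 fix a assume a: "u0 x < a"
 show "\<forall>\<^sub>F n in F. u0 (X n) < a"
 proof (cases "x = \<infinity>")
  case True
  then have "u0 (X n) \<le> u0 x" for n by (intro u0_mono) simp
  then show ?thesis using a by (intro always_eventually allI) (rule le_less_trans)
 next
  case False
  then have mx: "x = -\<infinity>" using x by auto
  then obtain m :: nat where m: "u0 (ereal (- real m)) < a"
   using order_tendstoD(2)[OF u0_tendsto_MInfty, of a] a by (auto simp: eventually_sequentially)
  have "\<forall>\<^sub>F n in F. X n < ereal (- real m)" using order_tendstoD(2)[OF X] mx by simp
  then show ?thesis
  proof eventually_elim
   case (elim n)
   then show ?case by (rule le_less_trans[OF u0_mono[OF less_imp_le] m])
  qed
 qed
qed

lemma u0_tendsto_isCont:
 assumes X: "(X \<longlongrightarrow> ereal x) F" and c: "isCont (\<lambda>x. u0 (ereal x)) x"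
 shows "((\<lambda>n. u0 (X n)) \<longlongrightarrow> u0 (ereal x)) F"
proof -
 have "((\<lambda>x. u0 (ereal x)) \<longlongrightarrow> u0 (ereal x)) (nhds x)"
  using c by (simp add: isCont_def tendsto_at_iff_tendsto_nhds[of "\<lambda>x. u0 (ereal x)"])
 then have "(u0 \<longlongrightarrow> u0 (ereal x)) (nhds (ereal x))"
  by (simp add: nhds_ereal filterlim_filtermap)
 then show ?thesis by (rule filterlim_compose[OF _ X])
qed

lemma u0_measurable [measurable]: "u0 \<in> borel_measurable borel"
proof -
 have "(\<lambda>(y, z). of_bool (z \<le> y) :: real) \<in> borel_measurable (borel \<Otimes>\<^sub>M \<mu>)"
  unfolding measurable_cong_sets[OF sets_pair_measure_cong[OF refl sets_\<mu>] refl] by measurable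
 then have "(\<lambda>y. \<integral>z. of_bool (z \<le> y) \<partial>\<mu> :: real) \<in> borel_measurable (borel :: ereal measure)"
  by (rule borel_measurable_lebesgue_integral)
 moreover have "(\<integral>z. of_bool (z \<le> y) \<partial>\<mu> :: real) = u0 y" for y
 proof -
  have "(\<integral>z. of_bool (z \<le> y) \<partial>\<mu> :: real) = (\<integral>z. indicator {..y} z \<partial>\<mu>)"
   by (intro Bochner_Integration.integral_cong) (auto simp: indicator_def)
  then show ?thesis by simp
 qed
 ultimately show ?thesis by simp
qed

lemma countable_discont: "countable {x. \<not> isCont (\<lambda>x. u0 (ereal x)) x}"
 by (rule mono_ctble_discont) (auto simp: mono_def intro: u0_mono)

text \<open>At a positive time the Gaussian ignores the countably many jumps of \<open>u0\<close>;
  at time 0 there is no smoothing, and continuity of \<open>u0\<close> at the limit point takes its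
  place.\<close>

lemma heat_u0_tendsto:
 assumes T: "T \<longlonglongrightarrow> t" and X: "X \<longlonglongrightarrow> x"
  and ok: "0 < t \<or> \<bar>x\<bar> = \<infinity> \<or> (t = 0 \<and> isCont (\<lambda>x. u0 (ereal x)) (real_of_ereal x))"
 shows "(\<lambda>n. heat (T n) u0 (X n)) \<longlonglongrightarrow> heat t u0 x"
proof (rule heat_tendsto)
 have lim: "(\<lambda>n. X n + ereal (sqrt (T n) * z)) \<longlonglongrightarrow> x + ereal (sqrt t * z)" for z
  by (intro tendsto_add_ereal_real X tendsto_intros T)
 show "AE z in gauss. (\<lambda>n. u0 (X n + ereal (sqrt (T n) * z))) \<longlonglongrightarrow> u0 (x + ereal (sqrt t * z))"
 proof (cases x)
  case (real a)
  define C where "C = {z. \<not> isCont (\<lambda>x. u0 (ereal x)) (a + sqrt t * z)}"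
  have "AE z in gauss. z \<notin> C"
  proof (cases "0 < t")
   case True
   have "C \<subseteq> (\<lambda>w. (w - a) / sqrt t) ` {x. \<not> isCont (\<lambda>x. u0 (ereal x)) x}"
   proof
    fix z assume "z \<in> C"
    then show "z \<in> (\<lambda>w. (w - a) / sqrt t) ` {x. \<not> isCont (\<lambda>x. u0 (ereal x)) x}"
     using True by (intro image_eqI[where x="a + sqrt t * z"]) (auto simp: C_def)
   qed
   then show ?thesis
    by (intro gauss_AE_notin_countable countable_subset[OF _ countable_image[OF countable_discont]])
  next
   case False
   then show ?thesis using ok real by (simp add: C_def)
  qed
  then show ?thesis
  proof eventually_elim
   case (elim z)
   then show ?case using u0_tendsto_isCont[of _ "a + sqrt t * z"] lim[of z] by (simp add: C_def real)
  qed
 qed (use u0_tendsto_infinite[OF lim] in simp_all)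
qed (use u0_01 in \<open>auto simp: abs_of_nonneg\<close>)

end

locale hydrodynamics = extended_cdf \<mu> + mild_problem "\<lambda>y. measure \<mu> {..y}" "\<lambda>v. h_p k lam p (clip v)" 1 L H
 for \<mu> and k :: nat and lam p L H +
 fixes M :: "nat => 'a measure" and Y :: "nat => real => 'a => nat => ereal"
 assumes k: "2 \<le> k" and lam: "0 < lam" and p: "set_pmf p \<subseteq> mark_pairs k"
  and bbm: "\<And>N. N \<ge> k ==> np_BBM k lam p N (M N) (Y N)"
  and init: "tendsto_0_in_prob M (\<lambda>N w. SUP x. \<bar>empirical_cdf N (Y N 0 w) x - u0 (ereal x)\<bar>)"
begin

lemma ps: "N \<ge> k ==> prob_space (M N)"
 using bbm unfolding np_BBM_def by blast

lemma ex_bbm_mild: assumes N: "N \<ge> k" shows "\<exists>B \<tau> S q. bbm_mild (M N) k lam p N (Y N) B \<tau> S q u0 L H"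
proof -
 obtain B \<tau> S q where d: "np_BBM_driven_by k lam p N (M N) (Y N) B \<tau> S q" using bbm[OF N] unfolding np_BBM_def by blast
 interpret N: prob_space "M N" by (rule ps[OF N])
 have "np_bbm_driven (M N) k lam p N (Y N) B \<tau> S q" by unfold_locales (use k N lam p d in auto)
 then show ?thesis using mild_problem_axioms unfolding bbm_mild_def by blast
qed

abbreviation "sqe N t x \<equiv> (\<integral>w. (emp N (Y N t w) x - mild t x)\<^sup>2 \<partial>M N)"

lemma emp_meas:
 assumes N: "N \<ge> k" and t: "0 \<le> t" shows "(\<lambda>w. emp N (Y N t w) x) \<in> borel_measurable (M N)"
proof -
 obtain B \<tau> S q where "bbm_mild (M N) k lam p N (Y N) B \<tau> S q u0 L H" using ex_bbm_mild[OF N] by blast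
 then show ?thesis by (rule bbm_mild.emp_Y_measurable[OF _ t])
qed

lemma sqe_integrable:
 assumes N: "N \<ge> k" and t: "0 \<le> t" shows "integrable (M N) (\<lambda>w. (emp N (Y N t w) x - mild t x)\<^sup>2)"
proof -
 interpret N: prob_space "M N" by (rule ps[OF N])
 note [measurable] = emp_meas[OF N t]
 have "\<bar>emp N (Y N t w) x - mild t x\<bar> \<le> 1 + (1 + H * t)" for w
  using emp_01[of N "Y N t w" x] mild_bound[OF t, of x] by linarith
 from power_mono[OF this abs_ge_zero, where n=2] show ?thesis
  by (intro N.integrable_const_bound[where B="(1 + (1 + H * t))\<^sup>2"]) auto
qed

lemma emp_u0_abs: "\<bar>emp N z y - u0 y\<bar> \<le> 1"
 using emp_01[of N z y] u0_01[of y] by linarith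

text \<open>The supremum runs over real thresholds, whereas the error estimate is uniform over the
  extended line. At \<open>\<infinity>\<close> both functions are 1, and \<open>-\<infinity>\<close>
  is reached by a limit.\<close>

lemma emp_u0_le_SUP:
 assumes N: "N > 0" shows "\<bar>emp N z y - u0 y\<bar> \<le> (SUP x. \<bar>empirical_cdf N z x - u0 (ereal x)\<bar>)"
proof -
 let ?S = "SUP x. \<bar>empirical_cdf N z x - u0 (ereal x)\<bar>"
 have bdd: "bdd_above (range (\<lambda>x. \<bar>empirical_cdf N z x - u0 (ereal x)\<bar>))"
  using emp_u0_abs by (intro bdd_aboveI[where M=1]) (auto simp: empirical_cdf_emp)
 have r: "\<bar>emp N z (ereal x) - u0 (ereal x)\<bar> \<le> ?S" for x
  using cSUP_upper[OF UNIV_I bdd, of x] by (simp add: empirical_cdf_emp)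
 show ?thesis
 proof (cases y)
  case PInf
  then show ?thesis using r[of 0] emp_infinity[OF N] u0_infinity by simp
 next
  case MInf
  have "(\<lambda>n. \<bar>emp N z (ereal (- real n)) - u0 (ereal (- real n))\<bar>) \<longlonglongrightarrow> \<bar>emp N z (-\<infinity>) - u0 (-\<infinity>)\<bar>"
   by (intro tendsto_intros emp_tendsto_MInfty u0_tendsto_MInfty)
  then show ?thesis unfolding MInf by (rule LIMSEQ_le_const2) (use r in blast)
 qed (use r in simp)
qed

text \<open>A strict inequality at some threshold persists on a right neighbourhood by
  right-continuity, and this contains a rational; the event is therefore a countable union.\<close>

lemma SUP_event:
 assumes N: "N \<ge> k" and \<epsilon>: "0 < \<epsilon>"
 shows "{\<omega> \<in> space (M N). \<bar>SUP x. \<bar>empirical_cdf N (Y N 0 \<omega>) x - u0 (ereal x)\<bar>\<bar> > \<epsilon>} \<in> sets (M N)" (is "?E \<in> _")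
proof -
 let ?D = "\<lambda>r. {\<omega> \<in> space (M N). \<epsilon> < \<bar>emp N (Y N 0 \<omega>) (ereal r) - u0 (ereal r)\<bar>}"
 have "?E = (\<Union>r\<in>\<rat>. ?D r)"
 proof (intro equalityI subsetI)
  fix \<omega> assume w: "\<omega> \<in> ?E"
  let ?f = "\<lambda>x. \<bar>emp N (Y N 0 \<omega>) (ereal x) - u0 (ereal x)\<bar>"
  have "\<exists>x. \<epsilon> < ?f x"
  proof (rule ccontr)
   assume "\<not> ?thesis"
   then have le: "?f x \<le> \<epsilon>" for x by (simp add: not_less)
   have "(SUP x. ?f x) \<le> \<epsilon>" by (rule cSUP_least) (use le in auto)
   moreover have "0 \<le> (SUP x. ?f x)"
    using emp_u0_le_SUP[of N "Y N 0 \<omega>" 0] N k by (simp add: empirical_cdf_emp)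
   ultimately show False using w by (simp add: empirical_cdf_emp)
  qed
  then obtain x where x: "\<epsilon> < ?f x" by blast
  have "(?f \<longlongrightarrow> ?f x) (at_right x)" by (intro tendsto_intros emp_right_cont u0_right_cont)
  from order_tendstoD(1)[OF this x] obtain b where b: "x < b" "\<And>y. x < y ==> y < b ==> \<epsilon> < ?f y"
   unfolding eventually_at_right_field by blast
  obtain r where "r \<in> \<rat>" "x < r" "r < b" using Rats_dense_in_real[OF b(1)] by blast
  then show "\<omega> \<in> (\<Union>r\<in>\<rat>. ?D r)" using b(2) w by blast
 next
  fix \<omega> assume "\<omega> \<in> (\<Union>r\<in>\<rat>. ?D r)"
  then obtain r where r: "\<omega> \<in> space (M N)" "\<epsilon> < \<bar>emp N (Y N 0 \<omega>) (ereal r) - u0 (ereal r)\<bar>" by blast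
  have "\<bar>emp N (Y N 0 \<omega>) (ereal r) - u0 (ereal r)\<bar> \<le> (SUP x. \<bar>empirical_cdf N (Y N 0 \<omega>) x - u0 (ereal x)\<bar>)"
   by (rule emp_u0_le_SUP) (use N k in simp)
  with r show "\<omega> \<in> ?E" by simp
 qed
 also have "... \<in> sets (M N)"
 proof (rule sets.countable_UN''[OF countable_rat])
  fix r :: real
  note [measurable] = emp_meas[OF N order.refl]
  show "?D r \<in> sets (M N)" by measurable
 qed
 finally show ?thesis .
qed

text \<open>The squared error is at most \<open>\<epsilon>^2\<close> off the exceptional event and
  at most 1 on it. The bound is uniform in \<open>y\<close>, which is the form in which the Gronwall
  estimate starts.\<close>

lemma initial_error:
 assumes N: "N \<ge> k" and \<epsilon>: "0 < \<epsilon>"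
 shows "(\<integral>\<omega>. (emp N (Y N 0 \<omega>) y - u0 y)\<^sup>2 \<partial>M N) \<le> \<epsilon>\<^sup>2 + measure (M N) {\<omega> \<in> space (M N). \<bar>SUP x. \<bar>empirical_cdf N (Y N 0 \<omega>) x - u0 (ereal x)\<bar>\<bar> > \<epsilon>}"
  (is "_ \<le> _ + measure _ ?E")
proof -
 interpret N: prob_space "M N" by (rule ps[OF N])
 note E = SUP_event[OF N \<epsilon>]
 have I: "integrable (M N) (indicator ?E :: _ => real)"
  by (rule integrable_real_indicator[OF E]) (simp add: less_top[symmetric])
 have "(\<integral>\<omega>. (emp N (Y N 0 \<omega>) y - u0 y)\<^sup>2 \<partial>M N) \<le> (\<integral>\<omega>. \<epsilon>\<^sup>2 + indicator ?E \<omega> \<partial>M N)"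
 proof (rule integral_mono)
  show "integrable (M N) (\<lambda>\<omega>. (emp N (Y N 0 \<omega>) y - u0 y)\<^sup>2)"
   using sqe_integrable[OF N order.refl, of y] by (simp add: mild_0)
  show "integrable (M N) (\<lambda>\<omega>. \<epsilon>\<^sup>2 + indicator ?E \<omega>)"
   by (rule Bochner_Integration.integrable_add[OF N.integrable_const I])
  fix \<omega> assume w: "\<omega> \<in> space (M N)"
  show "(emp N (Y N 0 \<omega>) y - u0 y)\<^sup>2 \<le> \<epsilon>\<^sup>2 + indicator ?E \<omega>"
  proof (cases "\<omega> \<in> ?E")
   case True
   have "(emp N (Y N 0 \<omega>) y - u0 y)\<^sup>2 \<le> 1" using power_mono[OF emp_u0_abs abs_ge_zero, where n=2] by simp
   then show ?thesis using True by (simp add: add_increasing)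
  next
   case False
   then have "\<bar>emp N (Y N 0 \<omega>) y - u0 y\<bar> \<le> \<epsilon>" using w emp_u0_le_SUP[of N "Y N 0 \<omega>" y] N k by simp
   from power_mono[OF this abs_ge_zero, where n=2] show ?thesis using False by simp
  qed
 qed
 also have "... = \<epsilon>\<^sup>2 + measure (M N) ?E"
  unfolding Bochner_Integration.integral_add[OF N.integrable_const I] Bochner_Integration.integral_indicator sets.Int_space_eq2[OF E]
  by (simp add: N.prob_space)
 finally show ?thesis .
qed

lemma sqe_nonneg: "0 \<le> sqe N t x" by simp

lemma sqe_tendsto_0:
 assumes t: "0 < t" shows "(\<lambda>N. sqe N t x) \<longlonglongrightarrow> 0"
proof (rule order_tendstoI)
 fix e :: real assume e: "0 < e"
 let ?E = "exp (2 * L * t)"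
 \<comment> \<open>Chosen so that the Gronwall factor turns \<open>\<epsilon>^2\<close> into
   \<open>e / 2\<close>.\<close>
 define \<epsilon> where "\<epsilon> = sqrt (e / (2 * ?E))"
 have \<epsilon>: "0 < \<epsilon>" "\<epsilon>\<^sup>2 * ?E = e / 2" using e by (auto simp: \<epsilon>_def)
 define P where "P N = measure (M N) {w \<in> space (M N). \<bar>SUP x. \<bar>empirical_cdf N (Y N 0 w) x - u0 (ereal x)\<bar>\<bar> > \<epsilon>}" for N
 define C where "C = 1 + t * (2 * lam + 2 * (1 + (1 + H * t)) * h_fin_const k lam p)"
 have P: "P \<longlonglongrightarrow> 0" using init \<epsilon>(1) unfolding tendsto_0_in_prob_def P_def by blast
 have "(\<lambda>N. (\<epsilon>\<^sup>2 + P N + C / real N) * ?E) \<longlonglongrightarrow> (\<epsilon>\<^sup>2 + 0 + 0) * ?E"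
  by (intro tendsto_intros P tendsto_divide_0[OF tendsto_const] filterlim_at_top_imp_at_infinity filterlim_real_sequentially)
 then have "\<forall>\<^sub>F N in sequentially. (\<epsilon>\<^sup>2 + P N + C / real N) * ?E < e"
  by (rule order_tendstoD(2)) (use \<epsilon>(2) e in simp)
 with eventually_ge_at_top[of k] show "\<forall>\<^sub>F N in sequentially. sqe N t x < e"
 proof eventually_elim
  case (elim N)
  obtain B \<tau> S q where b: "bbm_mild (M N) k lam p N (Y N) B \<tau> S q u0 L H" using ex_bbm_mild[OF elim(1)] by blast
  have "sqe N t x \<le> (\<epsilon>\<^sup>2 + P N + C / real N) * ?E"
   using bbm_mild.Y_sq_err_bound[OF b t, of "\<epsilon>\<^sup>2 + P N" x] initial_error[OF elim(1) \<epsilon>(1)]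
   unfolding bbm_mild.cell_const_def[OF b] C_def P_def by simp
  with elim(2) show ?case by linarith
 qed
qed (use sqe_nonneg in \<open>auto intro!: always_eventually intro: less_le_trans\<close>)

text \<open>Both mean squared errors vanish in the limit, so a deterministic lower bound for their
  sum cannot be positive. In this way properties shared by all empirical distribution functions pass
  to \<open>mild\<close>, whose construction does not reveal them.\<close>

lemma limit_gap:
 assumes t: "0 < t" and c: "\<And>N w. N \<ge> k ==> c \<le> (emp N (Y N t w) x - mild t x)\<^sup>2 + (emp N (Y N t w) y - mild t y)\<^sup>2"
 shows "c \<le> 0"
proof -
 have "(\<lambda>N. sqe N t x + sqe N t y) \<longlonglongrightarrow> 0 + 0" by (intro tendsto_add sqe_tendsto_0 t)
 moreover have "c \<le> sqe N t x + sqe N t y" if N: "N \<ge> k" for N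
 proof -
  interpret N: prob_space "M N" by (rule ps[OF N])
  have i: "integrable (M N) (\<lambda>w. (emp N (Y N t w) x - mild t x)\<^sup>2)" "integrable (M N) (\<lambda>w. (emp N (Y N t w) y - mild t y)\<^sup>2)"
   using sqe_integrable[OF N] t by auto
  have "(\<integral>w. c \<partial>M N) \<le> (\<integral>w. (emp N (Y N t w) x - mild t x)\<^sup>2 + (emp N (Y N t w) y - mild t y)\<^sup>2 \<partial>M N)"
   by (rule integral_mono) (use i c[OF N] in auto)
  then show ?thesis using i by (simp add: N.prob_space)
 qed
 ultimately have "c \<le> 0 + 0" by (intro LIMSEQ_le_const) blast+
 then show ?thesis by simp
qed

lemma mild_01: assumes t: "0 \<le> t" shows "0 \<le> mild t x" "mild t x \<le> 1"
proof -
 have "clip (mild t x) = mild t x"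
 proof (cases "t = 0")
  case False
  have "(mild t x - clip (mild t x))\<^sup>2 \<le> (emp N (Y N t w) x - mild t x)\<^sup>2 + (emp N (Y N t w) x - mild t x)\<^sup>2" for N w
  proof -
   \<comment> \<open>Clipping gives the nearest point of the unit interval, in which
     \<open>emp\<close> lies.\<close>
   have "\<bar>mild t x - clip (mild t x)\<bar> \<le> \<bar>emp N (Y N t w) x - mild t x\<bar>"
    using emp_01[of N "Y N t w" x] by (auto simp: clip_def)
   then have "(mild t x - clip (mild t x))\<^sup>2 \<le> (emp N (Y N t w) x - mild t x)\<^sup>2" by (simp only: abs_le_square_iff)
   then show ?thesis using zero_le_power2[of "emp N (Y N t w) x - mild t x"] by linarith
  qed
  then have "(mild t x - clip (mild t x))\<^sup>2 \<le> 0" using t False by (intro limit_gap[of t _ x x]) auto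
  then show ?thesis by simp
 qed (use u0_01 in \<open>simp add: mild_0 clip_simps\<close>)
 then show "0 \<le> mild t x" "mild t x \<le> 1" using clip_simps(1,2)[of "mild t x"] by simp_all
qed

lemma mild_mono:
 assumes t: "0 < t" and xy: "x \<le> y" shows "mild t x \<le> mild t y"
proof (rule ccontr)
 assume a: "\<not> mild t x \<le> mild t y"
 have "(mild t x - mild t y)\<^sup>2 / 2 \<le> (emp N (Y N t w) x - mild t x)\<^sup>2 + (emp N (Y N t w) y - mild t y)\<^sup>2" for N w
 proof -
  define u where "u = mild t x - emp N (Y N t w) x"
  define v where "v = emp N (Y N t w) y - mild t y"
  \<comment> \<open>Since \<open>emp\<close> is increasing, a drop of \<open>mild\<close> from
    \<open>x\<close> to \<open>y\<close> is at most the sum of the two errors.\<close>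
  have "0 \<le> mild t x - mild t y" "mild t x - mild t y \<le> u + v" using a emp_mono[OF xy, of N "Y N t w"] by (auto simp: u_def v_def)
  then have "(mild t x - mild t y)\<^sup>2 \<le> (u + v)\<^sup>2" by (intro power_mono)
  also have "... \<le> 2 * (u\<^sup>2 + v\<^sup>2)" using sum_squares_bound[of u v] by (simp add: power2_sum)
  finally show ?thesis by (simp add: u_def v_def power2_commute)
 qed
 then have "(mild t x - mild t y)\<^sup>2 / 2 \<le> 0" by (rule limit_gap[OF t])
 then show False using a by simp
qed

lemma mild_continuous: "seq_cont mild"
 by (rule mild_seq_cont) (auto simp: seq_cont_def intro: heat_u0_tendsto)

text \<open>Finitely many points that bracket every real with little variation of
  \<open>mild t\<close> in between: the tails are settled by continuity at the infinite points,
  which belong to \<open>G\<close>, and the middle by the Lipschitz bound with step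
  \<open>\<eta>\<close>.\<close>

lemma mild_grid:
 assumes t: "0 < t" and \<epsilon>: "0 < \<epsilon>"
 obtains G where "finite G" "\<And>x. \<exists>a\<in>G. \<exists>b\<in>G. a \<le> ereal x \<and> ereal x \<le> b \<and> mild t b - mild t a \<le> \<epsilon>"
proof -
 have lim: "X \<longlonglongrightarrow> x ==> (\<lambda>n. mild t (X n)) \<longlonglongrightarrow> mild t x" for X x
  using mild_continuous[unfolded seq_cont_def, rule_format, of t "\<lambda>_. t" X x] t by simp
 have "\<forall>\<^sub>F n in sequentially. ereal (- real n) < ereal r" for r
 proof -
  obtain m :: nat where "- r < real m" using reals_Archimedean2 by blast
  then show ?thesis by (auto simp: eventually_sequentially intro!: exI[of _ m])
 qed
 then have minf: "(\<lambda>n. ereal (- real n)) \<longlonglongrightarrow> -\<infinity>" by (simp add: tendsto_MInfty)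
 have "(\<lambda>n. mild t (ereal (real n))) \<longlonglongrightarrow> mild t \<infinity>" "(\<lambda>n. mild t (ereal (- real n))) \<longlonglongrightarrow> mild t (-\<infinity>)"
  by (auto intro!: lim minf simp: tendsto_PInfty_eq_at_top filterlim_real_sequentially)
 then have "\<forall>\<^sub>F n in sequentially. mild t \<infinity> - \<epsilon> < mild t (ereal (real n))" "\<forall>\<^sub>F n in sequentially. mild t (ereal (- real n)) < mild t (-\<infinity>) + \<epsilon>"
  using \<epsilon> by (auto intro: order_tendstoD)
 from eventually_happens'[OF sequentially_bot eventually_conj[OF this]]
 obtain A :: nat where A: "mild t \<infinity> - \<epsilon> < mild t (ereal (real A))" "mild t (ereal (- real A)) < mild t (-\<infinity>) + \<epsilon>" by blast
 define \<Lambda> where "\<Lambda> = 1 / sqrt t + 2 * H * sqrt t"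
 have \<Lambda>: "0 < \<Lambda>" using t H_nonneg by (auto simp: \<Lambda>_def intro!: add_pos_nonneg)
 define \<eta> where "\<eta> = \<epsilon> / \<Lambda>"
 have \<eta>: "0 < \<eta>" "\<Lambda> * \<eta> = \<epsilon>" using \<epsilon> \<Lambda> by (auto simp: \<eta>_def)
 define n where "n = nat \<lceil>2 * real A / \<eta>\<rceil> + 1"
 define g where "g i = ereal (- real A + real i * \<eta>)" for i :: nat
 define G where "G = {-\<infinity>, \<infinity>, ereal (- real A), ereal (real A)} \<union> g ` {..n}"
 show thesis
 proof (rule that[of G])
  show "finite G" by (simp add: G_def)
  fix x :: real
  consider "x \<le> - real A" | "real A \<le> x" | "- real A < x" "x < real A" by linarith
  then show "\<exists>a\<in>G. \<exists>b\<in>G. a \<le> ereal x \<and> ereal x \<le> b \<and> mild t b - mild t a \<le> \<epsilon>"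
  proof cases
   case 1
   then show ?thesis using A(2) by (intro bexI[of _ "-\<infinity>"] bexI[of _ "ereal (- real A)"]) (auto simp: G_def)
  next
   case 2
   then show ?thesis using A(1) by (intro bexI[of _ "ereal (real A)"] bexI[of _ "\<infinity>"]) (auto simp: G_def)
  next
   case 3
   define i where "i = nat \<lfloor>(x + real A) / \<eta>\<rfloor>"
   have nn: "0 \<le> (x + real A) / \<eta>" using 3 \<eta> by simp
   have ri: "real i = of_int \<lfloor>(x + real A) / \<eta>\<rfloor>" unfolding i_def using nn by simp
   have "x + real A < (real i + 1) * \<eta>"
    using real_of_int_floor_add_one_gt[of "(x + real A) / \<eta>"] unfolding ri pos_divide_less_eq[OF \<eta>(1)] .
   moreover have "real i * \<eta> \<le> x + real A"
    using of_int_floor_le[of "(x + real A) / \<eta>"] unfolding ri pos_le_divide_eq[OF \<eta>(1)] .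
   ultimately have i1: "real i * \<eta> \<le> x + real A" "x + real A \<le> (real i + 1) * \<eta>" by simp_all
   have "(x + real A) / \<eta> \<le> 2 * real A / \<eta>" using 3 \<eta> by (intro divide_right_mono) auto
   then have "real i \<le> 2 * real A / \<eta>" unfolding ri by linarith
   then have "real i \<le> real (nat \<lceil>2 * real A / \<eta>\<rceil>)" by linarith
   then have n: "i \<le> n" "Suc i \<le> n" by (auto simp: n_def)
   have "g (Suc i) = g i + ereal \<eta>" by (simp add: g_def algebra_simps)
   then have "\<bar>mild t (g (Suc i)) - mild t (g i)\<bar> \<le> \<Lambda> * \<eta>" using mild_Lipschitz[OF t, of "g i" \<eta>] \<eta> by (simp add: \<Lambda>_def)
   then have "mild t (g (Suc i)) - mild t (g i) \<le> \<epsilon>" using \<eta>(2) by linarith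
   moreover have "g i \<in> G" "g (Suc i) \<in> G" using n by (simp_all add: G_def)
   moreover have "g i \<le> ereal x" "ereal x \<le> g (Suc i)" using i1 by (simp_all add: g_def algebra_simps)
   ultimately show ?thesis by blast
  qed
 qed
qed

text \<open>Both functions are monotone, so between two bracketing grid points the error is at most
  the error at one of them plus the oscillation of \<open>mild t\<close>. Markov's inequality for
  the squared errors at the finitely many grid points then suffices.\<close>

lemma convergence:
 assumes t: "0 < t" shows "tendsto_0_in_prob M (\<lambda>N \<omega>. SUP x. \<bar>empirical_cdf N (Y N t \<omega>) x - mild t (ereal x)\<bar>)"
 unfolding tendsto_0_in_prob_def
proof (intro allI impI)
 fix e :: real assume e: "0 < e"
 obtain G where G: "finite G" "\<And>x. \<exists>a\<in>G. \<exists>b\<in>G. a \<le> ereal x \<and> ereal x \<le> b \<and> mild t b - mild t a \<le> e / 2"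
  using mild_grid[OF t, of "e / 2"] e by auto
 let ?A = "\<lambda>N. {\<omega> \<in> space (M N). \<bar>SUP x. \<bar>empirical_cdf N (Y N t \<omega>) x - mild t (ereal x)\<bar>\<bar> > e}"
 have bound: "measure (M N) (?A N) \<le> (\<Sum>g\<in>G. sqe N t g / (e / 2)\<^sup>2)" if N: "N \<ge> k" for N
 proof -
  interpret N: prob_space "M N" by (rule ps[OF N])
  have t0: "0 \<le> t" using t by simp
  note [measurable] = emp_meas[OF N t0]
  define D where "D g = {\<omega> \<in> space (M N). (emp N (Y N t \<omega>) g - mild t g)\<^sup>2 \<ge> (e / 2)\<^sup>2}" for g
  have D: "D g \<in> sets (M N)" for g unfolding D_def by measurable
  have "?A N \<subseteq> (\<Union>g\<in>G. D g)"
  proof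
   fix \<omega> assume w: "\<omega> \<in> ?A N"
   show "\<omega> \<in> (\<Union>g\<in>G. D g)"
   proof (rule ccontr)
    assume "\<not> ?thesis"
    then have small: "\<bar>emp N (Y N t \<omega>) g - mild t g\<bar> < e / 2" if "g \<in> G" for g
     using w that e by (auto simp: D_def not_le abs_le_square_iff[symmetric])
    have le: "\<bar>empirical_cdf N (Y N t \<omega>) x - mild t (ereal x)\<bar> \<le> e" for x
    proof -
     obtain a b where ab: "a \<in> G" "b \<in> G" "a \<le> ereal x" "ereal x \<le> b" "mild t b - mild t a \<le> e / 2" using G(2) by blast
     then show ?thesis
      using small[OF ab(1)] small[OF ab(2)] mild_mono[OF t ab(3)] mild_mono[OF t ab(4)]
       emp_mono[OF ab(3), of N "Y N t \<omega>"] emp_mono[OF ab(4), of N "Y N t \<omega>"]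
      unfolding empirical_cdf_emp by linarith
    qed
    have "(SUP x. \<bar>empirical_cdf N (Y N t \<omega>) x - mild t (ereal x)\<bar>) \<le> e" by (rule cSUP_least) (use le in auto)
    moreover have "0 \<le> (SUP x. \<bar>empirical_cdf N (Y N t \<omega>) x - mild t (ereal x)\<bar>)"
     by (rule cSUP_upper2[of _ _ 0]) (use le in \<open>auto intro!: bdd_aboveI[where M=e]\<close>)
    ultimately show False using w by simp
   qed
  qed
  then have "measure (M N) (?A N) \<le> measure (M N) (\<Union>g\<in>G. D g)"
   using D G(1) by (intro N.finite_measure_mono sets.finite_UN) auto
  also have "... \<le> (\<Sum>g\<in>G. measure (M N) (D g))"
   using D G(1) by (intro N.finite_measure_subadditive_finite) auto
  also have "... \<le> (\<Sum>g\<in>G. sqe N t g / (e / 2)\<^sup>2)"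
  proof (intro sum_mono)
   fix g
   show "measure (M N) (D g) \<le> sqe N t g / (e / 2)\<^sup>2"
    unfolding D_def using sqe_integrable[OF N t0] e by (intro integral_Markov_inequality_measure[where A="{}"]) auto
  qed
  finally show ?thesis .
 qed
 have "(\<lambda>N. \<Sum>g\<in>G. sqe N t g / (e / 2)\<^sup>2) \<longlonglongrightarrow> (\<Sum>g\<in>G. 0 / (e / 2)\<^sup>2)"
  by (intro tendsto_intros sqe_tendsto_0 t) (use e in auto)
 then have lim: "(\<lambda>N. \<Sum>g\<in>G. sqe N t g / (e / 2)\<^sup>2) \<longlonglongrightarrow> 0" by simp
 show "(\<lambda>N. measure (M N) (?A N)) \<longlonglongrightarrow> 0"
  by (rule tendsto_sandwich[OF _ _ tendsto_const lim])
   (use bound in \<open>auto simp: eventually_at_top_linorder\<close>)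
qed

text \<open>By \<open>mild_01\<close> clipping acts as the identity along the solution, so the
  regularity theory applies with the polynomial itself. At small times \<open>s\<close> the solution
  is within \<open>H * s\<close> of the heat flow of \<open>u0\<close>, which attains
  \<open>u0\<close> at its continuity points.\<close>

lemma solution: "bounded_FKPP_solution (h_p k lam p) (\<lambda>x. u0 (ereal x)) (\<lambda>t x. mild t (ereal x))"
proof -
 have cl: "clip (mild t x) = mild t x" if "0 \<le> t" for t x using mild_01[OF that] by (simp add: clip_simps)
 have "compact (h_p' k lam p ` {0..1})" by (intro compact_continuous_image h_p'_cont compact_Icc)
 then obtain H' where H': "\<And>v. v \<in> {0..1} ==> \<bar>h_p' k lam p v\<bar> \<le> H'"
  using compact_imp_bounded bounded_iff by (metis imageI real_norm_def)
 interpret R: regular_flow mild "h_p k lam p" "h_p' k lam p" 1 H H'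
 proof
  fix s d x :: real assume sd: "0 < s" "0 < d"
  have "duhamel (\<lambda>r y. h_p k lam p (clip (mild (s + r) y))) d (ereal x) = duhamel (\<lambda>r y. h_p k lam p (mild (s + r) y)) d (ereal x)"
   unfolding duhamel_def using sd
   by (intro Bochner_Integration.integral_cong refl) (auto simp: indicator_def cl)
  then show "mild (s + d) (ereal x) = heat d (mild s) (ereal x) - duhamel (\<lambda>r y. h_p k lam p (mild (s + r) y)) d (ereal x)"
   using mild_flow[of s d "ereal x"] sd by simp
 next
  fix t :: real and y assume t: "0 < t"
  show "\<bar>mild t y\<bar> \<le> 1" using mild_01[of t y] t by simp
  show "\<bar>h_p k lam p (mild t y)\<bar> \<le> H" using h_bound[of "mild t y"] cl[of t y] t by simp
  show "\<bar>h_p' k lam p (mild t y)\<bar> \<le> H'" using mild_01[of t y] t by (intro H') auto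
 qed (use mild_measurable mild_continuous seq_cont_imp_real h_p_deriv h_p'_cont in auto)
 have init0: "((\<lambda>s. mild s (ereal x)) \<longlongrightarrow> u0 (ereal x)) (at_right 0)" if c: "isCont (\<lambda>x. u0 (ereal x)) x" for x
 proof (rule tendsto_at_right_sequentially[of 0 1])
  fix S :: "nat => real" assume S: "\<And>n. 0 < S n" "S \<longlonglongrightarrow> 0"
  have 1: "(\<lambda>n. heat (S n) u0 (ereal x)) \<longlonglongrightarrow> heat 0 u0 (ereal x)"
   by (rule heat_u0_tendsto) (use S c in auto)
  have "(\<lambda>n. H * S n) \<longlonglongrightarrow> 0" by (intro tendsto_mult_right_zero S)
  then have 2: "(\<lambda>n. mild (S n) (ereal x) - heat (S n) u0 (ereal x)) \<longlonglongrightarrow> 0"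
  proof (rule Lim_null_comparison[rotated])
   have m0: "mild 0 = u0" by (rule ext) (rule mild_0)
   have "\<bar>mild (S n) (ereal x) - heat (S n) u0 (ereal x)\<bar> \<le> H * S n" for n
    using mild_step_bound[of 0 "S n" "ereal x"] S(1)[of n] unfolding m0 by simp
   then show "\<forall>\<^sub>F n in sequentially. norm (mild (S n) (ereal x) - heat (S n) u0 (ereal x)) \<le> H * S n" by simp
  qed
  from tendsto_add[OF 1 2] show "(\<lambda>n. mild (S n) (ereal x)) \<longlonglongrightarrow> u0 (ereal x)" by simp
 qed simp
 show ?thesis
  unfolding bounded_FKPP_solution_def FKPP_solution_upto_def
 proof (intro conjI allI impI exI[of _ 1])
  fix T :: real assume "0 < T"
  show "\<exists>G V. open G \<and> {0<..T} \<times> UNIV \<subseteq> G \<and> C12_on G V \<and> (\<forall>t\<in>{0<..T}. \<forall>x. V t x = mild t (ereal x) \<and>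
    deriv (\<lambda>s. V s x) t = 1 / 2 * deriv (deriv (V t)) x - h_p k lam p (V t x))"
   using R.C12 R.pde by (intro exI[of _ "{0<..} \<times> UNIV"] exI[of _ "\<lambda>t x. mild t (ereal x)"]) (auto intro!: open_Times)
 next
  fix x show "mild 0 (ereal x) = u0 (ereal x)" by (rule mild_0)
 next
  fix x assume "isCont (\<lambda>x. u0 (ereal x)) x"
  then show "((\<lambda>s. mild s (ereal x)) \<longlongrightarrow> u0 (ereal x)) (at_right 0)" by (rule init0)
 next
  fix t x :: real assume "0 \<le> t"
  then show "\<bar>mild t (ereal x)\<bar> \<le> 1" using mild_01 by simp
 qed
qed

end

theorem theorem3p1:
  fixes k :: nat and lam :: real and p :: "(nat \<times> nat) pmf"
    and M :: "nat \<Rightarrow> 'a measure"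
    and Y :: "nat \<Rightarrow> real \<Rightarrow> 'a \<Rightarrow> nat \<Rightarrow> ereal"
    and \<mu> :: "ereal measure" and U0 :: "real \<Rightarrow> real"
  assumes "k \<ge> 2" and "lam > 0"
    and "set_pmf p \<subseteq> {(i, j). 1 \<le> i \<and> i < j \<and> j \<le> k}"
    and "\<And>N. N \<ge> k \<Longrightarrow> np_BBM k lam p N (M N) (Y N)"
    and "prob_space \<mu>" and "sets \<mu> = sets borel" and "emeasure \<mu> {\<infinity>} = 0"
    and "\<And>x. U0 x = measure \<mu> {..ereal x}"
    and "tendsto_0_in_prob M (\<lambda>N \<omega>. SUP x. \<bar>empirical_cdf N (Y N 0 \<omega>) x - U0 x\<bar>)"
  shows "\<exists>U. bounded_FKPP_solution (h_p k lam p) U0 U \<and>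
           (\<forall>V. bounded_FKPP_solution (h_p k lam p) U0 V \<longrightarrow> (\<forall>t\<ge>0. \<forall>x. V t x = U t x)) \<and>
           (\<forall>t>0. tendsto_0_in_prob M (\<lambda>N \<omega>. SUP x. \<bar>empirical_cdf N (Y N t \<omega>) x - U t x\<bar>))"
proof -
  have U0_eq: "U0 = (\<lambda>x. measure \<mu> {..ereal x})" using assms(8) by blast
  obtain L H where LH: "L > 0" "\<And>a b. \<bar>h_p k lam p (clip a) - h_p k lam p (clip b)\<bar> \<le> L * \<bar>a - b\<bar>"
    "\<And>a. \<bar>h_p k lam p (clip a)\<bar> \<le> H"
    using h_p_clip by metis
  interpret extended_cdf \<mu> by (intro extended_cdf.intro extended_cdf_axioms.intro assms)
  interpret hydrodynamics \<mu> k lam p L H M Y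
    by unfold_locales (use LH assms in \<open>auto simp: U0_eq mark_pairs_def\<close>)
  show ?thesis
  proof (intro exI[of _ "\<lambda>t x. mild t (ereal x)"] conjI allI impI)
    show "bounded_FKPP_solution (h_p k lam p) U0 (\<lambda>t x. mild t (ereal x))" unfolding U0_eq by (rule solution)
    fix V t x assume V: "bounded_FKPP_solution (h_p k lam p) U0 V" and t: "0 \<le> (t::real)"
    show "V t x = mild t (ereal x)"
      by (rule bounded_FKPP_unique[OF V _ h_p_Lipschitz _ t]) (use solution countable_discont in \<open>simp_all add: U0_eq\<close>)
  next
    fix t :: real assume "0 < t"
    then show "tendsto_0_in_prob M (\<lambda>N \<omega>. SUP x. \<bar>empirical_cdf N (Y N t \<omega>) x - mild t (ereal x)\<bar>)" by (rule convergence)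
  qed
qed

end
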